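(* Let $\Lambda$ be a lattice in $\mathbb{R}^{2d}$ and $v$ a GRS-weight. Then $M^1_v(\mathbb{R}^d)$ is a finitely generated projective left $\mathcal{A}^1_v(\Lambda,c)$-module. Consequently, there exist $n\in\mathbb{N}$ and $g_1,\dots,g_n\in M^1_v(\mathbb{R}^d)$ such that $\{g_i:i=1,\dots,n\}$ is a standard tight $\mathcal{A}^1_v(\Lambda,c)$-module frame, i.e. $$f=\sum_{i=1}^n{}_\Lambda\langle f,g_i\rangle\cdot g_i\qquad\text{for all } f\in M^1_v(\mathbb{R}^d).$$ Consequently, $\mathcal{G}(g_1,\dots,g_n;\Lambda)$ is a multi-window Gabor frame for the class of modulation spaces $M^{p,q}_m(\mathbb{R}^d)$, $p,q\in[1,\infty]$, for any $v$-moderate weight $m$.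
   Context: Time-frequency shifts: for $x,\omega\in\mathbb{R}^d$, $T_xf(t)=f(t-x)$, $M_\omega f(t)=e^{2\pi i\omega\cdot t}f(t)$, $\pi(x,\omega)=M_\omega T_x$. One has $\pi(\lambda)\pi(\mu)=c(\lambda,\mu)\pi(\lambda+\mu)$ with $c((x,\omega),(y,\eta))=e^{-2\pi i x\cdot\eta}$. $\langle f,g\rangle=\int f\overline{g}$. A lattice in $\mathbb{R}^{2d}$ is a discrete cocompact subgroup. A weight $v$ is a measurable $v:\mathbb{R}^{2d}\to[0,\infty)$ with $v(z+w)\le v(z)v(w)$, $v(z)\ge1$, $v(-z)=v(z)$ for all $z,w$. It is a GRS-weight if $\lim_{n\to\infty}v(n\lambda)^{1/n}=1$ for all $\lambda\in\Lambda$. A measurable function $m:\mathbb{R}^{2d}\to(0,\infty)$ is a $v$-moderate weight if there is $C>0$ with $m(z+w)\le Cv(z)m(w)$ for all $z,w\in\mathbb{R}^{2d}$. $\mathcal{A}^1_v(\Lambda,c)=\{\sum_{\lambda\in\Lambda}a(\lambda)\pi(\lambda):\sum_\lambda|a(\lambda)|v(\lambda)<\infty\}\subset\mathcal{B}(L^2(\mathbb{R}^d))$, an involutive Banach algebra under operator composition and adjoint with norm $\sum_\lambda|a(\lambda)|v(\lambda)$. $M^1_v(\mathbb{R}^d)=\{f\in L^2(\mathbb{R}^d):\int_{\mathbb{R}^{2d}}|\langle f,\pi(z)\varphi\rangle|v(z)\,dz<\infty\}$ with $\varphi(t)=e^{-\pi t\cdot t}$, normed by this integral. It is a left $\mathcal{A}^1_v(\Lambda,c)$-module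 via $A\cdot f=Af$, with inner product ${}_\Lambda\langle f,g\rangle=\sum_{\lambda\in\Lambda}\langle f,\pi(\lambda)g\rangle\pi(\lambda)\in\mathcal{A}^1_v(\Lambda,c)$. Modulation spaces: for a fixed non-zero $g\in M^1_v(\mathbb{R}^d)$ put $V_gf(x,\omega)=\langle f,\pi(x,\omega)g\rangle$; $M^{p,q}_m(\mathbb{R}^d)$ is the space of $f$ in the space of bounded conjugate-linear functionals on $M^1_v(\mathbb{R}^d)$ with $\|f\|_{M^{p,q}_m}=\big(\int_{\mathbb{R}^d}(\int_{\mathbb{R}^d}|V_gf(x,\omega)|^pm(x,\omega)^p\,dx)^{q/p}d\omega\big)^{1/q}<\infty$ (usual modification if $p$ or $q$ is $\infty$); different $g$ give the same space with equivalent norms. $L^{p,q}_m(\mathbb{R}^{2d})$ is the corresponding weighted mixed-norm space. $\mathcal{G}(g_1,\dots,g_n;\Lambda)=\{\pi(\lambda)g_i:\lambda\in\Lambda,1\le i\le n\}$. It is a multi-window Gabor frame for $M^{p,q}_m(\mathbb{R}^d)$ if it is a Banach frame for it: with $Q$ a relatively compact measurable fundamental domain of $\Lambda$ and $Y$ the space of $(a_i(\lambda))_{i,\lambda}$ with norm $\sum_{i=1}^n\big\|\sum_{\lambda\in\Lambda}|a_i(\lambda)|\mathbf{1}_{\lambda+Q}\big\|_{L^{p,q}_m}<\infty$, there exist $A,B>0$ with $A\|f\|_{M^{p,q}_m}\le\|(\langle f,\pi(\lambda)g_i\rangle)_{i,\lambda}\|_Y\le B\|f\|_{M^{p,q}_m}$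 for all $f\in M^{p,q}_m(\mathbb{R}^d)$, and there is a bounded linear operator $R:Y\to M^{p,q}_m(\mathbb{R}^d)$ with $R\big((\langle f,\pi(\lambda)g_i\rangle)_{i,\lambda}\big)=f$ for all $f\in M^{p,q}_m(\mathbb{R}^d)$. *)

theory Defs
  imports "HOL-Analysis.Analysis" "HOL-Algebra.Module"
begin

section \<open>The Hilbert space of square-integrable functions on \<open>\<real>\<^sup>d\<close>\<close>

text \<open>Functions are Borel measurable and identified when they agree almost everywhere; every class
  of Lebesgue measurable functions has a Borel representative. The pairing is linear in its first
  argument, and the real inner product of the type class is its real part.\<close>

definition sq_integrable :: "(real^'d \<Rightarrow> complex) \<Rightarrow> bool" where
  "sq_integrable f \<longleftrightarrow>
     f \<in> borel_measurable borel \<and> integrable lborel (\<lambda>t. (cmod (f t))\<^sup>2)"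

definition L2_rel :: "(real^'d \<Rightarrow> complex) \<Rightarrow> (real^'d \<Rightarrow> complex) \<Rightarrow> bool" where
  "L2_rel f g \<longleftrightarrow> sq_integrable f \<and> sq_integrable g \<and> (AE t in lborel. f t = g t)"

lemma sq_integrable_zero: "sq_integrable (\<lambda>_. 0)"
  by (simp add: sq_integrable_def)

quotient_type (overloaded) 'd L2 = "real^'d::finite \<Rightarrow> complex" / partial: L2_rel
proof (rule part_equivpI)
  show "\<exists>x. L2_rel (x :: real^'d \<Rightarrow> complex) x"
    by (intro exI[of _ "\<lambda>_. 0"]) (simp add: L2_rel_def sq_integrable_zero)
  show "symp (L2_rel :: (real^'d \<Rightarrow> complex) \<Rightarrow> _)"
    by (rule sympI) (auto simp: L2_rel_def eq_commute)
  show "transp (L2_rel :: (real^'d \<Rightarrow> complex) \<Rightarrow> _)"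
    by (rule transpI) (auto simp: L2_rel_def elim: AE_mp)
qed

lemma sq_integrable_add:
  assumes "sq_integrable f" "sq_integrable g"
  shows "sq_integrable (\<lambda>t. f t + g t)"
proof -
  have [measurable]: "f \<in> borel_measurable borel" "g \<in> borel_measurable borel"
    using assms by (auto simp: sq_integrable_def)
  have "integrable lborel (\<lambda>t. (cmod (f t + g t))\<^sup>2)"
  proof (rule Bochner_Integration.integrable_bound)
    show "integrable lborel (\<lambda>t. 2 * (cmod (f t))\<^sup>2 + 2 * (cmod (g t))\<^sup>2)"
      using assms by (auto simp: sq_integrable_def)
    have "(cmod (f t + g t))\<^sup>2 \<le> 2 * (cmod (f t))\<^sup>2 + 2 * (cmod (g t))\<^sup>2" for t
    proof -
      have "(cmod (f t + g t))\<^sup>2 \<le> (cmod (f t) + cmod (g t))\<^sup>2"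
        by (intro power_mono norm_triangle_ineq) auto
      also have "\<dots> \<le> 2 * (cmod (f t))\<^sup>2 + 2 * (cmod (g t))\<^sup>2"
        using sum_squares_bound[of "cmod (f t)" "cmod (g t)"] by (simp add: power2_sum)
      finally show ?thesis .
    qed
    then show "AE t in lborel. norm ((cmod (f t + g t))\<^sup>2)
        \<le> norm (2 * (cmod (f t))\<^sup>2 + 2 * (cmod (g t))\<^sup>2)"
      by (intro AE_I2) (smt (verit) real_norm_def zero_le_power2)
  qed measurable
  then show ?thesis
    by (simp add: sq_integrable_def)
qed

lemma sq_integrable_cmult: "sq_integrable f \<Longrightarrow> sq_integrable (\<lambda>t. c * f t)"
  by (auto simp: sq_integrable_def norm_mult power_mult_distrib)

lemma integrable_mult_cnj:
  assumes "sq_integrable f" "sq_integrable g"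
  shows "integrable lborel (\<lambda>t. f t * cnj (g t))"
proof (rule Bochner_Integration.integrable_bound)
  have [measurable]: "f \<in> borel_measurable borel" "g \<in> borel_measurable borel"
    using assms by (auto simp: sq_integrable_def)
  show "integrable lborel (\<lambda>t. (cmod (f t))\<^sup>2 + (cmod (g t))\<^sup>2)"
    using assms by (auto simp: sq_integrable_def)
  show "AE t in lborel. norm (f t * cnj (g t)) \<le> norm ((cmod (f t))\<^sup>2 + (cmod (g t))\<^sup>2)"
  proof (rule AE_I2)
    fix t
    have "2 * (cmod (f t) * cmod (g t)) \<le> (cmod (f t))\<^sup>2 + (cmod (g t))\<^sup>2"
      using sum_squares_bound[of "cmod (f t)" "cmod (g t)"] by simp
    then have "cmod (f t) * cmod (g t) \<le> (cmod (f t))\<^sup>2 + (cmod (g t))\<^sup>2"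
      using mult_nonneg_nonneg[OF norm_ge_zero norm_ge_zero, of "f t" "g t"] by linarith
    then show "norm (f t * cnj (g t)) \<le> norm ((cmod (f t))\<^sup>2 + (cmod (g t))\<^sup>2)"
      by (simp add: norm_mult)
  qed
  have "cnj \<in> borel_measurable borel"
    by (intro borel_measurable_continuous_onI continuous_intros)
  then show "(\<lambda>t. f t * cnj (g t)) \<in> borel_measurable lborel"
    by measurable
qed

lift_definition cinner :: "'d::finite L2 \<Rightarrow> 'd L2 \<Rightarrow> complex" is
  "\<lambda>f g. \<integral>t. f t * cnj (g t) \<partial>lborel"
proof -
  fix f f' g g' :: "real^'d \<Rightarrow> complex"
  assume a: "L2_rel f f'" "L2_rel g g'"
  have "(\<lambda>t. f t * cnj (g t)) \<in> borel_measurable lborel"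
    "(\<lambda>t. f' t * cnj (g' t)) \<in> borel_measurable lborel"
    using a by (blast intro: borel_measurable_integrable integrable_mult_cnj
        dest: L2_rel_def[THEN iffD1])+
  then show "(\<integral>t. f t * cnj (g t) \<partial>lborel) = (\<integral>t. f' t * cnj (g' t) \<partial>lborel)"
    using a by (intro integral_cong_AE) (auto simp: L2_rel_def)
qed

lift_definition cscale :: "complex \<Rightarrow> 'd::finite L2 \<Rightarrow> 'd L2" is "\<lambda>c f t. c * f t"
  by (auto simp: L2_rel_def intro: sq_integrable_cmult)

instantiation L2 :: (finite) real_vector
begin

lift_definition zero_L2 :: "'a L2" is "\<lambda>_. 0"
  by (simp add: L2_rel_def sq_integrable_zero)

lift_definition plus_L2 :: "'a L2 \<Rightarrow> 'a L2 \<Rightarrow> 'a L2" is "\<lambda>f g t. f t + g t"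
  by (auto simp: L2_rel_def intro: sq_integrable_add)

definition uminus_L2 :: "'a L2 \<Rightarrow> 'a L2" where "uminus_L2 f = cscale (-1) f"

definition minus_L2 :: "'a L2 \<Rightarrow> 'a L2 \<Rightarrow> 'a L2" where "minus_L2 f g = f + cscale (-1) g"

definition scaleR_L2 :: "real \<Rightarrow> 'a L2 \<Rightarrow> 'a L2" where
  "scaleR_L2 r f = cscale (complex_of_real r) f"

instance
proof
  fix x y z :: "'a L2" and a b :: real
  show "x + y + z = x + (y + z)"
    by transfer (auto simp: L2_rel_def add.assoc intro!: sq_integrable_add)
  show "x + y = y + x"
    by transfer (auto simp: L2_rel_def add.commute intro!: sq_integrable_add)
  show "0 + x = x"
    by transfer (auto simp: L2_rel_def)
  show "- x + x = 0"
    unfolding uminus_L2_def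
    by transfer
      (use sq_integrable_cmult[of _ "-1"] in \<open>auto simp: L2_rel_def sq_integrable_zero\<close>)
  show "x - y = x + - y"
    by (simp add: minus_L2_def uminus_L2_def)
  show "a *\<^sub>R (x + y) = a *\<^sub>R x + a *\<^sub>R y"
    unfolding scaleR_L2_def
    by transfer (auto simp: L2_rel_def distrib_left distrib_right intro!: sq_integrable_add sq_integrable_cmult)
  show "(a + b) *\<^sub>R x = a *\<^sub>R x + b *\<^sub>R x"
    unfolding scaleR_L2_def
    by transfer (auto simp: L2_rel_def distrib_left distrib_right intro!: sq_integrable_add sq_integrable_cmult)
  show "a *\<^sub>R b *\<^sub>R x = (a * b) *\<^sub>R x"
    unfolding scaleR_L2_def
    by transfer (auto simp: L2_rel_def mult.assoc intro!: sq_integrable_cmult)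
  show "1 *\<^sub>R x = x"
    unfolding scaleR_L2_def by transfer (auto simp: L2_rel_def)
qed

end

instantiation L2 :: (finite) real_inner
begin

definition inner_L2 :: "'a L2 \<Rightarrow> 'a L2 \<Rightarrow> real" where "inner_L2 f g = Re (cinner f g)"

definition norm_L2 :: "'a L2 \<Rightarrow> real" where "norm_L2 f = sqrt (inner f f)"

definition sgn_L2 :: "'a L2 \<Rightarrow> 'a L2" where "sgn_L2 f = f /\<^sub>R norm f"

definition dist_L2 :: "'a L2 \<Rightarrow> 'a L2 \<Rightarrow> real" where "dist_L2 f g = norm (f - g)"

definition uniformity_L2 :: "('a L2 \<times> 'a L2) filter" where
  "uniformity_L2 = (INF e\<in>{0 <..}. principal {(x, y). dist x y < e})"

definition open_L2 :: "'a L2 set \<Rightarrow> bool" where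
  "open_L2 U \<longleftrightarrow> (\<forall>x\<in>U. \<forall>\<^sub>F (x', y) in uniformity. x' = x \<longrightarrow> y \<in> U)"

instance
proof
  fix x y z :: "'a L2" and r :: real
  show "dist x y = norm (x - y)"
    by (simp add: dist_L2_def)
  show "sgn x = x /\<^sub>R norm x"
    by (simp add: sgn_L2_def)
  show "uniformity = (INF e\<in>{0 <..}. principal {(x::'a L2, y). dist x y < e})"
    by (simp add: uniformity_L2_def)
  show "open U \<longleftrightarrow> (\<forall>x\<in>U. \<forall>\<^sub>F (x', y) in uniformity. x' = x \<longrightarrow> y \<in> U)" for U :: "'a L2 set"
    by (simp add: open_L2_def)
  show "inner x y = inner y x"
    unfolding inner_L2_def
  proof transfer
    fix f g :: "real^'a \<Rightarrow> complex"
    have "(\<integral>t. f t * cnj (g t) \<partial>lborel) = (\<integral>t. cnj (g t * cnj (f t)) \<partial>lborel)"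
      by (simp add: mult.commute)
    also have "\<dots> = cnj (\<integral>t. g t * cnj (f t) \<partial>lborel)"
      by (rule Bochner_Integration.integral_cnj)
    finally show "Re (\<integral>t. f t * cnj (g t) \<partial>lborel) = Re (\<integral>t. g t * cnj (f t) \<partial>lborel)"
      by simp
  qed
  show "inner (x + y) z = inner x z + inner y z"
    unfolding inner_L2_def
    by transfer (auto simp: L2_rel_def algebra_simps integrable_mult_cnj)
  show "inner (r *\<^sub>R x) y = r * inner x y"
    unfolding inner_L2_def scaleR_L2_def
    by transfer (auto simp: L2_rel_def mult.assoc integrable_mult_cnj)
  have sq: "(\<integral>t. f t * cnj (f t) \<partial>lborel) = complex_of_real (\<integral>t. (cmod (f t))\<^sup>2 \<partial>lborel)"
    for f :: "real^'a \<Rightarrow> complex"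
    by (simp flip: complex_norm_square of_real_power)
  show "0 \<le> inner x x"
    unfolding inner_L2_def by transfer (simp add: sq)
  show "inner x x = 0 \<longleftrightarrow> x = 0"
    unfolding inner_L2_def
  proof transfer
    fix f :: "real^'a \<Rightarrow> complex"
    assume "L2_rel f f"
    then have f: "sq_integrable f" by (simp add: L2_rel_def)
    then have "(\<integral>t. (cmod (f t))\<^sup>2 \<partial>lborel) = 0 \<longleftrightarrow> (AE t in lborel. (cmod (f t))\<^sup>2 = 0)"
      by (intro integral_nonneg_eq_0_iff_AE) (auto simp: sq_integrable_def)
    then show "Re (\<integral>t. f t * cnj (f t) \<partial>lborel) = 0 \<longleftrightarrow> L2_rel f (\<lambda>_. 0)"
      using f by (simp add: sq L2_rel_def sq_integrable_zero)
  qed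
  show "norm x = sqrt (inner x x)"
    by (simp add: norm_L2_def)
qed

end

lemma cscale_add_right: "cscale c (f + g) = cscale c f + cscale c g"
  by transfer (auto simp: L2_rel_def distrib_left distrib_right intro!: sq_integrable_add sq_integrable_cmult)

lemma cscale_cscale: "cscale a (cscale b f) = cscale (a * b) f"
  by transfer (auto simp: L2_rel_def mult.assoc intro!: sq_integrable_cmult)

lemma norm_cscale: "norm (cscale c f) = cmod c * norm f"
proof -
  have "inner (cscale c f) (cscale c f) = (cmod c)\<^sup>2 * inner f f"
    unfolding inner_L2_def
  proof transfer
    fix c :: complex and f :: "real^'a \<Rightarrow> complex"
    have "c * f t * cnj (c * f t) = of_real ((cmod c)\<^sup>2) * (f t * cnj (f t))" for t
      by (simp add: complex_norm_square algebra_simps del: of_real_power)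
    then have "(\<integral>t. c * f t * cnj (c * f t) \<partial>lborel)
        = of_real ((cmod c)\<^sup>2) * (\<integral>t. f t * cnj (f t) \<partial>lborel)"
      by (simp only: integral_mult_right_zero)
    then show "Re (\<integral>t. c * f t * cnj (c * f t) \<partial>lborel)
        = (cmod c)\<^sup>2 * Re (\<integral>t. f t * cnj (f t) \<partial>lborel)"
      by (simp only: Re_complex_of_real times_complex.sel Im_complex_of_real mult_zero_left diff_zero)
  qed
  then show ?thesis
    by (simp add: norm_eq_sqrt_inner real_sqrt_mult)
qed


section \<open>Time-frequency shifts\<close>

text \<open>Phase space \<open>\<real>\<^sup>2\<^sup>d\<close> consists of the pairs \<open>(x, \<omega>)\<close>.\<close>

type_synonym 'd phase = "(real^'d) \<times> (real^'d)"

lemma lborel_distr_shift: "distr lborel borel (\<lambda>t. t - x) = (lborel :: 'a::euclidean_space measure)"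
  using lborel_distr_plus[of "- x"] by (simp add: add.commute[of "- x"] cong: distr_cong)

lemma AE_lborel_shift:
  fixes P :: "'a::euclidean_space \<Rightarrow> bool"
  assumes "AE t in lborel. P t"
  shows "AE t in lborel. P (t - x)"
proof -
  obtain N where N: "N \<in> null_sets lborel" "{t. \<not> P t} \<subseteq> N"
    using assms by (auto simp: eventually_ae_filter)
  have "AE t in distr lborel borel (\<lambda>t. t - x). t \<notin> N"
    unfolding lborel_distr_shift by (rule AE_not_in[OF N(1)])
  then have "AE t in lborel. t - x \<notin> N"
    using N(1) by (subst (asm) AE_distr_iff) (auto simp: null_sets_def)
  then show ?thesis
    by eventually_elim (use N(2) in auto)
qed

lemma sq_integrable_shift:
  assumes "sq_integrable f"
  shows "sq_integrable (\<lambda>t. f (t - x))"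
proof -
  have [measurable]: "f \<in> borel_measurable borel"
    using assms by (simp add: sq_integrable_def)
  have "integrable (distr lborel borel (\<lambda>t. t - x)) (\<lambda>t. (cmod (f t))\<^sup>2)"
    using assms by (simp add: sq_integrable_def lborel_distr_shift)
  then have "integrable lborel (\<lambda>t. (cmod (f (t - x)))\<^sup>2)"
    by (subst (asm) integrable_distr_eq) auto
  then show ?thesis
    by (simp add: sq_integrable_def)
qed

lemma norm_exp_ii: "cmod (exp (2 * of_real pi * \<i> * of_real r)) = 1"
  by (simp add: norm_exp_eq_Re)

lemma sq_integrable_modulation:
  assumes "sq_integrable f"
  shows "sq_integrable (\<lambda>t. exp (2 * of_real pi * \<i> * of_real (\<omega> \<bullet> t)) * f t)"
proof -
  have [measurable]: "f \<in> borel_measurable borel"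
    using assms by (simp add: sq_integrable_def)
  have [measurable]: "(\<lambda>t. exp (2 * of_real pi * \<i> * of_real (\<omega> \<bullet> t)) :: complex) \<in> borel_measurable borel"
    by (intro borel_measurable_continuous_onI continuous_intros)
  show ?thesis
    using assms by (simp add: sq_integrable_def norm_mult norm_exp_ii)
qed

lift_definition translation :: "real^'d::finite \<Rightarrow> 'd L2 \<Rightarrow> 'd L2" is "\<lambda>x f t. f (t - x)"
  unfolding L2_rel_def by (blast intro: sq_integrable_shift
      AE_lborel_shift[where P = "\<lambda>t. f t = g t" for f g])

lift_definition modulation :: "real^'d::finite \<Rightarrow> 'd L2 \<Rightarrow> 'd L2" is
  "\<lambda>\<omega> f t. exp (2 * of_real pi * \<i> * of_real (\<omega> \<bullet> t)) * f t"
  by (auto simp: L2_rel_def intro: sq_integrable_modulation)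

lemma translation_add: "translation x (f + g) = translation x f + translation x g"
  by transfer (auto simp: L2_rel_def intro!: sq_integrable_shift sq_integrable_add)

lemma translation_cscale: "translation x (cscale c f) = cscale c (translation x f)"
  by transfer (auto simp: L2_rel_def intro!: sq_integrable_shift sq_integrable_cmult)

lemma modulation_add: "modulation \<omega> (f + g) = modulation \<omega> f + modulation \<omega> g"
  by transfer
    (auto simp: L2_rel_def distrib_left intro!: sq_integrable_modulation sq_integrable_add)

lemma modulation_cscale: "modulation \<omega> (cscale c f) = cscale c (modulation \<omega> f)"
  by transfer
    (auto simp: L2_rel_def mult.left_commute intro!: sq_integrable_modulation sq_integrable_cmult)

lemma norm_translation: "norm (translation x f) = norm f"
proof -
  have "inner (translation x f) (translation x f) = inner f f"
    unfolding inner_L2_def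
  proof transfer
    fix x :: "real^'a" and f :: "real^'a \<Rightarrow> complex"
    assume "L2_rel f f"
    then have "(\<lambda>t. f t * cnj (f t)) \<in> borel_measurable borel"
      using integrable_mult_cnj[of f f] by (auto simp: L2_rel_def dest: borel_measurable_integrable)
    then have "(\<integral>t. f t * cnj (f t) \<partial>distr lborel borel (\<lambda>t. t - x))
        = (\<integral>t. f (t - x) * cnj (f (t - x)) \<partial>lborel)"
      by (subst integral_distr) auto
    then show "Re (\<integral>t. f (t - x) * cnj (f (t - x)) \<partial>lborel) = Re (\<integral>t. f t * cnj (f t) \<partial>lborel)"
      by (simp add: lborel_distr_shift)
  qed
  then show ?thesis
    by (simp add: norm_eq_sqrt_inner)
qed

lemma norm_modulation: "norm (modulation \<omega> f) = norm f"
proof -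
  have "inner (modulation \<omega> f) (modulation \<omega> f) = inner f f"
    unfolding inner_L2_def
  proof transfer
    fix \<omega> :: "real^'a" and f :: "real^'a \<Rightarrow> complex"
    have "exp (2 * of_real pi * \<i> * of_real (\<omega> \<bullet> t)) * f t
        * cnj (exp (2 * of_real pi * \<i> * of_real (\<omega> \<bullet> t)) * f t) = f t * cnj (f t)" for t
      by (simp only: complex_norm_square[symmetric] norm_mult norm_exp_ii mult_1)
    then show "Re (\<integral>t. exp (2 * of_real pi * \<i> * of_real (\<omega> \<bullet> t)) * f t
        * cnj (exp (2 * of_real pi * \<i> * of_real (\<omega> \<bullet> t)) * f t) \<partial>lborel)
      = Re (\<integral>t. f t * cnj (f t) \<partial>lborel)"
      by (simp only:)
  qed
  then show ?thesis
    by (simp add: norm_eq_sqrt_inner)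
qed

definition tf_shift :: "'d::finite phase \<Rightarrow> 'd L2 \<Rightarrow>\<^sub>L 'd L2" where
  "tf_shift z = Blinfun (\<lambda>f. modulation (snd z) (translation (fst z) f))"

lemma tf_shift_apply: "tf_shift (x, \<omega>) f = modulation \<omega> (translation x f)"
proof -
  have "bounded_linear (\<lambda>f. modulation \<omega> (translation x f))"
  proof (rule bounded_linear_intro[where K = 1])
    fix f g :: "'a L2" and r :: real
    show "modulation \<omega> (translation x (f + g))
        = modulation \<omega> (translation x f) + modulation \<omega> (translation x g)"
      by (simp add: translation_add modulation_add)
    show "modulation \<omega> (translation x (r *\<^sub>R f)) = r *\<^sub>R modulation \<omega> (translation x f)"
      by (simp add: scaleR_L2_def translation_cscale modulation_cscale)
    show "norm (modulation \<omega> (translation x f)) \<le> norm f * 1"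
      by (simp add: norm_modulation norm_translation)
  qed
  then show ?thesis
    by (simp add: tf_shift_def bounded_linear_Blinfun_apply)
qed

lemma bounded_linear_cscale: "bounded_linear (cscale c)"
proof (rule bounded_linear_intro[where K = "cmod c"])
  fix f g :: "'a L2" and r :: real
  show "cscale c (f + g) = cscale c f + cscale c g" by (rule cscale_add_right)
  show "cscale c (r *\<^sub>R f) = r *\<^sub>R cscale c f"
    by (simp add: scaleR_L2_def cscale_cscale mult.commute)
  show "norm (cscale c f) \<le> norm f * cmod c"
    by (simp add: norm_cscale)
qed

definition cscale_op :: "complex \<Rightarrow> ('d::finite L2 \<Rightarrow>\<^sub>L 'd L2) \<Rightarrow> 'd L2 \<Rightarrow>\<^sub>L 'd L2" where
  "cscale_op c T = Blinfun (\<lambda>f. cscale c (T f))"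

lemma cscale_op_apply: "cscale_op c T f = cscale c (T f)"
  unfolding cscale_op_def
  by (subst bounded_linear_Blinfun_apply)
     (auto intro: bounded_linear_compose[OF bounded_linear_cscale] blinfun.bounded_linear_right)


section \<open>Lattices and weights\<close>

text \<open>Cocompactness: the coset space with the quotient topology is compact.\<close>

definition is_lattice :: "'d::finite phase set \<Rightarrow> bool" where
  "is_lattice \<Lambda> \<longleftrightarrow>
     0 \<in> \<Lambda> \<and> (\<forall>l\<in>\<Lambda>. \<forall>k\<in>\<Lambda>. l + k \<in> \<Lambda>) \<and> (\<forall>l\<in>\<Lambda>. - l \<in> \<Lambda>) \<and>
     discrete \<Lambda> \<and>
     (\<exists>Y :: 'd phase set topology.
        quotient_map euclidean Y (\<lambda>z. (\<lambda>l. z + l) ` \<Lambda>) \<and> compact_space Y)"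

definition is_weight :: "('d::finite phase \<Rightarrow> real) \<Rightarrow> bool" where
  "is_weight v \<longleftrightarrow>
     v \<in> borel_measurable lebesgue \<and>
     (\<forall>z w. v (z + w) \<le> v z * v w) \<and> (\<forall>z. 1 \<le> v z) \<and> (\<forall>z. v (- z) = v z)"

definition GRS_weight :: "'d::finite phase set \<Rightarrow> ('d phase \<Rightarrow> real) \<Rightarrow> bool" where
  "GRS_weight \<Lambda> v \<longleftrightarrow>
     is_weight v \<and> (\<forall>l\<in>\<Lambda>. (\<lambda>n. root n (v (real n *\<^sub>R l))) \<longlonglongrightarrow> 1)"

definition moderate_weight :: "('d::finite phase \<Rightarrow> real) \<Rightarrow> ('d phase \<Rightarrow> real) \<Rightarrow> bool" where
  "moderate_weight v m \<longleftrightarrow>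
     m \<in> borel_measurable lebesgue \<and> (\<forall>z. 0 < m z) \<and>
     (\<exists>C>0. \<forall>z w. m (z + w) \<le> C * v z * m w)"


section \<open>Finitely generated projective left modules\<close>

text \<open>The locale \<^locale>\<open>module\<close> requires a commutative ring of scalars, so left modules over an
  arbitrary ring are introduced here. The ring fields \<^const>\<open>mult\<close> and \<^const>\<open>one\<close> of a module record
  carry no information.\<close>

locale left_module = R?: ring R + M?: abelian_group M
  for R :: "('r, 'k) ring_scheme" (structure) and M :: "('r, 'm, 'l) module_scheme" (structure) +
  assumes smult_closed: "\<lbrakk>a \<in> carrier R; x \<in> carrier M\<rbrakk> \<Longrightarrow> a \<odot>\<^bsub>M\<^esub> x \<in> carrier M"
    and smult_l_distr: "\<lbrakk>a \<in> carrier R; b \<in> carrier R; x \<in> carrier M\<rbrakk> \<Longrightarrow>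
      (a \<oplus>\<^bsub>R\<^esub> b) \<odot>\<^bsub>M\<^esub> x = a \<odot>\<^bsub>M\<^esub> x \<oplus>\<^bsub>M\<^esub> b \<odot>\<^bsub>M\<^esub> x"
    and smult_r_distr: "\<lbrakk>a \<in> carrier R; x \<in> carrier M; y \<in> carrier M\<rbrakk> \<Longrightarrow>
      a \<odot>\<^bsub>M\<^esub> (x \<oplus>\<^bsub>M\<^esub> y) = a \<odot>\<^bsub>M\<^esub> x \<oplus>\<^bsub>M\<^esub> a \<odot>\<^bsub>M\<^esub> y"
    and smult_assoc: "\<lbrakk>a \<in> carrier R; b \<in> carrier R; x \<in> carrier M\<rbrakk> \<Longrightarrow>
      (a \<otimes>\<^bsub>R\<^esub> b) \<odot>\<^bsub>M\<^esub> x = a \<odot>\<^bsub>M\<^esub> (b \<odot>\<^bsub>M\<^esub> x)"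
    and smult_one: "x \<in> carrier M \<Longrightarrow> \<one>\<^bsub>R\<^esub> \<odot>\<^bsub>M\<^esub> x = x"

definition free_left_module :: "('r, 'k) ring_scheme \<Rightarrow> nat \<Rightarrow> ('r, nat \<Rightarrow> 'r) module" where
  "free_left_module R n =
     \<lparr>carrier = {..<n} \<rightarrow>\<^sub>E carrier R, mult = undefined, one = undefined,
      zero = (\<lambda>i\<in>{..<n}. \<zero>\<^bsub>R\<^esub>),
      add = (\<lambda>x y. \<lambda>i\<in>{..<n}. x i \<oplus>\<^bsub>R\<^esub> y i),
      smult = (\<lambda>a x. \<lambda>i\<in>{..<n}. a \<otimes>\<^bsub>R\<^esub> x i)\<rparr>"

definition left_module_hom ::
  "('r, 'k) ring_scheme \<Rightarrow> ('r, 'm, 'l) module_scheme \<Rightarrow> ('r, 'n, 'o) module_scheme \<Rightarrow> ('m \<Rightarrow> 'n) set"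
  where
  "left_module_hom R M N =
     {h. h \<in> carrier M \<rightarrow> carrier N \<and>
         (\<forall>x\<in>carrier M. \<forall>y\<in>carrier M. h (x \<oplus>\<^bsub>M\<^esub> y) = h x \<oplus>\<^bsub>N\<^esub> h y) \<and>
         (\<forall>a\<in>carrier R. \<forall>x\<in>carrier M. h (a \<odot>\<^bsub>M\<^esub> x) = a \<odot>\<^bsub>N\<^esub> h x)}"

definition direct_sum_of_submodules ::
  "('r, 'k) ring_scheme \<Rightarrow> ('r, 'm, 'l) module_scheme \<Rightarrow> 'm set \<Rightarrow> 'm set \<Rightarrow> bool" where
  "direct_sum_of_submodules R M P N \<longleftrightarrow>
     submodule P R M \<and> submodule N R M \<and>
     (\<forall>x\<in>carrier M. \<exists>!(p, q). p \<in> P \<and> q \<in> N \<and> x = p \<oplus>\<^bsub>M\<^esub> q)"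

text \<open>A left module is finitely generated projective if it is isomorphic to a direct summand of
  the free module \<open>R\<^sup>n\<close> for some \<open>n\<close>.\<close>

definition fg_projective_left_module ::
  "('r, 'k) ring_scheme \<Rightarrow> ('r, 'm, 'l) module_scheme \<Rightarrow> bool" where
  "fg_projective_left_module R M \<longleftrightarrow>
     left_module R M \<and>
     (\<exists>n P N h. direct_sum_of_submodules R (free_left_module R n) P N \<and>
        h \<in> left_module_hom R M ((free_left_module R n)\<lparr>carrier := P\<rparr>) \<and>
        bij_betw h (carrier M) P)"


section \<open>The twisted group algebra and the module of windows\<close>

text \<open>The sums over \<open>\<Lambda>\<close> converge in the operator norm.\<close>

definition twisted_algebra ::
  "'d::finite phase set \<Rightarrow> ('d phase \<Rightarrow> real) \<Rightarrow> ('d L2 \<Rightarrow>\<^sub>L 'd L2) ring" where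
  "twisted_algebra \<Lambda> v =
     \<lparr>carrier = {T. \<exists>a. (\<lambda>l. cmod (a l) * v l) summable_on \<Lambda> \<and>
                       ((\<lambda>l. cscale_op (a l) (tf_shift l)) has_sum T) \<Lambda>},
      mult = (o\<^sub>L), one = id_blinfun, zero = 0, add = (+)\<rparr>"

lemma nn_integral_exp_square_finite:
  assumes "1 \<le> a"
  shows "(\<integral>\<^sup>+x. ennreal (exp (- (a * x\<^sup>2))) \<partial>lborel) < \<infinity>"
proof -
  have "((\<lambda>x::real. - exp (- x)) \<longlongrightarrow> - 0) at_top"
    by (intro tendsto_minus filterlim_compose[OF exp_at_bot] filterlim_uminus_at_bot_at_top)
  then have E: "(\<integral>\<^sup>+x. ennreal (exp (- x)) * indicator {0::real..} x \<partial>lborel) = 1"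
    by (subst nn_integral_FTC_atLeast[where F = "\<lambda>x. - exp (- x)" and T = 0])
       (auto intro!: derivative_eq_intros)
  have E': "(\<integral>\<^sup>+x. ennreal (exp x) * indicator {..0::real} x \<partial>lborel) = 1"
    using E nn_integral_real_affine[of "\<lambda>x. ennreal (exp (- x)) * indicator {0::real..} x" "-1" 0]
    by (simp add: indicator_def)
  have "(\<integral>\<^sup>+x. ennreal (exp (- (a * x\<^sup>2))) \<partial>lborel)
      \<le> (\<integral>\<^sup>+x. ennreal (exp 1) * (ennreal (exp (- x)) * indicator {0::real..} x
            + ennreal (exp x) * indicator {..0::real} x) \<partial>lborel)"
  proof (rule nn_integral_mono)
    fix x :: real
    have "0 \<le> (\<bar>x\<bar> - 1)\<^sup>2" by simp
    then have "2 * \<bar>x\<bar> \<le> x\<^sup>2 + 1" by (simp add: power2_diff)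
    moreover have "1 * x\<^sup>2 \<le> a * x\<^sup>2"
      using assms by (intro mult_right_mono) auto
    ultimately have "- (a * x\<^sup>2) \<le> 1 - \<bar>x\<bar>" by linarith
    then have "exp (- (a * x\<^sup>2)) \<le> exp (1 - \<bar>x\<bar>)" by simp
    also have "\<dots> = exp 1 * exp (- \<bar>x\<bar>)" by (simp flip: exp_add)
    finally have "ennreal (exp (- (a * x\<^sup>2))) \<le> ennreal (exp 1) * ennreal (exp (- \<bar>x\<bar>))"
      by (simp flip: ennreal_mult add: ennreal_leI)
    also have "\<dots> \<le> ennreal (exp 1) * (ennreal (exp (- x)) * indicator {0::real..} x
            + ennreal (exp x) * indicator {..0::real} x)"
      by (intro mult_left_mono) (auto simp: indicator_def abs_if)
    finally show "ennreal (exp (- (a * x\<^sup>2))) \<le> \<dots>" .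
  qed
  also have "\<dots> = ennreal (exp 1) * (1 + 1)"
    by (subst nn_integral_cmult) (auto simp: nn_integral_add E E')
  also have "\<dots> < \<infinity>"
    by (simp add: ennreal_mult_less_top)
  finally show ?thesis .
qed

lemma sq_integrable_gaussian:
  "sq_integrable (\<lambda>t :: real^'d::finite. complex_of_real (exp (- pi * (t \<bullet> t))))"
proof -
  have [measurable]:
    "(\<lambda>t :: real^'d. complex_of_real (exp (- pi * (t \<bullet> t)))) \<in> borel_measurable borel"
    by (intro borel_measurable_continuous_onI continuous_intros)
  have "(cmod (complex_of_real (exp (- pi * (t \<bullet> t)))))\<^sup>2
      = (\<Prod>b\<in>Basis. exp (- (2 * pi * (t \<bullet> b)\<^sup>2)))" for t :: "real^'d"
    by (subst euclidean_inner)
       (simp add: exp_sum[symmetric] sum_negf sum_distrib_left power2_eq_square mult.assoc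
          flip: exp_add)
  then have "(\<integral>\<^sup>+t. ennreal ((cmod (complex_of_real (exp (- pi * (t \<bullet> t)))))\<^sup>2)
        \<partial>(lborel :: (real^'d) measure))
      = (\<integral>\<^sup>+t. (\<Prod>b\<in>Basis. ennreal (exp (- (2 * pi * (t \<bullet> b)\<^sup>2))))
        \<partial>(lborel :: (real^'d) measure))"
    by (simp only: prod_ennreal[symmetric] exp_ge_zero)
  also have "\<dots> = (\<Prod>b\<in>(Basis :: (real^'d) set). \<integral>\<^sup>+x. ennreal (exp (- (2 * pi * x\<^sup>2))) \<partial>lborel)"
    by (rule nn_integral_lborel_prod) auto
  also have "\<dots> < \<infinity>"
    using nn_integral_exp_square_finite[of "2 * pi"] pi_gt3
    by (simp add: power_less_top_ennreal)
  finally show ?thesis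
    by (auto simp: sq_integrable_def integrable_iff_bounded)
qed

lift_definition gaussian :: "'d::finite L2" is "\<lambda>t. of_real (exp (- pi * (t \<bullet> t)))"
  using sq_integrable_gaussian by (simp add: L2_rel_def)

definition M1_norm :: "('d::finite phase \<Rightarrow> real) \<Rightarrow> 'd L2 \<Rightarrow> ennreal" where
  "M1_norm v f = (\<integral>\<^sup>+z. ennreal (cmod (cinner f (tf_shift z gaussian)) * v z) \<partial>lebesgue)"

definition M1 :: "('d::finite phase \<Rightarrow> real) \<Rightarrow> 'd L2 set" where
  "M1 v = {f. M1_norm v f < \<infinity>}"

definition M1_module ::
  "('d::finite phase \<Rightarrow> real) \<Rightarrow> ('d L2 \<Rightarrow>\<^sub>L 'd L2, 'd L2) module" where
  "M1_module v =
     \<lparr>carrier = M1 v, mult = undefined, one = undefined, zero = 0, add = (+),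
      smult = blinfun_apply\<rparr>"

definition lattice_inner ::
  "'d::finite phase set \<Rightarrow> 'd L2 \<Rightarrow> 'd L2 \<Rightarrow> 'd L2 \<Rightarrow>\<^sub>L 'd L2" where
  "lattice_inner \<Lambda> f g = (\<Sum>\<^sub>\<infinity>l\<in>\<Lambda>. cscale_op (cinner f (tf_shift l g)) (tf_shift l))"

definition standard_tight_module_frame ::
  "'d::finite phase set \<Rightarrow> ('d phase \<Rightarrow> real) \<Rightarrow> nat \<Rightarrow> (nat \<Rightarrow> 'd L2) \<Rightarrow> bool" where
  "standard_tight_module_frame \<Lambda> v n g \<longleftrightarrow>
     (\<forall>i\<in>{1..n}. g i \<in> M1 v) \<and>
     (\<forall>f\<in>M1 v. f = (\<Sum>i=1..n. blinfun_apply (lattice_inner \<Lambda> f (g i)) (g i)))"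


section \<open>Modulation spaces\<close>

definition ennreal_powr :: "ennreal \<Rightarrow> real \<Rightarrow> ennreal" where
  "ennreal_powr x r = (if x = \<infinity> then \<infinity> else ennreal (enn2real x powr r))"

text \<open>The norm of \<open>L\<^sup>p(\<real>\<^sup>d)\<close> for \<open>1 \<le> p \<le> \<infty>\<close>, applied to the modulus of a function; it is the
  essential supremum for \<open>p = \<infinity>\<close>.\<close>

definition Lp_norm :: "ennreal \<Rightarrow> (real^'d::finite \<Rightarrow> ennreal) \<Rightarrow> ennreal" where
  "Lp_norm p F =
     (if p = \<infinity> then Inf {c. AE x in lebesgue. F x \<le> c}
      else ennreal_powr (\<integral>\<^sup>+x. ennreal_powr (F x) (enn2real p) \<partial>lebesgue) (1 / enn2real p))"

definition Lpq_norm ::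
  "ennreal \<Rightarrow> ennreal \<Rightarrow> ('d::finite phase \<Rightarrow> real) \<Rightarrow> ('d phase \<Rightarrow> ennreal) \<Rightarrow> ennreal" where
  "Lpq_norm p q m F = Lp_norm q (\<lambda>\<omega>. Lp_norm p (\<lambda>x. F (x, \<omega>) * ennreal (m (x, \<omega>))))"

text \<open>Bounded conjugate-linear functionals on \<^term>\<open>M1 v\<close>, represented by functions on all of
  \<open>L\<^sup>2\<close> that vanish off \<^term>\<open>M1 v\<close>. Such a functional \<open>u\<close> pairs with \<open>g \<in> M1 v\<close> by
  \<open>\<langle>u, g\<rangle> = u g\<close>, which extends \<^const>\<open>cinner\<close>.\<close>

definition M1_antidual :: "('d::finite phase \<Rightarrow> real) \<Rightarrow> ('d L2 \<Rightarrow> complex) set" where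
  "M1_antidual v =
     {u. (\<forall>f\<in>M1 v. \<forall>g\<in>M1 v. u (f + g) = u f + u g) \<and>
         (\<forall>c. \<forall>f\<in>M1 v. u (cscale c f) = cnj c * u f) \<and>
         (\<exists>C. \<forall>f\<in>M1 v. cmod (u f) \<le> C * enn2real (M1_norm v f)) \<and>
         (\<forall>f. f \<notin> M1 v \<longrightarrow> u f = 0)}"

definition modulation_norm ::
  "'d::finite L2 \<Rightarrow> ennreal \<Rightarrow> ennreal \<Rightarrow> ('d phase \<Rightarrow> real) \<Rightarrow> ('d L2 \<Rightarrow> complex) \<Rightarrow> ennreal" where
  "modulation_norm \<gamma> p q m u = Lpq_norm p q m (\<lambda>z. ennreal (cmod (u (tf_shift z \<gamma>))))"

definition modulation_space ::
  "('d::finite phase \<Rightarrow> real) \<Rightarrow> 'd L2 \<Rightarrow> ennreal \<Rightarrow> ennreal \<Rightarrow> ('d phase \<Rightarrow> real) \<Rightarrow>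
   ('d L2 \<Rightarrow> complex) set" where
  "modulation_space v \<gamma> p q m = {u \<in> M1_antidual v. modulation_norm \<gamma> p q m u < \<infinity>}"


section \<open>Multi-window Gabor frames\<close>

definition fundamental_domain :: "'d::finite phase set \<Rightarrow> 'd phase set \<Rightarrow> bool" where
  "fundamental_domain \<Lambda> Q \<longleftrightarrow>
     Q \<in> sets lebesgue \<and> compact (closure Q) \<and> (\<forall>z. \<exists>!l. l \<in> \<Lambda> \<and> z \<in> (\<lambda>y. l + y) ` Q)"

definition coeff_norm ::
  "'d::finite phase set \<Rightarrow> 'd phase set \<Rightarrow> nat \<Rightarrow> ennreal \<Rightarrow> ennreal \<Rightarrow> ('d phase \<Rightarrow> real) \<Rightarrow>
   (nat \<Rightarrow> 'd phase \<Rightarrow> complex) \<Rightarrow> ennreal" where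
  "coeff_norm \<Lambda> Q n p q m a =
     (\<Sum>i=1..n. Lpq_norm p q m
        (\<lambda>z. \<Sum>\<^sub>\<infinity>l\<in>\<Lambda>. ennreal (cmod (a i l)) * indicator ((\<lambda>y. l + y) ` Q) z))"

text \<open>Families indexed by \<open>{1..n} \<times> \<Lambda>\<close> are extended by zero to all indices.\<close>

definition coeff_space ::
  "'d::finite phase set \<Rightarrow> 'd phase set \<Rightarrow> nat \<Rightarrow> ennreal \<Rightarrow> ennreal \<Rightarrow> ('d phase \<Rightarrow> real) \<Rightarrow>
   (nat \<Rightarrow> 'd phase \<Rightarrow> complex) set" where
  "coeff_space \<Lambda> Q n p q m =
     {a. (\<forall>i l. \<not> (i \<in> {1..n} \<and> l \<in> \<Lambda>) \<longrightarrow> a i l = 0) \<and> coeff_norm \<Lambda> Q n p q m a < \<infinity>}"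

definition gabor_coeffs ::
  "'d::finite phase set \<Rightarrow> nat \<Rightarrow> (nat \<Rightarrow> 'd L2) \<Rightarrow> ('d L2 \<Rightarrow> complex) \<Rightarrow>
   nat \<Rightarrow> 'd phase \<Rightarrow> complex" where
  "gabor_coeffs \<Lambda> n g u = (\<lambda>i l. if i \<in> {1..n} \<and> l \<in> \<Lambda> then u (tf_shift l (g i)) else 0)"

definition multi_window_gabor_frame ::
  "'d::finite phase set \<Rightarrow> 'd phase set \<Rightarrow> ('d phase \<Rightarrow> real) \<Rightarrow> 'd L2 \<Rightarrow>
   ennreal \<Rightarrow> ennreal \<Rightarrow> ('d phase \<Rightarrow> real) \<Rightarrow> nat \<Rightarrow> (nat \<Rightarrow> 'd L2) \<Rightarrow> bool" where
  "multi_window_gabor_frame \<Lambda> Q v \<gamma> p q m n g \<longleftrightarrow>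
     (\<exists>A B :: real. 0 < A \<and> 0 < B \<and>
        (\<forall>u\<in>modulation_space v \<gamma> p q m.
           ennreal A * modulation_norm \<gamma> p q m u \<le> coeff_norm \<Lambda> Q n p q m (gabor_coeffs \<Lambda> n g u) \<and>
           coeff_norm \<Lambda> Q n p q m (gabor_coeffs \<Lambda> n g u) \<le> ennreal B * modulation_norm \<gamma> p q m u)) \<and>
     (\<exists>R :: (nat \<Rightarrow> 'd phase \<Rightarrow> complex) \<Rightarrow> 'd L2 \<Rightarrow> complex.
        R \<in> coeff_space \<Lambda> Q n p q m \<rightarrow> modulation_space v \<gamma> p q m \<and>
        (\<forall>a\<in>coeff_space \<Lambda> Q n p q m. \<forall>b\<in>coeff_space \<Lambda> Q n p q m.
           R (\<lambda>i l. a i l + b i l) = (\<lambda>h. R a h + R b h)) \<and>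
        (\<forall>c. \<forall>a\<in>coeff_space \<Lambda> Q n p q m. R (\<lambda>i l. c * a i l) = (\<lambda>h. c * R a h)) \<and>
        (\<exists>K :: real. \<forall>a\<in>coeff_space \<Lambda> Q n p q m.
           modulation_norm \<gamma> p q m (R a) \<le> ennreal K * coeff_norm \<Lambda> Q n p q m a) \<and>
        (\<forall>u\<in>modulation_space v \<gamma> p q m. R (gabor_coeffs \<Lambda> n g u) = u))"

end

theory Submission
  imports Defs "HOL-Probability.Characteristic_Functions"
begin

text \<open>Write \<open>N\<close> for the norm of \<open>M\<^sup>1\<^sub>v\<close>, where \<open>v\<close> may be replaced by an equivalent Borel weight. Partition
  \<open>\<real>\<^sup>2\<^sup>d\<close> into the sets \<open>l + Q\<^sub>k\<close> with \<open>l \<in> \<Lambda>\<close> and tiny pieces \<open>Q\<^sub>k\<close> around points \<open>p\<^sub>k\<close>. For a window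
  \<open>\<gamma>\<close> of norm one the operator \<open>S = \<Sum>\<^sub>k |Q\<^sub>k| \<Sum>\<^sub>l \<langle>\<cdot>, \<pi>(l) \<pi>(p\<^sub>k) \<gamma>\<rangle> \<pi>(l) \<pi>(p\<^sub>k) \<gamma>\<close> is a Riemann sum of Moyal's inversion
  formula, and \<open>\<parallel>1 - S\<parallel> \<le> 1/2\<close> on \<open>M\<^sup>1\<^sub>v\<close> because \<open>N (\<pi>(y) \<gamma> - \<gamma>)\<close> is small for small \<open>y\<close>. Thus \<open>S\<^sup>-\<^sup>1\<^sup>/\<^sup>2\<close> is
  a convergent binomial series in \<open>1 - S\<close> on \<open>M\<^sup>1\<^sub>v\<close>; it commutes with \<open>\<pi>(\<Lambda>)\<close>, so its values at \<open>|Q\<^sub>k|\<^sup>1\<^sup>/\<^sup>2 \<pi>(p\<^sub>k) \<gamma>\<close>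
  form a tight frame, and \<open>S\<^sup>-\<^sup>1\<close> yields windows dual to the \<open>\<pi>(p\<^sub>k) \<gamma>\<close>.

  The tight frame splits \<open>M\<^sup>1\<^sub>v\<close> off a free module. For \<open>g, h \<in> M\<^sup>1\<^sub>v\<close> the local suprema of \<open>|\<langle>g, \<pi>(\<cdot>) h\<rangle>|\<close>
  around the lattice points are \<open>v\<close>-summable; expanding \<open>\<pi>(l) g\<close> in the dual system built from \<open>\<gamma>\<close> hence bounds
  analysis and synthesis by weighted sums of translates, which are bounded on the mixed-norm spaces by Minkowski's
  inequality.\<close>


section \<open>Completeness of \<open>L\<^sup>2\<close> and time-frequency shifts\<close>

text \<open>The obstacle is that the windows must stay in M^1: functional calculus for the frame
  operator on L^2 would produce S^(-1/2) but say nothing about the weighted norm of its values.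
  Closeness to the identity is therefore arranged in the norm of M^1 itself, where the binomial
  series can be summed. The Gaussian is the right test window because a weight grows at most
  exponentially while the ambiguity function of the Gaussian decays like a Gaussian; convolving with
  it turns integrability of \<open>stft f\<close> into summability of local suprema over the
  lattice.

  One operator yields two families of windows because they answer different demands. The tight
  windows are made once, from the Gaussian, and serve all p, q and m. The norm of a modulation space
  is given by an arbitrary nonzero \<gamma>, and a comparison with it requires an expansion in
  shifts of that very \<gamma>; so the construction is repeated for \<gamma>, and the second family
  keeps those shifts on the synthesis side.

  The weight is made Borel because nearly every estimate interchanges integrals over product
  spaces.\<close>

lemma L2_rel_rep: "L2_rel (rep_L2 f) (rep_L2 f)"
  by (rule Quotient3_rep_reflp[OF Quotient3_L2])

lemma abs_rep_L2 [simp]: "abs_L2 (rep_L2 f) = f"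
  by (rule Quotient3_abs_rep[OF Quotient3_L2])

lemma sq_integrable_rep: "sq_integrable (rep_L2 f)"
  using L2_rel_rep[of f] by (simp add: L2_rel_def)

lemma measurable_rep_L2 [measurable]: "rep_L2 f \<in> borel_measurable borel"
  using sq_integrable_rep[of f] by (simp add: sq_integrable_def)

lemma cnj_measurable [measurable]: "cnj \<in> borel_measurable borel"
  by (intro borel_measurable_continuous_onI continuous_intros)

lemma L2_rel_refl: "sq_integrable f \<Longrightarrow> L2_rel f f"
  by (simp add: L2_rel_def)

lemma cinner_abs: "sq_integrable f \<Longrightarrow> sq_integrable g \<Longrightarrow>
    cinner (abs_L2 f) (abs_L2 g) = (\<integral>t. f t * cnj (g t) \<partial>lborel)"
  by (intro cinner.abs_eq L2_rel_refl)

lemma cinner_rep: "cinner f g = (\<integral>t. rep_L2 f t * cnj (rep_L2 g t) \<partial>lborel)"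
  using cinner_abs[OF sq_integrable_rep sq_integrable_rep, of f g] by simp

lemma cinner_commute: "cinner g f = cnj (cinner f g)"
proof -
  have "cinner g f = (\<integral>t. cnj (rep_L2 f t * cnj (rep_L2 g t)) \<partial>lborel)"
    by (simp add: cinner_rep mult.commute)
  also have "\<dots> = cnj (cinner f g)"
    unfolding cinner_rep by (rule Bochner_Integration.integral_cnj)
  finally show ?thesis .
qed

lemma cinner_add_left: "cinner (f + g) h = cinner f h + cinner g h"
  by transfer (auto simp: L2_rel_def algebra_simps integrable_mult_cnj)

lemma cinner_cscale_left: "cinner (cscale c f) h = c * cinner f h"
  by transfer (auto simp: L2_rel_def mult.assoc integrable_mult_cnj)

lemma cinner_add_right: "cinner h (f + g) = cinner h f + cinner h g"
  by (metis cinner_add_left cinner_commute complex_cnj_add)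

lemma cinner_cscale_right: "cinner h (cscale c f) = cnj c * cinner h f"
  by (metis cinner_cscale_left cinner_commute complex_cnj_mult)

lemma cscale_minus1: "cscale (-1) f = - f"
  by (simp add: uminus_L2_def)

lemma cscale_of_real: "cscale (of_real r) f = r *\<^sub>R f"
  by (simp add: scaleR_L2_def)

lemma cscale_1 [simp]: "cscale 1 f = f"
  using cscale_of_real[of 1 f] by simp

lemma cscale_0 [simp]: "cscale 0 f = 0"
  using cscale_of_real[of 0 f] by simp

lemma cscale_zero [simp]: "cscale c 0 = 0"
  using norm_cscale[of c 0] by simp

lemma cscale_add_left: "cscale (a + b) f = cscale a f + cscale b f"
  by transfer (auto simp: L2_rel_def distrib_right intro!: sq_integrable_add sq_integrable_cmult)

lemma cinner_uminus_left: "cinner (- f) h = - cinner f h"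
  using cinner_cscale_left[of "-1" f h] by (simp add: cscale_minus1)

lemma cinner_uminus_right: "cinner h (- f) = - cinner h f"
  using cinner_cscale_right[of h "-1" f] by (simp add: cscale_minus1)

lemma cinner_diff_left: "cinner (f - g) h = cinner f h - cinner g h"
  using cinner_add_left[of f "- g" h] by (simp add: cinner_uminus_left)

lemma cinner_diff_right: "cinner h (f - g) = cinner h f - cinner h g"
  using cinner_add_right[of h f "- g"] by (simp add: cinner_uminus_right)

lemma cinner_0_left [simp]: "cinner 0 h = 0"
  using cinner_cscale_left[of 0 0 h] by simp

lemma cinner_0_right [simp]: "cinner h 0 = 0"
  using cinner_cscale_right[of h 0 0] by simp

lemma cinner_self: "cinner f f = of_real ((norm f)\<^sup>2)"
proof -
  have "Im (cinner f f) = 0"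
    using cinner_commute[of f f] by (simp add: complex_eq_iff)
  moreover have "Re (cinner f f) = (norm f)\<^sup>2"
    by (simp add: power2_norm_eq_inner inner_L2_def)
  ultimately show ?thesis
    by (simp add: complex_eq_iff)
qed

lemma cinner_CS: "cmod (cinner f g) \<le> norm f * norm g"
proof (cases "cinner f g = 0")
  case False
  \<comment> \<open>The factor of modulus one that rotates the pairing onto the positive axis, so
    that the real Cauchy-Schwarz inequality of the type class applies.\<close>
  define c where "c = cnj (cinner f g) / of_real (cmod (cinner f g))"
  have c: "cmod c = 1"
    using False by (simp add: c_def norm_divide)
  have "c * cinner f g = of_real (cmod (cinner f g))"
    using False by (simp add: c_def divide_simps complex_norm_square[symmetric] mult.commute power2_eq_square
        flip: of_real_mult)
  then have "cmod (cinner f g) = inner (cscale c f) g"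
    by (simp add: inner_L2_def cinner_cscale_left)
  also have "\<dots> \<le> norm (cscale c f) * norm g"
    by (rule norm_cauchy_schwarz)
  finally show ?thesis
    by (simp add: norm_cscale c)
qed auto

lemma bounded_linear_cinner_left: "bounded_linear (\<lambda>f. cinner f g)"
  by (rule bounded_linear_intro[where K = "norm g"])
     (auto simp: cinner_add_left scaleR_L2_def cinner_cscale_left cinner_CS scaleR_conv_of_real)

text \<open>Conjugate linearity is still real linearity, and that is the notion under which
  \<open>has_sum_bounded_linear\<close> moves pairings through series.\<close>

lemma bounded_linear_cinner_right: "bounded_linear (\<lambda>f. cinner g f)"
  by (rule bounded_linear_intro[where K = "norm g"])
     (auto simp: cinner_add_right scaleR_L2_def cinner_cscale_right scaleR_conv_of_real
        intro: order_trans[OF cinner_CS])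

lemma norm_abs_L2:
  assumes "sq_integrable f"
  shows "(norm (abs_L2 f))\<^sup>2 = (\<integral>t. (cmod (f t))\<^sup>2 \<partial>lborel)"
proof -
  have "cinner (abs_L2 f) (abs_L2 f) = (\<integral>t. of_real ((cmod (f t))\<^sup>2) \<partial>lborel)"
    by (simp only: cinner_abs[OF assms assms] complex_norm_square)
  also have "\<dots> = of_real (\<integral>t. (cmod (f t))\<^sup>2 \<partial>lborel)"
    by (rule integral_of_real) (use assms in \<open>simp add: sq_integrable_def\<close>)
  finally show ?thesis
    unfolding cinner_self of_real_eq_iff .
qed

lemma nn_norm_abs_L2:
  assumes "sq_integrable f"
  shows "ennreal ((norm (abs_L2 f))\<^sup>2) = (\<integral>\<^sup>+t. ennreal ((cmod (f t))\<^sup>2) \<partial>lborel)"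
  unfolding norm_abs_L2[OF assms]
  using assms by (subst nn_integral_eq_integral) (auto simp: sq_integrable_def)

lemma nn_norm_rep:
  "ennreal ((norm f)\<^sup>2) = (\<integral>\<^sup>+t. ennreal ((cmod (rep_L2 f t))\<^sup>2) \<partial>lborel)"
  using nn_norm_abs_L2[OF sq_integrable_rep, of f] by simp

lemma sq_integrableI:
  assumes "f \<in> borel_measurable borel" "(\<integral>\<^sup>+t. ennreal ((cmod (f t))\<^sup>2) \<partial>lborel) < \<infinity>"
  shows "sq_integrable f"
  using assms by (auto simp: sq_integrable_def integrable_iff_bounded)

lemma sq_integrable_diff:
  assumes "sq_integrable f" "sq_integrable g"
  shows "sq_integrable (\<lambda>t. f t - g t)"
  using sq_integrable_add[OF assms(1) sq_integrable_cmult[OF assms(2), of "-1"]] by simp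

lemma diff_abs_L2:
  assumes "sq_integrable f" "sq_integrable g"
  shows "abs_L2 f - abs_L2 g = abs_L2 (\<lambda>t. f t - g t)"
proof -
  have "cscale (-1) (abs_L2 g) = abs_L2 (\<lambda>t. - 1 * g t)"
    by (rule cscale.abs_eq[OF L2_rel_refl[OF assms(2)]])
  then have "abs_L2 f - abs_L2 g = abs_L2 f + abs_L2 (\<lambda>t. - 1 * g t)"
    by (simp add: cscale_minus1)
  also have "\<dots> = abs_L2 (\<lambda>t. f t + - 1 * g t)"
    by (intro plus_L2.abs_eq L2_rel_refl assms sq_integrable_cmult)
  finally show ?thesis by simp
qed

lemma nn_norm_diff:
  "ennreal ((norm (f - g))\<^sup>2) = (\<integral>\<^sup>+t. ennreal ((cmod (rep_L2 f t - rep_L2 g t))\<^sup>2) \<partial>lborel)"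
  using nn_norm_abs_L2[OF sq_integrable_diff[OF sq_integrable_rep sq_integrable_rep], of f g]
  by (simp add: diff_abs_L2[OF sq_integrable_rep sq_integrable_rep, symmetric])

text \<open>Riesz--Fischer: along a subsequence with \<open>\<parallel>f\<^sub>k\<^sub>+\<^sub>1 - f\<^sub>k\<parallel> < 2\<^sup>-\<^sup>k\<close> the sum
  \<open>\<Sum> 2\<^sup>k |f\<^sub>k\<^sub>+\<^sub>1 - f\<^sub>k|\<^sup>2\<close> is integrable, which forces pointwise convergence almost everywhere.\<close>

instance L2 :: (finite) banach
proof
  fix X :: "nat \<Rightarrow> 'a L2"
  assume X: "Cauchy X"
  have "\<forall>k. \<exists>N. \<forall>m\<ge>N. \<forall>n\<ge>N. dist (X m) (X n) < (1/2) ^ k"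
    using X unfolding Cauchy_def by (meson half_gt_zero_iff zero_less_one zero_less_power)
  then obtain N where N: "\<And>k m n. m \<ge> N k \<Longrightarrow> n \<ge> N k \<Longrightarrow> dist (X m) (X n) < (1/2) ^ k"
    by metis
  \<comment> \<open>The sum makes \<open>r k\<close> at least every threshold \<open>N i\<close>
    with i \<le> k; the summand k makes \<open>r\<close> strictly increasing.\<close>
  define r where "r k = (\<Sum>i\<le>k. N i) + k" for k
  have r: "N i \<le> r k" if "i \<le> k" for i k
    using member_le_sum[of i "{..k}" N] that by (auto simp: r_def)
  define f where "f k = rep_L2 (X (r k))" for k
  have [measurable]: "f k \<in> borel_measurable borel" for k
    by (simp add: f_def)
  have dist_r: "norm (X (r j) - X (r k)) < (1/2) ^ k" if "k \<le> j" for j k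
    using N[of k "r j" "r k"] r that by (simp add: dist_norm)
  have quarter: "((1/2) ^ k)\<^sup>2 = ((1/4) ^ k :: real)" for k
    by (simp add: power2_eq_square flip: power_mult_distrib)
  have f_le: "(\<integral>\<^sup>+t. ennreal ((cmod (f j t - f k t))\<^sup>2) \<partial>lborel) \<le> ennreal ((1/4) ^ k)" if "k \<le> j" for j k
  proof -
    have "(norm (X (r j) - X (r k)))\<^sup>2 \<le> ((1/2) ^ k)\<^sup>2"
      using dist_r[OF that] by (intro power_mono) auto
    note this[unfolded quarter]
    then show ?thesis
      unfolding f_def nn_norm_diff[symmetric] by (rule ennreal_leI)
  qed
  have "(\<integral>\<^sup>+t. (\<Sum>k. ennreal (2 ^ k) * ennreal ((cmod (f (Suc k) t - f k t))\<^sup>2)) \<partial>lborel)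
      = (\<Sum>k. ennreal (2 ^ k) * (\<integral>\<^sup>+t. ennreal ((cmod (f (Suc k) t - f k t))\<^sup>2) \<partial>lborel))"
    by (subst nn_integral_suminf) (auto simp: nn_integral_cmult)
  also have "\<dots> \<le> (\<Sum>k. ennreal ((1/2) ^ k))"
  proof (intro suminf_le allI)
    fix k
    have "ennreal (2 ^ k) * (\<integral>\<^sup>+t. ennreal ((cmod (f (Suc k) t - f k t))\<^sup>2) \<partial>lborel)
        \<le> ennreal (2 ^ k) * ennreal ((1/4) ^ k)"
      by (intro mult_left_mono f_le) auto
    also have "\<dots> = ennreal ((1/2) ^ k)"
      by (simp add: ennreal_mult[symmetric] flip: power_mult_distrib)
    finally show "ennreal (2 ^ k) * (\<integral>\<^sup>+t. ennreal ((cmod (f (Suc k) t - f k t))\<^sup>2) \<partial>lborel)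
        \<le> ennreal ((1/2) ^ k)" .
  qed auto
  also have "\<dots> < \<infinity>"
    by (subst suminf_ennreal2) auto
  finally have "AE t in lborel. (\<Sum>k. ennreal (2 ^ k) * ennreal ((cmod (f (Suc k) t - f k t))\<^sup>2)) \<noteq> \<infinity>"
    by (intro nn_integral_noteq_infinite) auto
  then have conv: "AE t in lborel. convergent (\<lambda>k. f k t)"
  proof eventually_elim
    case (elim t)
    define M where "M = enn2real (\<Sum>k. ennreal (2 ^ k) * ennreal ((cmod (f (Suc k) t - f k t))\<^sup>2))"
    have "ennreal (2 ^ k * (cmod (f (Suc k) t - f k t))\<^sup>2) \<le> ennreal M" for k
    proof -
      have "(\<Sum>j\<in>{k}. ennreal (2 ^ j) * ennreal ((cmod (f (Suc j) t - f j t))\<^sup>2))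
         \<le> (\<Sum>k. ennreal (2 ^ k) * ennreal ((cmod (f (Suc k) t - f k t))\<^sup>2))"
        by (intro sum_le_suminf) auto
      then show ?thesis
        using elim by (simp add: M_def ennreal_mult less_top)
    qed
    then have *: "2 ^ k * (cmod (f (Suc k) t - f k t))\<^sup>2 \<le> M" for k
      by (subst (asm) ennreal_le_iff) (auto simp: M_def)
    \<comment> \<open>Each term of a convergent series of nonnegative terms is at most its sum
      \<open>M\<close>, so the increments decay geometrically and are absolutely summable.\<close>
    have "cmod (f (Suc k) t - f k t) \<le> sqrt M * (sqrt (1/2)) ^ k" for k
    proof -
      have "(cmod (f (Suc k) t - f k t))\<^sup>2 \<le> M * (1/2) ^ k"
        using *[of k] by (simp add: field_simps power_one_over)
      then have "cmod (f (Suc k) t - f k t) \<le> sqrt (M * (1/2) ^ k)"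
        by (simp add: real_le_rsqrt)
      then show ?thesis
        by (simp add: real_sqrt_mult real_sqrt_power)
    qed
    note bnd = this
    have "summable (\<lambda>k. sqrt M * (sqrt (1/2)) ^ k)"
      by (intro summable_mult summable_geometric) (simp add: real_sqrt_divide)
    then have "summable (\<lambda>k. f (Suc k) t - f k t)"
      by (rule summable_comparison_test'[of _ 0]) (rule bnd)
    then have "convergent (\<lambda>n. \<Sum>k<n. f (Suc k) t - f k t)"
      by (simp add: summable_iff_convergent)
    then have "convergent (\<lambda>n. (f n t - f 0 t) + f 0 t)"
      using sum_lessThan_telescope[of "\<lambda>k. f k t"] by (intro convergent_add convergent_const) simp
    then show ?case by simp
  qed
  define F where "F t = lim (\<lambda>k. f k t)" for t
  have [measurable]: "F \<in> borel_measurable borel"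
    unfolding F_def by (rule borel_measurable_lim_metric) simp
  have F_le: "(\<integral>\<^sup>+t. ennreal ((cmod (F t - f k t))\<^sup>2) \<partial>lborel) \<le> ennreal ((1/4) ^ k)" for k
  proof -
    have "(\<integral>\<^sup>+t. ennreal ((cmod (F t - f k t))\<^sup>2) \<partial>lborel)
        = (\<integral>\<^sup>+t. liminf (\<lambda>j. ennreal ((cmod (f j t - f k t))\<^sup>2)) \<partial>lborel)"
    proof (rule nn_integral_cong_AE, use conv in eventually_elim)
      case (elim t)
      then have "(\<lambda>j. f j t) \<longlonglongrightarrow> F t"
        by (simp add: F_def convergent_LIMSEQ_iff)
      then have "(\<lambda>j. ennreal ((cmod (f j t - f k t))\<^sup>2)) \<longlonglongrightarrow> ennreal ((cmod (F t - f k t))\<^sup>2)"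
        by (intro tendsto_intros)
      from lim_imp_Liminf[OF _ this] show ?case
        by simp
    qed
    also have "\<dots> \<le> liminf (\<lambda>j. \<integral>\<^sup>+t. ennreal ((cmod (f j t - f k t))\<^sup>2) \<partial>lborel)"
      by (rule nn_integral_liminf) auto
    also have "\<dots> \<le> liminf (\<lambda>j. ennreal ((1/4) ^ k))"
      by (intro Liminf_mono) (use f_le in \<open>auto simp: eventually_sequentially\<close>)
    finally show ?thesis by (simp add: Liminf_const)
  qed
  have d: "sq_integrable (\<lambda>t. F t - f k t)" for k
    using F_le[of k] by (intro sq_integrableI) (auto intro: le_less_trans)
  then have F: "sq_integrable F"
    using sq_integrable_add[OF d[of 0] sq_integrable_rep[of "X (r 0)"]] by (simp add: f_def)
  have "norm (X (r k) - abs_L2 F) \<le> (1/2) ^ k" for k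
  proof -
    have "ennreal ((norm (abs_L2 F - X (r k)))\<^sup>2) \<le> ennreal ((1/4) ^ k)"
      using F_le[of k] nn_norm_abs_L2[OF d[of k]] diff_abs_L2[OF F sq_integrable_rep[of "X (r k)"]]
      by (simp add: f_def)
    then have "(norm (abs_L2 F - X (r k)))\<^sup>2 \<le> ((1/2) ^ k)\<^sup>2"
      unfolding quarter by (subst (asm) ennreal_le_iff) auto
    then show ?thesis
      by (subst norm_minus_commute) (rule power2_le_imp_le, auto)
  qed
  then have "(\<lambda>k. X (r k) - abs_L2 F) \<longlonglongrightarrow> 0"
    by (rule Lim_null_comparison[OF always_eventually[OF allI]]) (rule LIMSEQ_power_zero, simp)
  then have lim: "(X \<circ> r) \<longlonglongrightarrow> abs_L2 F"
    by (simp add: LIM_zero_iff o_def)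
  have "strict_mono r"
    by (rule strict_monoI_Suc) (simp add: r_def)
  then show "convergent X"
    using Cauchy_converges_subseq[OF X _ lim] by (auto simp: convergent_def)
qed


section \<open>Composition rules and covariance of time-frequency shifts\<close>

lemma translation_translation: "translation x (translation y f) = translation (x + y) f"
proof transfer
  fix x y :: "real^'a" and f :: "real^'a \<Rightarrow> complex"
  assume "L2_rel f f"
  then have "sq_integrable (\<lambda>t. f (t - (x + y)))"
    unfolding L2_rel_def by (blast intro: sq_integrable_shift)
  then show "L2_rel (\<lambda>t. f (t - x - y)) (\<lambda>t. f (t - (x + y)))"
    by (simp add: L2_rel_def diff_diff_eq)
qed

lemma modulation_modulation: "modulation x (modulation y f) = modulation (x + y) f"
proof transfer
  fix x y :: "real^'a" and f :: "real^'a \<Rightarrow> complex"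
  assume "L2_rel f f"
  moreover have "exp (2 * of_real pi * \<i> * of_real (x \<bullet> t)) * (exp (2 * of_real pi * \<i> * of_real (y \<bullet> t)) * f t)
      = exp (2 * of_real pi * \<i> * of_real ((x + y) \<bullet> t)) * f t" for t
    by (simp add: inner_left_distrib algebra_simps exp_add)
  ultimately show "L2_rel (\<lambda>t. exp (2 * of_real pi * \<i> * of_real (x \<bullet> t))
        * (exp (2 * of_real pi * \<i> * of_real (y \<bullet> t)) * f t))
      (\<lambda>t. exp (2 * of_real pi * \<i> * of_real ((x + y) \<bullet> t)) * f t)"
    by (simp add: L2_rel_def sq_integrable_modulation)
qed

lemma translation_modulation:
  "translation x (modulation y f)
     = cscale (exp (- (2 * of_real pi * \<i> * of_real (x \<bullet> y)))) (modulation y (translation x f))"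
proof transfer
  fix x y :: "real^'a" and f :: "real^'a \<Rightarrow> complex"
  assume "L2_rel f f"
  then have "sq_integrable (\<lambda>t. exp (- (2 * of_real pi * \<i> * of_real (x \<bullet> y))) *
       (exp (2 * of_real pi * \<i> * of_real (y \<bullet> t)) * f (t - x)))"
    unfolding L2_rel_def by (elim conjE) (rule sq_integrable_cmult sq_integrable_modulation sq_integrable_shift | assumption)+
  moreover have "exp (2 * of_real pi * \<i> * of_real (y \<bullet> (t - x))) * f (t - x)
     = exp (- (2 * of_real pi * \<i> * of_real (x \<bullet> y))) *
       (exp (2 * of_real pi * \<i> * of_real (y \<bullet> t)) * f (t - x))" for t
    by (simp add: inner_diff_right inner_commute[of y x] right_diff_distrib exp_diff exp_minus
        divide_inverse mult_ac)
  ultimately show "L2_rel (\<lambda>t. exp (2 * of_real pi * \<i> * of_real (y \<bullet> (t - x))) * f (t - x))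
     (\<lambda>t. exp (- (2 * of_real pi * \<i> * of_real (x \<bullet> y))) *
       (exp (2 * of_real pi * \<i> * of_real (y \<bullet> t)) * f (t - x)))"
    by (simp only: L2_rel_def) simp
qed

lemma translation_0 [simp]: "translation 0 f = f"
  by transfer (auto simp: L2_rel_def)

lemma modulation_0 [simp]: "modulation 0 f = f"
  by transfer (auto simp: L2_rel_def)

text \<open>The cocycle c of the twisted group algebra. Since it has modulus one, it disappears from
  every estimate on absolute values.\<close>

definition tf_phase :: "'d::finite phase \<Rightarrow> 'd phase \<Rightarrow> complex" where
  "tf_phase z w = exp (- (2 * of_real pi * \<i> * of_real (fst z \<bullet> snd w)))"

lemma norm_tf_phase [simp]: "cmod (tf_phase z w) = 1"
  by (simp add: tf_phase_def norm_exp_eq_Re)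

lemma tf_phase_nonzero [simp]: "tf_phase z w \<noteq> 0"
  by (simp add: tf_phase_def)

lemma tf_phase_cnj [simp]: "tf_phase z w * cnj (tf_phase z w) = 1" "cnj (tf_phase z w) * tf_phase z w = 1"
  by (simp_all add: mult.commute[of "cnj _"] complex_norm_square[symmetric])

lemma tf_shift_eq: "tf_shift z f = modulation (snd z) (translation (fst z) f)"
  using tf_shift_apply[of "fst z" "snd z"] by simp

lemma tf_shift_add: "tf_shift z (f + g) = tf_shift z f + tf_shift z g"
  by (rule blinfun.add_right)

lemma tf_shift_cscale: "tf_shift z (cscale c f) = cscale c (tf_shift z f)"
  by (simp add: tf_shift_eq translation_cscale modulation_cscale)

lemma norm_tf_shift [simp]: "norm (tf_shift z f) = norm f"
  by (simp add: tf_shift_eq norm_modulation norm_translation)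

lemma tf_shift_0 [simp]: "tf_shift 0 f = f"
  by (simp add: tf_shift_eq)

lemma tf_shift_tf_shift: "tf_shift z (tf_shift w f) = cscale (tf_phase z w) (tf_shift (z + w) f)"
  by (simp add: tf_shift_eq translation_modulation modulation_cscale modulation_modulation
      translation_translation tf_phase_def)

lemma tf_shift_plus: "tf_shift (z + w) f = cscale (cnj (tf_phase z w)) (tf_shift z (tf_shift w f))"
  by (simp add: tf_shift_tf_shift cscale_cscale)

text \<open>An isometry preserves the real inner product by polarization. The imaginary part of the
  pairing is the real part after replacing f by \<open>cscale (-\<i>) f\<close>.\<close>

lemma cinner_tf_shift [simp]: "cinner (tf_shift z f) (tf_shift z g) = cinner f g"
proof -
  have *: "inner (tf_shift z f) (tf_shift z g) = inner f g" for f g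
    by (simp add: dot_norm blinfun.add_right[symmetric] power2_norm_eq_inner[symmetric])
  show ?thesis
    using *[of f g] *[of "cscale (-\<i>) f" g]
    by (simp add: inner_L2_def tf_shift_cscale cinner_cscale_left complex_eq_iff)
qed

text \<open>Covariance: in modulus only the difference of the two points matters. All bounds on
  Gabor coefficients are made uniform over the lattice through this identity.\<close>

lemma cmod_cinner_tf_shift: "cmod (cinner (tf_shift z f) (tf_shift w g)) = cmod (cinner f (tf_shift (w - z) g))"
proof -
  have "tf_shift w g = cscale (cnj (tf_phase z (w - z))) (tf_shift z (tf_shift (w - z) g))"
    using tf_shift_plus[of z "w - z" g] by (simp only: add_diff_cancel_left' add.commute[of z] diff_add_cancel)
  then have "cinner (tf_shift z f) (tf_shift w g) = tf_phase z (w - z) * cinner f (tf_shift (w - z) g)"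
    by (simp only: cinner_cscale_right cinner_tf_shift complex_cnj_cnj)
  then show ?thesis
    by (simp add: norm_mult)
qed

lemma cmod_cinner_commute: "cmod (cinner f g) = cmod (cinner g f)"
  by (metis cinner_commute complex_mod_cnj)

section \<open>Plancherel's theorem and Moyal's formula\<close>

lemma norm_L2_tendsto_0I:
  fixes F :: "'d::finite L2"
  assumes "(\<lambda>n. ennreal ((norm (X n - F))\<^sup>2)) \<longlonglongrightarrow> 0"
  shows "X \<longlonglongrightarrow> F"
proof -
  have "(\<lambda>n. (norm (X n - F))\<^sup>2) \<longlonglongrightarrow> 0"
    using assms by (subst (asm) ennreal_0[symmetric], subst (asm) tendsto_ennreal_iff) auto
  then have "(\<lambda>n. sqrt ((norm (X n - F))\<^sup>2)) \<longlonglongrightarrow> sqrt 0"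
    by (rule tendsto_real_sqrt)
  then show ?thesis
    by (simp add: LIM_zero_iff tendsto_norm_zero_iff)
qed

lemma L2_tendsto_dominated:
  fixes F :: "real^'d::finite \<Rightarrow> complex"
  assumes f: "\<And>n. sq_integrable (f n)" and F: "sq_integrable F"
    and w: "w \<in> borel_measurable borel" "(\<integral>\<^sup>+t. w t \<partial>lborel) < \<infinity>"
    and bnd: "\<And>n. AE t in lborel. ennreal ((cmod (f n t - F t))\<^sup>2) \<le> w t"
    and lim: "AE t in lborel. (\<lambda>n. f n t) \<longlonglongrightarrow> F t"
  shows "(\<lambda>n. abs_L2 (f n)) \<longlonglongrightarrow> abs_L2 F"
proof (rule norm_L2_tendsto_0I)
  have [measurable]: "f n \<in> borel_measurable borel" "F \<in> borel_measurable borel" for n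
    using f F by (auto simp: sq_integrable_def)
  note [measurable] = w(1)
  have "ennreal ((norm (abs_L2 (f n) - abs_L2 F))\<^sup>2)
      = (\<integral>\<^sup>+t. ennreal ((cmod (f n t - F t))\<^sup>2) \<partial>lborel)" for n
    using nn_norm_abs_L2[OF sq_integrable_diff[OF f F]] by (simp add: diff_abs_L2[OF f F])
  moreover have "(\<lambda>n. \<integral>\<^sup>+t. ennreal ((cmod (f n t - F t))\<^sup>2) \<partial>lborel)
      \<longlonglongrightarrow> (\<integral>\<^sup>+t. 0 \<partial>(lborel :: (real^'d) measure))"
  proof (rule nn_integral_dominated_convergence[where w = w])
    show "AE t in lborel. (\<lambda>n. ennreal ((cmod (f n t - F t))\<^sup>2)) \<longlonglongrightarrow> 0"
      using lim
    proof eventually_elim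
      case (elim t)
      then have "(\<lambda>n. f n t - F t) \<longlonglongrightarrow> 0"
        by (simp add: LIM_zero_iff)
      then have "(\<lambda>n. ennreal ((cmod (f n t - F t))\<^sup>2)) \<longlonglongrightarrow> ennreal ((cmod 0)\<^sup>2)"
        by (intro tendsto_intros)
      then show ?case by simp
    qed
  qed (use bnd w in auto)
  ultimately show "(\<lambda>n. ennreal ((norm (abs_L2 (f n) - abs_L2 F))\<^sup>2)) \<longlonglongrightarrow> 0"
    by simp
qed

text \<open>The radial retraction of the plane onto the disc of radius k. It is continuous, so
  continuous approximants stay continuous while becoming bounded.\<close>

definition clip :: "real \<Rightarrow> complex \<Rightarrow> complex" where
  "clip k w = w / of_real (max 1 (cmod w / k))"

lemma cmod_clip: "0 < k \<Longrightarrow> cmod (clip k w) \<le> k"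
  by (cases "cmod w \<le> k") (auto simp: clip_def norm_divide norm_mult max_def field_simps)

lemma clip_id: "0 < k \<Longrightarrow> cmod w \<le> k \<Longrightarrow> clip k w = w"
  by (simp add: clip_def max_def)

lemma continuous_clip: "0 < k \<Longrightarrow> continuous_on UNIV (clip k)"
  unfolding clip_def by (intro continuous_intros) (auto simp: max_def)

lemma nn_integral_cball_finite:
  "(\<integral>\<^sup>+t. ennreal c * indicator (cball a r) t \<partial>(lborel :: ('a::euclidean_space) measure)) < \<infinity>"
  using emeasure_lborel_cball_finite[of a r]
  by (subst nn_integral_cmult_indicator) (simp_all add: ennreal_mult_less_top)

lemma cball_in_sets_borel [measurable]: "cball a r \<in> sets borel"
  by (simp add: borel_closed)

lemma sq_integrable_bounded:
  fixes f :: "real^'d::finite \<Rightarrow> complex"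
  assumes [measurable]: "f \<in> borel_measurable borel" and "\<And>t. cmod (f t) \<le> k" "\<And>t. t \<notin> cball 0 r \<Longrightarrow> f t = 0"
  shows "sq_integrable f"
proof (rule sq_integrableI)
  have "ennreal ((cmod (f t))\<^sup>2) \<le> ennreal (k\<^sup>2) * indicator (cball 0 r) t" for t
    using power_mono[OF assms(2)[of t], of 2] assms(3)[of t] by (auto simp: indicator_def ennreal_leI)
  then have "(\<integral>\<^sup>+t. ennreal ((cmod (f t))\<^sup>2) \<partial>lborel)
      \<le> (\<integral>\<^sup>+t. ennreal (k\<^sup>2) * indicator (cball (0::real^'d) r) t \<partial>lborel)"
    by (rule nn_integral_mono)
  then show "(\<integral>\<^sup>+t. ennreal ((cmod (f t))\<^sup>2) \<partial>lborel) < \<infinity>"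
    using nn_integral_cball_finite by (rule le_less_trans)
qed simp

text \<open>Square-integrable functions are first truncated to bounded functions of bounded support, which are
  limits of clipped continuous functions.\<close>

lemma L2_dense_bounded:
  fixes f :: "'d::finite L2"
  assumes "0 < e"
  obtains F k where "F \<in> borel_measurable borel" "0 < k" "\<And>t. cmod (F t) \<le> k"
    "\<And>t. t \<notin> cball 0 k \<Longrightarrow> F t = 0" "norm (abs_L2 F - f) < e"
proof -
  define g where "g n t = (if cmod (rep_L2 f t) \<le> real (Suc n) \<and> norm t \<le> real (Suc n) then rep_L2 f t else 0)" for n t
  have [measurable]: "g n \<in> borel_measurable borel" for n
    unfolding g_def by measurable
  have g: "sq_integrable (g n)" for n
    by (rule sq_integrable_bounded[where k = "real (Suc n)" and r = "real (Suc n)"]) (auto simp: g_def)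
  have "(\<lambda>n. abs_L2 (g n)) \<longlonglongrightarrow> abs_L2 (rep_L2 f)"
  proof (rule L2_tendsto_dominated[OF g sq_integrable_rep])
    show "(\<integral>\<^sup>+t. ennreal ((cmod (rep_L2 f t))\<^sup>2) \<partial>lborel) < \<infinity>"
      unfolding nn_norm_rep[symmetric] by simp
    show "AE t in lborel. ennreal ((cmod (g n t - rep_L2 f t))\<^sup>2) \<le> ennreal ((cmod (rep_L2 f t))\<^sup>2)" for n
      by (auto simp: g_def)
    show "AE t in lborel. (\<lambda>n. g n t) \<longlonglongrightarrow> rep_L2 f t"
    proof (rule AE_I2)
      fix t
      obtain N where N: "max (cmod (rep_L2 f t)) (norm t) \<le> real N"
        using real_arch_simple by blast
      have "\<forall>\<^sub>F n in sequentially. g n t = rep_L2 f t"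
        using N by (intro eventually_sequentiallyI[of N]) (auto simp: g_def)
      then show "(\<lambda>n. g n t) \<longlonglongrightarrow> rep_L2 f t"
        by (rule tendsto_eventually)
    qed
  qed simp
  then have "\<forall>\<^sub>F n in sequentially. dist (abs_L2 (g n)) f < e"
    using assms by (auto dest: tendstoD)
  then obtain n where "dist (abs_L2 (g n)) f < e"
    by (auto simp: eventually_sequentially)
  then show ?thesis
    by (intro that[of "g n" "real (Suc n)"]) (auto simp: g_def dist_norm)
qed

lemma L2_dense_continuous:
  fixes f :: "'d::finite L2"
  assumes "0 < e"
  obtains F k where "continuous_on UNIV F" "0 < k" "\<And>t. cmod (F t) \<le> k"
    "\<And>t. t \<notin> cball 0 k \<Longrightarrow> F t = 0" "norm (abs_L2 F - f) < e"
proof -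
  obtain G k where G: "G \<in> borel_measurable borel" "0 < k" "\<And>t. cmod (G t) \<le> k"
    "\<And>t. t \<notin> cball 0 k \<Longrightarrow> G t = 0" "norm (abs_L2 G - f) < e / 2"
    using L2_dense_bounded[of "e/2" f] assms by auto
  note [measurable] = G(1)
  have "G \<in> borel_measurable lebesgue"
    using G(1) by (simp add: measurable_completion)
  \<comment> \<open>Measurability in this form supplies continuous functions that converge to
    \<open>G\<close> off a negligible set. They need not be bounded or of bounded support, which the
    clipping and the cutoff repair.\<close>
  then have "G measurable_on UNIV"
    by (rule lebesgue_measurable_imp_measurable_on) simp
  then obtain N h where N: "negligible N" and h: "\<And>n. continuous_on UNIV (h n)"
    and lim: "\<And>t. t \<notin> N \<Longrightarrow> (\<lambda>n. h n t) \<longlonglongrightarrow> G t"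
    unfolding measurable_on_def by auto
  \<comment> \<open>Continuous, equal to 1 on the ball of radius k, where \<open>G\<close> lives,
    and to 0 outside the ball of radius k + 1. The dominating function can then be a constant on a
    ball.\<close>
  define cutoff :: "real^'d \<Rightarrow> real" where "cutoff t = max 0 (min 1 (k + 1 - norm t))" for t
  define g where "g n t = clip k (h n t) * of_real (cutoff t)" for n t
  have cg: "continuous_on UNIV (g n)" for n
    unfolding g_def cutoff_def
    by (intro continuous_intros continuous_on_compose2[OF continuous_clip[OF G(2)] h]) auto
  have [measurable]: "g n \<in> borel_measurable borel" for n
    by (rule borel_measurable_continuous_onI[OF cg])
  have gk: "cmod (g n t) \<le> k" for n t
  proof -
    have "cmod (g n t) \<le> k * 1"
      unfolding g_def norm_mult using cmod_clip[OF G(2), of "h n t"] G(2)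
      by (intro mult_mono) (auto simp: cutoff_def)
    then show ?thesis by simp
  qed
  have g0: "g n t = 0" if "t \<notin> cball 0 (k + 1)" for n t
    using that by (auto simp: g_def cutoff_def)
  have g: "sq_integrable (g n)" for n
    using gk g0 by (intro sq_integrable_bounded) auto
  have sG: "sq_integrable G"
    using G by (intro sq_integrable_bounded) auto
  have "(\<lambda>n. abs_L2 (g n)) \<longlonglongrightarrow> abs_L2 G"
  proof (rule L2_tendsto_dominated[OF g sG])
    show "(\<integral>\<^sup>+t. ennreal ((2 * k)\<^sup>2) * indicator (cball (0::real^'d) (k+1)) t \<partial>lborel) < \<infinity>"
      by (rule nn_integral_cball_finite)
    show "AE t in lborel. ennreal ((cmod (g n t - G t))\<^sup>2) \<le> ennreal ((2 * k)\<^sup>2) * indicator (cball 0 (k+1)) t" for n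
    proof (rule AE_I2)
      fix t
      have "cmod (g n t - G t) \<le> 2 * k"
        using norm_triangle_ineq4[of "g n t" "G t"] gk[of n t] G(3)[of t] by linarith
      then have "(cmod (g n t - G t))\<^sup>2 \<le> (2 * k)\<^sup>2"
        by (intro power_mono) auto
      then show "ennreal ((cmod (g n t - G t))\<^sup>2) \<le> ennreal ((2 * k)\<^sup>2) * indicator (cball 0 (k+1)) t"
        using g0[of t n] G(4)[of t] by (auto simp: indicator_def intro!: ennreal_leI)
    qed
    have "N \<in> null_sets lebesgue"
      using N by (simp add: negligible_iff_null_sets)
    then have "AE t in lebesgue. t \<notin> N"
      by (rule AE_not_in)
    then have "AE t in lborel. t \<notin> N"
      by (simp add: AE_completion_iff)
    then show "AE t in lborel. (\<lambda>n. g n t) \<longlonglongrightarrow> G t"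
    proof eventually_elim
      case (elim t)
      have "(\<lambda>n. clip k (h n t)) \<longlonglongrightarrow> clip k (G t)"
        using lim[OF elim] continuous_clip[OF G(2)] by (auto intro: isCont_tendsto_compose simp: continuous_on_eq_continuous_at)
      then have "(\<lambda>n. g n t) \<longlonglongrightarrow> clip k (G t) * of_real (cutoff t)"
        unfolding g_def by (intro tendsto_intros)
      also have "clip k (G t) * of_real (cutoff t) = G t"
        using G(4)[of t] G(3)[of t] G(2) by (cases "t \<in> cball 0 k") (auto simp: clip_id cutoff_def)
      finally show ?case .
    qed
  qed simp
  then have "\<forall>\<^sub>F n in sequentially. dist (abs_L2 (g n)) (abs_L2 G) < e / 2"
    by (rule tendstoD) (use assms in simp)
  then obtain n where n: "norm (abs_L2 (g n) - abs_L2 G) < e / 2"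
    by (auto simp: eventually_sequentially dist_norm)
  have "norm (abs_L2 (g n) - f) < e"
    using norm_triangle_lt[of "abs_L2 (g n) - abs_L2 G" "abs_L2 G - f" e] n G(5) by simp
  show ?thesis
  proof (rule that[of "g n" "k + 1"])
    show "cmod (g n t) \<le> k + 1" for t
      using gk[of n t] by linarith
  qed (use cg g0 G(2) \<open>norm (abs_L2 (g n) - f) < e\<close> in auto)
qed

lemma translation_abs: "sq_integrable f \<Longrightarrow> translation x (abs_L2 f) = abs_L2 (\<lambda>t. f (t - x))"
  by (rule translation.abs_eq[OF L2_rel_refl])

lemma translation_diff: "translation x (f - g) = translation x f - translation x g"
  by (simp only: diff_conv_add_uminus translation_add flip: cscale_minus1) (simp only: translation_cscale)

text \<open>Translations are isometries, so an e/3 argument reduces the claim to a bounded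
  continuous function of bounded support, where dominated convergence applies. Convergence of
  \<open>X\<close> bounds the region that the translates visit.\<close>

lemma translation_continuous:
  fixes f :: "'d::finite L2"
  assumes X: "X \<longlonglongrightarrow> 0"
  shows "(\<lambda>n. translation (X n) f) \<longlonglongrightarrow> f"
proof (rule LIMSEQ_I)
  fix e :: real assume e: "0 < e"
  obtain F k where F: "continuous_on UNIV F" "0 < k" "\<And>t. cmod (F t) \<le> k"
    "\<And>t. t \<notin> cball 0 k \<Longrightarrow> F t = 0" "norm (abs_L2 F - f) < e / 3"
    using L2_dense_continuous[of "e/3" f] e by auto
  have [measurable]: "F \<in> borel_measurable borel"
    by (rule borel_measurable_continuous_onI[OF F(1)])
  have sF: "sq_integrable F"
    using F by (intro sq_integrable_bounded) auto
  obtain M where M: "\<And>n. norm (X n) \<le> M"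
    using convergent_imp_Bseq[OF convergentI[OF X]] unfolding Bseq_def by blast
  have "(\<lambda>n. abs_L2 (\<lambda>t. F (t - X n))) \<longlonglongrightarrow> abs_L2 F"
  proof (rule L2_tendsto_dominated[OF sq_integrable_shift[OF sF] sF])
    show "(\<integral>\<^sup>+t. ennreal ((2 * k)\<^sup>2) * indicator (cball (0::real^'d) (k + M)) t \<partial>lborel) < \<infinity>"
      by (rule nn_integral_cball_finite)
    show "AE t in lborel. ennreal ((cmod (F (t - X n) - F t))\<^sup>2)
        \<le> ennreal ((2 * k)\<^sup>2) * indicator (cball 0 (k + M)) t" for n
    proof (rule AE_I2)
      fix t
      have "cmod (F (t - X n) - F t) \<le> 2 * k"
        using norm_triangle_ineq4[of "F (t - X n)" "F t"] F(3)[of "t - X n"] F(3)[of t] by linarith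
      then have 1: "(cmod (F (t - X n) - F t))\<^sup>2 \<le> (2 * k)\<^sup>2"
        by (intro power_mono) auto
      show "ennreal ((cmod (F (t - X n) - F t))\<^sup>2) \<le> ennreal ((2 * k)\<^sup>2) * indicator (cball 0 (k + M)) t"
      proof (cases "t \<in> cball 0 (k + M)")
        case False
        then have "norm t > k + M" by simp
        moreover have "norm t \<le> norm (t - X n) + norm (X n)"
          using norm_triangle_ineq[of "t - X n" "X n"] by simp
        ultimately have "norm (t - X n) > k" "norm t > k"
          using M[of n] norm_ge_zero[of "X n"] by linarith+
        then show ?thesis
          using F(4) by simp
      qed (use 1 in \<open>auto intro!: ennreal_leI\<close>)
    qed
    show "AE t in lborel. (\<lambda>n. F (t - X n)) \<longlonglongrightarrow> F t"
    proof (rule AE_I2)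
      fix t
      have "(\<lambda>n. t - X n) \<longlonglongrightarrow> t - 0"
        by (intro tendsto_intros X)
      then show "(\<lambda>n. F (t - X n)) \<longlonglongrightarrow> F t"
        using F(1) by (auto intro: isCont_tendsto_compose simp: continuous_on_eq_continuous_at)
    qed
  qed simp
  then have "(\<lambda>n. translation (X n) (abs_L2 F)) \<longlonglongrightarrow> abs_L2 F"
    by (simp add: translation_abs[OF sF])
  then obtain N where N: "\<And>n. n \<ge> N \<Longrightarrow> norm (translation (X n) (abs_L2 F) - abs_L2 F) < e / 3"
    using LIMSEQ_D[of _ "abs_L2 F" "e / 3"] e by (metis zero_less_divide_iff zero_less_numeral)
  have "norm (translation (X n) f - f) < e" if "n \<ge> N" for n
  proof -
    have "translation (X n) f - f = translation (X n) (f - abs_L2 F)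
        + (translation (X n) (abs_L2 F) - abs_L2 F) + (abs_L2 F - f)"
      by (simp add: translation_diff)
    then have "norm (translation (X n) f - f) \<le> norm (translation (X n) (f - abs_L2 F))
        + norm (translation (X n) (abs_L2 F) - abs_L2 F) + norm (abs_L2 F - f)"
      by (metis norm_triangle_mono norm_triangle_ineq order_refl)
    also have "norm (translation (X n) (f - abs_L2 F)) = norm (abs_L2 F - f)"
      by (simp add: norm_translation norm_minus_commute)
    finally show ?thesis
      using F(5) N[OF that] by linarith
  qed
  then show "\<exists>no. \<forall>n\<ge>no. norm (translation (X n) f - f) < e"
    by blast
qed

section \<open>Gaussian integrals and their Fourier transforms\<close>

lemma gaussian_integrable_1:
  assumes "0 < a"
  shows "integrable lborel (\<lambda>x::real. exp (- (a * x\<^sup>2)))"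
proof -
  define c where "c = 1 / sqrt a"
  have c: "c \<noteq> 0" "a * (c * x)\<^sup>2 = x\<^sup>2" for x
    using assms by (auto simp: c_def power_mult_distrib power_divide)
  have "(\<integral>\<^sup>+x. ennreal (exp (- (a * x\<^sup>2))) \<partial>lborel)
      = ennreal \<bar>c\<bar> * (\<integral>\<^sup>+x. ennreal (exp (- (1 * x\<^sup>2))) \<partial>lborel)"
    by (subst nn_integral_real_affine[where t = 0, OF _ c(1)]) (auto simp: c(2))
  also have "\<dots> < \<infinity>"
    using nn_integral_exp_square_finite[of 1] by (simp add: ennreal_mult_less_top)
  finally show ?thesis
    by (simp add: integrable_iff_bounded)
qed

lemma exp_inner_prod: "exp (- (a * (t \<bullet> t))) = (\<Prod>b\<in>Basis. exp (- (a * (t \<bullet> b)\<^sup>2)))"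
  for t :: "'a::euclidean_space"
  by (subst euclidean_inner)
     (simp add: exp_sum[symmetric] sum_negf sum_distrib_left power2_eq_square mult.assoc)

lemma gaussian_integrable:
  assumes "0 < a"
  shows "integrable lborel (\<lambda>t::'a::euclidean_space. exp (- (a * (t \<bullet> t))))"
proof -
  have "(\<integral>\<^sup>+t. ennreal (exp (- (a * (t \<bullet> t)))) \<partial>(lborel :: 'a measure))
      = (\<integral>\<^sup>+t. (\<Prod>b\<in>Basis. ennreal (exp (- (a * (t \<bullet> b)\<^sup>2)))) \<partial>(lborel :: 'a measure))"
    by (simp only: prod_ennreal[symmetric] exp_ge_zero exp_inner_prod)
  also have "\<dots> = (\<Prod>b\<in>(Basis :: 'a set). \<integral>\<^sup>+x. ennreal (exp (- (a * x\<^sup>2))) \<partial>lborel)"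
    by (rule nn_integral_lborel_prod) auto
  also have "\<dots> < \<infinity>"
    using gaussian_integrable_1[OF assms] by (simp add: power_less_top_ennreal integrable_iff_bounded)
  finally show ?thesis
    by (simp add: integrable_iff_bounded)
qed

text \<open>Factors the Fourier integral of a Gaussian over the coordinates, so that only the
  one-dimensional transform has to be known.\<close>

lemma lborel_integral_prod:
  fixes f :: "'a::euclidean_space \<Rightarrow> real \<Rightarrow> complex"
  assumes "\<And>b. b \<in> Basis \<Longrightarrow> integrable lborel (f b)"
  shows "(\<integral>t. (\<Prod>b\<in>Basis. f b (t \<bullet> b)) \<partial>lborel) = (\<Prod>b\<in>Basis. \<integral>x. f b x \<partial>lborel)"
proof -
  interpret product_sigma_finite "\<lambda>_::'a. lborel :: real measure"
    by standard
  have [measurable]: "f b \<in> borel_measurable borel" if "b \<in> Basis" for b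
    using borel_measurable_integrable[OF assms[OF that]] by simp
  have "(\<integral>t. (\<Prod>b\<in>Basis. f b (t \<bullet> b)) \<partial>lborel)
      = (\<integral>x. (\<Prod>b\<in>Basis. f b ((\<Sum>b\<in>Basis. x b *\<^sub>R b) \<bullet> b)) \<partial>(\<Pi>\<^sub>M b\<in>Basis. lborel))"
    by (subst lborel_eq) (subst integral_distr, measurable)
  also have "\<dots> = (\<integral>x. (\<Prod>b\<in>Basis. f b (x b)) \<partial>(\<Pi>\<^sub>M b\<in>Basis. lborel))"
    by (intro Bochner_Integration.integral_cong refl prod.cong) (simp add: inner_sum_left_Basis)
  also have "\<dots> = (\<Prod>b\<in>Basis. \<integral>x. f b x \<partial>lborel)"
    by (intro product_integral_prod assms) auto
  finally show ?thesis .
qed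

text \<open>This is the characteristic function of the standard normal law under the substitution by
  \<open>sqrt (2 * pi)\<close>: that factor turns exp (-x^2/2) into exp (-pi x^2) and cancels the
  normalizing constant of the density.\<close>

lemma gaussian_FT_1:
  "(\<integral>x. of_real (exp (- (pi * x\<^sup>2))) * exp (- (2 * of_real pi * \<i> * of_real (w * x))) \<partial>lborel)
     = complex_of_real (exp (- (pi * w\<^sup>2)))"
proof -
  define t where "t = - (sqrt (2 * pi) * w)"
  have t2: "t\<^sup>2 / 2 = pi * w\<^sup>2"
    by (simp add: t_def power_mult_distrib)
  have "complex_of_real (exp (- (pi * w\<^sup>2))) = char std_normal_distribution t"
    using t2 by (simp add: char_std_normal_distribution)
  also have "\<dots> = (\<integral>x. std_normal_density x *\<^sub>R iexp (t * x) \<partial>lborel)"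
    unfolding char_def by (subst integral_density) auto
  also have "\<dots> = \<bar>sqrt (2 * pi)\<bar> *\<^sub>R (\<integral>x. std_normal_density (0 + sqrt (2 * pi) * x) *\<^sub>R iexp (t * (0 + sqrt (2 * pi) * x)) \<partial>lborel)"
    by (rule lborel_integral_real_affine) simp
  also have "\<dots> = (\<integral>x. sqrt (2 * pi) *\<^sub>R (std_normal_density (sqrt (2 * pi) * x) *\<^sub>R iexp (t * (sqrt (2 * pi) * x))) \<partial>lborel)"
    by (subst integral_scaleR_right) simp_all
  also have "\<dots> = (\<integral>x. of_real (exp (- (pi * x\<^sup>2))) * exp (- (2 * of_real pi * \<i> * of_real (w * x))) \<partial>lborel)"
  proof (rule Bochner_Integration.integral_cong[OF refl])
    fix x :: real
    have "t * (sqrt (2 * pi) * x) = - (2 * pi * (w * x))"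
      by (simp add: t_def)
    then have "iexp (t * (sqrt (2 * pi) * x)) = exp (- (2 * of_real pi * \<i> * of_real (w * x)))"
      by (simp add: mult_ac)
    moreover have "sqrt (2 * pi) * std_normal_density (sqrt (2 * pi) * x) = exp (- (pi * x\<^sup>2))"
      by (simp add: std_normal_density_def power_mult_distrib)
    ultimately show "sqrt (2 * pi) *\<^sub>R (std_normal_density (sqrt (2 * pi) * x) *\<^sub>R iexp (t * (sqrt (2 * pi) * x)))
        = of_real (exp (- (pi * x\<^sup>2))) * exp (- (2 * of_real pi * \<i> * of_real (w * x)))"
      by (metis scaleR_conv_of_real scaleR_scaleR)
  qed
  finally show ?thesis ..
qed

lemma integrable_gaussian_exp:
  assumes "0 < a"
  shows "integrable lborel (\<lambda>t::'a::euclidean_space. complex_of_real (exp (- (a * (t \<bullet> t)))) * exp (- (2 * of_real pi * \<i> * of_real (w \<bullet> t))))"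
proof (rule Bochner_Integration.integrable_bound[OF gaussian_integrable[OF assms]])
  have "(\<lambda>t::'a. complex_of_real (exp (- (a * (t \<bullet> t)))) * exp (- (2 * of_real pi * \<i> * of_real (w \<bullet> t)))) \<in> borel_measurable borel"
    by (intro borel_measurable_continuous_onI continuous_intros)
  then show "(\<lambda>t::'a. complex_of_real (exp (- (a * (t \<bullet> t)))) * exp (- (2 * of_real pi * \<i> * of_real (w \<bullet> t)))) \<in> borel_measurable lborel"
    by simp
qed (simp add: norm_mult norm_exp_eq_Re)

lemma gaussian_FT:
  fixes w :: "'a::euclidean_space"
  shows "(\<integral>t. of_real (exp (- (pi * (t \<bullet> t)))) * exp (- (2 * of_real pi * \<i> * of_real (w \<bullet> t))) \<partial>lborel)
     = complex_of_real (exp (- (pi * (w \<bullet> w))))"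
proof -
  let ?f = "\<lambda>b x. complex_of_real (exp (- (pi * x\<^sup>2))) * exp (- (2 * of_real pi * \<i> * of_real ((w \<bullet> b) * x)))"
  have "of_real (exp (- (pi * (t \<bullet> t)))) * exp (- (2 * of_real pi * \<i> * of_real (w \<bullet> t)))
      = (\<Prod>b\<in>Basis. ?f b (t \<bullet> b))" for t
  proof -
    have "exp (- (2 * of_real pi * \<i> * of_real (w \<bullet> t)))
      = (\<Prod>b\<in>Basis. exp (- (2 * of_real pi * \<i> * of_real ((w \<bullet> b) * (t \<bullet> b)))))"
      by (subst euclidean_inner) (simp add: exp_sum[symmetric] sum_negf sum_distrib_left mult.assoc)
    then show ?thesis
      by (simp add: exp_inner_prod prod.distrib)
  qed
  then have "(\<integral>t. of_real (exp (- (pi * (t \<bullet> t)))) * exp (- (2 * of_real pi * \<i> * of_real (w \<bullet> t))) \<partial>lborel)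
      = (\<integral>t. (\<Prod>b\<in>Basis. ?f b (t \<bullet> b)) \<partial>lborel)"
    by simp
  also have "\<dots> = (\<Prod>b\<in>Basis. \<integral>x. ?f b x \<partial>lborel)"
    using integrable_gaussian_exp[of pi "w \<bullet> b" for b]
    by (intro lborel_integral_prod) (simp add: power2_eq_square)
  also have "\<dots> = (\<Prod>b\<in>Basis. complex_of_real (exp (- (pi * (w \<bullet> b)\<^sup>2))))"
    by (simp only: gaussian_FT_1)
  also have "\<dots> = complex_of_real (exp (- (pi * (w \<bullet> w))))"
    by (simp add: exp_inner_prod)
  finally show ?thesis .
qed

lemma lborel_integral_scale:
  fixes f :: "'a::euclidean_space \<Rightarrow> 'b::{banach, second_countable_topology}"
  assumes [measurable]: "f \<in> borel_measurable borel" and c: "0 < c"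
  shows "(\<integral>x. f x \<partial>lborel) = c ^ DIM('a) *\<^sub>R (\<integral>x. f (c *\<^sub>R x) \<partial>lborel)"
proof -
  have "(\<integral>x. f x \<partial>lborel) = (\<integral>x. f x \<partial>density (distr lborel borel (\<lambda>x::'a. 0 + c *\<^sub>R x)) (\<lambda>_. ennreal (c ^ DIM('a))))"
    using c by (subst lborel_affine[of c 0]) (auto simp: ennreal_power)
  also have "\<dots> = (\<integral>x. c ^ DIM('a) *\<^sub>R f x \<partial>distr lborel borel (\<lambda>x::'a. 0 + c *\<^sub>R x))"
    using c by (subst integral_density) auto
  also have "\<dots> = (\<integral>x. c ^ DIM('a) *\<^sub>R f (c *\<^sub>R x) \<partial>lborel)"
    by (subst integral_distr) auto
  finally show ?thesis
    by simp
qed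

lemma gaussian_total: "(\<integral>t. exp (- (pi * (t \<bullet> t))) \<partial>(lborel :: 'a::euclidean_space measure)) = 1"
proof -
  have "complex_of_real (\<integral>t. exp (- (pi * (t \<bullet> t))) \<partial>(lborel :: 'a measure)) = 1"
    using gaussian_FT[of "0::'a"] by (simp del: of_real_exp)
  then show ?thesis
    by (metis of_real_eq_1_iff)
qed

lemma gaussian_FT_scaled:
  fixes w :: "'a::euclidean_space"
  assumes e: "0 < e"
  shows "e ^ DIM('a) *\<^sub>R (\<integral>t. of_real (exp (- (pi * e\<^sup>2 * (t \<bullet> t)))) * exp (- (2 * of_real pi * \<i> * of_real (w \<bullet> t))) \<partial>lborel)
     = complex_of_real (exp (- (pi * ((w /\<^sub>R e) \<bullet> (w /\<^sub>R e)))))"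
proof -
  have eq: "pi * ((e *\<^sub>R t) \<bullet> (e *\<^sub>R t)) = pi * e\<^sup>2 * (t \<bullet> t)" "(w /\<^sub>R e) \<bullet> (e *\<^sub>R t) = w \<bullet> t" for t
    using e by (simp_all add: power2_eq_square)
  have "complex_of_real (exp (- (pi * ((w /\<^sub>R e) \<bullet> (w /\<^sub>R e))))) =
    (\<integral>t. of_real (exp (- (pi * (t \<bullet> t)))) * exp (- (2 * of_real pi * \<i> * of_real ((w /\<^sub>R e) \<bullet> t))) \<partial>lborel)"
    by (rule gaussian_FT[symmetric])
  also have "\<dots> = e ^ DIM('a) *\<^sub>R (\<integral>t. of_real (exp (- (pi * ((e *\<^sub>R t) \<bullet> (e *\<^sub>R t))))) * exp (- (2 * of_real pi * \<i> * of_real ((w /\<^sub>R e) \<bullet> (e *\<^sub>R t)))) \<partial>lborel)"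
    by (rule lborel_integral_scale[OF _ e]) (intro borel_measurable_continuous_onI continuous_intros)
  also have "\<dots> = e ^ DIM('a) *\<^sub>R (\<integral>t. of_real (exp (- (pi * e\<^sup>2 * (t \<bullet> t)))) * exp (- (2 * of_real pi * \<i> * of_real (w \<bullet> t))) \<partial>lborel)"
    using e by (simp only: eq)
  finally show ?thesis ..
qed

section \<open>The Fourier transform and Plancherel's identity\<close>

lemma integrable_pair_bound:
  fixes f :: "'a::euclidean_space \<times> 'b::euclidean_space \<Rightarrow> complex"
  assumes f: "f \<in> borel_measurable (lborel \<Otimes>\<^sub>M lborel)"
    and a: "integrable lborel a" and b: "integrable lborel b"
    and le: "\<And>x y. cmod (f (x, y)) \<le> a x * b y"
  shows "integrable (lborel \<Otimes>\<^sub>M lborel) f"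
proof (rule Bochner_Integration.integrable_bound)
  have [measurable]: "a \<in> borel_measurable borel" "b \<in> borel_measurable borel"
    using borel_measurable_integrable[OF a] borel_measurable_integrable[OF b] by auto
  show "integrable (lborel \<Otimes>\<^sub>M lborel) (\<lambda>z. a (fst z) * b (snd z))"
  proof (rule lborel_pair.Fubini_integrable)
    show "integrable lborel (\<lambda>x. \<integral>y. norm (a (fst (x, y)) * b (snd (x, y))) \<partial>lborel)"
      using a by (simp add: abs_mult)
    show "AE x in lborel. integrable lborel (\<lambda>y. a (fst (x, y)) * b (snd (x, y)))"
      using b by simp
  qed measurable
  show "AE z in lborel \<Otimes>\<^sub>M lborel. cmod (f z) \<le> norm (a (fst z) * b (snd z))"
  proof (rule AE_I2)
    fix z :: "'a \<times> 'b"
    show "cmod (f z) \<le> norm (a (fst z) * b (snd z))"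
      using le[of "fst z" "snd z"] by (simp add: abs_le_iff)
  qed
qed (fact f)

lemma lborel_integral_shift:
  fixes f :: "'a::euclidean_space \<Rightarrow> 'b::{banach, second_countable_topology}"
  assumes [measurable]: "f \<in> borel_measurable borel"
  shows "(\<integral>x. f x \<partial>lborel) = (\<integral>x. f (t + x) \<partial>lborel)"
  by (subst lborel_distr_plus[symmetric, of t], subst integral_distr) simp_all

lemma nn_integral_lborel_shift:
  fixes f :: "'a::euclidean_space \<Rightarrow> ennreal"
  assumes [measurable]: "f \<in> borel_measurable borel"
  shows "(\<integral>\<^sup>+x. f (t + x) \<partial>lborel) = (\<integral>\<^sup>+x. f x \<partial>lborel)"
  by (subst (2) lborel_distr_plus[symmetric, of t], subst nn_integral_distr) simp_all

lemma nn_integral_lborel_reflect: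
  fixes f :: "'a::euclidean_space \<Rightarrow> ennreal"
  assumes [measurable]: "f \<in> borel_measurable borel"
  shows "(\<integral>\<^sup>+x. f (t - x) \<partial>lborel) = (\<integral>\<^sup>+x. f x \<partial>lborel)"
proof -
  have "(\<integral>\<^sup>+x. f x \<partial>lborel) = (\<integral>\<^sup>+x. f x \<partial>density (distr lborel borel (\<lambda>x::'a. t + (-1) *\<^sub>R x)) (\<lambda>_. 1))"
    by (subst lborel_affine[of "-1" t]) auto
  also have "\<dots> = (\<integral>\<^sup>+x. f (t - x) \<partial>lborel)"
    by (subst nn_integral_density, simp, simp, subst nn_integral_distr) auto
  finally show ?thesis ..
qed

definition fourier :: "('a::euclidean_space \<Rightarrow> complex) \<Rightarrow> 'a \<Rightarrow> complex" where
  "fourier k w = (\<integral>t. k t * exp (- (2 * of_real pi * \<i> * of_real (w \<bullet> t))) \<partial>lborel)"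

lemma cmod_char: "cmod (exp (- (2 * of_real pi * \<i> * of_real r))) = 1"
  by (simp add: norm_exp_eq_Re)

lemma fourier_measurable [measurable]:
  assumes [measurable]: "k \<in> borel_measurable borel"
  shows "fourier k \<in> borel_measurable borel"
  unfolding fourier_def by measurable

lemma cmod_fourier_le:
  assumes "integrable lborel k"
  shows "cmod (fourier k w) \<le> (\<integral>t. cmod (k t) \<partial>lborel)"
  unfolding fourier_def
  by (rule order_trans[OF integral_norm_bound]) (simp add: norm_mult cmod_char)

text \<open>Gaussian regularization: the factor \<open>exp (- \<pi> \<epsilon>\<^sup>2 |\<omega>|\<^sup>2)\<close> justifies Fubini's theorem and turns the
  energy of the Fourier transform into an average of the autocorrelation of \<open>k\<close>.\<close>

lemma fourier_regularized:
  fixes k :: "'a::euclidean_space \<Rightarrow> complex"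
  assumes k: "integrable lborel k" and e: "0 < e"
  shows "(\<integral>w. of_real (exp (- (pi * e\<^sup>2 * (w \<bullet> w)))) * (fourier k w * cnj (fourier k w)) \<partial>lborel)
    = (\<integral>s. of_real (exp (- (pi * (s \<bullet> s)))) * (\<integral>t. k (t + e *\<^sub>R s) * cnj (k t) \<partial>lborel) \<partial>lborel)"
proof -
  note [measurable] = borel_measurable_integrable[OF k, simplified]
  define G :: "'a \<Rightarrow> complex" where "G w = of_real (exp (- (pi * e\<^sup>2 * (w \<bullet> w))))" for w
  define E where "E w t = exp (- (2 * of_real pi * \<i> * of_real (w \<bullet> t)))" for w t :: 'a
  \<comment> \<open>The Fourier transform of the regularizing factor: an approximate identity of
    width e.\<close>
  define h where "h r = exp (- (pi * ((r /\<^sub>R e) \<bullet> (r /\<^sub>R e)))) / e ^ DIM('a)" for r :: 'a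
  have h: "(\<integral>w. G w * E w r \<partial>lborel) = of_real (h r)" for r
  proof -
    define I where "I = (\<integral>w. G w * E w r \<partial>lborel)"
    have "e ^ DIM('a) *\<^sub>R I = of_real (exp (- (pi * ((r /\<^sub>R e) \<bullet> (r /\<^sub>R e)))))"
      unfolding I_def G_def E_def using gaussian_FT_scaled[OF e, of r] by (simp only: inner_commute[of _ r])
    then have "(1 / e ^ DIM('a)) *\<^sub>R (e ^ DIM('a) *\<^sub>R I) = of_real (h r)"
      by (simp only: h_def scaleR_conv_of_real flip: of_real_mult) simp
    then show ?thesis
      using e by (simp add: I_def)
  qed
  have [measurable]: "G \<in> borel_measurable borel" "h \<in> borel_measurable borel"
    unfolding G_def h_def by measurable
  have [measurable]: "(\<lambda>x. E (f x) (g x)) \<in> borel_measurable M"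
    if "f \<in> borel_measurable M" "g \<in> borel_measurable M" for f g :: "'m \<Rightarrow> 'a" and M
    unfolding E_def using that by measurable
  have cE: "cmod (E w t) = 1" "E w s * cnj (E w t) = E w (s - t)" for w s t
    by (simp_all add: E_def cmod_char exp_cnj flip: exp_add) (simp add: algebra_simps inner_diff_right)
  have iG: "integrable lborel (\<lambda>w. cmod (G w))"
    using gaussian_integrable[of "pi * e\<^sup>2", where ?'a = 'a] e by (simp add: G_def)
  define L where "L = (\<integral>t. cmod (k t) \<partial>lborel)"
  have K: "fourier k w = (\<integral>s. k s * E w s \<partial>lborel)" for w
    by (simp add: fourier_def E_def)
  have Kc: "cnj (fourier k w) = (\<integral>t. cnj (k t) * cnj (E w t) \<partial>lborel)" for w
    unfolding K by (subst Bochner_Integration.integral_cnj[symmetric]) simp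
  have KL: "cmod (fourier k w) \<le> L" for w
    unfolding L_def by (rule cmod_fourier_le[OF k])
  have inner: "(\<integral>w. G w * fourier k w * cnj (E w t) \<partial>lborel) = (\<integral>s. k (t + s) * of_real (h s) \<partial>lborel)" for t
  proof -
    have int: "integrable (lborel \<Otimes>\<^sub>M lborel) (\<lambda>(w, s). G w * (k s * E w s) * cnj (E w t))"
      by (rule integrable_pair_bound[OF _ iG integrable_norm[OF k]])
         (auto simp: norm_mult cE)
    have "(\<integral>w. G w * fourier k w * cnj (E w t) \<partial>lborel)
        = (\<integral>w. (\<integral>s. G w * (k s * E w s) * cnj (E w t) \<partial>lborel) \<partial>lborel)"
      by (simp add: K)
    also have "\<dots> = (\<integral>s. (\<integral>w. G w * (k s * E w s) * cnj (E w t) \<partial>lborel) \<partial>lborel)"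
      by (rule lborel_pair.Fubini_integral[OF int, symmetric])
    also have "\<dots> = (\<integral>s. k s * (\<integral>w. G w * E w (s - t) \<partial>lborel) \<partial>lborel)"
      by (simp flip: cE(2) integral_mult_right_zero add: mult_ac)
    also have "\<dots> = (\<integral>s. k s * of_real (h (s - t)) \<partial>lborel)"
      by (simp add: h)
    also have "\<dots> = (\<integral>s. k (t + s) * of_real (h s) \<partial>lborel)"
      by (subst lborel_integral_shift[of _ t]) simp_all
    finally show ?thesis .
  qed
  have int1: "integrable (lborel \<Otimes>\<^sub>M lborel) (\<lambda>(w, t). G w * fourier k w * (cnj (k t) * cnj (E w t)))"
  proof (rule integrable_pair_bound[OF _ integrable_mult_right[OF iG, of L] integrable_norm[OF k]])
    show "cmod (case (w, t) of (w, t) \<Rightarrow> G w * fourier k w * (cnj (k t) * cnj (E w t)))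
        \<le> L * cmod (G w) * cmod (k t)" for w t
      using mult_right_mono[OF KL[of w], of "cmod (G w) * cmod (k t)"] by (simp add: norm_mult cE mult_ac)
  qed measurable
  have hb: "0 \<le> h r" "h r \<le> 1 / e ^ DIM('a)" for r
    using e by (auto simp: h_def intro!: divide_right_mono)
  \<comment> \<open>The argument t + s rules out a bound by a product of functions of t and of s.
    Instead the iterated integral is estimated: \<open>h\<close> is bounded, and the integral of |k
    (t + s)| over s does not depend on t.\<close>
  have int2: "integrable (lborel \<Otimes>\<^sub>M lborel) (\<lambda>(t, s). cnj (k t) * (k (t + s) * of_real (h s)))"
  proof -
    have "(\<integral>\<^sup>+z. ennreal (cmod (case z of (t, s) \<Rightarrow> cnj (k t) * (k (t + s) * of_real (h s)))) \<partial>(lborel \<Otimes>\<^sub>M lborel))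
      = (\<integral>\<^sup>+t. (\<integral>\<^sup>+s. ennreal (cmod (cnj (k t) * (k (t + s) * of_real (h s)))) \<partial>lborel) \<partial>lborel)"
      by (subst lborel.nn_integral_fst[symmetric]) simp_all
    also have "\<dots> \<le> (\<integral>\<^sup>+t. (\<integral>\<^sup>+s. ennreal (cmod (k t) / e ^ DIM('a)) * ennreal (cmod (k (t + s))) \<partial>lborel) \<partial>lborel)"
    proof (intro nn_integral_mono)
      fix t s
      have "cmod (cnj (k t) * (k (t + s) * of_real (h s))) \<le> cmod (k t) * (cmod (k (t + s)) * (1 / e ^ DIM('a)))"
        using mult_left_mono[OF hb(2), of "cmod (k t) * cmod (k (t + s))" s] hb(1)[of s]
        by (simp add: norm_mult mult_ac)
      then show "ennreal (cmod (cnj (k t) * (k (t + s) * of_real (h s))))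
          \<le> ennreal (cmod (k t) / e ^ DIM('a)) * ennreal (cmod (k (t + s)))"
        using e by (subst ennreal_mult[symmetric]) (auto intro!: ennreal_leI simp: mult_ac)
    qed
    also have "\<dots> = (\<integral>\<^sup>+t. ennreal (cmod (k t) / e ^ DIM('a)) * (\<integral>\<^sup>+s. ennreal (cmod (k s)) \<partial>lborel) \<partial>lborel)"
      by (subst nn_integral_cmult) (simp_all add: nn_integral_lborel_shift[of "\<lambda>s. ennreal (cmod (k s))"])
    also have "\<dots> = (\<integral>\<^sup>+t. ennreal (cmod (k t) / e ^ DIM('a)) \<partial>lborel) * (\<integral>\<^sup>+s. ennreal (cmod (k s)) \<partial>lborel)"
      by (subst nn_integral_multc) simp_all
    also have "\<dots> < \<infinity>"
    proof -
      have "integrable lborel (\<lambda>t. k t / of_real (e ^ DIM('a)))"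
        using k by simp
      then have "(\<integral>\<^sup>+t. ennreal (cmod (k t) / e ^ DIM('a)) \<partial>lborel) < \<infinity>"
        using e by (simp add: integrable_iff_bounded norm_divide norm_power)
      then show ?thesis
        using k by (simp add: integrable_iff_bounded ennreal_mult_less_top)
    qed
    finally show ?thesis
      by (simp add: integrable_iff_bounded)
  qed
  have "(\<integral>w. G w * (fourier k w * cnj (fourier k w)) \<partial>lborel)
      = (\<integral>w. (\<integral>t. G w * fourier k w * (cnj (k t) * cnj (E w t)) \<partial>lborel) \<partial>lborel)"
    by (simp add: Kc mult.assoc)
  also have "\<dots> = (\<integral>t. (\<integral>w. G w * fourier k w * (cnj (k t) * cnj (E w t)) \<partial>lborel) \<partial>lborel)"
    by (rule lborel_pair.Fubini_integral[OF int1, symmetric])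
  also have "\<dots> = (\<integral>t. cnj (k t) * (\<integral>w. G w * fourier k w * cnj (E w t) \<partial>lborel) \<partial>lborel)"
    by (simp flip: integral_mult_right_zero add: mult_ac)
  also have "\<dots> = (\<integral>t. (\<integral>s. cnj (k t) * (k (t + s) * of_real (h s)) \<partial>lborel) \<partial>lborel)"
    by (simp add: inner)
  also have "\<dots> = (\<integral>s. (\<integral>t. cnj (k t) * (k (t + s) * of_real (h s)) \<partial>lborel) \<partial>lborel)"
    by (rule lborel_pair.Fubini_integral[OF int2, symmetric])
  also have "\<dots> = (\<integral>s. of_real (h s) * (\<integral>t. k (t + s) * cnj (k t) \<partial>lborel) \<partial>lborel)"
    by (simp flip: integral_mult_right_zero add: mult_ac)
  \<comment> \<open>Rescaling s moves the dependence on e from the Gaussian into the argument of the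
    autocorrelation, where it can tend to zero.\<close>
  also have "\<dots> = e ^ DIM('a) *\<^sub>R (\<integral>s. of_real (h (e *\<^sub>R s)) * (\<integral>t. k (t + e *\<^sub>R s) * cnj (k t) \<partial>lborel) \<partial>lborel)"
    by (rule lborel_integral_scale[OF _ e]) measurable
  also have "\<dots> = (\<integral>s. e ^ DIM('a) *\<^sub>R (of_real (h (e *\<^sub>R s)) * (\<integral>t. k (t + e *\<^sub>R s) * cnj (k t) \<partial>lborel)) \<partial>lborel)"
    by (rule integral_scaleR_right[symmetric])
  also have "\<dots> = (\<integral>s. of_real (exp (- (pi * (s \<bullet> s)))) * (\<integral>t. k (t + e *\<^sub>R s) * cnj (k t) \<partial>lborel) \<partial>lborel)"
  proof -
    have "e ^ DIM('a) *\<^sub>R (of_real (h (e *\<^sub>R s)) * c) = of_real (exp (- (pi * (s \<bullet> s)))) * c" for s and c :: complex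
    proof -
      have "e ^ DIM('a) * h (e *\<^sub>R s) = exp (- (pi * (s \<bullet> s)))"
        using e by (simp add: h_def)
      then show ?thesis
        by (metis (no_types) scaleR_conv_of_real of_real_mult mult.assoc)
    qed
    then show ?thesis by simp
  qed
  finally show ?thesis
    by (simp add: G_def)
qed

text \<open>Let the regularization tend to zero in \<open>fourier_regularized\<close>. The side with
  the autocorrelation converges by dominated convergence, since translations are strongly
  continuous; the side with the transform converges by monotone convergence, which presupposes no
  integrability of the transform.\<close>

lemma plancherel:
  fixes k :: "real^'d::finite \<Rightarrow> complex"
  assumes k: "integrable lborel k" and k2: "sq_integrable k"
  shows "(\<integral>\<^sup>+w. ennreal ((cmod (fourier k w))\<^sup>2) \<partial>lborel) = (\<integral>\<^sup>+t. ennreal ((cmod (k t))\<^sup>2) \<partial>lborel)"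
proof -
  note [measurable] = borel_measurable_integrable[OF k, simplified]
  define e where "e n = 1 / real (Suc n)" for n
  have e: "0 < e n" for n
    by (simp add: e_def)
  have e0: "e \<longlonglongrightarrow> 0"
    unfolding e_def by (rule LIMSEQ_Suc[OF lim_1_over_n])
  define \<kappa> where "\<kappa> = abs_L2 k"
  define B where "B r = (\<integral>t. k (t + r) * cnj (k t) \<partial>lborel)" for r
  have B: "B r = cinner (translation (- r) \<kappa>) \<kappa>" for r
    using cinner_abs[OF sq_integrable_shift[OF k2, of "- r"] k2]
    by (simp add: B_def \<kappa>_def translation_abs[OF k2])
  have [measurable]: "B \<in> borel_measurable borel"
    unfolding B_def by measurable
  have int: "(\<lambda>n. \<integral>s. complex_of_real (exp (- (pi * (s \<bullet> s)))) * B (e n *\<^sub>R s) \<partial>lborel)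
      \<longlonglongrightarrow> (\<integral>s. of_real (exp (- (pi * (s \<bullet> s)))) * of_real ((norm \<kappa>)\<^sup>2) \<partial>(lborel :: (real^'d) measure))"
  proof (rule integral_dominated_convergence[where w = "\<lambda>s. exp (- (pi * (s \<bullet> s))) * (norm \<kappa>)\<^sup>2"])
    show "integrable lborel (\<lambda>s::real^'d. exp (- (pi * (s \<bullet> s))) * (norm \<kappa>)\<^sup>2)"
      using gaussian_integrable[of pi, where ?'a = "real^'d"] by simp
    show "AE s in (lborel :: (real^'d) measure). (\<lambda>n. complex_of_real (exp (- (pi * (s \<bullet> s)))) * B (e n *\<^sub>R s))
        \<longlonglongrightarrow> of_real (exp (- (pi * (s \<bullet> s)))) * of_real ((norm \<kappa>)\<^sup>2)"
    proof (intro AE_I2 tendsto_mult tendsto_const)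
      fix s :: "real^'d"
      have "(\<lambda>n. - (e n *\<^sub>R s)) \<longlonglongrightarrow> - (0 *\<^sub>R s)"
        by (intro tendsto_intros e0)
      then have "(\<lambda>n. translation (- (e n *\<^sub>R s)) \<kappa>) \<longlonglongrightarrow> \<kappa>"
        by (intro translation_continuous) simp
      then have "(\<lambda>n. B (e n *\<^sub>R s)) \<longlonglongrightarrow> cinner \<kappa> \<kappa>"
        unfolding B by (rule bounded_linear.tendsto[OF bounded_linear_cinner_left])
      then show "(\<lambda>n. B (e n *\<^sub>R s)) \<longlonglongrightarrow> of_real ((norm \<kappa>)\<^sup>2)"
        by (simp only: cinner_self)
    qed
    show "AE s in (lborel :: (real^'d) measure). cmod (complex_of_real (exp (- (pi * (s \<bullet> s)))) * B (e n *\<^sub>R s))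
        \<le> exp (- (pi * (s \<bullet> s))) * (norm \<kappa>)\<^sup>2" for n
      unfolding B
      by (intro AE_I2) (auto simp: norm_mult power2_eq_square intro!: mult_left_mono order_trans[OF cinner_CS]
          simp: norm_translation)
  qed measurable
  have tot: "(\<integral>s. of_real (exp (- (pi * (s \<bullet> s)))) * of_real ((norm \<kappa>)\<^sup>2) \<partial>(lborel :: (real^'d) measure)) = complex_of_real ((norm \<kappa>)\<^sup>2)"
    using gaussian_total[where ?'a = "real^'d"]
    by (simp del: of_real_exp of_real_power flip: of_real_mult)
  define F where "F n w = exp (- (pi * (e n)\<^sup>2 * (w \<bullet> w))) * (cmod (fourier k w))\<^sup>2" for n and w :: "real^'d"
  have [measurable]: "F n \<in> borel_measurable borel" for n
    unfolding F_def by measurable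
  have iF: "integrable lborel (F n)" for n
  proof (rule Bochner_Integration.integrable_bound)
    show "integrable lborel (\<lambda>w::real^'d. exp (- (pi * (e n)\<^sup>2 * (w \<bullet> w))) * (\<integral>t. cmod (k t) \<partial>lborel)\<^sup>2)"
      using gaussian_integrable[of "pi * (e n)\<^sup>2", where ?'a = "real^'d"] e[of n] by simp
    show "AE w in lborel. norm (F n w) \<le> norm (exp (- (pi * (e n)\<^sup>2 * (w \<bullet> w))) * (\<integral>t. cmod (k t) \<partial>lborel)\<^sup>2)"
      by (auto simp: F_def abs_mult intro!: mult_left_mono power_mono cmod_fourier_le[OF k])
  qed measurable
  have "complex_of_real (\<integral>w. F n w \<partial>lborel) = (\<integral>s. of_real (exp (- (pi * (s \<bullet> s)))) * B (e n *\<^sub>R s) \<partial>lborel)" for n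
  proof -
    have "complex_of_real (\<integral>w. F n w \<partial>lborel) = (\<integral>w. of_real (F n w) \<partial>lborel)"
      by (rule integral_of_real[OF iF, symmetric])
    also have "\<dots> = (\<integral>w. of_real (exp (- (pi * (e n)\<^sup>2 * (w \<bullet> w)))) * (fourier k w * cnj (fourier k w)) \<partial>lborel)"
      unfolding F_def by (simp only: of_real_mult complex_norm_square)
    also have "\<dots> = (\<integral>s. of_real (exp (- (pi * (s \<bullet> s)))) * B (e n *\<^sub>R s) \<partial>lborel)"
      unfolding B_def by (rule fourier_regularized[OF k e])
    finally show ?thesis .
  qed
  then have "(\<lambda>n. complex_of_real (\<integral>w. F n w \<partial>lborel)) \<longlonglongrightarrow> complex_of_real ((norm \<kappa>)\<^sup>2)"
    using int by (simp only: tot)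
  then have "(\<lambda>n. \<integral>w. F n w \<partial>lborel) \<longlonglongrightarrow> (norm \<kappa>)\<^sup>2"
    by (simp only: tendsto_of_real_iff)
  then have "(\<lambda>n. ennreal (\<integral>w. F n w \<partial>lborel)) \<longlonglongrightarrow> ennreal ((norm \<kappa>)\<^sup>2)"
    by (rule tendsto_ennrealI)
  moreover have "ennreal (\<integral>w. F n w \<partial>lborel) = (\<integral>\<^sup>+w. ennreal (F n w) \<partial>lborel)" for n
    by (rule nn_integral_eq_integral[OF iF, symmetric]) (simp add: F_def)
  ultimately have lim1: "(\<lambda>n. \<integral>\<^sup>+w. ennreal (F n w) \<partial>lborel) \<longlonglongrightarrow> ennreal ((norm \<kappa>)\<^sup>2)"
    by simp
  have "(\<lambda>n. \<integral>\<^sup>+w. ennreal (F n w) \<partial>lborel) \<longlonglongrightarrow> (\<integral>\<^sup>+w. ennreal ((cmod (fourier k w))\<^sup>2) \<partial>lborel)"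
  proof (rule nn_integral_LIMSEQ)
    show "incseq (\<lambda>n w. ennreal (F n w))"
    proof (rule incseq_SucI, rule le_funI, rule ennreal_leI)
      fix n and w :: "real^'d"
      have "(e (Suc n))\<^sup>2 \<le> (e n)\<^sup>2"
        by (intro power_mono) (auto simp: e_def field_simps)
      then have "pi * (e (Suc n))\<^sup>2 * (w \<bullet> w) \<le> pi * (e n)\<^sup>2 * (w \<bullet> w)"
        by (intro mult_right_mono mult_left_mono) auto
      then show "F n w \<le> F (Suc n) w"
        unfolding F_def by (intro mult_right_mono) auto
    qed
    show "(\<lambda>n. ennreal (F n w)) \<longlonglongrightarrow> ennreal ((cmod (fourier k w))\<^sup>2)" for w
    proof (rule tendsto_ennrealI)
      have "(\<lambda>n. F n w) \<longlonglongrightarrow> exp (- (pi * 0\<^sup>2 * (w \<bullet> w))) * (cmod (fourier k w))\<^sup>2"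
        unfolding F_def by (intro tendsto_intros e0)
      then show "(\<lambda>n. F n w) \<longlonglongrightarrow> (cmod (fourier k w))\<^sup>2"
        by simp
    qed
  qed simp
  then have "(\<integral>\<^sup>+w. ennreal ((cmod (fourier k w))\<^sup>2) \<partial>lborel) = ennreal ((norm \<kappa>)\<^sup>2)"
    using lim1 by (rule LIMSEQ_unique)
  then show ?thesis
    by (simp only: \<kappa>_def nn_norm_abs_L2[OF k2])
qed

section \<open>Ambiguity functions and Moyal's formula\<close>

lemma fst_measurable_borel [measurable]:
  "(fst :: 'a::euclidean_space \<times> 'b::euclidean_space \<Rightarrow> 'a) \<in> borel_measurable borel"
  by (intro borel_measurable_continuous_onI continuous_intros)

lemma snd_measurable_borel [measurable]:
  "(snd :: 'a::euclidean_space \<times> 'b::euclidean_space \<Rightarrow> 'b) \<in> borel_measurable borel"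
  by (intro borel_measurable_continuous_onI continuous_intros)

text \<open>For fixed x the pairing is a Fourier transform in the frequency variable. Joint
  measurability and Moyal's formula both come from this form.\<close>

lemma cinner_tf_shift_abs:
  assumes F: "sq_integrable F" and G: "sq_integrable G"
  shows "cinner (abs_L2 F) (tf_shift z (abs_L2 G)) = fourier (\<lambda>t. F t * cnj (G (t - fst z))) (snd z)"
proof -
  have sh: "sq_integrable (\<lambda>t. G (t - fst z))"
    by (rule sq_integrable_shift[OF G])
  have "tf_shift z (abs_L2 G) = modulation (snd z) (abs_L2 (\<lambda>t. G (t - fst z)))"
    by (simp only: tf_shift_eq translation_abs[OF G])
  also have "\<dots> = abs_L2 (\<lambda>t. exp (2 * of_real pi * \<i> * of_real (snd z \<bullet> t)) * G (t - fst z))"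
    by (rule modulation.abs_eq[OF L2_rel_refl[OF sh]])
  finally have "cinner (abs_L2 F) (tf_shift z (abs_L2 G))
      = cinner (abs_L2 F) (abs_L2 (\<lambda>t. exp (2 * of_real pi * \<i> * of_real (snd z \<bullet> t)) * G (t - fst z)))"
    by simp
  also have "\<dots> = (\<integral>t. F t * cnj (exp (2 * of_real pi * \<i> * of_real (snd z \<bullet> t)) * G (t - fst z)) \<partial>lborel)"
    by (rule cinner_abs[OF F sq_integrable_modulation[OF sh]])
  also have "\<dots> = fourier (\<lambda>t. F t * cnj (G (t - fst z))) (snd z)"
    unfolding fourier_def by (intro Bochner_Integration.integral_cong refl) (simp add: exp_cnj)
  finally show ?thesis .
qed

lemma cinner_tf_shift_fourier:
  "cinner f (tf_shift z g) = fourier (\<lambda>t. rep_L2 f t * cnj (rep_L2 g (t - fst z))) (snd z)"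
  using cinner_tf_shift_abs[OF sq_integrable_rep[of f] sq_integrable_rep[of g], of z] by (simp only: abs_rep_L2)

lemma cinner_tf_shift_measurable [measurable]:
  "(\<lambda>z. cinner f (tf_shift z g)) \<in> borel_measurable borel"
  unfolding cinner_tf_shift_fourier fourier_def by measurable

text \<open>Plancherel in frequency for almost every x, then Tonelli in x and t. The product
  \<open>k x\<close> is integrable for every x but square integrable only for almost every x, which
  is read off from the finite total.\<close>

lemma moyal_nn:
  "(\<integral>\<^sup>+z. ennreal ((cmod (cinner f (tf_shift z g)))\<^sup>2) \<partial>lborel) = ennreal ((norm f)\<^sup>2 * (norm g)\<^sup>2)"
proof -
  define k where "k x t = rep_L2 f t * cnj (rep_L2 g (t - x))" for x t
  have [measurable]: "(\<lambda>z. k (fst z) (snd z)) \<in> borel_measurable (borel \<Otimes>\<^sub>M borel)"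
    unfolding k_def by measurable
  have [measurable]: "k x \<in> borel_measurable borel" for x
    unfolding k_def by measurable
  have k1: "integrable lborel (k x)" for x
    unfolding k_def by (rule integrable_mult_cnj[OF sq_integrable_rep sq_integrable_shift[OF sq_integrable_rep]])
  have "(\<integral>\<^sup>+x. (\<integral>\<^sup>+t. ennreal ((cmod (k x t))\<^sup>2) \<partial>lborel) \<partial>lborel)
      = (\<integral>\<^sup>+t. (\<integral>\<^sup>+x. ennreal ((cmod (k x t))\<^sup>2) \<partial>lborel) \<partial>lborel)"
    by (rule lborel_pair.Fubini'[symmetric]) measurable
  also have "\<dots> = (\<integral>\<^sup>+t. (\<integral>\<^sup>+x. ennreal ((cmod (rep_L2 f t))\<^sup>2) * ennreal ((cmod (rep_L2 g (t - x)))\<^sup>2) \<partial>lborel) \<partial>lborel)"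
    by (simp add: k_def norm_mult power_mult_distrib ennreal_mult)
  also have "\<dots> = (\<integral>\<^sup>+t. ennreal ((cmod (rep_L2 f t))\<^sup>2) * ennreal ((norm g)\<^sup>2) \<partial>lborel)"
    by (subst nn_integral_cmult)
       (simp_all add: nn_norm_rep nn_integral_lborel_reflect[of "\<lambda>x. ennreal ((cmod (rep_L2 g x))\<^sup>2)"])
  also have "\<dots> = ennreal ((norm f)\<^sup>2) * ennreal ((norm g)\<^sup>2)"
    by (subst nn_integral_multc) (simp_all add: nn_norm_rep)
  finally have tot: "(\<integral>\<^sup>+x. (\<integral>\<^sup>+t. ennreal ((cmod (k x t))\<^sup>2) \<partial>lborel) \<partial>lborel) = ennreal ((norm f)\<^sup>2 * (norm g)\<^sup>2)"
    by (simp add: ennreal_mult)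
  then have "AE x in lborel. (\<integral>\<^sup>+t. ennreal ((cmod (k x t))\<^sup>2) \<partial>lborel) \<noteq> \<infinity>"
    by (intro nn_integral_noteq_infinite) simp_all
  then have ae: "AE x in lborel. (\<integral>\<^sup>+w. ennreal ((cmod (fourier (k x) w))\<^sup>2) \<partial>lborel) = (\<integral>\<^sup>+t. ennreal ((cmod (k x t))\<^sup>2) \<partial>lborel)"
  proof eventually_elim
    case (elim x)
    then have "sq_integrable (k x)"
      by (intro sq_integrableI) (simp_all add: less_top)
    then show ?case
      by (rule plancherel[OF k1])
  qed
  have m: "(\<lambda>z. ennreal ((cmod (cinner f (tf_shift z g)))\<^sup>2)) \<in> borel_measurable (lborel \<Otimes>\<^sub>M lborel)"
    by (simp add: lborel_prod)
  have "(\<integral>\<^sup>+z. ennreal ((cmod (cinner f (tf_shift z g)))\<^sup>2) \<partial>lborel)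
      = (\<integral>\<^sup>+z. ennreal ((cmod (cinner f (tf_shift z g)))\<^sup>2) \<partial>(lborel \<Otimes>\<^sub>M lborel))"
    by (simp add: lborel_prod)
  also have "\<dots> = (\<integral>\<^sup>+x. (\<integral>\<^sup>+w. ennreal ((cmod (cinner f (tf_shift (x, w) g)))\<^sup>2) \<partial>lborel) \<partial>lborel)"
    by (rule lborel.nn_integral_fst[OF m, symmetric])
  also have "\<dots> = (\<integral>\<^sup>+x. (\<integral>\<^sup>+w. ennreal ((cmod (fourier (k x) w))\<^sup>2) \<partial>lborel) \<partial>lborel)"
    by (simp add: cinner_tf_shift_fourier k_def[abs_def])
  also have "\<dots> = (\<integral>\<^sup>+x. (\<integral>\<^sup>+t. ennreal ((cmod (k x t))\<^sup>2) \<partial>lborel) \<partial>lborel)"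
    by (rule nn_integral_cong_AE[OF ae])
  finally show ?thesis
    by (simp only: tot)
qed

lemma complex_polarization:
  "a * cnj b = (of_real ((cmod (a + b))\<^sup>2) - of_real ((cmod (a - b))\<^sup>2)
     + \<i> * of_real ((cmod (a + \<i> * b))\<^sup>2) - \<i> * of_real ((cmod (a - \<i> * b))\<^sup>2)) / 4"
  unfolding cmod_power2 by (simp add: complex_eq_iff power2_eq_square algebra_simps)

lemma cinner_polarization:
  "cinner f h = (of_real ((norm (f + h))\<^sup>2) - of_real ((norm (f - h))\<^sup>2)
     + \<i> * of_real ((norm (f + cscale \<i> h))\<^sup>2) - \<i> * of_real ((norm (f - cscale \<i> h))\<^sup>2)) / 4"
  unfolding cinner_self[symmetric]
  by (simp add: cinner_add_left cinner_add_right cinner_diff_left cinner_diff_right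
      cinner_cscale_left cinner_cscale_right algebra_simps)

text \<open>Polarization of \<open>moyal_nn\<close> in its first argument. In weak form this is the
  inversion formula whose Riemann sums are the Gabor frame operators below.\<close>

lemma has_bochner_integral_moyal:
  "has_bochner_integral lborel (\<lambda>z. cinner f (tf_shift z g) * cinner (tf_shift z g) h)
     (of_real ((norm g)\<^sup>2) * cinner f h)"
proof -
  define V where "V u z = cinner u (tf_shift z g)" for u z
  have *: "has_bochner_integral lborel (\<lambda>z. complex_of_real ((cmod (V u z))\<^sup>2)) (of_real ((norm u)\<^sup>2 * (norm g)\<^sup>2))" for u
    unfolding V_def
    by (intro has_bochner_integral_of_real has_bochner_integral_nn_integral moyal_nn) auto
  have "has_bochner_integral lborel (\<lambda>z. (of_real ((cmod (V (f + h) z))\<^sup>2) - of_real ((cmod (V (f - h) z))\<^sup>2)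
     + \<i> * of_real ((cmod (V (f + cscale \<i> h) z))\<^sup>2) - \<i> * of_real ((cmod (V (f - cscale \<i> h) z))\<^sup>2)) / 4)
    ((of_real ((norm (f + h))\<^sup>2 * (norm g)\<^sup>2) - of_real ((norm (f - h))\<^sup>2 * (norm g)\<^sup>2)
     + \<i> * of_real ((norm (f + cscale \<i> h))\<^sup>2 * (norm g)\<^sup>2) - \<i> * of_real ((norm (f - cscale \<i> h))\<^sup>2 * (norm g)\<^sup>2)) / 4)"
    by (intro has_bochner_integral_divide_zero has_bochner_integral_diff has_bochner_integral_add
        has_bochner_integral_mult_right *)
  moreover have "(of_real ((cmod (V (f + h) z))\<^sup>2) - of_real ((cmod (V (f - h) z))\<^sup>2)
     + \<i> * of_real ((cmod (V (f + cscale \<i> h) z))\<^sup>2) - \<i> * of_real ((cmod (V (f - cscale \<i> h) z))\<^sup>2)) / 4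
     = cinner f (tf_shift z g) * cinner (tf_shift z g) h" for z
  proof -
    have "V (f + h) z = V f z + V h z" "V (f - h) z = V f z - V h z"
      "V (f + cscale \<i> h) z = V f z + \<i> * V h z" "V (f - cscale \<i> h) z = V f z - \<i> * V h z"
      by (simp_all add: V_def cinner_add_left cinner_diff_left cinner_cscale_left)
    then show ?thesis
      using complex_polarization[of "V f z" "V h z"]
      by (simp only: V_def) (simp only: cinner_commute[symmetric])
  qed
  moreover have "(of_real ((norm (f + h))\<^sup>2 * (norm g)\<^sup>2) - of_real ((norm (f - h))\<^sup>2 * (norm g)\<^sup>2)
     + \<i> * of_real ((norm (f + cscale \<i> h))\<^sup>2 * (norm g)\<^sup>2) - \<i> * of_real ((norm (f - cscale \<i> h))\<^sup>2 * (norm g)\<^sup>2)) / 4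
     = of_real ((norm g)\<^sup>2) * cinner f h"
    unfolding cinner_polarization[of f h] by (simp add: algebra_simps)
  ultimately show ?thesis
    by (simp only:)
qed

section \<open>Weights and lattices\<close>

lemma is_weightD:
  assumes "is_weight v"
  shows "v (z + w) \<le> v z * v w" "1 \<le> v z" "0 < v z" "0 \<le> v z" "v (- z) = v z" "v \<in> borel_measurable lebesgue"
proof -
  show 1: "1 \<le> v z"
    using assms unfolding is_weight_def by blast
  show "0 < v z" "0 \<le> v z"
    using 1 by linarith+
qed (use assms in \<open>unfold is_weight_def, blast+\<close>)

text \<open>For large \<open>n\<close> the set \<open>E = {v \<le> n}\<close> fills most of a ball, so \<open>E\<close> and \<open>x + E\<close> meet for every small
  \<open>x\<close>, and \<open>v x \<le> n\<^sup>2\<close> follows.\<close>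

lemma weight_bounded_on_ball:
  fixes v :: "'d::finite phase \<Rightarrow> real"
  assumes v: "is_weight v"
  obtains K where "1 \<le> K" "\<And>z. norm z \<le> R \<Longrightarrow> v z \<le> K"
proof (cases "R > 0")
  case False
  then have "norm z \<le> R \<Longrightarrow> z = 0" for z :: "'d phase"
    by (metis norm_le_zero_iff not_le order_trans)
  then show ?thesis
    using that[of "v 0"] is_weightD(2)[OF v, of 0] by fastforce
next
  case R: True
  define B :: "'d phase set" where "B = ball 0 R"
  define D where "D n = B - {z. v z \<le> real n}" for n
  have [measurable]: "v \<in> borel_measurable lebesgue"
    by (rule is_weightD(6)[OF v])
  have E: "{z. v z \<le> real n} \<in> sets lebesgue" for n
  proof -
    have "{z \<in> space lebesgue. v z \<le> real n} \<in> sets lebesgue"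
      by measurable
    then show ?thesis by simp
  qed
  have D: "D n \<in> lmeasurable" for n
    unfolding D_def B_def by (intro fmeasurable_Diff lmeasurable_ball E)
  \<comment> \<open>Since v is finite everywhere, the sets \<open>D n\<close> decrease to the empty
    set.\<close>
  have "(\<lambda>n. emeasure lebesgue (D n)) \<longlonglongrightarrow> emeasure lebesgue (\<Inter>n. D n)"
  proof (rule Lim_emeasure_decseq)
    show "decseq D"
      by (rule decseq_SucI) (auto simp: D_def)
    show "emeasure lebesgue (D i) \<noteq> \<infinity>" for i
      using fmeasurableD2[OF D[of i]] by simp
  qed (use D in auto)
  moreover have "(\<Inter>n. D n) = {}"
    using real_arch_simple[of "v z" for z] by (force simp: D_def)
  ultimately have "(\<lambda>n. emeasure lebesgue (D n)) \<longlonglongrightarrow> 0"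
    by simp
  then have lim: "(\<lambda>n. measure lebesgue (D n)) \<longlonglongrightarrow> 0"
    using D by (auto simp: emeasure_eq_measure2 fmeasurableD2 tendsto_ennreal_iff simp flip: ennreal_0)
  define \<beta> where "\<beta> = measure lebesgue (ball (0::'d phase) (R / 2))"
  have "\<beta> > 0"
    using R content_ball_pos[of "R/2" "0::'d phase"] by (simp add: \<beta>_def)
  then have "\<forall>\<^sub>F n in sequentially. measure lebesgue (D n) < \<beta> / 2"
    by (intro order_tendstoD[OF lim]) simp
  then obtain n where n: "measure lebesgue (D n) < \<beta> / 2"
    by (auto simp: eventually_sequentially)
  have "v x \<le> (real n)\<^sup>2" if x: "norm x \<le> R" for x
  proof (rule ccontr)
    assume contra: "\<not> v x \<le> (real n)\<^sup>2"
    \<comment> \<open>For y in this ball both y and y - x stay in \<open>B\<close>. If neither lay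
      in \<open>D n\<close>, submultiplicativity and symmetry would give v x \<le> n^2; so
      \<open>H\<close> is covered by two copies of \<open>D n\<close>, each of less than half its
      measure.\<close>
    define H where "H = ball (x /\<^sub>R 2) (R / 2)"
    have "H \<subseteq> D n \<union> (+) x ` D n"
    proof
      fix y assume y: "y \<in> H"
      have xy: "norm (x /\<^sub>R 2 - y) < R / 2" and x2: "norm (x /\<^sub>R 2) \<le> R / 2"
        using y x by (simp_all add: H_def dist_norm)
      have "norm y < R"
        using norm_triangle_ineq4[of "x /\<^sub>R 2" "x /\<^sub>R 2 - y"] xy x2 by simp
      moreover have "norm (y - x) < R"
      proof -
        have "x - y = x /\<^sub>R 2 + (x /\<^sub>R 2 - y)"
          by (simp add: scaleR_half_double algebra_simps flip: scaleR_add_left)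
        then have "norm (x - y) \<le> norm (x /\<^sub>R 2) + norm (x /\<^sub>R 2 - y)"
          by (metis norm_triangle_ineq)
        then show ?thesis
          using xy x2 by (simp only: norm_minus_commute[of y x])
      qed
      moreover have "\<not> (v y \<le> real n \<and> v (y - x) \<le> real n)"
      proof
        assume *: "v y \<le> real n \<and> v (y - x) \<le> real n"
        have "v x \<le> v y * v (- (y - x))"
          using is_weightD(1)[OF v, of y "- (y - x)"] by simp
        also have "\<dots> \<le> real n * real n"
          unfolding is_weightD(5)[OF v] using * is_weightD(4)[OF v] by (intro mult_mono) auto
        finally show False
          using contra by (simp add: power2_eq_square)
      qed
      ultimately have "y \<in> D n \<or> y - x \<in> D n"
        by (auto simp: D_def B_def)
      then show "y \<in> D n \<union> (+) x ` D n"
        by (auto simp: image_iff intro: bexI[of _ "y - x"])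
    qed
    then have "measure lebesgue H \<le> measure lebesgue (D n \<union> (+) x ` D n)"
      by (intro measure_mono_fmeasurable fmeasurable.Un D measurable_translation) (auto simp: H_def)
    also have "\<dots> \<le> measure lebesgue (D n) + measure lebesgue ((+) x ` D n)"
      by (intro measure_Un_le) (use D measurable_translation in blast)+
    also have "\<dots> < \<beta>"
      using n by (simp add: measure_translation)
    also have "\<beta> = measure lebesgue H"
      using R by (simp add: \<beta>_def H_def content_ball)
    finally show False by simp
  qed
  then show ?thesis
    using that[of "max 1 ((real n)\<^sup>2)"] by fastforce
qed

text \<open>The factor \<open>v 0\<close> covers n = 0, where v 0 may exceed 1.\<close>

lemma weight_scaleR_le:
  assumes v: "is_weight v"
  shows "v (real n *\<^sub>R z) \<le> v 0 * v z ^ n"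
proof (induction n)
  case (Suc n)
  have "v (real (Suc n) *\<^sub>R z) \<le> v z * v (real n *\<^sub>R z)"
    using is_weightD(1)[OF v, of z "real n *\<^sub>R z"] by (simp add: algebra_simps)
  also have "\<dots> \<le> v z * (v 0 * v z ^ n)"
    by (intro mult_left_mono Suc is_weightD(4)[OF v])
  finally show ?case
    by (simp add: mult_ac)
qed simp

text \<open>A submultiplicative function that is bounded on the unit ball grows at most
  exponentially, because z is a multiple n of a vector in that ball with n about |z|. Completing the
  square trades c |z| for b |z|^2 plus a constant, so any Gaussian, however flat, beats the
  weight.\<close>

lemma weight_le_exp_square:
  fixes v :: "'d::finite phase \<Rightarrow> real"
  assumes v: "is_weight v" and b: "0 < b"
  obtains C where "0 < C" "\<And>z. v z \<le> C * exp (b * (z \<bullet> z))"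
proof -
  obtain K where K: "1 \<le> K" "\<And>z. norm z \<le> 1 \<Longrightarrow> v z \<le> K"
    using weight_bounded_on_ball[OF v, of 1] by metis
  define c where "c = ln K"
  have c: "0 \<le> c" "K = exp c"
    using K(1) by (auto simp: c_def)
  have *: "v z \<le> (K * K * K * exp (c\<^sup>2 / (4 * b))) * exp (b * (z \<bullet> z))" for z
  proof -
    \<comment> \<open>The added 1 keeps n positive at z = 0, where z is divided by n.\<close>
    define n where "n = nat \<lceil>norm z\<rceil> + 1"
    have n: "norm z \<le> real n" "real n \<le> norm z + 2" "0 < n"
      unfolding n_def by (linarith | auto)+
    have "norm (z /\<^sub>R real n) \<le> 1"
      using n by (simp add: field_simps)
    then have "v (z /\<^sub>R real n) \<le> K"
      by (rule K)
    then have "v (z /\<^sub>R real n) ^ n \<le> K ^ n"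
      by (intro power_mono is_weightD(4)[OF v])
    moreover have "v z \<le> v 0 * v (z /\<^sub>R real n) ^ n"
      using weight_scaleR_le[OF v, of n "z /\<^sub>R real n"] n(3) by simp
    moreover have "v 0 \<le> K"
      by (rule K) simp
    ultimately have "v z \<le> K * K ^ n"
      using K(1) is_weightD(4)[OF v] by (smt (verit) mult_mono zero_le_power)
    also have "K ^ n = exp (c * real n)"
      by (simp add: c(2) exp_of_nat2_mult mult.commute)
    also have "exp (c * real n) \<le> exp (c * (norm z + 2))"
      using c n by (simp add: mult_left_mono)
    also have "exp (c * (norm z + 2)) = K * K * exp (c * norm z)"
      by (simp add: c(2) algebra_simps flip: exp_add)
    also have "exp (c * norm z) \<le> exp (c\<^sup>2 / (4 * b) + b * (z \<bullet> z))"
    proof -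
      have "0 \<le> b * (norm z - c / (2 * b))\<^sup>2"
        using b by simp
      also have "\<dots> = c\<^sup>2 / (4 * b) + b * (z \<bullet> z) - c * norm z"
        using b by (simp add: power2_diff power2_norm_eq_inner[symmetric] field_simps power2_eq_square)
      finally show ?thesis by simp
    qed
    finally have "v z \<le> K * (K * K * exp (c\<^sup>2 / (4 * b) + b * (z \<bullet> z)))"
      using K(1) by (simp add: mult_left_mono)
    then show ?thesis
      by (simp add: exp_add mult.assoc)
  qed
  show ?thesis
    by (rule that[OF _ *]) (use K(1) in simp)
qed

section \<open>Rounding to the integer grid and Borel representatives of weights\<close>

definition grid_round :: "'a::euclidean_space \<Rightarrow> 'a" where
  "grid_round z = (\<Sum>b\<in>Basis. of_int \<lfloor>z \<bullet> b\<rfloor> *\<^sub>R b)"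

lemma norm_grid_round: "norm (z - grid_round z) \<le> real DIM('a)" for z :: "'a::euclidean_space"
proof -
  have "norm (z - grid_round z) \<le> (\<Sum>b\<in>Basis. \<bar>(z - grid_round z) \<bullet> b\<bar>)"
    by (rule norm_le_l1)
  also have "\<dots> \<le> (\<Sum>b\<in>(Basis :: 'a set). 1)"
  proof (rule sum_mono)
    fix b :: 'a assume b: "b \<in> Basis"
    have "(z - grid_round z) \<bullet> b = z \<bullet> b - of_int \<lfloor>z \<bullet> b\<rfloor>"
      using b by (simp add: grid_round_def inner_diff_left inner_sum_left_Basis)
    then show "\<bar>(z - grid_round z) \<bullet> b\<bar> \<le> 1"
      by linarith
  qed
  finally show ?thesis by simp
qed

lemma grid_round_measurable: "grid_round \<in> borel_measurable borel"
  unfolding grid_round_def[abs_def] by measurable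

lemma countable_range_grid_round: "countable (range (grid_round :: 'a::euclidean_space \<Rightarrow> 'a))"
proof -
  have "grid_round z \<in> (\<lambda>f. \<Sum>b\<in>Basis. of_int (f b) *\<^sub>R b) ` (Basis \<rightarrow>\<^sub>E UNIV)" for z :: 'a
    by (rule image_eqI[of _ _ "\<lambda>b\<in>Basis. \<lfloor>z \<bullet> b\<rfloor>"]) (auto simp: grid_round_def)
  then have "range (grid_round :: 'a \<Rightarrow> 'a) \<subseteq> (\<lambda>f. \<Sum>b\<in>Basis. of_int (f b) *\<^sub>R b) ` (Basis \<rightarrow>\<^sub>E (UNIV :: int set))"
    by auto
  then show ?thesis
    by (rule countable_subset) (intro countable_image countable_PiE, auto)
qed

text \<open>Composition with a function of countable range is measurable whatever the outer function is.\<close>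

lemma grid_round_compose_measurable: "(\<lambda>z. f (grid_round z)) \<in> borel_measurable borel"
proof (rule measurable_compose_countable'[OF _ _ countable_range_grid_round])
  show "grid_round \<in> borel \<rightarrow>\<^sub>M count_space (range (grid_round :: 'a \<Rightarrow> 'a))"
  proof (subst measurable_count_space_eq_countable[OF countable_range_grid_round], intro conjI ballI)
    fix a assume "a \<in> range (grid_round :: 'a \<Rightarrow> 'a)"
    show "grid_round -` {a} \<inter> space borel \<in> sets borel"
      using measurable_sets[OF grid_round_measurable, of "{a}"] by simp
  qed auto
qed simp

text \<open>Precomposition with \<open>grid_round\<close> makes any function Borel, and it changes v
  only by a bounded factor because the displacement is bounded. It destroys symmetry and
  submultiplicativity, though. Adding the reflected copy restores the first, and a constant factor
  \<open>M\<close> the second, since u (z + w) \<le> M u(z) u(w) says that \<open>M * u\<close> is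
  submultiplicative.\<close>

lemma is_weight_borel_equivalent:
  fixes v :: "'d::finite phase \<Rightarrow> real"
  assumes v: "is_weight v"
  obtains w C where "is_weight w" "w \<in> borel_measurable borel" "1 \<le> C"
    "\<And>z. v z \<le> C * w z" "\<And>z. w z \<le> C * v z"
proof -
  obtain K where K: "1 \<le> K" "\<And>z. norm z \<le> real DIM('d phase) \<Longrightarrow> v z \<le> K"
    using weight_bounded_on_ball[OF v] by metis
  have vK: "v (grid_round z) \<le> K * v z" "v z \<le> K * v (grid_round z)" for z
  proof -
    have "v (z - grid_round z) \<le> K"
      by (rule K(2)) (rule norm_grid_round)
    moreover have "v (grid_round z) \<le> v (- (z - grid_round z)) * v z" "v z \<le> v (z - grid_round z) * v (grid_round z)"
      using is_weightD(1)[OF v, of "- (z - grid_round z)" z] is_weightD(1)[OF v, of "z - grid_round z" "grid_round z"] by simp_all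
    ultimately show "v (grid_round z) \<le> K * v z" "v z \<le> K * v (grid_round z)"
      unfolding is_weightD(5)[OF v] by (meson is_weightD(4)[OF v] mult_right_mono order_trans)+
  qed
  define u where "u z = v (grid_round z) + v (grid_round (- z))" for z
  have u: "v z \<le> K * u z" "u z \<le> 2 * K * v z" "1 \<le> u z" "u (- z) = u z" for z
  proof -
    show "v z \<le> K * u z"
      using vK(2)[of z] is_weightD(4)[OF v, of "grid_round (- z)"] K(1) unfolding u_def
      by (smt (verit, best) mult_left_mono)
    show "u z \<le> 2 * K * v z"
      using vK(1)[of z] vK(1)[of "- z"] by (simp add: u_def is_weightD(5)[OF v])
    show "1 \<le> u z"
      using is_weightD(2)[OF v, of "grid_round z"] is_weightD(4)[OF v, of "grid_round (- z)"] by (simp add: u_def)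
  qed (simp add: u_def)
  \<comment> \<open>A factor 2 K comes from u \<le> 2 K v, and one factor K from each of v z \<le> K
    u z and v w \<le> K u w.\<close>
  define M where "M = 2 * K * K * K"
  have "1 \<le> K * K"
    using K(1) mult_mono[of 1 K 1 K] by simp
  then have "1 \<le> K * K * K"
    using K(1) mult_mono[of 1 "K * K" 1 K] by simp
  then have M: "1 \<le> M"
    by (simp add: M_def)
  have uu: "u (z + w) \<le> M * u z * u w" for z w
  proof -
    have "u (z + w) \<le> 2 * K * (v z * v w)"
      using u(2)[of "z + w"] is_weightD(1)[OF v, of z w] K(1)
      by (meson mult_left_mono order_trans zero_le_mult_iff zero_le_numeral zero_le_one)
    also have "\<dots> \<le> 2 * K * ((K * u z) * (K * u w))"
      using K(1) by (intro mult_left_mono mult_mono u is_weightD(4)[OF v] mult_nonneg_nonneg order_trans[OF zero_le_one u(3)]) auto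
    finally show ?thesis
      by (simp add: M_def mult_ac)
  qed
  show ?thesis
  proof (rule that[of "\<lambda>z. M * u z" "2 * M * K"])
    have [measurable]: "u \<in> borel_measurable borel"
      unfolding u_def
      by (intro borel_measurable_add grid_round_compose_measurable measurable_compose[OF _ grid_round_compose_measurable]) measurable
    show "(\<lambda>z. M * u z) \<in> borel_measurable borel"
      by measurable
    then have "(\<lambda>z. M * u z) \<in> borel_measurable lebesgue"
      by (simp add: measurable_completion)
    moreover have "M * u (z + w) \<le> M * u z * (M * u w)" for z w
      using mult_left_mono[OF uu[of z w], of M] M by (simp add: mult_ac)
    moreover have "1 \<le> M * u z" for z
      using mult_mono[OF M u(3)[of z]] M by simp
    ultimately show "is_weight (\<lambda>z. M * u z)"
      by (simp add: is_weight_def u(4))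
    show "1 \<le> 2 * M * K"
      using mult_mono[of 1 M 1 K] M K(1) by simp
    show "v z \<le> 2 * M * K * (M * u z)" for z
    proof -
      have "1 * (K * u z) \<le> (2 * M * M) * (K * u z)"
        using K(1) u(3)[of z] M mult_mono[of 1 M 1 M] by (intro mult_right_mono) auto
      then show ?thesis
        using u(1)[of z] by (simp add: mult_ac)
    qed
    show "M * u z \<le> 2 * M * K * v z" for z
      using mult_left_mono[OF u(2)[of z], of M] M by (simp add: mult_ac)
  qed
qed

text \<open>Only positivity and comparability have to survive here, and these pass to the
  composition with \<open>grid_round\<close> directly; moderateness is used in the original
  m.\<close>

lemma moderate_weight_borel_equivalent:
  fixes v m :: "'d::finite phase \<Rightarrow> real"
  assumes v: "is_weight v" and m: "moderate_weight v m"
  obtains m' C where "m' \<in> borel_measurable borel" "1 \<le> C" "\<And>z. 0 < m' z"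
    "\<And>z. m z \<le> C * m' z" "\<And>z. m' z \<le> C * m z"
proof -
  obtain K where K: "1 \<le> K" "\<And>z. norm z \<le> real DIM('d phase) \<Longrightarrow> v z \<le> K"
    using weight_bounded_on_ball[OF v] by metis
  obtain C where C: "0 < C" "\<And>z w. m (z + w) \<le> C * v z * m w" and m0: "\<And>z. 0 < m z"
    using m unfolding moderate_weight_def by blast
  have mK: "m (grid_round z) \<le> C * K * m z" "m z \<le> C * K * m (grid_round z)" for z
  proof -
    have K': "v (z - grid_round z) \<le> K"
      by (rule K(2)) (rule norm_grid_round)
    have "m (grid_round z) \<le> C * v (- (z - grid_round z)) * m z" "m z \<le> C * v (z - grid_round z) * m (grid_round z)"
      using C(2)[of "- (z - grid_round z)" z] C(2)[of "z - grid_round z" "grid_round z"] by simp_all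
    moreover have "C * v (z - grid_round z) * m y \<le> C * K * m y" for y
      using K' C(1) less_imp_le[OF m0] by (intro mult_right_mono mult_left_mono) auto
    ultimately show "m (grid_round z) \<le> C * K * m z" "m z \<le> C * K * m (grid_round z)"
      unfolding is_weightD(5)[OF v] by (meson order_trans)+
  qed
  have *: "C * K * m y \<le> max 1 (C * K) * m y" for y
    using less_imp_le[OF m0] by (intro mult_right_mono) auto
  show ?thesis
    by (rule that[of "\<lambda>z. m (grid_round z)" "max 1 (C * K)"])
       (rule grid_round_compose_measurable max.cobounded1 m0 order_trans[OF mK(1) *] order_trans[OF mK(2) *])+
qed

section \<open>Unordered sums as integrals over a counting measure\<close>

lemma nn_sum_eq_infsum:
  fixes f :: "'i \<Rightarrow> real"
  assumes f: "f summable_on I" and pos: "\<And>i. i \<in> I \<Longrightarrow> 0 \<le> f i"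
  shows "(\<integral>\<^sup>+i. ennreal (f i) \<partial>count_space I) = ennreal (infsum f I)"
proof -
  have "Infinite_Sum.abs_summable_on f I"
    using f summable_on_iff_abs_summable_on_real by blast
  then have "Infinite_Set_Sum.abs_summable_on f I"
    unfolding abs_summable_equivalent .
  then have i: "Infinite_Set_Sum.abs_summable_on f I" "infsetsum f I = infsum f I"
    by - (assumption, rule infsetsum_infsum)
  then have "(\<integral>\<^sup>+i. ennreal (f i) \<partial>count_space I) = ennreal (\<integral>i. f i \<partial>count_space I)"
    by (intro nn_integral_eq_integral) (simp_all add: Infinite_Set_Sum.abs_summable_on_def AE_count_space pos)
  then show ?thesis
    using i(2) by (simp add: infsetsum_def)
qed

lemma summable_on_nn_sum:
  fixes f :: "'i \<Rightarrow> real"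
  assumes fin: "(\<integral>\<^sup>+i. ennreal (f i) \<partial>count_space I) < \<infinity>" and pos: "\<And>i. i \<in> I \<Longrightarrow> 0 \<le> f i"
  shows "f summable_on I"
proof -
  have "(\<integral>\<^sup>+i. ennreal (norm (f i)) \<partial>count_space I) = (\<integral>\<^sup>+i. ennreal (f i) \<partial>count_space I)"
    by (intro nn_integral_cong) (simp add: pos)
  then have "integrable (count_space I) f"
    using fin by (simp add: integrable_iff_bounded)
  then have "Infinite_Sum.abs_summable_on f I"
    using abs_summable_equivalent[of f I] by (simp only: Infinite_Set_Sum.abs_summable_on_def)
  then show ?thesis
    by (rule abs_summable_summable)
qed

text \<open>The usual exit from a Tonelli argument: a finite bound over the counting measure yields
  summability together with the bound on the real sum.\<close>

lemma infsum_le_nn_sum: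
  fixes f :: "'i \<Rightarrow> real"
  assumes le: "(\<integral>\<^sup>+i. ennreal (f i) \<partial>count_space I) \<le> ennreal C" and C: "0 \<le> C" and pos: "\<And>i. i \<in> I \<Longrightarrow> 0 \<le> f i"
  shows "f summable_on I" "infsum f I \<le> C"
proof -
  show *: "f summable_on I"
    by (rule summable_on_nn_sum[OF _ pos]) (use le in \<open>auto intro: le_less_trans\<close>)
  show "infsum f I \<le> C"
    using le C nn_sum_eq_infsum[OF * pos] by simp
qed

lemma nn_sum_reindex:
  assumes "bij_betw g A B"
  shows "(\<integral>\<^sup>+i. f (g i) \<partial>count_space A) = (\<integral>\<^sup>+i. f i \<partial>count_space B)"
  using nn_integral_bij_count_space[OF assms, of f] by simp

text \<open>Discreteness and cocompactness in quantitative form: \<open>sep\<close> bounds the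
  nonzero lattice vectors from below and \<open>cov\<close> is a covering radius.\<close>

locale phase_lattice =
  fixes \<Lambda> :: "'d::finite phase set" and sep cov :: real
  assumes zero_in: "0 \<in> \<Lambda>" and add_in: "\<And>l k. l \<in> \<Lambda> \<Longrightarrow> k \<in> \<Lambda> \<Longrightarrow> l + k \<in> \<Lambda>"
    and minus_in: "\<And>l. l \<in> \<Lambda> \<Longrightarrow> - l \<in> \<Lambda>"
    and sep_pos: "0 < sep" and sep: "\<And>l. l \<in> \<Lambda> \<Longrightarrow> l \<noteq> 0 \<Longrightarrow> sep \<le> norm l"
    and cov_pos: "0 < cov" and cov: "\<And>z. \<exists>l\<in>\<Lambda>. norm (z - l) \<le> cov"
begin

lemma diff_in: "l \<in> \<Lambda> \<Longrightarrow> k \<in> \<Lambda> \<Longrightarrow> l - k \<in> \<Lambda>"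
  using add_in[of l "- k"] minus_in[of k] by simp

lemma sep_dist: "l \<in> \<Lambda> \<Longrightarrow> k \<in> \<Lambda> \<Longrightarrow> norm (l - k) < sep \<Longrightarrow> l = k"
  using sep[of "l - k"] diff_in[of l k] by (metis not_le right_minus_eq)

text \<open>Balls of radius sep/2 around lattice points are disjoint nonempty open sets, of which a
  separable space holds only countably many.\<close>

lemma countable_lattice: "countable \<Lambda>"
proof -
  define B where "B l = ball l (sep / 2)" for l :: "'d phase"
  have disj: "B l \<inter> B k = {}" if "l \<in> \<Lambda>" "k \<in> \<Lambda>" "l \<noteq> k" for l k
  proof (rule ccontr)
    assume "B l \<inter> B k \<noteq> {}"
    then obtain y where "dist l y < sep / 2" "dist k y < sep / 2"
      by (auto simp: B_def)
    then have "norm (l - k) < sep"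
      using dist_triangle2[of l k y] by (simp add: dist_norm)
    then show False
      using sep_dist that by blast
  qed
  have "countable (B ` \<Lambda>)"
  proof (rule countable_disjoint_open_subsets)
    show "pairwise disjnt (B ` \<Lambda>)"
      unfolding pairwise_def disjnt_def using disj by blast
  qed (auto simp: B_def)
  moreover have "inj_on B \<Lambda>"
  proof (rule inj_onI)
    fix l k assume "l \<in> \<Lambda>" "k \<in> \<Lambda>" "B l = B k"
    moreover have "l \<in> B l"
      using sep_pos by (simp add: B_def)
    ultimately show "l = k"
      using disj[of l k] by auto
  qed
  ultimately show ?thesis
    by (rule countable_image_inj_on)
qed

lemma bij_lattice_shift: "k \<in> \<Lambda> \<Longrightarrow> bij_betw (\<lambda>l. k + l) \<Lambda> \<Lambda>"
  by (rule bij_betwI[of _ _ _ "\<lambda>l. l - k"]) (auto intro: add_in diff_in)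

text \<open>Comparison with an integral over disjoint balls. From |w - y|^2 \<le> 2 |w - l|^2 + 2
  r^2 the term at l is at most exp (a r^2) times the Gaussian with exponent a/2 at any y in the ball
  around l. Giving up half of the exponent makes the bound uniform in w.\<close>

lemma gaussian_lattice_sum:
  assumes a: "0 < a"
  obtains C where "0 < C" "\<And>w. (\<integral>\<^sup>+l. ennreal (exp (- (a * ((w - l) \<bullet> (w - l))))) \<partial>count_space \<Lambda>) \<le> ennreal C"
proof -
  define r where "r = sep / 2"
  define \<beta> where "\<beta> = measure lborel (ball (0::'d phase) r)"
  have [measurable]: "ball x s \<in> sets borel" for x :: "'d phase" and s
    by (simp add: borel_open)
  define I where "I = (\<integral>y. exp (- (a / 2 * (y \<bullet> y))) \<partial>(lborel :: 'd phase measure))"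
  have r: "0 < r" and \<beta>: "0 < \<beta>"
    using sep_pos content_ball_pos[of r "0::'d phase"] by (auto simp: r_def \<beta>_def)
  have eb: "emeasure lborel (ball l r) = ennreal \<beta>" for l :: "'d phase"
  proof -
    have "emeasure lborel (ball l r) = measure lborel (ball l r)"
      using emeasure_lborel_ball_finite[of l r] by (intro emeasure_eq_ennreal_measure) (simp add: less_top)
    also have "measure lborel (ball l r) = \<beta>"
      using measure_translation[of l "ball 0 r"] by (simp add: \<beta>_def flip: ball_translation)
    finally show ?thesis .
  qed
  have "(\<integral>\<^sup>+l. ennreal (exp (- (a * ((w - l) \<bullet> (w - l))))) \<partial>count_space \<Lambda>) \<le> ennreal ((exp (a * r\<^sup>2) * I) / \<beta>)" for w
  proof -
    have *: "ennreal \<beta> * ennreal (exp (- (a * ((w - l) \<bullet> (w - l)))))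
        \<le> (\<integral>\<^sup>+y. ennreal (exp (a * r\<^sup>2) * exp (- (a / 2 * ((w - y) \<bullet> (w - y))))) * indicator (ball l r) y \<partial>lborel)" for l
    proof -
      have "ennreal \<beta> * ennreal (exp (- (a * ((w - l) \<bullet> (w - l)))))
          = (\<integral>\<^sup>+y. ennreal (exp (- (a * ((w - l) \<bullet> (w - l))))) * indicator (ball l r) y \<partial>lborel)"
        by (subst nn_integral_cmult_indicator) (simp_all add: eb mult.commute)
      also have "\<dots> \<le> (\<integral>\<^sup>+y. ennreal (exp (a * r\<^sup>2) * exp (- (a / 2 * ((w - y) \<bullet> (w - y))))) * indicator (ball l r) y \<partial>lborel)"
      proof (intro nn_integral_mono)
        fix y
        show "ennreal (exp (- (a * ((w - l) \<bullet> (w - l))))) * indicator (ball l r) y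
            \<le> ennreal (exp (a * r\<^sup>2) * exp (- (a / 2 * ((w - y) \<bullet> (w - y))))) * indicator (ball l r) y"
        proof (cases "y \<in> ball l r")
          case True
          have "norm (w - y) \<le> norm (w - l) + r"
            using norm_triangle_ineq[of "w - l" "l - y"] True by (simp add: dist_norm)
          then have "(norm (w - y))\<^sup>2 \<le> (norm (w - l) + r)\<^sup>2"
            by (intro power_mono) auto
          also have "\<dots> \<le> 2 * (norm (w - l))\<^sup>2 + 2 * r\<^sup>2"
            using sum_squares_bound[of "norm (w - l)" r] by (simp add: power2_sum)
          finally have "a / 2 * ((w - y) \<bullet> (w - y)) \<le> a / 2 * (2 * ((w - l) \<bullet> (w - l)) + 2 * r\<^sup>2)"
            using a by (intro mult_left_mono) (auto simp: power2_norm_eq_inner)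
          then have "- (a * ((w - l) \<bullet> (w - l))) \<le> a * r\<^sup>2 + - (a / 2 * ((w - y) \<bullet> (w - y)))"
            by (simp add: algebra_simps)
          then show ?thesis
            using True by (auto simp flip: exp_add intro!: ennreal_leI)
        qed auto
      qed
      finally show ?thesis .
    qed
    have "ennreal \<beta> * (\<integral>\<^sup>+l. ennreal (exp (- (a * ((w - l) \<bullet> (w - l))))) \<partial>count_space \<Lambda>)
        = (\<integral>\<^sup>+l. ennreal \<beta> * ennreal (exp (- (a * ((w - l) \<bullet> (w - l))))) \<partial>count_space \<Lambda>)"
      by (rule nn_integral_cmult[symmetric]) simp
    also have "\<dots> \<le> (\<integral>\<^sup>+l. (\<integral>\<^sup>+y. ennreal (exp (a * r\<^sup>2) * exp (- (a / 2 * ((w - y) \<bullet> (w - y))))) * indicator (ball l r) y \<partial>lborel) \<partial>count_space \<Lambda>)"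
      by (intro nn_integral_mono *)
    also have "\<dots> = (\<integral>\<^sup>+y. (\<integral>\<^sup>+l. ennreal (exp (a * r\<^sup>2) * exp (- (a / 2 * ((w - y) \<bullet> (w - y))))) * indicator (ball l r) y \<partial>count_space \<Lambda>) \<partial>lborel)"
      by (rule nn_integral_count_space_nn_integral[OF countable_lattice, symmetric]) simp
    also have "\<dots> \<le> (\<integral>\<^sup>+y. ennreal (exp (a * r\<^sup>2) * exp (- (a / 2 * ((w - y) \<bullet> (w - y))))) \<partial>lborel)"
    proof (intro nn_integral_mono)
      fix y
      have "(\<integral>\<^sup>+l. indicator (ball l r) y \<partial>count_space \<Lambda>) \<le> (1::ennreal)"
      proof (cases "\<exists>k\<in>\<Lambda>. y \<in> ball k r")
        case True
        then obtain k where k: "k \<in> \<Lambda>" "y \<in> ball k r" by auto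
        have eq: "l = k" if "l \<in> \<Lambda>" "y \<in> ball l r" for l
        proof -
          have "norm (l - k) < sep"
            using k that dist_triangle2[of l k y] by (simp add: dist_norm r_def)
          then show ?thesis using sep_dist that k by blast
        qed
        have "(\<integral>\<^sup>+l. indicator (ball l r) y \<partial>count_space \<Lambda>) = (\<Sum>l\<in>{k}. indicator (ball l r) y :: ennreal)"
        proof (rule nn_integral_count_space')
          fix x assume x: "x \<in> \<Lambda>" "x \<notin> {k}"
          then have "y \<notin> ball x r"
            using eq by blast
          then show "indicator (ball x r) y = (0::ennreal)"
            by (rule indicator_simps(2))
        qed (use k in simp_all)
        then show ?thesis
          using k by simp
      next
        case False
        then have "(\<integral>\<^sup>+l. indicator (ball l r) y \<partial>count_space \<Lambda>) = (\<integral>\<^sup>+l. (0::ennreal) \<partial>count_space \<Lambda>)"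
          by (intro nn_integral_cong) auto
        then show ?thesis by simp
      qed
      then show "(\<integral>\<^sup>+l. ennreal (exp (a * r\<^sup>2) * exp (- (a / 2 * ((w - y) \<bullet> (w - y))))) * indicator (ball l r) y \<partial>count_space \<Lambda>)
          \<le> ennreal (exp (a * r\<^sup>2) * exp (- (a / 2 * ((w - y) \<bullet> (w - y)))))"
        by (subst nn_integral_cmult) (auto intro: mult_left_le)
    qed
    also have "\<dots> = ennreal (exp (a * r\<^sup>2)) * (\<integral>\<^sup>+y. ennreal (exp (- (a / 2 * ((w - y) \<bullet> (w - y))))) \<partial>lborel)"
      by (simp add: ennreal_mult nn_integral_cmult)
    also have "(\<integral>\<^sup>+y. ennreal (exp (- (a / 2 * ((w - y) \<bullet> (w - y))))) \<partial>lborel) = ennreal I"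
      using nn_integral_lborel_reflect[of "\<lambda>y. ennreal (exp (- (a / 2 * (y \<bullet> y))))" w]
        nn_integral_eq_integral[OF gaussian_integrable[of "a / 2", where ?'a = "'d phase"]] a
      by (simp add: I_def)
    finally have "ennreal \<beta> * (\<integral>\<^sup>+l. ennreal (exp (- (a * ((w - l) \<bullet> (w - l))))) \<partial>count_space \<Lambda>)
        \<le> ennreal (exp (a * r\<^sup>2) * I)"
      by (simp add: ennreal_mult')
    then have "(\<integral>\<^sup>+l. ennreal (exp (- (a * ((w - l) \<bullet> (w - l))))) \<partial>count_space \<Lambda>) * ennreal \<beta> / ennreal \<beta>
        \<le> ennreal (exp (a * r\<^sup>2) * I) / ennreal \<beta>"
      by (intro divide_right_mono_ennreal) (simp add: mult.commute)
    then have "(\<integral>\<^sup>+l. ennreal (exp (- (a * ((w - l) \<bullet> (w - l))))) \<partial>count_space \<Lambda>) \<le> ennreal (exp (a * r\<^sup>2) * I) / ennreal \<beta>"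
      using \<beta> by (simp add: ennreal_mult_divide_eq)
    then show ?thesis
      using \<beta> by (simp add: divide_ennreal I_def integral_nonneg_AE)
  qed
  note * = this
  show ?thesis
    by (rule that[of "max 1 ((exp (a * r\<^sup>2) * I) / \<beta>)"]) (auto intro: order_trans[OF *] ennreal_leI)
qed

end

text \<open>Isolation of 0 gives the separation. Under the quotient map, the images of balls around
  0 are open, because their preimages are unions of lattice translates, and they exhaust the
  quotient; a finite subcover gives the covering radius.\<close>

lemma is_lattice_imp_phase_lattice:
  assumes L: "is_lattice \<Lambda>"
  obtains sep cov where "phase_lattice \<Lambda> sep cov"
proof -
  from L have 1: "0 \<in> \<Lambda>" "\<And>l k. l \<in> \<Lambda> \<Longrightarrow> k \<in> \<Lambda> \<Longrightarrow> l + k \<in> \<Lambda>" "\<And>l. l \<in> \<Lambda> \<Longrightarrow> - l \<in> \<Lambda>" "discrete \<Lambda>"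
    unfolding is_lattice_def by blast+
  from L obtain Y :: "'a phase set topology" where
    Y: "quotient_map euclidean Y (\<lambda>z. (\<lambda>l. z + l) ` \<Lambda>)" "compact_space Y"
    unfolding is_lattice_def by blast
  from 1 have "0 isolated_in \<Lambda>"
    by (auto dest: discreteD)
  then obtain e where e: "e > 0" "\<And>y. y \<in> \<Lambda> \<Longrightarrow> dist 0 y < e \<Longrightarrow> y = 0"
    unfolding isolated_in_dist_Ex_iff by blast
  define q where "q z = (\<lambda>l. z + l) ` \<Lambda>" for z :: "'a phase"
  have q: "quotient_map euclidean Y q"
    using Y(1) by (simp add: q_def[abs_def])
  have vim: "{x. q x \<in> q ` ball 0 (real n)} = (\<Union>l\<in>\<Lambda>. (+) l ` ball 0 (real n))" for n
  proof (rule equalityI; rule subsetI)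
    fix x assume "x \<in> {x. q x \<in> q ` ball 0 (real n)}"
    then obtain y where y: "y \<in> ball 0 (real n)" "q x = q y" by auto
    have "x \<in> q x"
      using 1(1) by (auto simp: q_def image_iff intro: bexI[of _ 0])
    then obtain l where "l \<in> \<Lambda>" "x = y + l"
      using y(2) by (auto simp: q_def)
    then have "x = l + y"
      by (simp add: add.commute)
    with \<open>l \<in> \<Lambda>\<close> y(1) show "x \<in> (\<Union>l\<in>\<Lambda>. (+) l ` ball 0 (real n))"
      by blast
  next
    fix x assume "x \<in> (\<Union>l\<in>\<Lambda>. (+) l ` ball 0 (real n))"
    then obtain l y where l: "l \<in> \<Lambda>" "y \<in> ball 0 (real n)" "x = l + y" by blast
    have "q x = q y"
    proof (rule equalityI; rule subsetI)
      fix u assume "u \<in> q x"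
      then obtain k where "k \<in> \<Lambda>" "u = x + k" by (auto simp: q_def)
      then show "u \<in> q y"
        using l 1(2)[of l k] by (auto simp: q_def image_iff add_ac intro!: bexI[of _ "l + k"])
    next
      fix u assume "u \<in> q y"
      then obtain k where "k \<in> \<Lambda>" "u = y + k" by (auto simp: q_def)
      then show "u \<in> q x"
        using l 1(2)[of "- l" k] 1(3)[of l] by (auto simp: q_def image_iff add_ac intro!: bexI[of _ "- l + k"])
    qed
    then show "x \<in> {x. q x \<in> q ` ball 0 (real n)}"
      using l by auto
  qed
  have op: "openin Y (q ` ball 0 (real n))" for n
  proof -
    have "open (\<Union>l\<in>\<Lambda>. (+) l ` ball (0::'a phase) (real n))"
      by (intro open_UN ballI open_translation open_ball)
    then have "openin euclidean {x \<in> topspace euclidean. q x \<in> q ` ball 0 (real n)}"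
      using vim[of n] by simp
    moreover have "q ` ball 0 (real n) \<subseteq> topspace Y"
      using quotient_imp_surjective_map[OF q] by auto
    ultimately show ?thesis
      using q unfolding quotient_map_def by blast
  qed
  have top: "topspace Y = range q"
    using quotient_imp_surjective_map[OF q] by auto
  have "topspace Y \<subseteq> \<Union> (range (\<lambda>n. q ` ball 0 (real n)))"
  proof
    fix y assume "y \<in> topspace Y"
    then obtain z where z: "y = q z" by (auto simp: top)
    obtain n where "norm z < real n"
      using reals_Archimedean2 by blast
    then have "z \<in> ball 0 (real n)"
      by simp
    then show "y \<in> \<Union> (range (\<lambda>n. q ` ball 0 (real n)))"
      using z by blast
  qed
  moreover have "\<forall>S\<in>range (\<lambda>n. q ` ball 0 (real n)). openin Y S"
    using op by blast
  ultimately obtain F where F: "finite F" "F \<subseteq> range (\<lambda>n. q ` ball 0 (real n))" "topspace Y \<subseteq> \<Union>F"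
    using Y(2) unfolding compact_space_alt by meson
  then obtain N where N: "finite N" "F = (\<lambda>n. q ` ball 0 (real n)) ` N"
    by (meson finite_subset_image)
  \<comment> \<open>Inserting 1 keeps the maximum defined for an empty subcover and makes the radius
    positive.\<close>
  define M where "M = Max (insert 1 N)"
  have M: "real n \<le> real M" if "n \<in> N" for n
    using N(1) that by (simp add: M_def)
  have "1 \<le> M"
    using N(1) by (simp add: M_def)
  have "\<exists>l\<in>\<Lambda>. norm (z - l) \<le> real M" for z
  proof -
    have "q z \<in> \<Union>F"
      using F(3) unfolding top by blast
    then obtain n where n: "n \<in> N" "q z \<in> q ` ball 0 (real n)"
      using N by auto
    then obtain l y where "l \<in> \<Lambda>" "y \<in> ball 0 (real n)" "z = l + y"
      using vim[of n] by blast
    then show ?thesis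
      using M[OF n(1)] by (intro bexI[of _ l]) auto
  qed
  then have "phase_lattice \<Lambda> e (real M)"
    using 1 e \<open>1 \<le> M\<close> by unfold_locales (auto simp: not_less dist_norm intro: leI)
  then show ?thesis by (rule that)
qed

text \<open>Countable additivity of the integral in the unordered sense. The error of a finite
  partial sum is at most the integral of the norm of f over the remaining pieces, that is, the tail
  of the scalar family \<open>a\<close>, whose total is computed by Tonelli.\<close>

lemma has_sum_integral_partition:
  fixes f :: "'a \<Rightarrow> 'b::{banach, second_countable_topology}"
  assumes I: "countable I" and A: "\<And>i. i \<in> I \<Longrightarrow> A i \<in> sets M"
    and disj: "disjoint_family_on A I" and cover: "(\<Union>i\<in>I. A i) = space M"
    and f: "integrable M f"
  shows "((\<lambda>i. \<integral>x. indicator (A i) x *\<^sub>R f x \<partial>M) has_sum (\<integral>x. f x \<partial>M)) I"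
proof -
  define a where "a i = (\<integral>x. indicator (A i) x * norm (f x) \<partial>M)" for i
  have int: "integrable M (\<lambda>x. indicator (A i) x *\<^sub>R f x)" "integrable M (\<lambda>x. indicator (A i) x * norm (f x))" if "i \<in> I" for i
    using integrable_mult_indicator[OF A[OF that] f] integrable_mult_indicator[OF A[OF that] integrable_norm[OF f]] by simp_all
  have [measurable]: "f \<in> borel_measurable M"
    using f by (rule borel_measurable_integrable)
  have eq1: "(\<integral>\<^sup>+i. indicator (A i) x \<partial>count_space I) = (1::ennreal)" if "x \<in> space M" for x
  proof -
    have "x \<in> (\<Union>i\<in>I. A i)"
      unfolding cover by (rule that)
    then obtain j where j: "j \<in> I" "x \<in> A j"
      by (rule UN_E)
    have "(\<integral>\<^sup>+i. indicator (A i) x \<partial>count_space I) = (\<Sum>i\<in>{j}. indicator (A i) x :: ennreal)"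
    proof (rule nn_integral_count_space')
      fix i assume "i \<in> I" "i \<notin> {j}"
      then have "x \<notin> A i"
        using disj j by (auto simp: disjoint_family_on_def)
      then show "indicator (A i) x = (0::ennreal)" by simp
    qed (use j in auto)
    then show ?thesis using j by simp
  qed
  have nn: "(\<integral>\<^sup>+i. ennreal (a i) \<partial>count_space I) = (\<integral>\<^sup>+x. ennreal (norm (f x)) \<partial>M)"
  proof -
    have "(\<integral>\<^sup>+i. ennreal (a i) \<partial>count_space I)
        = (\<integral>\<^sup>+i. (\<integral>\<^sup>+x. ennreal (norm (f x)) * indicator (A i) x \<partial>M) \<partial>count_space I)"
    proof (rule nn_integral_cong)
      fix i assume "i \<in> space (count_space I)"
      then have "ennreal (a i) = (\<integral>\<^sup>+x. ennreal (indicator (A i) x * norm (f x)) \<partial>M)"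
        unfolding a_def by (intro nn_integral_eq_integral[symmetric] int) simp_all
      then show "ennreal (a i) = (\<integral>\<^sup>+x. ennreal (norm (f x)) * indicator (A i) x \<partial>M)"
        by (simp add: ennreal_mult' mult.commute ennreal_indicator)
    qed
    also have "\<dots> = (\<integral>\<^sup>+x. (\<integral>\<^sup>+i. ennreal (norm (f x)) * indicator (A i) x \<partial>count_space I) \<partial>M)"
      by (rule nn_integral_count_space_nn_integral[OF I, symmetric]) (use A in measurable)
    also have "\<dots> = (\<integral>\<^sup>+x. ennreal (norm (f x)) \<partial>M)"
      by (intro nn_integral_cong) (simp add: nn_integral_cmult eq1)
    finally show ?thesis .
  qed
  have a0: "0 \<le> a i" for i
    unfolding a_def by (rule integral_nonneg_AE) simp
  have sa: "a summable_on I"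
    by (rule summable_on_nn_sum) (use nn f a0 in \<open>simp_all add: integrable_iff_bounded\<close>)
  have "ennreal (infsum a I) = ennreal (\<integral>x. norm (f x) \<partial>M)"
    using nn nn_sum_eq_infsum[OF sa a0] nn_integral_eq_integral[OF integrable_norm[OF f]] by simp
  then have "infsum a I = (\<integral>x. norm (f x) \<partial>M)"
    by (simp add: infsum_nonneg a0)
  then have ha: "(a has_sum (\<integral>x. norm (f x) \<partial>M)) I"
    using has_sum_infsum[OF sa] by simp
  define g where "g i = (\<integral>x. indicator (A i) x *\<^sub>R f x \<partial>M)" for i
  have bound: "norm (sum g F - (\<integral>x. f x \<partial>M)) \<le> (\<integral>x. norm (f x) \<partial>M) - sum a F" if F: "finite F" "F \<subseteq> I" for F
  proof -
    have dF: "disjoint_family_on A F"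
      using disj F(2) by (rule disjoint_family_on_mono[rotated])
    have ind: "(\<Sum>i\<in>F. indicator (A i) x :: real) = indicator (\<Union>i\<in>F. A i) x" for x
      by (rule indicator_UN_disjoint[OF F(1) dF, symmetric])
    have i1: "integrable M (\<lambda>x. \<Sum>i\<in>F. indicator (A i) x *\<^sub>R f x)"
      and i2: "integrable M (\<lambda>x. \<Sum>i\<in>F. indicator (A i) x * norm (f x))"
      by (rule Bochner_Integration.integrable_sum, use F(2) int in blast)+
    have s1: "(\<integral>x. (\<Sum>i\<in>F. indicator (A i) x *\<^sub>R f x) \<partial>M) = sum g F"
      unfolding g_def by (rule Bochner_Integration.integral_sum) (use F(2) int in blast)
    have s2: "(\<integral>x. (\<Sum>i\<in>F. indicator (A i) x * norm (f x)) \<partial>M) = sum a F"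
      unfolding a_def by (rule Bochner_Integration.integral_sum) (use F(2) int in blast)
    have "sum g F - (\<integral>x. f x \<partial>M) = (\<integral>x. (\<Sum>i\<in>F. indicator (A i) x *\<^sub>R f x) - f x \<partial>M)"
      by (simp only: s1[symmetric] Bochner_Integration.integral_diff[OF i1 f])
    also have "norm \<dots> \<le> (\<integral>x. norm ((\<Sum>i\<in>F. indicator (A i) x *\<^sub>R f x) - f x) \<partial>M)"
      by (rule integral_norm_bound)
    also have "\<dots> = (\<integral>x. norm (f x) - (\<Sum>i\<in>F. indicator (A i) x * norm (f x)) \<partial>M)"
    proof (intro Bochner_Integration.integral_cong refl)
      fix x
      show "norm ((\<Sum>i\<in>F. indicator (A i) x *\<^sub>R f x) - f x) = norm (f x) - (\<Sum>i\<in>F. indicator (A i) x * norm (f x))"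
        unfolding scaleR_sum_left[symmetric] sum_distrib_right[symmetric] ind
        by (cases "x \<in> (\<Union>i\<in>F. A i)") (simp_all only: indicator_simps, simp_all)
    qed
    also have "\<dots> = (\<integral>x. norm (f x) \<partial>M) - sum a F"
      by (simp only: s2[symmetric] Bochner_Integration.integral_diff[OF integrable_norm[OF f] i2])
    finally show ?thesis .
  qed
  have "((\<lambda>F. (\<integral>x. norm (f x) \<partial>M) - sum a F) \<longlongrightarrow> (\<integral>x. norm (f x) \<partial>M) - (\<integral>x. norm (f x) \<partial>M)) (finite_subsets_at_top I)"
    using ha unfolding has_sum_def by (intro tendsto_diff tendsto_const)
  then have lim0: "((\<lambda>F. (\<integral>x. norm (f x) \<partial>M) - sum a F) \<longlongrightarrow> 0) (finite_subsets_at_top I)"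
    by simp
  have "((\<lambda>F. sum g F - (\<integral>x. f x \<partial>M)) \<longlongrightarrow> 0) (finite_subsets_at_top I)"
    by (rule Lim_null_comparison[OF _ lim0]) (auto simp: eventually_finite_subsets_at_top intro!: exI[of _ "{}"] bound)
  then show ?thesis
    unfolding has_sum_def g_def[symmetric] by (simp add: LIM_zero_iff)
qed

context phase_lattice
begin

text \<open>Cover the ball of radius \<open>cov\<close> by finitely many small balls and remove from
  each the lattice translates of the earlier ones. What is left tiles the space: a point belongs to
  the first \<open>U k\<close> that contains it, and a radius of at most sep/2 prevents two
  translates of the same piece from meeting.\<close>

lemma fine_partition:
  assumes \<delta>: "0 < \<delta>"
  obtains n :: nat and p Q where "\<And>k. k < n \<Longrightarrow> Q k \<in> sets borel" "\<And>k. k < n \<Longrightarrow> Q k \<subseteq> ball (p k) \<delta>"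
    "\<And>k. k < n \<Longrightarrow> norm (p k) \<le> cov" "\<And>k. k < n \<Longrightarrow> Q k \<subseteq> ball 0 (cov + sep)"
    "disjoint_family_on Q {..<n}"
    "(\<Union>(k, l)\<in>{..<n} \<times> \<Lambda>. (+) l ` Q k) = UNIV"
    "disjoint_family_on (\<lambda>(k, l). (+) l ` Q k) ({..<n} \<times> \<Lambda>)"
proof -
  define \<epsilon> where "\<epsilon> = min \<delta> (sep / 2)"
  have \<epsilon>: "0 < \<epsilon>" "\<epsilon> \<le> \<delta>" "\<epsilon> \<le> sep / 2"
    using \<delta> sep_pos by (auto simp: \<epsilon>_def)
  have "cball 0 cov \<subseteq> (\<Union>c\<in>cball 0 cov. ball c \<epsilon>)"
    using \<epsilon>(1) by force
  then obtain P where P: "P \<subseteq> cball 0 cov" "finite P" "cball 0 cov \<subseteq> (\<Union>c\<in>P. ball (c :: 'd phase) \<epsilon>)"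
    using compactE_image[OF compact_cball, of "cball 0 cov" "\<lambda>c. ball c \<epsilon>" "0::'d phase" cov] by auto
  obtain p where p: "bij_betw p {0..<card P} P"
    using ex_bij_betw_nat_finite[OF P(2)] by blast
  define n where "n = card P"
  define B where "B k = ball (p k) \<epsilon>" for k
  define U where "U k = (\<Union>l\<in>\<Lambda>. (+) l ` B k)" for k
  define Q where "Q k = B k - (\<Union>j<k. U j)" for k
  have pk: "norm (p k) \<le> cov" if "k < n" for k
    using bij_betw_apply[OF p, of k] that P(1) by (auto simp: n_def)
  have cover: "\<exists>k<n. y \<in> B k" if "norm y \<le> cov" for y
  proof -
    have "y \<in> cball 0 cov"
      using that by simp
    then obtain c where c: "c \<in> P" "y \<in> ball c \<epsilon>"
      using P(3) by blast
    obtain k where "k \<in> {0..<card P}" "p k = c"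
      using c(1) p by (metis bij_betw_imp_surj_on imageE)
    then show ?thesis
      using c(2) by (auto simp: n_def B_def)
  qed
  have opU: "open (U k)" for k
    unfolding U_def B_def by (intro open_UN ballI open_translation open_ball)
  have inv: "y \<in> U k" if ly: "l + y \<in> U k" "l \<in> \<Lambda>" for l y k
  proof -
    obtain l' b where l': "l' \<in> \<Lambda>" "b \<in> B k" "l + y = l' + b"
      using ly(1) unfolding U_def by blast
    have "y = (l + y) - l"
      by simp
    also have "\<dots> = (l' - l) + b"
      unfolding l'(3) by simp
    finally show ?thesis
      unfolding U_def using l'(2) diff_in[OF l'(1) ly(2)] by blast
  qed
  have uniq: "k = k' \<and> l = l'" if "k < n" "k' < n" "l \<in> \<Lambda>" "l' \<in> \<Lambda>" "y \<in> Q k" "y' \<in> Q k'" "l + y = l' + y'" for k k' l l' y y'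
  proof -
    have not_less: "\<not> k < k'" if "l \<in> \<Lambda>" "l' \<in> \<Lambda>" "y \<in> Q k" "y' \<in> Q k'" "l + y = l' + y'" for k k' l l' y y'
    proof
      assume "k < k'"
      have "l' + y' \<in> U k"
        using that(1,3) unfolding U_def Q_def that(5)[symmetric] by blast
      then have "y' \<in> U k"
        by (rule inv[OF _ that(2)])
      then show False
        using that(4) \<open>k < k'\<close> unfolding Q_def by blast
    qed
    have k: "k = k'"
      using not_less[OF that(3-7)] not_less[OF that(4) that(3) that(6) that(5) that(7)[symmetric]] by simp
    have "norm (y - p k) < \<epsilon>" "norm (y' - p k) < \<epsilon>"
      using that(5,6) by (simp_all add: k Q_def B_def dist_norm norm_minus_commute)
    moreover have "l - l' = (y' - p k) - (y - p k)"
      using that(7) by (simp add: algebra_simps)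
    ultimately have "norm (l - l') < 2 * \<epsilon>"
      using norm_triangle_ineq4[of "y' - p k" "y - p k"] by (simp only:)
    then have "l = l'"
      using sep_dist[OF that(3,4)] \<epsilon>(3) by linarith
    with k show ?thesis by simp
  qed
  show ?thesis
  proof (rule that[of n Q p])
    show "Q k \<in> sets borel" for k
      unfolding Q_def using opU by (intro sets.Diff borel_open open_UN) (auto simp: B_def)
    show "Q k \<subseteq> ball (p k) \<delta>" for k
      using \<epsilon>(2) by (auto simp: Q_def B_def)
    show "Q k \<subseteq> ball 0 (cov + sep)" if "k < n" for k
    proof
      fix y assume "y \<in> Q k"
      then have "norm (y - p k) < \<epsilon>"
        by (simp add: Q_def B_def dist_norm norm_minus_commute)
      then have "norm y < cov + sep"
        using norm_triangle_ineq[of "y - p k" "p k"] pk[OF that] \<epsilon>(3) sep_pos by simp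
      then show "y \<in> ball 0 (cov + sep)" by simp
    qed
    show "disjoint_family_on Q {..<n}"
      unfolding disjoint_family_on_def
    proof (intro ballI impI)
      fix j k assume "j \<in> {..<n}" "k \<in> {..<n}" "j \<noteq> k"
      then show "Q j \<inter> Q k = {}"
        using uniq[of j k 0 0] zero_in by fastforce
    qed
    show "disjoint_family_on (\<lambda>(k, l). (+) l ` Q k) ({..<n} \<times> \<Lambda>)"
      unfolding disjoint_family_on_def
    proof (intro ballI impI)
      fix i j assume ij: "i \<in> {..<n} \<times> \<Lambda>" "j \<in> {..<n} \<times> \<Lambda>" "i \<noteq> j"
      obtain k l k' l' where kl: "i = (k, l)" "j = (k', l')" by (metis surj_pair)
      have "(+) l ` Q k \<inter> (+) l' ` Q k' = {}"
      proof (rule ccontr)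
        assume "(+) l ` Q k \<inter> (+) l' ` Q k' \<noteq> {}"
        then obtain y y' where "y \<in> Q k" "y' \<in> Q k'" "l + y = l' + y'"
          by blast
        then show False
          using uniq[of k k' l l' y y'] ij unfolding kl by simp
      qed
      then show "(case i of (k, l) \<Rightarrow> (+) l ` Q k) \<inter> (case j of (k, l) \<Rightarrow> (+) l ` Q k) = {}"
        by (simp add: kl)
    qed
    show "(\<Union>(k, l)\<in>{..<n} \<times> \<Lambda>. (+) l ` Q k) = UNIV"
    proof (rule UNIV_eq_I[symmetric])
      fix z
      obtain l0 where l0: "l0 \<in> \<Lambda>" "norm (z - l0) \<le> cov"
        using cov by blast
      obtain k0 where "k0 < n" "z - l0 \<in> B k0"
        using cover[OF l0(2)] by blast
      moreover have "z = l0 + (z - l0)" by simp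
      ultimately have ex: "k0 < n \<and> z \<in> U k0"
        unfolding U_def using l0(1) by blast
      \<comment> \<open>Minimality for z passes to its representative b in \<open>B k\<close>,
        because each \<open>U j\<close> is invariant under the lattice.\<close>
      define k where "k = (LEAST k. k < n \<and> z \<in> U k)"
      have k: "k < n" "z \<in> U k"
        using LeastI[of "\<lambda>k. k < n \<and> z \<in> U k", OF ex] by (auto simp: k_def)
      have least: "z \<notin> U j" if "j < k" for j
        using not_less_Least[of j "\<lambda>k. k < n \<and> z \<in> U k"] that k(1) by (auto simp: k_def)
      obtain l b where l: "l \<in> \<Lambda>" "b \<in> B k" "z = l + b"
        using k(2) unfolding U_def by blast
      have "b \<notin> U j" if "j < k" for j
      proof
        assume "b \<in> U j"
        moreover have "b = - l + z" using l(3) by simp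
        ultimately have "z \<in> U j"
          using inv[of "- l" z j] minus_in[OF l(1)] by simp
        then show False using least[OF that] by blast
      qed
      then have "b \<in> Q k"
        using l(2) by (auto simp: Q_def)
      then show "z \<in> (\<Union>(k, l)\<in>{..<n} \<times> \<Lambda>. (+) l ` Q k)"
        using k(1) l(1,3) by blast
    qed
  qed (use pk in auto)
qed

end

section \<open>Strong continuity of time-frequency shifts and the ambiguity function of the
  Gaussian\<close>

lemma modulation_continuous:
  fixes f :: "'d::finite L2"
  assumes X: "X \<longlonglongrightarrow> 0"
  shows "(\<lambda>n. modulation (X n) f) \<longlonglongrightarrow> f"
proof -
  define E where "E n t = exp (2 * of_real pi * \<i> * of_real (X n \<bullet> t))" for n t
  have E1: "cmod (E n t) = 1" for n t
    by (simp add: E_def norm_exp_ii)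
  have sq: "sq_integrable (\<lambda>t. E n t * rep_L2 f t)" for n
    unfolding E_def by (rule sq_integrable_modulation[OF sq_integrable_rep])
  have "(\<lambda>n. abs_L2 (\<lambda>t. E n t * rep_L2 f t)) \<longlonglongrightarrow> abs_L2 (rep_L2 f)"
  proof (rule L2_tendsto_dominated[OF sq sq_integrable_rep])
    have "(\<integral>\<^sup>+t. ennreal (4 * (cmod (rep_L2 f t))\<^sup>2) \<partial>lborel) = 4 * ennreal ((norm f)\<^sup>2)"
      by (simp add: ennreal_mult nn_integral_cmult nn_norm_rep)
    then show "(\<integral>\<^sup>+t. ennreal (4 * (cmod (rep_L2 f t))\<^sup>2) \<partial>lborel) < \<infinity>"
      by (simp add: ennreal_mult_less_top)
    show "AE t in lborel. ennreal ((cmod (E n t * rep_L2 f t - rep_L2 f t))\<^sup>2) \<le> ennreal (4 * (cmod (rep_L2 f t))\<^sup>2)" for n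
    proof (intro AE_I2 ennreal_leI)
      fix t
      have "cmod (E n t * rep_L2 f t - rep_L2 f t) \<le> 2 * cmod (rep_L2 f t)"
        using norm_triangle_ineq4[of "E n t * rep_L2 f t" "rep_L2 f t"] by (simp add: norm_mult E1)
      then have "(cmod (E n t * rep_L2 f t - rep_L2 f t))\<^sup>2 \<le> (2 * cmod (rep_L2 f t))\<^sup>2"
        by (intro power_mono) auto
      then show "(cmod (E n t * rep_L2 f t - rep_L2 f t))\<^sup>2 \<le> 4 * (cmod (rep_L2 f t))\<^sup>2"
        by (simp add: power_mult_distrib)
    qed
    show "AE t in lborel. (\<lambda>n. E n t * rep_L2 f t) \<longlonglongrightarrow> rep_L2 f t"
    proof (rule AE_I2)
      fix t
      have "(\<lambda>n. E n t * rep_L2 f t) \<longlonglongrightarrow> exp (2 * of_real pi * \<i> * of_real (0 \<bullet> t)) * rep_L2 f t"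
        unfolding E_def by (intro tendsto_intros X)
      then show "(\<lambda>n. E n t * rep_L2 f t) \<longlonglongrightarrow> rep_L2 f t"
        by simp
    qed
  qed simp
  moreover have "modulation (X n) f = abs_L2 (\<lambda>t. E n t * rep_L2 f t)" for n
    using modulation.abs_eq[OF L2_rel_refl[OF sq_integrable_rep[of f]], of "X n"] by (simp add: E_def)
  ultimately show ?thesis
    by simp
qed

lemma modulation_diff: "modulation x (f - g) = modulation x f - modulation x g"
  by (simp only: diff_conv_add_uminus modulation_add flip: cscale_minus1) (simp only: modulation_cscale)

lemma tf_shift_continuous:
  fixes f :: "'d::finite L2"
  assumes Z: "Z \<longlonglongrightarrow> 0"
  shows "(\<lambda>n. tf_shift (Z n) f) \<longlonglongrightarrow> f"
proof -
  have 1: "(\<lambda>n. translation (fst (Z n)) f) \<longlonglongrightarrow> f" and 2: "(\<lambda>n. modulation (snd (Z n)) f) \<longlonglongrightarrow> f"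
    using tendsto_fst[OF Z] tendsto_snd[OF Z] by (intro translation_continuous modulation_continuous; simp)+
  have lim: "(\<lambda>n. norm (translation (fst (Z n)) f - f) + norm (modulation (snd (Z n)) f - f)) \<longlonglongrightarrow> 0"
    using tendsto_add[OF tendsto_norm_zero[OF LIM_zero[OF 1]] tendsto_norm_zero[OF LIM_zero[OF 2]]] by simp
  have bnd: "norm (tf_shift (Z n) f - f) \<le> norm (translation (fst (Z n)) f - f) + norm (modulation (snd (Z n)) f - f)" for n
  proof -
    have "tf_shift (Z n) f - f = modulation (snd (Z n)) (translation (fst (Z n)) f - f) + (modulation (snd (Z n)) f - f)"
      by (simp add: tf_shift_eq modulation_diff)
    then show ?thesis
      using norm_triangle_ineq[of "modulation (snd (Z n)) (translation (fst (Z n)) f - f)" "modulation (snd (Z n)) f - f"]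
      by (simp only: norm_modulation)
  qed
  have "(\<lambda>n. tf_shift (Z n) f - f) \<longlonglongrightarrow> 0"
    by (rule Lim_null_comparison[OF always_eventually[OF allI[OF bnd]] lim])
  then show ?thesis
    by (simp add: LIM_zero_iff)
qed

text \<open>Moving the origin to x/2 makes the product of the two Gaussians even: |t + x/2|^2 + |t -
  x/2|^2 = |x|^2/2 + 2 |t|^2. There remains the Fourier transform of a Gaussian scaled by
  \<open>sqrt 2\<close>, which accounts for the power of \<open>sqrt 2\<close>; the leftover
  modulation has modulus one.\<close>

lemma gaussian_ambiguity:
  fixes z :: "'d::finite phase"
  shows "cmod (cinner (gaussian :: 'd L2) (tf_shift z gaussian))
     = exp (- (pi / 2 * (z \<bullet> z))) / sqrt 2 ^ CARD('d)"
proof -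
  obtain x \<omega> where z: "z = (x, \<omega>)" by (metis surj_pair)
  define g :: "real^'d \<Rightarrow> complex" where "g t = of_real (exp (- pi * (t \<bullet> t)))" for t
  have g: "sq_integrable g"
    unfolding g_def by (rule sq_integrable_gaussian)
  have gs: "gaussian = abs_L2 g"
    by (simp add: gaussian_def g_def[abs_def])
  define E where "E t = exp (- (2 * of_real pi * \<i> * of_real (\<omega> \<bullet> t)))" for t
  define y where "y = x /\<^sub>R 2"
  have xy: "x = y + y"
    by (simp add: y_def flip: scaleR_add_left)
  have [measurable]: "E \<in> borel_measurable borel" "g \<in> borel_measurable borel"
    unfolding E_def g_def by measurable
  have "cinner gaussian (tf_shift z gaussian) = (\<integral>t. g t * cnj (g (t - x)) * E t \<partial>lborel)"
    unfolding gs cinner_tf_shift_abs[OF g g] by (simp add: fourier_def z E_def)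
  also have "\<dots> = (\<integral>t. g (y + t) * cnj (g (y + t - x)) * E (y + t) \<partial>lborel)"
    by (rule lborel_integral_shift) measurable
  also have "\<dots> = (\<integral>t. (of_real (exp (- (pi / 2 * (x \<bullet> x)))) * E y) * (of_real (exp (- (pi * (sqrt 2)\<^sup>2 * (t \<bullet> t)))) * E t) \<partial>lborel)"
  proof (rule Bochner_Integration.integral_cong[OF refl])
    fix t
    have yx: "y + t - x = t - y"
      by (simp add: xy)
    have "(y + t) \<bullet> (y + t) + (t - y) \<bullet> (t - y) = 2 * (y \<bullet> y) + 2 * (t \<bullet> t)"
      by (simp add: inner_add_left inner_add_right inner_diff_left inner_diff_right inner_commute[of t y])
    moreover have "x \<bullet> x = 4 * (y \<bullet> y)"
      unfolding xy inner_add_left inner_add_right by simp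
    ultimately have "(y + t) \<bullet> (y + t) + (t - y) \<bullet> (t - y) = (x \<bullet> x) / 2 + 2 * (t \<bullet> t)"
      by linarith
    then have "- pi * ((y + t) \<bullet> (y + t) + (t - y) \<bullet> (t - y)) = - (pi / 2 * (x \<bullet> x)) + - (pi * (sqrt 2)\<^sup>2 * (t \<bullet> t))"
      by (simp only: real_sqrt_pow2 zero_le_numeral) (simp add: algebra_simps)
    then have "- pi * ((y + t) \<bullet> (y + t)) + - pi * ((y + t - x) \<bullet> (y + t - x)) = - (pi / 2 * (x \<bullet> x)) + - (pi * (sqrt 2)\<^sup>2 * (t \<bullet> t))"
      unfolding yx by (simp only: distrib_left)
    then have "exp (- pi * ((y + t) \<bullet> (y + t))) * exp (- pi * ((y + t - x) \<bullet> (y + t - x))) = exp (- (pi / 2 * (x \<bullet> x))) * exp (- (pi * (sqrt 2)\<^sup>2 * (t \<bullet> t)))"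
      by (simp only: exp_add[symmetric])
    then have "g (y + t) * cnj (g (y + t - x)) = of_real (exp (- (pi / 2 * (x \<bullet> x)))) * of_real (exp (- (pi * (sqrt 2)\<^sup>2 * (t \<bullet> t))))"
      unfolding g_def complex_cnj_complex_of_real of_real_mult[symmetric] by (simp only:)
    moreover have "E (y + t) = E y * E t"
      by (simp add: E_def inner_add_right distrib_left exp_add[symmetric])
    ultimately show "g (y + t) * cnj (g (y + t - x)) * E (y + t)
        = (of_real (exp (- (pi / 2 * (x \<bullet> x)))) * E y) * (of_real (exp (- (pi * (sqrt 2)\<^sup>2 * (t \<bullet> t)))) * E t)"
      by (simp only: mult_ac)
  qed
  also have "\<dots> = (of_real (exp (- (pi / 2 * (x \<bullet> x)))) * E y) * (\<integral>t. of_real (exp (- (pi * (sqrt 2)\<^sup>2 * (t \<bullet> t)))) * E t \<partial>lborel)"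
    by (rule integral_mult_right_zero)
  finally have *: "cmod (cinner gaussian (tf_shift z gaussian))
      = exp (- (pi / 2 * (x \<bullet> x))) * cmod (\<integral>t. of_real (exp (- (pi * (sqrt 2)\<^sup>2 * (t \<bullet> t)))) * E t \<partial>lborel)"
    by (simp only: norm_mult norm_of_real abs_exp_cancel) (simp add: E_def cmod_char)
  have "sqrt 2 ^ DIM(real^'d) *\<^sub>R (\<integral>t. of_real (exp (- (pi * (sqrt 2)\<^sup>2 * (t \<bullet> t)))) * E t \<partial>lborel)
      = complex_of_real (exp (- (pi * ((\<omega> /\<^sub>R sqrt 2) \<bullet> (\<omega> /\<^sub>R sqrt 2)))))"
    unfolding E_def by (rule gaussian_FT_scaled) simp
  then have "norm (sqrt 2 ^ DIM(real^'d) *\<^sub>R (\<integral>t. of_real (exp (- (pi * (sqrt 2)\<^sup>2 * (t \<bullet> t)))) * E t \<partial>lborel))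
      = exp (- (pi * ((\<omega> /\<^sub>R sqrt 2) \<bullet> (\<omega> /\<^sub>R sqrt 2))))"
    by (simp only: norm_of_real abs_exp_cancel)
  moreover have "pi * ((\<omega> /\<^sub>R sqrt 2) \<bullet> (\<omega> /\<^sub>R sqrt 2)) = pi / 2 * (\<omega> \<bullet> \<omega>)"
    by (simp add: field_simps flip: power2_eq_square)
  ultimately have "sqrt 2 ^ CARD('d) * cmod (\<integral>t. of_real (exp (- (pi * (sqrt 2)\<^sup>2 * (t \<bullet> t)))) * E t \<partial>lborel)
      = exp (- (pi / 2 * (\<omega> \<bullet> \<omega>)))"
    by (simp only: norm_scaleR) simp
  then have "cmod (\<integral>t. of_real (exp (- (pi * (sqrt 2)\<^sup>2 * (t \<bullet> t)))) * E t \<partial>lborel) = exp (- (pi / 2 * (\<omega> \<bullet> \<omega>))) / sqrt 2 ^ CARD('d)"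
    by (simp add: field_simps)
  then have "cmod (cinner gaussian (tf_shift z gaussian)) = exp (- (pi / 2 * (x \<bullet> x))) * exp (- (pi / 2 * (\<omega> \<bullet> \<omega>))) / sqrt 2 ^ CARD('d)"
    unfolding * by simp
  also have "exp (- (pi / 2 * (x \<bullet> x))) * exp (- (pi / 2 * (\<omega> \<bullet> \<omega>))) = exp (- (pi / 2 * (z \<bullet> z)))"
    by (simp add: z inner_prod_def algebra_simps flip: exp_add)
  finally show ?thesis .
qed

section \<open>Local suprema of ambiguity functions\<close>

definition stft :: "'d::finite L2 \<Rightarrow> 'd phase \<Rightarrow> real" where
  "stft f z = cmod (cinner f (tf_shift z gaussian))"

lemma stft_nonneg [simp]: "0 \<le> stft f z"
  by (simp add: stft_def)

lemma stft_measurable [measurable]: "stft f \<in> borel_measurable borel"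
  unfolding stft_def by measurable

lemma stft_tf_shift: "stft (tf_shift u f) z = stft f (z - u)"
  unfolding stft_def by (rule cmod_cinner_tf_shift)

lemma stft_add: "stft (f + g) z \<le> stft f z + stft g z"
  unfolding stft_def cinner_add_left by (rule norm_triangle_ineq)

lemma stft_cscale: "stft (cscale c f) z = cmod c * stft f z"
  by (simp add: stft_def cinner_cscale_left norm_mult)

lemma stft_gaussian:
  "stft (gaussian :: 'd::finite L2) z = exp (- (pi / 2 * (z \<bullet> z))) / sqrt 2 ^ CARD('d)"
  unfolding stft_def by (rule gaussian_ambiguity)

text \<open>The constant by which Moyal's formula is normalized when it serves as a reproducing
  formula.\<close>

definition inv_energy :: "'d::finite L2 \<Rightarrow> real" where
  "inv_energy f = 1 / (norm f)\<^sup>2"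

lemma gaussian_nonzero: "(gaussian :: 'd::finite L2) \<noteq> 0"
proof
  assume "(gaussian :: 'd L2) = 0"
  then show False
    using stft_gaussian[where ?'d = 'd, of 0] by (simp add: stft_def)
qed

text \<open>Moyal's formula with the Gaussian inserted between f and h, in absolute values. It
  separates f from h, and the bounds on pairings below go through it.\<close>

lemma cinner_le_stft:
  fixes f h :: "'d::finite L2"
  shows "ennreal (cmod (cinner f h)) \<le> ennreal (inv_energy (gaussian :: 'd L2)) *
    (\<integral>\<^sup>+z. ennreal (stft f z) * ennreal (stft h z) \<partial>lborel)"
proof -
  define \<kappa> where "\<kappa> = (norm (gaussian :: 'd L2))\<^sup>2"
  have \<kappa>: "0 < \<kappa>"
    using gaussian_nonzero[where ?'d = 'd] by (simp add: \<kappa>_def)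
  have "of_real \<kappa> * cinner f h = (\<integral>z. cinner f (tf_shift z gaussian) * cinner (tf_shift z gaussian) h \<partial>lborel)"
    unfolding \<kappa>_def by (rule has_bochner_integral_integral_eq[OF has_bochner_integral_moyal, symmetric])
  moreover have "integrable lborel (\<lambda>z. cinner f (tf_shift z gaussian) * cinner (tf_shift z gaussian) h)"
    using has_bochner_integral_moyal[of f gaussian h] by (simp only: has_bochner_integral_iff)
  ultimately have "ennreal (norm (of_real \<kappa> * cinner f h)) \<le> (\<integral>\<^sup>+z. norm (cinner f (tf_shift z gaussian) * cinner (tf_shift z gaussian) h) \<partial>lborel)"
    by (simp only: integral_norm_bound_ennreal)
  also have "\<dots> = (\<integral>\<^sup>+z. ennreal (stft f z) * ennreal (stft h z) \<partial>lborel)"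
    by (intro nn_integral_cong) (simp add: stft_def norm_mult ennreal_mult cmod_cinner_commute[of _ h])
  finally have "ennreal (1 / \<kappa>) * ennreal (norm (of_real \<kappa> * cinner f h)) \<le> ennreal (1 / \<kappa>) * (\<integral>\<^sup>+z. ennreal (stft f z) * ennreal (stft h z) \<partial>lborel)"
    by (rule mult_left_mono) simp
  then show ?thesis
    using \<kappa> by (simp add: norm_mult inv_energy_def flip: ennreal_mult \<kappa>_def)
qed

lemma nn_integral_cmult_multc:
  assumes "F \<in> borel_measurable M"
  shows "c * (\<integral>\<^sup>+u. F u \<partial>M) * d = (\<integral>\<^sup>+u. c * (F u * d) \<partial>M)"
  using assms by (subst nn_integral_cmult) (simp_all add: nn_integral_multc mult.assoc)

locale gabor_weight = phase_lattice \<Lambda> sep cov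
  for \<Lambda> :: "'d::finite phase set" and sep cov +
  fixes w :: "'d phase \<Rightarrow> real"
  assumes weight: "is_weight w" and w_measurable [measurable]: "w \<in> borel_measurable borel"
begin

lemmas w_submult = is_weightD(1)[OF weight] and w_ge1 = is_weightD(2)[OF weight]
  and w_pos = is_weightD(3)[OF weight] and w_nonneg = is_weightD(4)[OF weight] and w_minus = is_weightD(5)[OF weight]

lemma w_submult': "ennreal (w (z + u)) \<le> ennreal (w z) * ennreal (w u)"
  using w_submult[of z u] by (simp add: ennreal_leI w_nonneg flip: ennreal_mult)

lemma M1_norm_eq: "M1_norm w f = (\<integral>\<^sup>+z. ennreal (stft f z) * ennreal (w z) \<partial>lborel)"
  by (simp add: M1_norm_def nn_integral_completion stft_def ennreal_mult w_nonneg)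

lemma M1_norm_ge: "(\<integral>\<^sup>+z. ennreal (stft f z) \<partial>lborel) \<le> M1_norm w f"
  unfolding M1_norm_eq
proof (intro nn_integral_mono)
  fix z
  show "ennreal (stft f z) \<le> ennreal (stft f z) * ennreal (w z)"
    using mult_left_mono[OF w_ge1[of z] stft_nonneg[of f z]] by (simp add: ennreal_leI w_nonneg flip: ennreal_mult)
qed

lemma M1_norm_tf_shift: "M1_norm w (tf_shift u f) \<le> ennreal (w u) * M1_norm w f"
proof -
  have "M1_norm w (tf_shift u f) = (\<integral>\<^sup>+z. ennreal (stft f (u + z - u)) * ennreal (w (u + z)) \<partial>lborel)"
    unfolding M1_norm_eq stft_tf_shift by (rule nn_integral_lborel_shift[symmetric]) measurable
  also have "\<dots> \<le> (\<integral>\<^sup>+z. ennreal (w u) * (ennreal (stft f z) * ennreal (w z)) \<partial>lborel)"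
  proof (rule nn_integral_mono)
    fix z
    show "ennreal (stft f (u + z - u)) * ennreal (w (u + z)) \<le> ennreal (w u) * (ennreal (stft f z) * ennreal (w z))"
      using mult_left_mono[OF w_submult'[of u z], of "ennreal (stft f z)"] by (simp add: mult_ac)
  qed
  also have "\<dots> = ennreal (w u) * M1_norm w f"
    unfolding M1_norm_eq by (rule nn_integral_cmult) measurable
  finally show ?thesis .
qed

lemma M1_norm_add: "M1_norm w (f + g) \<le> M1_norm w f + M1_norm w g"
proof -
  have "M1_norm w (f + g) \<le> (\<integral>\<^sup>+z. ennreal (stft f z) * ennreal (w z) + ennreal (stft g z) * ennreal (w z) \<partial>lborel)"
    unfolding M1_norm_eq
    by (intro nn_integral_mono) (simp add: stft_add mult_right_mono ennreal_leI flip: distrib_right ennreal_plus)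
  also have "\<dots> = M1_norm w f + M1_norm w g"
    unfolding M1_norm_eq by (rule nn_integral_add) measurable
  finally show ?thesis .
qed

lemma M1_norm_cscale: "M1_norm w (cscale c f) = ennreal (cmod c) * M1_norm w f"
  unfolding M1_norm_eq stft_cscale
  by (subst nn_integral_cmult[symmetric]) (simp_all add: ennreal_mult mult.assoc)

lemma M1_norm_zero: "M1_norm w 0 = 0"
  using M1_norm_cscale[of 0 0] by simp

text \<open>The Gaussian majorant of the ambiguity function of the Gaussian, stable under shifts by at most \<open>R\<close>.\<close>

definition maj :: "real \<Rightarrow> 'd phase \<Rightarrow> real" where
  "maj R z = exp (pi / 2 * R\<^sup>2) * exp (- (pi / 4 * (z \<bullet> z)))"

lemma maj_nonneg [simp]: "0 \<le> maj R z"
  by (simp add: maj_def)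

lemma maj_measurable [measurable]: "maj R \<in> borel_measurable borel"
  unfolding maj_def by measurable

text \<open>Here |z|^2 \<le> 2 |z - y|^2 + 2 R^2, so passing from exponent pi/2 to pi/4 pays for
  every shift of length at most R, at the cost of a constant.\<close>

lemma stft_gaussian_le_maj:
  assumes "norm y \<le> R"
  shows "stft gaussian (z - y) \<le> maj R z"
proof -
  have "norm z \<le> norm (z - y) + R"
    using norm_triangle_ineq[of "z - y" y] assms by simp
  then have "(norm z)\<^sup>2 \<le> (norm (z - y) + R)\<^sup>2"
    by (intro power_mono) auto
  also have "\<dots> \<le> 2 * (norm (z - y))\<^sup>2 + 2 * R\<^sup>2"
    using sum_squares_bound[of "norm (z - y)" R] by (simp add: power2_sum)
  finally have "z \<bullet> z \<le> 2 * ((z - y) \<bullet> (z - y)) + 2 * R\<^sup>2"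
    by (simp add: power2_norm_eq_inner)
  then have "pi / 4 * (z \<bullet> z) \<le> pi / 4 * (2 * ((z - y) \<bullet> (z - y)) + 2 * R\<^sup>2)"
    by (intro mult_left_mono) auto
  then have "- (pi / 2 * ((z - y) \<bullet> (z - y))) \<le> pi / 2 * R\<^sup>2 + - (pi / 4 * (z \<bullet> z))"
    by (simp add: algebra_simps)
  then have "exp (- (pi / 2 * ((z - y) \<bullet> (z - y)))) \<le> maj R z"
    unfolding maj_def exp_add[symmetric] by simp
  moreover have "exp (- (pi / 2 * ((z - y) \<bullet> (z - y)))) / sqrt 2 ^ CARD('d) \<le> exp (- (pi / 2 * ((z - y) \<bullet> (z - y))))"
    by (simp add: divide_le_eq mult_le_cancel_left1 one_le_power)
  ultimately show ?thesis
    unfolding stft_gaussian by linarith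
qed

lemma stft_gaussian_uminus: "stft gaussian (- z) = stft (gaussian :: 'd L2) z"
  by (simp add: stft_gaussian)

text \<open>The weight is bounded by a Gaussian of growth pi/8, half of the decay pi/4 of
  \<open>maj\<close>; the remaining decay pi/8 is still summable.\<close>

lemma maj_weight_le:
  obtains C where "0 < C" "\<And>z. maj R z * w z \<le> C * exp (- (pi / 8 * (z \<bullet> z)))"
proof -
  obtain C where C: "0 < C" "\<And>z. w z \<le> C * exp (pi / 8 * (z \<bullet> z))"
    using weight_le_exp_square[OF weight, of "pi / 8"] by auto
  have "maj R z * w z \<le> (exp (pi / 2 * R\<^sup>2) * C) * exp (- (pi / 8 * (z \<bullet> z)))" for z
  proof -
    have "maj R z * w z \<le> maj R z * (C * exp (pi / 8 * (z \<bullet> z)))"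
      by (intro mult_left_mono C) simp
    also have "\<dots> = (exp (pi / 2 * R\<^sup>2) * C) * (exp (- (pi / 4 * (z \<bullet> z))) * exp (pi / 8 * (z \<bullet> z)))"
      by (simp add: maj_def)
    also have "exp (- (pi / 4 * (z \<bullet> z))) * exp (pi / 8 * (z \<bullet> z)) = exp (- (pi / 8 * (z \<bullet> z)))"
      by (simp flip: exp_add)
    finally show ?thesis .
  qed
  then show ?thesis
    using C(1) by (intro that[of "exp (pi / 2 * R\<^sup>2) * C"]) auto
qed

lemma maj_weight_integral: "(\<integral>\<^sup>+z. ennreal (maj R z) * ennreal (w z) \<partial>lborel) < \<infinity>"
proof -
  obtain C where C: "0 < C" "\<And>z. maj R z * w z \<le> C * exp (- (pi / 8 * (z \<bullet> z)))"
    using maj_weight_le by blast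
  have "(\<integral>\<^sup>+z. ennreal (maj R z) * ennreal (w z) \<partial>lborel) \<le> (\<integral>\<^sup>+z. ennreal (C * exp (- (pi / 8 * (z \<bullet> z)))) \<partial>(lborel :: 'd phase measure))"
    by (intro nn_integral_mono) (simp only: ennreal_mult[symmetric] maj_nonneg w_nonneg ennreal_leI[OF C(2)])
  also have "\<dots> = ennreal C * (\<integral>\<^sup>+z. ennreal (exp (- (pi / 8 * (z \<bullet> z)))) \<partial>(lborel :: 'd phase measure))"
    using C(1) by (subst nn_integral_cmult[symmetric]) (auto simp: ennreal_mult)
  also have "\<dots> < \<infinity>"
    using gaussian_integrable[of "pi / 8", where ?'a = "'d phase"] by (simp add: ennreal_mult_less_top integrable_iff_bounded)
  finally show ?thesis .
qed

lemma maj_weight_lattice_sum: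
  obtains C where "0 < C" "\<And>x. (\<integral>\<^sup>+l. ennreal (maj R (x - l)) * ennreal (w (x - l)) \<partial>count_space \<Lambda>) \<le> ennreal C"
proof -
  obtain C where C: "0 < C" "\<And>z. maj R z * w z \<le> C * exp (- (pi / 8 * (z \<bullet> z)))"
    using maj_weight_le by blast
  obtain D where D: "0 < D" "\<And>x. (\<integral>\<^sup>+l. ennreal (exp (- (pi / 8 * ((x - l) \<bullet> (x - l))))) \<partial>count_space \<Lambda>) \<le> ennreal D"
    using gaussian_lattice_sum[of "pi / 8"] by auto
  have "(\<integral>\<^sup>+l. ennreal (maj R (x - l)) * ennreal (w (x - l)) \<partial>count_space \<Lambda>) \<le> ennreal (C * D)" for x
  proof -
    have "(\<integral>\<^sup>+l. ennreal (maj R (x - l)) * ennreal (w (x - l)) \<partial>count_space \<Lambda>)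
        \<le> (\<integral>\<^sup>+l. ennreal C * ennreal (exp (- (pi / 8 * ((x - l) \<bullet> (x - l))))) \<partial>count_space \<Lambda>)"
      using C by (intro nn_integral_mono) (simp add: ennreal_leI w_nonneg flip: ennreal_mult)
    also have "\<dots> = ennreal C * (\<integral>\<^sup>+l. ennreal (exp (- (pi / 8 * ((x - l) \<bullet> (x - l))))) \<partial>count_space \<Lambda>)"
      by (rule nn_integral_cmult) simp
    also have "\<dots> \<le> ennreal (C * D)"
      using C(1) D by (simp add: mult_left_mono ennreal_mult)
    finally show ?thesis .
  qed
  then show ?thesis
    using C(1) D(1) by (intro that[of "C * D"]) auto
qed

text \<open>A bound for the supremum of \<open>stft f\<close> over the ball of radius R around z.
  Written as a convolution it is measurable, and Young-type estimates apply to it without any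
  discussion of the supremum itself.\<close>

definition stft_maj :: "real \<Rightarrow> 'd L2 \<Rightarrow> 'd phase \<Rightarrow> ennreal" where
  "stft_maj R f z = ennreal (inv_energy (gaussian :: 'd L2)) * (\<integral>\<^sup>+u. ennreal (stft f u) * ennreal (maj R (z - u)) \<partial>lborel)"

lemma stft_maj_measurable [measurable]: "stft_maj R f \<in> borel_measurable borel"
  unfolding stft_maj_def by measurable

lemma stft_le_stft_maj:
  assumes "norm y \<le> R"
  shows "ennreal (stft f (z - y)) \<le> stft_maj R f z"
proof -
  have "ennreal (stft f (z - y)) \<le> ennreal (inv_energy (gaussian :: 'd L2)) * (\<integral>\<^sup>+u. ennreal (stft f u) * ennreal (stft (tf_shift (z - y) gaussian) u) \<partial>lborel)"
    unfolding stft_def[of f "z - y"] by (rule cinner_le_stft)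
  also have "\<dots> \<le> stft_maj R f z"
    unfolding stft_maj_def
  proof (intro mult_left_mono nn_integral_mono)
    fix u
    have "stft (tf_shift (z - y) gaussian) u = stft gaussian (z - u - y)"
      unfolding stft_tf_shift using stft_gaussian_uminus[of "z - u - y"] by (simp add: algebra_simps)
    then have "stft (tf_shift (z - y) gaussian) u \<le> maj R (z - u)"
      using stft_gaussian_le_maj[OF assms, of "z - u"] by simp
    then show "ennreal (stft (tf_shift (z - y) gaussian) u) \<le> ennreal (maj R (z - u))"
      by (rule ennreal_leI)
  qed simp_all
  finally show ?thesis .
qed

text \<open>Young's inequality for a weighted L^1 space: submultiplicativity of w distributes the
  weight over the two factors of the convolution.\<close>

lemma stft_maj_integral:
  assumes "M1_norm w f < \<infinity>"
  shows "(\<integral>\<^sup>+z. stft_maj R f z * ennreal (w z) \<partial>lborel) < \<infinity>"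
proof -
  have "(\<integral>\<^sup>+z. stft_maj R f z * ennreal (w z) \<partial>lborel)
      = (\<integral>\<^sup>+z. (\<integral>\<^sup>+u. ennreal (inv_energy (gaussian :: 'd L2)) * (ennreal (stft f u) * ennreal (maj R (z - u)) * ennreal (w z)) \<partial>lborel) \<partial>lborel)"
    unfolding stft_maj_def by (subst nn_integral_cmult_multc) simp_all
  also have "\<dots> = (\<integral>\<^sup>+u. (\<integral>\<^sup>+z. ennreal (inv_energy (gaussian :: 'd L2)) * (ennreal (stft f u) * ennreal (maj R (z - u)) * ennreal (w z)) \<partial>lborel) \<partial>lborel)"
    by (rule lborel_pair.Fubini') measurable
  also have "\<dots> \<le> (\<integral>\<^sup>+u. ennreal (inv_energy (gaussian :: 'd L2)) * (ennreal (stft f u) * ennreal (w u)) * (\<integral>\<^sup>+z. ennreal (maj R z) * ennreal (w z) \<partial>lborel) \<partial>lborel)"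
  proof (rule nn_integral_mono)
    fix u
    have "(\<integral>\<^sup>+z. ennreal (inv_energy (gaussian :: 'd L2)) * (ennreal (stft f u) * ennreal (maj R (z - u)) * ennreal (w z)) \<partial>lborel)
        = (\<integral>\<^sup>+z. ennreal (inv_energy (gaussian :: 'd L2)) * (ennreal (stft f u) * ennreal (maj R (u + z - u)) * ennreal (w (u + z))) \<partial>lborel)"
      by (rule nn_integral_lborel_shift[symmetric]) measurable
    also have "\<dots> \<le> (\<integral>\<^sup>+z. ennreal (inv_energy (gaussian :: 'd L2)) * (ennreal (stft f u) * ennreal (w u)) * (ennreal (maj R z) * ennreal (w z)) \<partial>lborel)"
    proof (rule nn_integral_mono)
      fix z
      have "ennreal (inv_energy (gaussian :: 'd L2)) * (ennreal (stft f u) * ennreal (maj R z) * ennreal (w (u + z)))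
          \<le> ennreal (inv_energy (gaussian :: 'd L2)) * (ennreal (stft f u) * ennreal (maj R z) * (ennreal (w u) * ennreal (w z)))"
        by (intro mult_left_mono w_submult') simp_all
      then show "ennreal (inv_energy (gaussian :: 'd L2)) * (ennreal (stft f u) * ennreal (maj R (u + z - u)) * ennreal (w (u + z)))
          \<le> ennreal (inv_energy (gaussian :: 'd L2)) * (ennreal (stft f u) * ennreal (w u)) * (ennreal (maj R z) * ennreal (w z))"
        by (simp add: mult_ac)
    qed
    also have "\<dots> = ennreal (inv_energy (gaussian :: 'd L2)) * (ennreal (stft f u) * ennreal (w u)) * (\<integral>\<^sup>+z. ennreal (maj R z) * ennreal (w z) \<partial>lborel)"
      by (rule nn_integral_cmult) measurable
    finally show "(\<integral>\<^sup>+z. ennreal (inv_energy (gaussian :: 'd L2)) * (ennreal (stft f u) * ennreal (maj R (z - u)) * ennreal (w z)) \<partial>lborel) \<le> \<dots>" .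
  qed
  also have "\<dots> = ennreal (inv_energy (gaussian :: 'd L2)) * M1_norm w f * (\<integral>\<^sup>+z. ennreal (maj R z) * ennreal (w z) \<partial>lborel)"
    unfolding M1_norm_eq by (subst nn_integral_multc, simp, subst nn_integral_cmult, simp_all)
  also have "\<dots> < \<infinity>"
    using assms maj_weight_integral[of R] by (simp add: ennreal_mult_less_top)
  finally show ?thesis .
qed

text \<open>The same argument with a lattice sum in place of the outer integral. Uniformity in x is
  inherited from the Gaussian lattice sums.\<close>

lemma stft_maj_lattice_sum:
  obtains C where "0 < C" "\<And>f x. (\<integral>\<^sup>+l. stft_maj R f (x - l) * ennreal (w (x - l)) \<partial>count_space \<Lambda>) \<le> ennreal C * M1_norm w f"
proof -
  obtain C where C: "0 < C" "\<And>x. (\<integral>\<^sup>+l. ennreal (maj R (x - l)) * ennreal (w (x - l)) \<partial>count_space \<Lambda>) \<le> ennreal C"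
    using maj_weight_lattice_sum by blast
  define K where "K = inv_energy (gaussian :: 'd L2)"
  have K: "0 < K" "ennreal (inv_energy (gaussian :: 'd L2)) = ennreal K"
    using gaussian_nonzero[where ?'d = 'd] by (auto simp: K_def inv_energy_def)
  have "(\<integral>\<^sup>+l. stft_maj R f (x - l) * ennreal (w (x - l)) \<partial>count_space \<Lambda>) \<le> ennreal (K * C) * M1_norm w f" for f x
  proof -
    have "(\<integral>\<^sup>+l. stft_maj R f (x - l) * ennreal (w (x - l)) \<partial>count_space \<Lambda>)
        = (\<integral>\<^sup>+l. (\<integral>\<^sup>+u. ennreal (inv_energy (gaussian :: 'd L2)) * (ennreal (stft f u) * ennreal (maj R (x - l - u)) * ennreal (w (x - l))) \<partial>lborel) \<partial>count_space \<Lambda>)"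
      unfolding stft_maj_def by (subst nn_integral_cmult_multc) simp_all
    also have "\<dots> = (\<integral>\<^sup>+u. (\<integral>\<^sup>+l. ennreal (inv_energy (gaussian :: 'd L2)) * (ennreal (stft f u) * ennreal (maj R (x - l - u)) * ennreal (w (x - l))) \<partial>count_space \<Lambda>) \<partial>lborel)"
      by (rule nn_integral_count_space_nn_integral[OF countable_lattice, symmetric]) measurable
    also have "\<dots> \<le> (\<integral>\<^sup>+u. ennreal (inv_energy (gaussian :: 'd L2)) * (ennreal (stft f u) * ennreal (w u)) * ennreal C \<partial>lborel)"
    proof (rule nn_integral_mono)
      fix u
      have "(\<integral>\<^sup>+l. ennreal (inv_energy (gaussian :: 'd L2)) * (ennreal (stft f u) * ennreal (maj R (x - l - u)) * ennreal (w (x - l))) \<partial>count_space \<Lambda>)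
          \<le> (\<integral>\<^sup>+l. ennreal (inv_energy (gaussian :: 'd L2)) * (ennreal (stft f u) * ennreal (w u)) * (ennreal (maj R (x - u - l)) * ennreal (w (x - u - l))) \<partial>count_space \<Lambda>)"
      proof (rule nn_integral_mono)
        fix l
        have eq: "x - l - u = x - u - l" "x - l = u + (x - u - l)"
          by (simp_all add: algebra_simps)
        have "ennreal (inv_energy (gaussian :: 'd L2)) * (ennreal (stft f u) * ennreal (maj R (x - u - l)) * ennreal (w (u + (x - u - l))))
            \<le> ennreal (inv_energy (gaussian :: 'd L2)) * (ennreal (stft f u) * ennreal (maj R (x - u - l)) * (ennreal (w u) * ennreal (w (x - u - l))))"
          by (intro mult_left_mono w_submult') simp_all
        then show "ennreal (inv_energy (gaussian :: 'd L2)) * (ennreal (stft f u) * ennreal (maj R (x - l - u)) * ennreal (w (x - l)))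
            \<le> ennreal (inv_energy (gaussian :: 'd L2)) * (ennreal (stft f u) * ennreal (w u)) * (ennreal (maj R (x - u - l)) * ennreal (w (x - u - l)))"
          unfolding eq(1) by (subst eq(2)) (simp only: mult_ac)
      qed
      also have "\<dots> = ennreal (inv_energy (gaussian :: 'd L2)) * (ennreal (stft f u) * ennreal (w u)) * (\<integral>\<^sup>+l. ennreal (maj R (x - u - l)) * ennreal (w (x - u - l)) \<partial>count_space \<Lambda>)"
        by (rule nn_integral_cmult) simp
      also have "\<dots> \<le> ennreal (inv_energy (gaussian :: 'd L2)) * (ennreal (stft f u) * ennreal (w u)) * ennreal C"
        by (intro mult_left_mono C(2)) simp
      finally show "(\<integral>\<^sup>+l. ennreal (inv_energy (gaussian :: 'd L2)) * (ennreal (stft f u) * ennreal (maj R (x - l - u)) * ennreal (w (x - l))) \<partial>count_space \<Lambda>) \<le> \<dots>" .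
    qed
    also have "\<dots> = ennreal (inv_energy (gaussian :: 'd L2)) * M1_norm w f * ennreal C"
      unfolding M1_norm_eq by (subst nn_integral_multc, simp, subst nn_integral_cmult, simp_all)
    also have "\<dots> = ennreal (K * C) * M1_norm w f"
      using K C(1) by (simp add: ennreal_mult mult_ac)
    finally show ?thesis .
  qed
  then show ?thesis
    using that[of "K * C"] K(1) C(1) by auto
qed

text \<open>Dominates the pairings of f with \<pi>(l + y) g for all y of norm at most R at once. Its
  weighted lattice sum controls a Wiener amalgam norm of the ambiguity function of f and g.\<close>

definition amalgam :: "real \<Rightarrow> 'd L2 \<Rightarrow> 'd L2 \<Rightarrow> 'd phase \<Rightarrow> ennreal" where
  "amalgam R f g l = ennreal (inv_energy (gaussian :: 'd L2)) * (\<integral>\<^sup>+u. ennreal (stft f u) * stft_maj R g (u - l) \<partial>lborel)"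

lemma cinner_le_amalgam:
  assumes "norm y \<le> R"
  shows "ennreal (cmod (cinner f (tf_shift (l + y) g))) \<le> amalgam R f g l"
proof -
  have "ennreal (cmod (cinner f (tf_shift (l + y) g))) \<le> ennreal (inv_energy (gaussian :: 'd L2)) * (\<integral>\<^sup>+u. ennreal (stft f u) * ennreal (stft (tf_shift (l + y) g) u) \<partial>lborel)"
    by (rule cinner_le_stft)
  also have "\<dots> \<le> amalgam R f g l"
    unfolding amalgam_def
  proof (intro mult_left_mono nn_integral_mono)
    fix u
    show "ennreal (stft (tf_shift (l + y) g) u) \<le> stft_maj R g (u - l)"
      using stft_le_stft_maj[OF assms, of g "u - l"] by (simp add: stft_tf_shift diff_diff_eq)
  qed simp_all
  finally show ?thesis .
qed

text \<open>Symmetry and submultiplicativity give w l \<le> w u * w (u - l). One factor completes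
  the norm of f, the other the lattice sum of \<open>stft_maj R g\<close>.\<close>

lemma amalgam_sum:
  obtains C where "0 < C"
    "\<And>f g. (\<integral>\<^sup>+l. amalgam R f g l * ennreal (w l) \<partial>count_space \<Lambda>) \<le> ennreal C * M1_norm w f * M1_norm w g"
proof -
  obtain C where C: "0 < C" "\<And>f x. (\<integral>\<^sup>+l. stft_maj R f (x - l) * ennreal (w (x - l)) \<partial>count_space \<Lambda>) \<le> ennreal C * M1_norm w f"
    using stft_maj_lattice_sum by blast
  define K where "K = inv_energy (gaussian :: 'd L2)"
  have K: "0 < K" "ennreal (inv_energy (gaussian :: 'd L2)) = ennreal K"
    using gaussian_nonzero[where ?'d = 'd] by (auto simp: K_def inv_energy_def)
  have "(\<integral>\<^sup>+l. amalgam R f g l * ennreal (w l) \<partial>count_space \<Lambda>) \<le> ennreal (K * C) * M1_norm w f * M1_norm w g" for f g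
  proof -
    have "(\<integral>\<^sup>+l. amalgam R f g l * ennreal (w l) \<partial>count_space \<Lambda>)
        = (\<integral>\<^sup>+l. (\<integral>\<^sup>+u. ennreal (inv_energy (gaussian :: 'd L2)) * (ennreal (stft f u) * stft_maj R g (u - l) * ennreal (w l)) \<partial>lborel) \<partial>count_space \<Lambda>)"
      unfolding amalgam_def by (subst nn_integral_cmult_multc) simp_all
    also have "\<dots> = (\<integral>\<^sup>+u. (\<integral>\<^sup>+l. ennreal (inv_energy (gaussian :: 'd L2)) * (ennreal (stft f u) * stft_maj R g (u - l) * ennreal (w l)) \<partial>count_space \<Lambda>) \<partial>lborel)"
      by (rule nn_integral_count_space_nn_integral[OF countable_lattice, symmetric]) measurable
    also have "\<dots> \<le> (\<integral>\<^sup>+u. ennreal (inv_energy (gaussian :: 'd L2)) * (ennreal (stft f u) * ennreal (w u)) * (ennreal C * M1_norm w g) \<partial>lborel)"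
    proof (rule nn_integral_mono)
      fix u
      have "(\<integral>\<^sup>+l. ennreal (inv_energy (gaussian :: 'd L2)) * (ennreal (stft f u) * stft_maj R g (u - l) * ennreal (w l)) \<partial>count_space \<Lambda>)
          \<le> (\<integral>\<^sup>+l. ennreal (inv_energy (gaussian :: 'd L2)) * (ennreal (stft f u) * ennreal (w u)) * (stft_maj R g (u - l) * ennreal (w (u - l))) \<partial>count_space \<Lambda>)"
      proof (rule nn_integral_mono)
        fix l
        have "ennreal (w l) \<le> ennreal (w u) * ennreal (w (u - l))"
          using w_submult'[of u "- (u - l)"] by (simp add: w_minus del: minus_diff_eq)
        then have "ennreal (inv_energy (gaussian :: 'd L2)) * (ennreal (stft f u) * stft_maj R g (u - l) * ennreal (w l))
            \<le> ennreal (inv_energy (gaussian :: 'd L2)) * (ennreal (stft f u) * stft_maj R g (u - l) * (ennreal (w u) * ennreal (w (u - l))))"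
          by (intro mult_left_mono) simp_all
        then show "ennreal (inv_energy (gaussian :: 'd L2)) * (ennreal (stft f u) * stft_maj R g (u - l) * ennreal (w l))
            \<le> ennreal (inv_energy (gaussian :: 'd L2)) * (ennreal (stft f u) * ennreal (w u)) * (stft_maj R g (u - l) * ennreal (w (u - l)))"
          by (simp only: mult_ac)
      qed
      also have "\<dots> = ennreal (inv_energy (gaussian :: 'd L2)) * (ennreal (stft f u) * ennreal (w u)) * (\<integral>\<^sup>+l. stft_maj R g (u - l) * ennreal (w (u - l)) \<partial>count_space \<Lambda>)"
        by (rule nn_integral_cmult) simp
      also have "\<dots> \<le> ennreal (inv_energy (gaussian :: 'd L2)) * (ennreal (stft f u) * ennreal (w u)) * (ennreal C * M1_norm w g)"
        by (intro mult_left_mono C(2)) simp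
      finally show "(\<integral>\<^sup>+l. ennreal (inv_energy (gaussian :: 'd L2)) * (ennreal (stft f u) * stft_maj R g (u - l) * ennreal (w l)) \<partial>count_space \<Lambda>) \<le> \<dots>" .
    qed
    also have "\<dots> = ennreal (inv_energy (gaussian :: 'd L2)) * M1_norm w f * (ennreal C * M1_norm w g)"
      unfolding M1_norm_eq[of f] by (subst nn_integral_multc, simp, subst nn_integral_cmult, simp_all)
    also have "\<dots> = ennreal (K * C) * M1_norm w f * M1_norm w g"
      using K C(1) by (simp add: ennreal_mult mult_ac)
    finally show ?thesis .
  qed
  then show ?thesis
    using that[of "K * C"] K(1) C(1) by auto
qed

end

section \<open>The norm of M^1 as a real number, series in M^1 and sampling of ambiguity
  functions\<close>

context gabor_weight
begin

definition N :: "'d L2 \<Rightarrow> real" where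
  "N f = enn2real (M1_norm w f)"

lemma M1_iff: "f \<in> M1 w \<longleftrightarrow> M1_norm w f < \<infinity>"
  by (simp add: M1_def)

lemma M1_norm_N: "f \<in> M1 w \<Longrightarrow> M1_norm w f = ennreal (N f)"
  by (simp add: M1_iff N_def)

lemma N_nonneg [simp]: "0 \<le> N f"
  by (simp add: N_def)

lemma M1I: "M1_norm w f \<le> ennreal C \<Longrightarrow> f \<in> M1 w"
  by (auto simp: M1_iff intro: le_less_trans)

lemma N_le: "M1_norm w f \<le> ennreal C \<Longrightarrow> 0 \<le> C \<Longrightarrow> N f \<le> C"
  unfolding N_def by (rule enn2real_leI) auto

lemma M1_0 [simp]: "0 \<in> M1 w"
  by (simp add: M1_iff M1_norm_zero)

lemma N_0 [simp]: "N 0 = 0"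
  by (simp add: N_def M1_norm_zero)

lemma M1_add_le:
  assumes "f \<in> M1 w" "g \<in> M1 w"
  shows "M1_norm w (f + g) \<le> ennreal (N f + N g)"
  using M1_norm_add[of f g] by (simp add: M1_norm_N assms)

lemma M1_add: "f \<in> M1 w \<Longrightarrow> g \<in> M1 w \<Longrightarrow> f + g \<in> M1 w"
  by (rule M1I[OF M1_add_le])

lemma N_add: "f \<in> M1 w \<Longrightarrow> g \<in> M1 w \<Longrightarrow> N (f + g) \<le> N f + N g"
  by (rule N_le[OF M1_add_le]) auto

lemma M1_cscale: "f \<in> M1 w \<Longrightarrow> cscale c f \<in> M1 w"
  by (simp add: M1_iff M1_norm_cscale ennreal_mult_less_top)

lemma N_cscale: "N (cscale c f) = cmod c * N f"
  by (simp add: N_def M1_norm_cscale enn2real_mult)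

lemma M1_uminus: "f \<in> M1 w \<Longrightarrow> - f \<in> M1 w"
  using M1_cscale[of f "-1"] by (simp add: cscale_minus1)

lemma M1_diff: "f \<in> M1 w \<Longrightarrow> g \<in> M1 w \<Longrightarrow> f - g \<in> M1 w"
  using M1_add[of f "- g"] M1_uminus[of g] by simp

lemma M1_tf_shift_le:
  assumes "f \<in> M1 w"
  shows "M1_norm w (tf_shift u f) \<le> ennreal (w u * N f)"
  using M1_norm_tf_shift[of u f] by (simp add: M1_norm_N assms ennreal_mult w_nonneg)

lemma M1_tf_shift: "f \<in> M1 w \<Longrightarrow> tf_shift u f \<in> M1 w"
  by (rule M1I[OF M1_tf_shift_le])

lemma N_tf_shift: "f \<in> M1 w \<Longrightarrow> N (tf_shift u f) \<le> w u * N f"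
  by (rule N_le[OF M1_tf_shift_le]) (simp_all add: w_nonneg)

lemma M1_sum: "(\<And>i. i \<in> F \<Longrightarrow> f i \<in> M1 w) \<Longrightarrow> sum f F \<in> M1 w"
  by (induction F rule: infinite_finite_induct) (auto intro: M1_add)

text \<open>In the reproducing bound for the pairing of f with itself, one factor
  \<open>stft f\<close> is bounded by Cauchy-Schwarz and the other is integrated. Cancelling one
  factor \<open>norm f\<close> leaves the embedding of M^1 into L^2.\<close>

lemma norm_le_N:
  assumes f: "f \<in> M1 w"
  shows "norm f \<le> N f / norm (gaussian :: 'd L2)"
proof (cases "f = 0")
  case False
  define G where "G = norm (gaussian :: 'd L2)"
  have G: "0 < G"
    using gaussian_nonzero[where ?'d = 'd] by (simp add: G_def)
  have "ennreal ((norm f)\<^sup>2) = ennreal (cmod (cinner f f))"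
    by (simp only: cinner_self norm_of_real abs_power2)
  also have "\<dots> \<le> ennreal (inv_energy (gaussian :: 'd L2)) * (\<integral>\<^sup>+z. ennreal (stft f z) * ennreal (stft f z) \<partial>lborel)"
    by (rule cinner_le_stft)
  also have "\<dots> \<le> ennreal (inv_energy (gaussian :: 'd L2)) * (\<integral>\<^sup>+z. ennreal (stft f z) * ennreal (norm f * G) \<partial>lborel)"
    by (intro mult_left_mono nn_integral_mono ennreal_leI)
       (use cinner_CS[of f "tf_shift z gaussian" for z] in \<open>simp_all add: stft_def G_def\<close>)
  also have "\<dots> \<le> ennreal (inv_energy (gaussian :: 'd L2)) * (ennreal (N f) * ennreal (norm f * G))"
    using M1_norm_ge[of f] M1_norm_N[OF f]
    by (simp add: nn_integral_multc mult_left_mono mult_right_mono)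
  also have "\<dots> = ennreal (N f * norm f / G)"
    using G by (simp add: inv_energy_def G_def[symmetric] power2_eq_square flip: ennreal_mult)
  finally have "norm f * norm f \<le> (N f / G) * norm f"
    using G by (subst (asm) ennreal_le_iff) (simp_all add: power2_eq_square)
  then show ?thesis
    using False mult_right_le_imp_le[of "norm f" "norm f" "N f / G"] by (simp add: G_def)
qed auto

lemma gaussian_M1: "(gaussian :: 'd L2) \<in> M1 w"
proof -
  have "M1_norm w gaussian \<le> (\<integral>\<^sup>+z. ennreal (maj 0 z) * ennreal (w z) \<partial>lborel)"
    unfolding M1_norm_eq using stft_gaussian_le_maj[of 0 0]
    by (intro nn_integral_mono mult_right_mono ennreal_leI) simp_all
  then show ?thesis
    using maj_weight_integral[of 0] by (auto simp: M1_iff)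
qed

text \<open>This stands in for completeness of M^1. The series converges in L^2 by
  \<open>norm_le_N\<close>; that the sum lies in M^1 follows from countable subadditivity of
  \<open>stft\<close> and Tonelli.\<close>

lemma M1_infsum:
  assumes I: "countable I" and f: "\<And>i. i \<in> I \<Longrightarrow> f i \<in> M1 w" and s: "(\<lambda>i. N (f i)) summable_on I"
  shows "f summable_on I" "infsum f I \<in> M1 w" "N (infsum f I) \<le> infsum (\<lambda>i. N (f i)) I"
proof -
  have "(\<lambda>i. N (f i) * (1 / norm (gaussian :: 'd L2))) summable_on I"
    by (rule summable_on_cmult_left[OF s])
  then have sn: "(\<lambda>i. norm (f i)) summable_on I"
    by (rule summable_on_comparison_test) (use norm_le_N[OF f] in simp_all)
  then show sf: "f summable_on I"
    by (rule abs_summable_summable)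
  have st: "ennreal (stft (infsum f I) z) \<le> (\<integral>\<^sup>+i. ennreal (stft (f i) z) \<partial>count_space I)" for z
  proof -
    let ?h = "tf_shift z gaussian :: 'd L2"
    have hs: "((\<lambda>i. cinner (f i) ?h) has_sum cinner (infsum f I) ?h) I"
      by (rule has_sum_bounded_linear[OF bounded_linear_cinner_left has_sum_infsum[OF sf]])
    have "(\<lambda>i. norm (f i) * norm ?h) summable_on I"
      by (rule summable_on_cmult_left[OF sn])
    then have sc: "(\<lambda>i. cmod (cinner (f i) ?h)) summable_on I"
      by (rule summable_on_comparison_test) (rule cinner_CS, simp)
    have "stft (infsum f I) z \<le> infsum (\<lambda>i. cmod (cinner (f i) ?h)) I"
      unfolding stft_def infsumI[OF hs, symmetric] by (rule norm_infsum_bound[OF sc])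
    then show ?thesis
      using nn_sum_eq_infsum[OF sc] by (simp add: stft_def ennreal_leI)
  qed
  have "M1_norm w (infsum f I) \<le> (\<integral>\<^sup>+z. (\<integral>\<^sup>+i. ennreal (stft (f i) z) * ennreal (w z) \<partial>count_space I) \<partial>lborel)"
    unfolding M1_norm_eq by (intro nn_integral_mono) (simp add: nn_integral_multc st mult_right_mono)
  also have "\<dots> = (\<integral>\<^sup>+i. (\<integral>\<^sup>+z. ennreal (stft (f i) z) * ennreal (w z) \<partial>lborel) \<partial>count_space I)"
    by (rule nn_integral_count_space_nn_integral[OF I]) measurable
  also have "\<dots> = (\<integral>\<^sup>+i. ennreal (N (f i)) \<partial>count_space I)"
    by (intro nn_integral_cong) (simp add: M1_norm_eq[symmetric] M1_norm_N f)
  also have "\<dots> = ennreal (infsum (\<lambda>i. N (f i)) I)"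
    by (rule nn_sum_eq_infsum[OF s]) simp
  finally have le: "M1_norm w (infsum f I) \<le> ennreal (infsum (\<lambda>i. N (f i)) I)" .
  show "infsum f I \<in> M1 w"
    by (rule M1I[OF le])
  show "N (infsum f I) \<le> infsum (\<lambda>i. N (f i)) I"
    by (rule N_le[OF le]) (simp add: infsum_nonneg)
qed

lemma M1_has_sum_map:
  fixes T :: "'d L2 \<Rightarrow> 'b::real_normed_vector"
  assumes I: "countable I" and f: "\<And>i. i \<in> I \<Longrightarrow> f i \<in> M1 w" and s: "(\<lambda>i. N (f i)) summable_on I"
    and add: "\<And>g h. g \<in> M1 w \<Longrightarrow> h \<in> M1 w \<Longrightarrow> T (g + h) = T g + T h"
    and bnd: "\<And>g. g \<in> M1 w \<Longrightarrow> norm (T g) \<le> C * N g"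
  shows "((\<lambda>i. T (f i)) has_sum T (infsum f I)) I"
proof -
  have T0: "T 0 = 0"
    using bnd[of 0] by simp
  have Tsum: "T (sum f F) = (\<Sum>i\<in>F. T (f i))" if "finite F" "F \<subseteq> I" for F
    using that
  proof (induction F rule: finite_induct)
    case (insert i F)
    then show ?case
      using add[of "f i" "sum f F"] f by (simp add: M1_sum subset_iff)
  qed (simp add: T0)
  have rest: "norm ((\<Sum>i\<in>F. T (f i)) - T (infsum f I)) \<le> \<bar>C\<bar> * (infsum (\<lambda>i. N (f i)) I - (\<Sum>i\<in>F. N (f i)))"
    if F: "finite F" "F \<subseteq> I" for F
  proof -
    have IF: "countable (I - F)" "\<And>i. i \<in> I - F \<Longrightarrow> f i \<in> M1 w" "(\<lambda>i. N (f i)) summable_on (I - F)"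
      using I f summable_on_subset_banach[OF s, of "I - F"] by auto
    note r = M1_infsum[OF IF]
    have "infsum f I = sum f F + infsum f (I - F)"
      using infsum_Un_disjoint[of f F "I - F"] F r(1) by (simp add: Un_absorb1)
    moreover have "sum f F \<in> M1 w"
      using F f by (intro M1_sum) auto
    ultimately have "T (infsum f I) = (\<Sum>i\<in>F. T (f i)) + T (infsum f (I - F))"
      using add[of "sum f F" "infsum f (I - F)"] r(2) Tsum[OF F] by simp
    then have "norm ((\<Sum>i\<in>F. T (f i)) - T (infsum f I)) = norm (T (infsum f (I - F)))"
      by simp
    also have "\<dots> \<le> C * N (infsum f (I - F))"
      by (rule bnd[OF r(2)])
    also have "\<dots> \<le> \<bar>C\<bar> * N (infsum f (I - F))"
      by (intro mult_right_mono) auto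
    also have "\<dots> \<le> \<bar>C\<bar> * infsum (\<lambda>i. N (f i)) (I - F)"
      by (intro mult_left_mono r(3)) auto
    also have "infsum (\<lambda>i. N (f i)) (I - F) = infsum (\<lambda>i. N (f i)) I - (\<Sum>i\<in>F. N (f i))"
      using infsum_Un_disjoint[of "\<lambda>i. N (f i)" F "I - F"] F IF(3) by (simp add: Un_absorb1)
    finally show ?thesis .
  qed
  have "((\<lambda>F. \<bar>C\<bar> * (infsum (\<lambda>i. N (f i)) I - (\<Sum>i\<in>F. N (f i)))) \<longlongrightarrow> \<bar>C\<bar> * (infsum (\<lambda>i. N (f i)) I - infsum (\<lambda>i. N (f i)) I)) (finite_subsets_at_top I)"
    using has_sum_infsum[OF s] unfolding has_sum_def by (intro tendsto_intros)
  then have lim0: "((\<lambda>F. \<bar>C\<bar> * (infsum (\<lambda>i. N (f i)) I - (\<Sum>i\<in>F. N (f i)))) \<longlongrightarrow> 0) (finite_subsets_at_top I)"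
    by simp
  have "((\<lambda>F. (\<Sum>i\<in>F. T (f i)) - T (infsum f I)) \<longlongrightarrow> 0) (finite_subsets_at_top I)"
    by (rule Lim_null_comparison[OF _ lim0]) (auto simp: eventually_finite_subsets_at_top intro!: exI[of _ "{}"] rest)
  then show ?thesis
    unfolding has_sum_def by (simp add: LIM_zero_iff)
qed

text \<open>The constant is fixed before f and g. Since w is positive, finiteness of the weighted
  sum makes each value of \<open>amalgam\<close> finite, which permits real numbers b l.\<close>

lemma amalgam_bound:
  obtains C where "0 < C" "\<And>f g. f \<in> M1 w \<Longrightarrow> g \<in> M1 w \<Longrightarrow>
    \<exists>b. (\<forall>l. 0 \<le> b l) \<and> (\<forall>l\<in>\<Lambda>. \<forall>y. norm y \<le> R \<longrightarrow> cmod (cinner f (tf_shift (l + y) g)) \<le> b l) \<and>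
      (\<lambda>l. b l * w l) summable_on \<Lambda> \<and> infsum (\<lambda>l. b l * w l) \<Lambda> \<le> C * N f * N g"
proof -
  obtain C where C: "0 < C"
    "\<And>f g. (\<integral>\<^sup>+l. amalgam R f g l * ennreal (w l) \<partial>count_space \<Lambda>) \<le> ennreal C * M1_norm w f * M1_norm w g"
    using amalgam_sum by blast
  have "\<exists>b. (\<forall>l. 0 \<le> b l) \<and> (\<forall>l\<in>\<Lambda>. \<forall>y. norm y \<le> R \<longrightarrow> cmod (cinner f (tf_shift (l + y) g)) \<le> b l) \<and>
      (\<lambda>l. b l * w l) summable_on \<Lambda> \<and> infsum (\<lambda>l. b l * w l) \<Lambda> \<le> C * N f * N g" if fg: "f \<in> M1 w" "g \<in> M1 w" for f g
  proof -
    define b where "b l = enn2real (amalgam R f g l)" for l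
    have b0: "0 \<le> b l" for l
      by (simp add: b_def)
    have le: "(\<integral>\<^sup>+l. amalgam R f g l * ennreal (w l) \<partial>count_space \<Lambda>) \<le> ennreal (C * N f * N g)"
      using C(2)[of f g] C(1) unfolding M1_norm_N[OF fg(1)] M1_norm_N[OF fg(2)]
      by (simp flip: ennreal_mult)
    then have "(\<integral>\<^sup>+l. amalgam R f g l * ennreal (w l) \<partial>count_space \<Lambda>) \<noteq> \<infinity>"
      by (auto simp: top_unique)
    then have "AE l in count_space \<Lambda>. amalgam R f g l * ennreal (w l) \<noteq> \<infinity>"
      by (intro nn_integral_noteq_infinite) simp_all
    then have fin: "amalgam R f g l \<noteq> \<infinity>" if "l \<in> \<Lambda>" for l
      using that w_pos[of l] by (auto simp: AE_count_space ennreal_mult_eq_top_iff)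
    have b: "amalgam R f g l = ennreal (b l)" if "l \<in> \<Lambda>" for l
      using fin[OF that] by (simp add: b_def less_top)
    have "(\<integral>\<^sup>+l. ennreal (b l * w l) \<partial>count_space \<Lambda>) = (\<integral>\<^sup>+l. amalgam R f g l * ennreal (w l) \<partial>count_space \<Lambda>)"
      by (intro nn_integral_cong) (simp add: b ennreal_mult b0 w_nonneg)
    then have "(\<integral>\<^sup>+l. ennreal (b l * w l) \<partial>count_space \<Lambda>) \<le> ennreal (C * N f * N g)"
      using le by simp
    note s = infsum_le_nn_sum[OF this]
    show ?thesis
    proof (intro exI[of _ b] conjI ballI allI impI)
      show "cmod (cinner f (tf_shift (l + y) g)) \<le> b l" if "l \<in> \<Lambda>" "norm y \<le> R" for l y
        using cinner_le_amalgam[OF that(2), of f l g] unfolding b[OF that(1)] by (simp add: b0)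
    qed (use s C(1) in \<open>simp_all add: b0 w_nonneg\<close>)
  qed
  then show ?thesis
    using that C(1) by blast
qed

text \<open>The case R = 0. It makes Gabor series converge in M^1 and puts
  \<open>lattice_inner\<close> into the twisted algebra.\<close>

lemma sampling_bound:
  obtains C where "0 < C" "\<And>f g. f \<in> M1 w \<Longrightarrow> g \<in> M1 w \<Longrightarrow> (\<lambda>l. cmod (cinner f (tf_shift l g)) * w l) summable_on \<Lambda>"
    "\<And>f g. f \<in> M1 w \<Longrightarrow> g \<in> M1 w \<Longrightarrow> infsum (\<lambda>l. cmod (cinner f (tf_shift l g)) * w l) \<Lambda> \<le> C * N f * N g"
proof -
  obtain C where C: "0 < C" "\<And>f g. f \<in> M1 w \<Longrightarrow> g \<in> M1 w \<Longrightarrow>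
    \<exists>b. (\<forall>l. 0 \<le> b l) \<and> (\<forall>l\<in>\<Lambda>. \<forall>y. norm y \<le> 0 \<longrightarrow> cmod (cinner f (tf_shift (l + y) g)) \<le> b l) \<and>
      (\<lambda>l. b l * w l) summable_on \<Lambda> \<and> infsum (\<lambda>l. b l * w l) \<Lambda> \<le> C * N f * N g"
    using amalgam_bound[of 0] by blast
  have "(\<lambda>l. cmod (cinner f (tf_shift l g)) * w l) summable_on \<Lambda> \<and> infsum (\<lambda>l. cmod (cinner f (tf_shift l g)) * w l) \<Lambda> \<le> C * N f * N g"
    if fg: "f \<in> M1 w" "g \<in> M1 w" for f g
  proof -
    obtain b where b: "\<And>l y. l \<in> \<Lambda> \<Longrightarrow> norm y \<le> 0 \<Longrightarrow> cmod (cinner f (tf_shift (l + y) g)) \<le> b l"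
      "(\<lambda>l. b l * w l) summable_on \<Lambda>" "infsum (\<lambda>l. b l * w l) \<Lambda> \<le> C * N f * N g"
      using C(2)[OF fg] by blast
    have le: "cmod (cinner f (tf_shift l g)) * w l \<le> b l * w l" if "l \<in> \<Lambda>" for l
      using b(1)[OF that, of 0] by (simp add: w_nonneg mult_right_mono)
    have "(\<lambda>l. cmod (cinner f (tf_shift l g)) * w l) summable_on \<Lambda>"
      by (rule summable_on_comparison_test[OF b(2)]) (simp_all add: le w_nonneg)
    then show ?thesis
      using infsum_mono[OF _ b(2) le] b(3) by auto
  qed
  then show ?thesis
    using that C(1) by blast
qed

text \<open>Pointwise convergence comes from strong continuity on L^2. The dominating function is
  \<open>stft_maj 1 f\<close>, which bounds \<open>stft\<close> of every shift of f by at most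
  1.\<close>

lemma N_tf_shift_tendsto:
  assumes f: "f \<in> M1 w" and Z: "Z \<longlonglongrightarrow> 0" "\<And>n. norm (Z n) \<le> 1"
  shows "(\<lambda>n. N (tf_shift (Z n) f - f)) \<longlonglongrightarrow> 0"
proof -
  have "(\<lambda>n. \<integral>\<^sup>+z. ennreal (stft (tf_shift (Z n) f - f) z) * ennreal (w z) \<partial>lborel) \<longlonglongrightarrow> (\<integral>\<^sup>+z. 0 \<partial>(lborel :: 'd phase measure))"
  proof (rule nn_integral_dominated_convergence[where w = "\<lambda>z. 2 * (stft_maj 1 f z * ennreal (w z))"])
    show "AE z in lborel. ennreal (stft (tf_shift (Z n) f - f) z) * ennreal (w z) \<le> 2 * (stft_maj 1 f z * ennreal (w z))" for n
    proof (rule AE_I2)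
      fix z
      have "stft (tf_shift (Z n) f - f) z \<le> stft (tf_shift (Z n) f) z + stft f z"
        unfolding stft_def cinner_diff_left by (rule norm_triangle_ineq4)
      then have "stft (tf_shift (Z n) f - f) z \<le> stft f (z - Z n) + stft f (z - 0)"
        by (simp add: stft_tf_shift)
      then have "ennreal (stft (tf_shift (Z n) f - f) z) \<le> ennreal (stft f (z - Z n)) + ennreal (stft f (z - 0))"
        by (simp add: ennreal_leI flip: ennreal_plus)
      also have "\<dots> \<le> stft_maj 1 f z + stft_maj 1 f z"
        by (intro add_mono stft_le_stft_maj Z) simp
      finally have "ennreal (stft (tf_shift (Z n) f - f) z) * ennreal (w z) \<le> (stft_maj 1 f z + stft_maj 1 f z) * ennreal (w z)"
        by (rule mult_right_mono) simp
      then show "ennreal (stft (tf_shift (Z n) f - f) z) * ennreal (w z) \<le> 2 * (stft_maj 1 f z * ennreal (w z))"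
        by (simp add: mult_2 distrib_right)
    qed
    have "(\<integral>\<^sup>+z. 2 * (stft_maj 1 f z * ennreal (w z)) \<partial>lborel) = 2 * (\<integral>\<^sup>+z. stft_maj 1 f z * ennreal (w z) \<partial>lborel)"
      by (rule nn_integral_cmult) measurable
    then show "(\<integral>\<^sup>+z. 2 * (stft_maj 1 f z * ennreal (w z)) \<partial>lborel) < \<infinity>"
      using stft_maj_integral[of f 1] f by (simp add: M1_iff ennreal_mult_less_top)
    show "AE z in lborel. (\<lambda>n. ennreal (stft (tf_shift (Z n) f - f) z) * ennreal (w z)) \<longlonglongrightarrow> 0"
    proof (rule AE_I2)
      fix z
      have "(\<lambda>n. cinner (tf_shift (Z n) f - f) (tf_shift z gaussian)) \<longlonglongrightarrow> cinner (f - f) (tf_shift z gaussian)"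
        by (intro bounded_linear.tendsto[OF bounded_linear_cinner_left] tendsto_diff tendsto_const tf_shift_continuous Z)
      then have "(\<lambda>n. stft (tf_shift (Z n) f - f) z * w z) \<longlonglongrightarrow> cmod (cinner (f - f) (tf_shift z gaussian)) * w z"
        unfolding stft_def by (intro tendsto_intros)
      then have "(\<lambda>n. ennreal (stft (tf_shift (Z n) f - f) z * w z)) \<longlonglongrightarrow> ennreal 0"
        by (intro tendsto_ennrealI) simp
      then show "(\<lambda>n. ennreal (stft (tf_shift (Z n) f - f) z) * ennreal (w z)) \<longlonglongrightarrow> 0"
        by (simp add: ennreal_mult w_nonneg)
    qed
  qed measurable
  then have "(\<lambda>n. M1_norm w (tf_shift (Z n) f - f)) \<longlonglongrightarrow> 0"
    unfolding M1_norm_eq by simp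
  moreover have "M1_norm w (tf_shift (Z n) f - f) = ennreal (N (tf_shift (Z n) f - f))" for n
    by (intro M1_norm_N M1_diff M1_tf_shift f)
  ultimately have "(\<lambda>n. ennreal (N (tf_shift (Z n) f - f))) \<longlonglongrightarrow> ennreal 0"
    by simp
  then show ?thesis
    by (subst (asm) tendsto_ennreal_iff) auto
qed

lemma N_tf_shift_small:
  assumes f: "f \<in> M1 w" and e: "0 < e"
  obtains d where "0 < d" "\<And>u. norm u < d \<Longrightarrow> N (tf_shift u f - f) < e"
proof (rule ccontr)
  assume "\<not> thesis"
  then have "\<exists>u. norm u < 1 / real (Suc n) \<and> \<not> N (tf_shift u f - f) < e" for n
    using that[of "1 / real (Suc n)"] by auto
  then obtain Z where Z: "\<And>n. norm (Z n) < 1 / real (Suc n)" "\<And>n. \<not> N (tf_shift (Z n) f - f) < e"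
    by metis
  have "(\<lambda>n. 1 / real (Suc n)) \<longlonglongrightarrow> 0"
    by (rule LIMSEQ_Suc[OF lim_1_over_n])
  then have Z0: "Z \<longlonglongrightarrow> 0"
    by (rule Lim_null_comparison[rotated]) (use Z(1) in \<open>auto intro!: always_eventually less_imp_le\<close>)
  have "norm (Z n) \<le> 1" for n
    using Z(1)[of n] by (rule less_imp_le[OF less_le_trans]) simp
  from N_tf_shift_tendsto[OF f Z0 this] have "\<forall>\<^sub>F n in sequentially. N (tf_shift (Z n) f - f) < e"
    by (rule order_tendstoD) (rule e)
  then show False
    using Z(2) by (auto simp: eventually_sequentially)
qed

end

section \<open>Inverse square roots of operators on \<open>M\<^sup>1\<close>\<close>

definition sqrt_coeff :: "nat \<Rightarrow> real" where
  "sqrt_coeff n = pochhammer (1/2) n / fact n"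

lemma sqrt_coeff_nonneg: "0 \<le> sqrt_coeff n"
  by (simp add: sqrt_coeff_def pochhammer_nonneg)

text \<open>The coefficients are those of \<open>(1 - x)\<^sup>-\<^sup>1\<^sup>/\<^sup>2\<close>, whose square is the geometric series.\<close>

lemma sqrt_coeff_convolution: "(\<Sum>i\<le>n. sqrt_coeff i * sqrt_coeff (n - i)) = 1"
proof -
  have c: "sqrt_coeff k = (-1) ^ k * ((-1/2) gchoose k)" for k
    by (simp add: sqrt_coeff_def gbinomial_pochhammer flip: mult.assoc power_add)
  have "(\<Sum>i\<le>n. sqrt_coeff i * sqrt_coeff (n - i)) = (\<Sum>i=0..n. (-1) ^ n * (((-1/2) gchoose i) * ((-1/2) gchoose (n - i))))"
    by (intro sum.cong) (auto simp: c simp flip: power_add mult.assoc)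
  \<comment> \<open>Vandermonde's identity for the exponents -1/2 and -1/2, which add up to
    -1.\<close>
  also have "\<dots> = (-1) ^ n * ((-1) gchoose n)"
    using gbinomial_Vandermonde[of "-1/2 :: real" "-1/2" n] by (simp flip: sum_distrib_left)
  also have "\<dots> = 1"
    using gbinomial_minus[of "1 :: real" n] by (simp add: binomial_gbinomial[symmetric] flip: mult.assoc power_add)
  finally show ?thesis .
qed

lemma sqrt_coeff_0: "sqrt_coeff 0 = 1"
  by (simp add: sqrt_coeff_def)

lemma sqrt_coeff_le_1: "sqrt_coeff n \<le> 1"
proof -
  have "sqrt_coeff 0 * sqrt_coeff (n - 0) \<le> (\<Sum>i\<le>n. sqrt_coeff i * sqrt_coeff (n - i))"
    by (rule member_le_sum) (auto simp: sqrt_coeff_nonneg)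
  then show ?thesis
    by (simp add: sqrt_coeff_convolution sqrt_coeff_0)
qed

context gabor_weight
begin

lemma N_scaleR: "N (r *\<^sub>R f) = \<bar>r\<bar> * N f"
  unfolding cscale_of_real[symmetric] N_cscale by simp

lemma M1_scaleR: "f \<in> M1 w \<Longrightarrow> r *\<^sub>R f \<in> M1 w"
  unfolding cscale_of_real[symmetric] by (rule M1_cscale)

text \<open>The operators are plain functions on L^2, so every condition is restricted to M^1.
  Symmetry and commutation with the lattice shifts are included because together they let an
  operator pass from a window of a Gabor sum to its argument.\<close>

definition M1_op :: "('d L2 \<Rightarrow> 'd L2) \<Rightarrow> bool" where
  "M1_op A \<longleftrightarrow> (\<forall>f\<in>M1 w. A f \<in> M1 w) \<and> (\<forall>f\<in>M1 w. \<forall>g\<in>M1 w. A (f + g) = A f + A g) \<and>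
     (\<forall>c. \<forall>f\<in>M1 w. A (cscale c f) = cscale c (A f)) \<and> (\<exists>C\<ge>0. \<forall>f\<in>M1 w. N (A f) \<le> C * N f) \<and>
     (\<forall>l\<in>\<Lambda>. \<forall>f\<in>M1 w. A (tf_shift l f) = tf_shift l (A f)) \<and>
     (\<forall>f\<in>M1 w. \<forall>g\<in>M1 w. cinner (A f) g = cinner f (A g))"

lemma M1_opD:
  assumes "M1_op A"
  shows "f \<in> M1 w \<Longrightarrow> A f \<in> M1 w" "f \<in> M1 w \<Longrightarrow> g \<in> M1 w \<Longrightarrow> A (f + g) = A f + A g"
    "f \<in> M1 w \<Longrightarrow> A (cscale c f) = cscale c (A f)"
    "l \<in> \<Lambda> \<Longrightarrow> f \<in> M1 w \<Longrightarrow> A (tf_shift l f) = tf_shift l (A f)"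
    "f \<in> M1 w \<Longrightarrow> g \<in> M1 w \<Longrightarrow> cinner (A f) g = cinner f (A g)"
  using assms unfolding M1_op_def by blast+

lemma M1_op_bound:
  assumes "M1_op A"
  obtains C where "0 \<le> C" "\<And>f. f \<in> M1 w \<Longrightarrow> N (A f) \<le> C * N f"
  using assms unfolding M1_op_def by blast

lemma M1_op_scaleR: "M1_op A \<Longrightarrow> f \<in> M1 w \<Longrightarrow> A (r *\<^sub>R f) = r *\<^sub>R A f"
  unfolding cscale_of_real[symmetric] by (rule M1_opD(3))

lemma M1_op_diff: "M1_op A \<Longrightarrow> f \<in> M1 w \<Longrightarrow> g \<in> M1 w \<Longrightarrow> A (f - g) = A f - A g"
  using M1_opD(2)[of A "f - g" g] M1_diff by (simp add: eq_diff_eq)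

lemma M1_op_has_sum:
  assumes A: "M1_op A" and I: "countable I" and f: "\<And>i. i \<in> I \<Longrightarrow> f i \<in> M1 w" and s: "(\<lambda>i. N (f i)) summable_on I"
  shows "((\<lambda>i. A (f i)) has_sum A (infsum f I)) I"
proof -
  obtain C where C: "0 \<le> C" "\<And>f. f \<in> M1 w \<Longrightarrow> N (A f) \<le> C * N f"
    using M1_op_bound[OF A] by blast
  show ?thesis
  proof (rule M1_has_sum_map[OF I f s])
    show "norm (A g) \<le> (C / norm (gaussian :: 'd L2)) * N g" if "g \<in> M1 w" for g
      using order_trans[OF norm_le_N[OF M1_opD(1)[OF A that]] divide_right_mono[OF C(2)[OF that]]] by simp
  qed (use M1_opD(2)[OF A] in auto)
qed

lemma M1_op_id: "M1_op (\<lambda>f. f)"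
  unfolding M1_op_def by (auto intro!: exI[of _ 1])

lemma M1_op_add:
  assumes A: "M1_op A" and B: "M1_op B"
  shows "M1_op (\<lambda>f. A f + B f)"
proof -
  obtain C where C: "0 \<le> C" "\<And>f. f \<in> M1 w \<Longrightarrow> N (A f) \<le> C * N f"
    using M1_op_bound[OF A] by blast
  obtain D where D: "0 \<le> D" "\<And>f. f \<in> M1 w \<Longrightarrow> N (B f) \<le> D * N f"
    using M1_op_bound[OF B] by blast
  have "N (A f + B f) \<le> (C + D) * N f" if "f \<in> M1 w" for f
    using N_add[OF M1_opD(1)[OF A that] M1_opD(1)[OF B that]] C(2)[OF that] D(2)[OF that]
    by (simp add: distrib_right)
  then have "\<exists>C\<ge>0. \<forall>f\<in>M1 w. N (A f + B f) \<le> C * N f"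
    using C(1) D(1) by (intro exI[of _ "C + D"]) auto
  then show ?thesis
    unfolding M1_op_def
    by (simp add: M1_opD[OF A] M1_opD[OF B] M1_add cscale_add_right tf_shift_add cinner_add_left cinner_add_right algebra_simps)
qed

lemma M1_op_scale:
  assumes A: "M1_op A"
  shows "M1_op (\<lambda>f. r *\<^sub>R A f)"
proof -
  obtain C where C: "0 \<le> C" "\<And>f. f \<in> M1 w \<Longrightarrow> N (A f) \<le> C * N f"
    using M1_op_bound[OF A] by blast
  have "N (r *\<^sub>R A f) \<le> (\<bar>r\<bar> * C) * N f" if "f \<in> M1 w" for f
    using mult_left_mono[OF C(2)[OF that], of "\<bar>r\<bar>"] by (simp add: N_scaleR mult.assoc)
  then have "\<exists>C\<ge>0. \<forall>f\<in>M1 w. N (r *\<^sub>R A f) \<le> C * N f"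
    using C(1) by (intro exI[of _ "\<bar>r\<bar> * C"]) auto
  then show ?thesis
    unfolding M1_op_def cscale_of_real[symmetric]
    by (simp add: M1_opD[OF A] M1_cscale cscale_add_right tf_shift_cscale cinner_cscale_left cinner_cscale_right
        cscale_cscale mult.commute)
qed

lemma M1_op_minus:
  assumes A: "M1_op A" and B: "M1_op B"
  shows "M1_op (\<lambda>f. A f - B f)"
  using M1_op_add[OF A M1_op_scale[OF B, of "-1"]] by simp

lemma M1_op_sum:
  assumes "\<And>k. k \<in> F \<Longrightarrow> M1_op (A k)"
  shows "M1_op (\<lambda>f. \<Sum>k\<in>F. A k f)"
  using assms
proof (induction F rule: infinite_finite_induct)
  case (insert k F)
  then show ?case
    by (simp add: M1_op_add)
qed (use M1_op_scale[OF M1_op_id, of 0] in simp_all)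

text \<open>The factors have to commute for the product to be symmetric again.\<close>

lemma M1_op_compose:
  assumes A: "M1_op A" and B: "M1_op B" and comm: "\<And>f. f \<in> M1 w \<Longrightarrow> A (B f) = B (A f)"
  shows "M1_op (\<lambda>f. A (B f))"
proof -
  obtain C where C: "0 \<le> C" "\<And>f. f \<in> M1 w \<Longrightarrow> N (A f) \<le> C * N f"
    using M1_op_bound[OF A] by blast
  obtain D where D: "0 \<le> D" "\<And>f. f \<in> M1 w \<Longrightarrow> N (B f) \<le> D * N f"
    using M1_op_bound[OF B] by blast
  have "N (A (B f)) \<le> (C * D) * N f" if "f \<in> M1 w" for f
    using order_trans[OF C(2)[OF M1_opD(1)[OF B that]] mult_left_mono[OF D(2)[OF that] C(1)]] by (simp add: mult.assoc)
  then have bd: "\<exists>C\<ge>0. \<forall>f\<in>M1 w. N (A (B f)) \<le> C * N f"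
    using C(1) D(1) by (intro exI[of _ "C * D"]) auto
  have "cinner (A (B f)) g = cinner f (A (B g))" if "f \<in> M1 w" "g \<in> M1 w" for f g
    using that by (simp add: M1_opD[OF A] M1_opD[OF B] comm)
  with bd show ?thesis
    unfolding M1_op_def
    by (simp add: M1_opD(1-4)[OF A] M1_opD(1-4)[OF B])
qed

lemma M1_op_funpow:
  assumes D: "M1_op D"
  shows "M1_op (D ^^ n)"
proof (induction n)
  case (Suc n)
  have "M1_op (\<lambda>f. D ((D ^^ n) f))"
    by (rule M1_op_compose[OF D Suc]) (simp add: funpow_swap1)
  then show ?case by (simp add: o_def)
qed (use M1_op_id in \<open>simp add: id_def\<close>)

lemma N_funpow:
  assumes D: "M1_op D" and half: "\<And>f. f \<in> M1 w \<Longrightarrow> N (D f) \<le> N f / 2" and f: "f \<in> M1 w"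
  shows "N ((D ^^ n) f) \<le> (1/2) ^ n * N f"
proof (induction n)
  case (Suc n)
  have "N ((D ^^ Suc n) f) \<le> N ((D ^^ n) f) / 2"
    using half[OF M1_opD(1)[OF M1_op_funpow[OF D] f]] by simp
  with Suc show ?case by simp
qed simp

text \<open>Stands for (1 - D)^(-1/2). The sum is taken in L^2; under the bound 1/2 on D the terms
  are also summable with respect to \<open>N\<close>.\<close>

definition inv_sqrt :: "('d L2 \<Rightarrow> 'd L2) \<Rightarrow> 'd L2 \<Rightarrow> 'd L2" where
  "inv_sqrt D f = infsum (\<lambda>n. sqrt_coeff n *\<^sub>R (D ^^ n) f) UNIV"

lemma geometric_summable_on: "(\<lambda>n::nat. (1/2::real) ^ n * c) summable_on UNIV" "infsum (\<lambda>n::nat. (1/2::real) ^ n * c) UNIV = 2 * c"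
proof -
  have "((\<lambda>n::nat. (1/2::real) ^ n) has_sum 2) UNIV"
    using geometric_sums[of "1/2 :: real"] by (intro sums_nonneg_imp_has_sum) simp_all
  then have "((\<lambda>n::nat. (1/2::real) ^ n * c) has_sum 2 * c) UNIV"
    by (rule has_sum_cmult_left)
  then show "(\<lambda>n::nat. (1/2::real) ^ n * c) summable_on UNIV" "infsum (\<lambda>n::nat. (1/2::real) ^ n * c) UNIV = 2 * c"
    by (auto simp: has_sum_imp_summable infsumI)
qed

context
  fixes D :: "'d L2 \<Rightarrow> 'd L2"
  assumes D: "M1_op D" and half: "\<And>f. f \<in> M1 w \<Longrightarrow> N (D f) \<le> N f / 2"
begin

lemma series_M1: "f \<in> M1 w \<Longrightarrow> r *\<^sub>R (D ^^ n) f \<in> M1 w"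
  by (intro M1_scaleR M1_opD(1)[OF M1_op_funpow[OF D]])

lemma series_N:
  assumes "f \<in> M1 w"
  shows "N (sqrt_coeff n *\<^sub>R (D ^^ n) f) \<le> (1/2) ^ n * N f"
proof -
  have "sqrt_coeff n * N ((D ^^ n) f) \<le> 1 * N ((D ^^ n) f)"
    by (intro mult_right_mono sqrt_coeff_le_1) simp
  then show ?thesis
    using N_funpow[OF D half assms, of n] sqrt_coeff_nonneg[of n] by (simp add: N_scaleR)
qed

lemma series_summable: "f \<in> M1 w \<Longrightarrow> (\<lambda>n. N (sqrt_coeff n *\<^sub>R (D ^^ n) f)) summable_on UNIV"
  by (rule summable_on_comparison_test[OF geometric_summable_on(1)[of "N f"] series_N]) simp_all

lemma inv_sqrt_M1: "f \<in> M1 w \<Longrightarrow> inv_sqrt D f \<in> M1 w"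
  unfolding inv_sqrt_def by (rule M1_infsum(2)[OF _ _ series_summable]) (simp_all add: series_M1)

lemma inv_sqrt_N:
  assumes f: "f \<in> M1 w"
  shows "N (inv_sqrt D f) \<le> 2 * N f"
proof -
  have "N (inv_sqrt D f) \<le> infsum (\<lambda>n. N (sqrt_coeff n *\<^sub>R (D ^^ n) f)) UNIV"
    unfolding inv_sqrt_def by (rule M1_infsum(3)[OF _ _ series_summable[OF f]]) (simp_all add: series_M1 f)
  also have "\<dots> \<le> infsum (\<lambda>n. (1/2) ^ n * N f) UNIV"
    by (rule infsum_mono[OF series_summable[OF f] geometric_summable_on(1) series_N[OF f]])
  finally show ?thesis
    by (simp only: geometric_summable_on)
qed

lemma series_has_sum: "f \<in> M1 w \<Longrightarrow> ((\<lambda>n. sqrt_coeff n *\<^sub>R (D ^^ n) f) has_sum inv_sqrt D f) UNIV"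
  unfolding inv_sqrt_def by (intro has_sum_infsum M1_infsum(1) series_summable series_M1) simp_all

lemma inv_sqrt_commute:
  assumes A: "M1_op A" and comm: "\<And>f. f \<in> M1 w \<Longrightarrow> A (D f) = D (A f)" and f: "f \<in> M1 w"
  shows "A (inv_sqrt D f) = inv_sqrt D (A f)"
proof -
  have c: "A ((D ^^ n) f) = (D ^^ n) (A f)" for n
  proof (induction n)
    case (Suc n)
    then show ?case
      using comm[OF M1_opD(1)[OF M1_op_funpow[OF D] f, of n]] by simp
  qed simp
  have "((\<lambda>n. A (sqrt_coeff n *\<^sub>R (D ^^ n) f)) has_sum A (inv_sqrt D f)) UNIV"
    unfolding inv_sqrt_def by (rule M1_op_has_sum[OF A _ series_M1[OF f] series_summable[OF f]]) simp
  then have "((\<lambda>n. sqrt_coeff n *\<^sub>R (D ^^ n) (A f)) has_sum A (inv_sqrt D f)) UNIV"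
    by (simp add: M1_op_scaleR[OF A] M1_opD(1)[OF M1_op_funpow[OF D] f] c)
  then show ?thesis
    using series_has_sum[OF M1_opD(1)[OF A f]] by (rule has_sum_unique)
qed

lemma M1_op_inv_sqrt: "M1_op (inv_sqrt D)"
  unfolding M1_op_def
proof (intro conjI ballI allI)
  fix f assume f: "f \<in> M1 w"
  show "inv_sqrt D f \<in> M1 w"
    by (rule inv_sqrt_M1[OF f])
  show "inv_sqrt D (cscale c f) = cscale c (inv_sqrt D f)" for c
  proof -
    have "((\<lambda>n. cscale c (sqrt_coeff n *\<^sub>R (D ^^ n) f)) has_sum cscale c (inv_sqrt D f)) UNIV"
      by (rule has_sum_bounded_linear[OF bounded_linear_cscale series_has_sum[OF f]])
    moreover have "cscale c (sqrt_coeff n *\<^sub>R (D ^^ n) f) = sqrt_coeff n *\<^sub>R (D ^^ n) (cscale c f)" for n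
      by (simp add: M1_opD(3)[OF M1_op_funpow[OF D] f] cscale_cscale mult.commute flip: cscale_of_real)
    ultimately show ?thesis
      using series_has_sum[OF M1_cscale[OF f, of c]] by (simp add: has_sum_unique)
  qed
  show "inv_sqrt D (tf_shift l f) = tf_shift l (inv_sqrt D f)" if "l \<in> \<Lambda>" for l
  proof -
    have "((\<lambda>n. tf_shift l (sqrt_coeff n *\<^sub>R (D ^^ n) f)) has_sum tf_shift l (inv_sqrt D f)) UNIV"
      by (rule has_sum_bounded_linear[OF blinfun.bounded_linear_right series_has_sum[OF f]])
    moreover have "tf_shift l (sqrt_coeff n *\<^sub>R (D ^^ n) f) = sqrt_coeff n *\<^sub>R (D ^^ n) (tf_shift l f)" for n
      by (simp add: M1_opD(4)[OF M1_op_funpow[OF D] that f] blinfun.scaleR_right)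
    ultimately show ?thesis
      using series_has_sum[OF M1_tf_shift[OF f, of l]] by (simp add: has_sum_unique)
  qed
  fix g assume g: "g \<in> M1 w"
  show "inv_sqrt D (f + g) = inv_sqrt D f + inv_sqrt D g"
  proof -
    have "((\<lambda>n. sqrt_coeff n *\<^sub>R (D ^^ n) f + sqrt_coeff n *\<^sub>R (D ^^ n) g) has_sum inv_sqrt D f + inv_sqrt D g) UNIV"
      by (intro has_sum_add series_has_sum f g)
    moreover have "sqrt_coeff n *\<^sub>R (D ^^ n) f + sqrt_coeff n *\<^sub>R (D ^^ n) g = sqrt_coeff n *\<^sub>R (D ^^ n) (f + g)" for n
      by (simp add: M1_opD(2)[OF M1_op_funpow[OF D] f g] scaleR_add_right)
    ultimately show ?thesis
      using series_has_sum[OF M1_add[OF f g]] by (simp add: has_sum_unique)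
  qed
  show "cinner (inv_sqrt D f) g = cinner f (inv_sqrt D g)"
  proof -
    have "((\<lambda>n. cinner (sqrt_coeff n *\<^sub>R (D ^^ n) f) g) has_sum cinner (inv_sqrt D f) g) UNIV"
      by (rule has_sum_bounded_linear[OF bounded_linear_cinner_left series_has_sum[OF f]])
    moreover have "((\<lambda>n. cinner f (sqrt_coeff n *\<^sub>R (D ^^ n) g)) has_sum cinner f (inv_sqrt D g)) UNIV"
      by (rule has_sum_bounded_linear[OF bounded_linear_cinner_right series_has_sum[OF g]])
    moreover have "cinner (sqrt_coeff n *\<^sub>R (D ^^ n) f) g = cinner f (sqrt_coeff n *\<^sub>R (D ^^ n) g)" for n
      by (simp add: cinner_cscale_left cinner_cscale_right M1_opD(5)[OF M1_op_funpow[OF D] f g] flip: cscale_of_real)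
    ultimately show ?thesis
      by (simp add: has_sum_unique)
  qed
next
  show "\<exists>C\<ge>0. \<forall>f\<in>M1 w. N (inv_sqrt D f) \<le> C * N f"
    using inv_sqrt_N by (intro exI[of _ 2]) auto
qed

text \<open>A Cauchy product. The double series is absolutely summable in L^2 and may be summed
  along antidiagonals, where the coefficients add up to 1; the Neumann series of 1 - D
  results.\<close>

lemma inv_sqrt_inv_sqrt:
  assumes f: "f \<in> M1 w"
  shows "((\<lambda>n. (D ^^ n) f) has_sum inv_sqrt D (inv_sqrt D f)) UNIV"
proof -
  define c where "c = N f / norm (gaussian :: 'd L2)"
  have c: "0 \<le> c"
    by (simp add: c_def)
  have geo: "((\<lambda>n::nat. (1/2) ^ n * c) has_sum 2 * c) UNIV"
    using has_sum_infsum[OF geometric_summable_on(1)[of c]] by (simp only: geometric_summable_on(2))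
  define F where "F = (\<lambda>(m, n). (sqrt_coeff m * sqrt_coeff n) *\<^sub>R (D ^^ (m + n)) f)"
  have Fn: "norm (F (m, n)) \<le> (1/2) ^ m * ((1/2) ^ n * c)" for m n
  proof -
    have "norm (F (m, n)) = (sqrt_coeff m * sqrt_coeff n) * norm ((D ^^ (m + n)) f)"
      by (simp add: F_def sqrt_coeff_nonneg)
    also have "\<dots> \<le> (1 * 1) * norm ((D ^^ (m + n)) f)"
      by (intro mult_right_mono mult_mono sqrt_coeff_le_1) (auto simp: sqrt_coeff_nonneg)
    also have "\<dots> \<le> N ((D ^^ (m + n)) f) / norm (gaussian :: 'd L2)"
      using norm_le_N[OF M1_opD(1)[OF M1_op_funpow[OF D] f]] by simp
    also have "\<dots> \<le> ((1/2) ^ (m + n) * N f) / norm (gaussian :: 'd L2)"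
      by (intro divide_right_mono N_funpow[OF D half f]) simp_all
    finally show ?thesis
      by (simp add: power_add mult.assoc c_def)
  qed
  have sumF: "F summable_on UNIV \<times> UNIV"
  proof (rule abs_summable_summable, rule summable_on_comparison_test)
    show "(\<lambda>(m, n). (1/2) ^ m * ((1/2) ^ n * c)) summable_on (UNIV :: nat set) \<times> (UNIV :: nat set)"
    proof (rule summable_on_SigmaI)
      show "((\<lambda>n. case (m, n) of (m, n) \<Rightarrow> (1/2) ^ m * ((1/2) ^ n * c)) has_sum
          (1/2) ^ m * (2 * c)) UNIV" for m :: nat
        using has_sum_cmult_right[OF geo, of "(1/2) ^ m"] by simp
      show "(\<lambda>m::nat. (1/2) ^ m * (2 * c)) summable_on UNIV"
        by (rule geometric_summable_on)
    qed (use c in auto)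
    show "norm (F p) \<le> (case p of (m, n) \<Rightarrow> (1/2) ^ m * ((1/2) ^ n * c))" for p
      using Fn by (cases p) simp
  qed simp
  have inner: "((\<lambda>n. F (m, n)) has_sum sqrt_coeff m *\<^sub>R (D ^^ m) (inv_sqrt D f)) UNIV" for m
  proof -
    have "((\<lambda>n. (D ^^ m) (sqrt_coeff n *\<^sub>R (D ^^ n) f)) has_sum (D ^^ m) (inv_sqrt D f)) UNIV"
      unfolding inv_sqrt_def
      by (rule M1_op_has_sum[OF M1_op_funpow[OF D] _ series_M1[OF f] series_summable[OF f]]) simp
    then have "((\<lambda>n. sqrt_coeff m *\<^sub>R (D ^^ m) (sqrt_coeff n *\<^sub>R (D ^^ n) f)) has_sum sqrt_coeff m *\<^sub>R (D ^^ m) (inv_sqrt D f)) UNIV"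
      by (rule has_sum_bounded_linear[OF bounded_linear_scaleR_right])
    moreover have "sqrt_coeff m *\<^sub>R (D ^^ m) (sqrt_coeff n *\<^sub>R (D ^^ n) f) = F (m, n)" for n
      by (simp add: F_def M1_op_scaleR[OF M1_op_funpow[OF D] M1_opD(1)[OF M1_op_funpow[OF D] f]] funpow_add)
    ultimately show ?thesis
      by simp
  qed
  have tot: "(F has_sum inv_sqrt D (inv_sqrt D f)) (UNIV \<times> UNIV)"
    by (rule has_sum_SigmaI[OF inner series_has_sum[OF inv_sqrt_M1[OF f]] sumF])
  \<comment> \<open>The pair (k, m) with m \<le> k stands for position m on the antidiagonal of
    index k.\<close>
  have bij: "bij_betw (\<lambda>(k, m). (m, k - m)) (SIGMA k:UNIV. {..k}) (UNIV \<times> (UNIV :: nat set))"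
    by (rule bij_betwI[of _ _ _ "\<lambda>(m, n). (m + n, m)"]) auto
  have "((\<lambda>p. F ((\<lambda>(k, m). (m, k - m)) p)) has_sum inv_sqrt D (inv_sqrt D f)) (SIGMA k:UNIV. {..k})"
    unfolding has_sum_reindex_bij_betw[OF bij] by (rule tot)
  moreover have "((\<lambda>m. F ((\<lambda>(k, m). (m, k - m)) (k, m))) has_sum (D ^^ k) f) {..k}" for k
  proof (rule has_sum_finiteI)
    have "(\<Sum>m\<le>k. F (m, k - m)) = (\<Sum>m\<le>k. sqrt_coeff m * sqrt_coeff (k - m)) *\<^sub>R (D ^^ k) f"
      unfolding scaleR_sum_left by (intro sum.cong) (auto simp: F_def)
    then show "(D ^^ k) f = (\<Sum>m\<le>k. F ((\<lambda>(k, m). (m, k - m)) (k, m)))"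
      by (simp add: sqrt_coeff_convolution)
  qed simp
  ultimately show ?thesis
    by (rule has_sum_SigmaD)
qed

text \<open>Applying D to the Neumann series shifts it by one place, so only its term of index 0,
  which is f, is left in the difference.\<close>

lemma inv_sqrt_inverse:
  assumes f: "f \<in> M1 w"
  shows "inv_sqrt D (inv_sqrt D f) - D (inv_sqrt D (inv_sqrt D f)) = f"
proof -
  define s where "s = inv_sqrt D (inv_sqrt D f)"
  have Ds: "((\<lambda>n. (D ^^ n) f) has_sum s) UNIV"
    unfolding s_def by (rule inv_sqrt_inv_sqrt[OF f])
  have "(\<lambda>n. N ((D ^^ n) f)) summable_on UNIV"
    by (rule summable_on_comparison_test[OF geometric_summable_on(1)[of "N f"] N_funpow[OF D half f]]) simp_all
  then have "((\<lambda>n. D ((D ^^ n) f)) has_sum D (infsum (\<lambda>n. (D ^^ n) f) UNIV)) UNIV"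
    by (intro M1_op_has_sum[OF D] M1_opD(1)[OF M1_op_funpow[OF D] f]) simp_all
  then have 1: "((\<lambda>n. (D ^^ Suc n) f) has_sum D s) UNIV"
    using infsumI[OF Ds] by simp
  have "((\<lambda>n. (D ^^ n) f) has_sum D s) (range Suc)"
    unfolding has_sum_reindex[OF inj_Suc] using 1 by (simp add: o_def)
  then have "((\<lambda>n. (D ^^ n) f) has_sum (f + D s)) (insert 0 (range Suc))"
    using has_sum_insert[of 0 "range Suc" "\<lambda>n. (D ^^ n) f" "D s"] by simp
  moreover have "insert 0 (range Suc) = UNIV"
    using UNIV_nat_eq by blast
  ultimately have "s = f + D s"
    using Ds has_sum_unique by metis
  then show ?thesis
    unfolding s_def by (simp add: diff_eq_eq)
qed

end

end

section \<open>Tight Gabor frames in \<open>M\<^sup>1\<close>\<close>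

text \<open>The phase between \<pi>(z + u) and \<pi>(z) \<pi>(u) enters once plainly and once
  conjugated, so rank-one operators do not see the cocycle.\<close>

lemma rank_one_phase:
  "cscale (cinner f (tf_shift (z + u) g)) (tf_shift (z + u) h)
     = cscale (cinner f (tf_shift z (tf_shift u g))) (tf_shift z (tf_shift u h))"
  by (simp only: tf_shift_plus cinner_cscale_right cscale_cscale complex_cnj_cnj)
     (simp add: mult.commute mult.left_commute mult.assoc[symmetric])

lemma tf_phase_measurable [measurable]:
  assumes [measurable]: "a \<in> borel_measurable M" "b \<in> borel_measurable M"
  shows "(\<lambda>x. tf_phase (a x) (b x)) \<in> borel_measurable M"
  unfolding tf_phase_def by measurable

lemma cinner_tf_shift_compose_measurable [measurable]:
  assumes [measurable]: "a \<in> borel_measurable M" "b \<in> borel_measurable M"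
  shows "(\<lambda>x. cinner (tf_shift (a x) f) (tf_shift (b x) g)) \<in> borel_measurable M"
proof -
  have "cinner (tf_shift z f) (tf_shift u g) = tf_phase z (u - z) * cinner f (tf_shift (u - z) g)" for z u
  proof -
    have "tf_shift u g = cscale (cnj (tf_phase z (u - z))) (tf_shift z (tf_shift (u - z) g))"
      using tf_shift_plus[of z "u - z" g] by (simp only: add_diff_cancel_left' add.commute[of z] diff_add_cancel)
    then show ?thesis
      by (simp only: cinner_cscale_right cinner_tf_shift complex_cnj_cnj)
  qed
  then show ?thesis
    by (simp only:) measurable
qed

lemma tf_shift3:
  "tf_shift l (tf_shift p (tf_shift x g)) = cscale (tf_phase p x * tf_phase l (p + x)) (tf_shift (l + (p + x)) g)"
  by (simp add: tf_shift_tf_shift tf_shift_cscale cscale_cscale)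

lemma nn_integral_count_space_times:
  fixes g :: "'a \<times> 'b \<Rightarrow> ennreal"
  assumes K: "finite K" and L: "countable L"
  shows "(\<integral>\<^sup>+i. g i \<partial>count_space (K \<times> L)) = (\<Sum>k\<in>K. \<integral>\<^sup>+l. g (k, l) \<partial>count_space L)"
proof -
  interpret L: sigma_finite_measure "count_space L"
    using L by (rule sigma_finite_measure_count_space_countable)
  have eq: "count_space K \<Otimes>\<^sub>M count_space L = count_space (K \<times> L)"
    by (rule pair_measure_countable[OF countable_finite[OF K] L])
  have "(\<integral>\<^sup>+i. g i \<partial>count_space (K \<times> L)) = (\<integral>\<^sup>+k. \<integral>\<^sup>+l. g (k, l) \<partial>count_space L \<partial>count_space K)"
    unfolding eq[symmetric] by (rule L.nn_integral_fst[symmetric]) (simp add: eq)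
  then show ?thesis
    by (simp add: nn_integral_count_space_finite K)
qed

lemma has_sum_times_finite:
  fixes f :: "'a \<times> 'b \<Rightarrow> 'c::topological_comm_monoid_add"
  assumes "finite K" "\<And>k. k \<in> K \<Longrightarrow> ((\<lambda>l. f (k, l)) has_sum g k) L"
  shows "(f has_sum (\<Sum>k\<in>K. g k)) (K \<times> L)"
  using assms
proof (induction K rule: finite_induct)
  case (insert k K)
  have "(f has_sum g k) (Pair k ` L)"
    using insert by (subst has_sum_reindex) (auto simp: inj_on_def o_def)
  then have "(f has_sum g k + (\<Sum>k\<in>K. g k)) (Pair k ` L \<union> K \<times> L)"
    using insert by (intro has_sum_Un_disjoint) auto
  moreover have "Pair k ` L \<union> K \<times> L = insert k K \<times> L"
    by auto
  ultimately show ?case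
    using insert by simp
qed simp

lemma ennreal_norm_has_sum_le:
  fixes f :: "'i \<Rightarrow> 'b::banach"
  assumes "(f has_sum s) I"
  shows "ennreal (norm s) \<le> (\<integral>\<^sup>+i. ennreal (norm (f i)) \<partial>count_space I)"
proof (cases "(\<integral>\<^sup>+i. ennreal (norm (f i)) \<partial>count_space I) < \<infinity>")
  case True
  then have "(\<lambda>i. norm (f i)) summable_on I"
    by (rule summable_on_nn_sum) simp
  then show ?thesis
    using norm_infsum_bound[of f I] nn_sum_eq_infsum[of "\<lambda>i. norm (f i)" I] infsumI[OF assms] by (simp add: ennreal_leI)
qed (simp add: not_less top_unique)

context gabor_weight
begin

text \<open>The mixed frame operator with analysis window g and synthesis window h. In module terms
  it is \<open>lattice_inner \<Lambda> f g\<close> applied to h.\<close>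

definition gabor_op :: "'d L2 \<Rightarrow> 'd L2 \<Rightarrow> 'd L2 \<Rightarrow> 'd L2" where
  "gabor_op g h f = infsum (\<lambda>l. cscale (cinner f (tf_shift l g)) (tf_shift l h)) \<Lambda>"

lemma gabor_term_N:
  assumes h: "h \<in> M1 w"
  shows "N (cscale (cinner f (tf_shift l g)) (tf_shift l h)) \<le> (cmod (cinner f (tf_shift l g)) * w l) * N h"
  using mult_left_mono[OF N_tf_shift[OF h, of l], of "cmod (cinner f (tf_shift l g))"] by (simp add: N_cscale mult.assoc)

lemma gabor_term_summable:
  assumes f: "f \<in> M1 w" and g: "g \<in> M1 w" and h: "h \<in> M1 w"
  shows "(\<lambda>l. N (cscale (cinner f (tf_shift l g)) (tf_shift l h))) summable_on \<Lambda>"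
proof -
  have "(\<lambda>l. cmod (cinner f (tf_shift l g)) * w l) summable_on \<Lambda>"
    using sampling_bound f g by blast
  then have "(\<lambda>l. (cmod (cinner f (tf_shift l g)) * w l) * N h) summable_on \<Lambda>"
    by (rule summable_on_cmult_left)
  then show ?thesis
    by (rule summable_on_comparison_test) (simp_all add: gabor_term_N[OF h])
qed

lemma gabor_term_M1: "h \<in> M1 w \<Longrightarrow> cscale (cinner f (tf_shift l g)) (tf_shift l h) \<in> M1 w"
  by (intro M1_cscale M1_tf_shift)

lemma gabor_op_has_sum:
  assumes "f \<in> M1 w" "g \<in> M1 w" "h \<in> M1 w"
  shows "((\<lambda>l. cscale (cinner f (tf_shift l g)) (tf_shift l h)) has_sum gabor_op g h f) \<Lambda>"
  unfolding gabor_op_def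
  by (intro has_sum_infsum M1_infsum(1) countable_lattice gabor_term_M1 gabor_term_summable assms)

lemma gabor_op_M1:
  assumes "f \<in> M1 w" "g \<in> M1 w" "h \<in> M1 w"
  shows "gabor_op g h f \<in> M1 w"
  unfolding gabor_op_def
  by (intro M1_infsum(2) countable_lattice gabor_term_M1 gabor_term_summable assms)

lemma gabor_op_N:
  assumes g: "g \<in> M1 w" and h: "h \<in> M1 w"
  shows "\<exists>C\<ge>0. \<forall>f\<in>M1 w. N (gabor_op g h f) \<le> C * N f"
proof -
  obtain C where C: "0 < C" "\<And>f g. f \<in> M1 w \<Longrightarrow> g \<in> M1 w \<Longrightarrow> (\<lambda>l. cmod (cinner f (tf_shift l g)) * w l) summable_on \<Lambda>"
    "\<And>f g. f \<in> M1 w \<Longrightarrow> g \<in> M1 w \<Longrightarrow> infsum (\<lambda>l. cmod (cinner f (tf_shift l g)) * w l) \<Lambda> \<le> C * N f * N g"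
    using sampling_bound by blast
  have "N (gabor_op g h f) \<le> (C * N g * N h) * N f" if f: "f \<in> M1 w" for f
  proof -
    have "N (gabor_op g h f) \<le> infsum (\<lambda>l. N (cscale (cinner f (tf_shift l g)) (tf_shift l h))) \<Lambda>"
      unfolding gabor_op_def
      by (intro M1_infsum(3) countable_lattice gabor_term_M1 gabor_term_summable f g h)
    also have "\<dots> \<le> infsum (\<lambda>l. (cmod (cinner f (tf_shift l g)) * w l) * N h) \<Lambda>"
      by (intro infsum_mono gabor_term_summable f g h gabor_term_N summable_on_cmult_left C(2))
    also have "\<dots> = infsum (\<lambda>l. cmod (cinner f (tf_shift l g)) * w l) \<Lambda> * N h"
      by (rule infsum_cmult_left') 
    also have "\<dots> \<le> (C * N f * N g) * N h"
      by (intro mult_right_mono C(3) f g) simp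
    finally show ?thesis
      by (simp add: mult_ac)
  qed
  then show ?thesis
    using C(1) by (intro exI[of _ "C * N g * N h"]) simp
qed

lemma cinner_gabor_op:
  assumes f: "f \<in> M1 w" and g: "g \<in> M1 w" and h: "h \<in> M1 w" and u: "u \<in> M1 w"
  shows "cinner (gabor_op g h f) u = cinner f (gabor_op h g u)"
proof -
  have "((\<lambda>l. cinner (cscale (cinner f (tf_shift l g)) (tf_shift l h)) u) has_sum cinner (gabor_op g h f) u) \<Lambda>"
    by (rule has_sum_bounded_linear[OF bounded_linear_cinner_left gabor_op_has_sum[OF f g h]])
  moreover have "((\<lambda>l. cinner f (cscale (cinner u (tf_shift l h)) (tf_shift l g))) has_sum cinner f (gabor_op h g u)) \<Lambda>"
    by (rule has_sum_bounded_linear[OF bounded_linear_cinner_right gabor_op_has_sum[OF u h g]])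
  moreover have "cinner (cscale (cinner f (tf_shift l g)) (tf_shift l h)) u = cinner f (cscale (cinner u (tf_shift l h)) (tf_shift l g))" for l
    by (simp add: cinner_cscale_left cinner_cscale_right cinner_commute[of u])
  ultimately show ?thesis
    by (simp add: has_sum_unique)
qed

lemma gabor_op_tf_shift:
  assumes f: "f \<in> M1 w" and g: "g \<in> M1 w" and h: "h \<in> M1 w" and k: "k \<in> \<Lambda>"
  shows "gabor_op g h (tf_shift k f) = tf_shift k (gabor_op g h f)"
proof -
  have "((\<lambda>l. tf_shift k (cscale (cinner f (tf_shift l g)) (tf_shift l h))) has_sum tf_shift k (gabor_op g h f)) \<Lambda>"
    by (rule has_sum_bounded_linear[OF blinfun.bounded_linear_right gabor_op_has_sum[OF f g h]])
  moreover have "tf_shift k (cscale (cinner f (tf_shift l g)) (tf_shift l h))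
      = cscale (cinner (tf_shift k f) (tf_shift (k + l) g)) (tf_shift (k + l) h)" for l
    unfolding rank_one_phase by (simp add: tf_shift_cscale)
  ultimately have "((\<lambda>l. cscale (cinner (tf_shift k f) (tf_shift (k + l) g)) (tf_shift (k + l) h)) has_sum tf_shift k (gabor_op g h f)) \<Lambda>"
    by simp
  then have "((\<lambda>l. cscale (cinner (tf_shift k f) (tf_shift l g)) (tf_shift l h)) has_sum tf_shift k (gabor_op g h f)) \<Lambda>"
    using has_sum_reindex_bij_betw[OF bij_lattice_shift[OF k], of "\<lambda>l. cscale (cinner (tf_shift k f) (tf_shift l g)) (tf_shift l h)"] by simp
  then show ?thesis
    using gabor_op_has_sum[OF M1_tf_shift[OF f] g h] has_sum_unique by blast
qed

lemma M1_op_gabor_op: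
  assumes g: "g \<in> M1 w"
  shows "M1_op (gabor_op g g)"
  unfolding M1_op_def
proof (intro conjI ballI allI)
  fix f assume f: "f \<in> M1 w"
  show "gabor_op g g f \<in> M1 w"
    by (rule gabor_op_M1[OF f g g])
  show "gabor_op g g (tf_shift l f) = tf_shift l (gabor_op g g f)" if "l \<in> \<Lambda>" for l
    by (rule gabor_op_tf_shift[OF f g g that])
  show "gabor_op g g (cscale c f) = cscale c (gabor_op g g f)" for c
  proof -
    have "((\<lambda>l. cscale c (cscale (cinner f (tf_shift l g)) (tf_shift l g))) has_sum cscale c (gabor_op g g f)) \<Lambda>"
      by (rule has_sum_bounded_linear[OF bounded_linear_cscale gabor_op_has_sum[OF f g g]])
    then show ?thesis
      using gabor_op_has_sum[OF M1_cscale[OF f] g g, of c] by (simp add: cscale_cscale cinner_cscale_left has_sum_unique)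
  qed
  fix u assume u: "u \<in> M1 w"
  show "cinner (gabor_op g g f) u = cinner f (gabor_op g g u)"
    by (rule cinner_gabor_op[OF f g g u])
  show "gabor_op g g (f + u) = gabor_op g g f + gabor_op g g u"
  proof -
    have "((\<lambda>l. cscale (cinner f (tf_shift l g)) (tf_shift l g) + cscale (cinner u (tf_shift l g)) (tf_shift l g))
        has_sum gabor_op g g f + gabor_op g g u) \<Lambda>"
      by (intro has_sum_add gabor_op_has_sum f g u)
    then show ?thesis
      using gabor_op_has_sum[OF M1_add[OF f u] g g] by (simp add: cscale_add_left cinner_add_left has_sum_unique)
  qed
next
  show "\<exists>C\<ge>0. \<forall>f\<in>M1 w. N (gabor_op g g f) \<le> C * N f"
    by (rule gabor_op_N[OF g g])
qed

text \<open>Symmetry and commutation with the lattice move P from the analysis window to f. Together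
  with the companion for the synthesis window, replacing both windows by their images under P turns
  the frame operator S into P S P.\<close>

lemma gabor_op_M1_op_left:
  assumes P: "M1_op P" and f: "f \<in> M1 w" and g: "g \<in> M1 w"
  shows "gabor_op (P g) h f = gabor_op g h (P f)"
  unfolding gabor_op_def
  using P f g by (intro infsum_cong) (simp add: M1_opD(4)[OF P, symmetric] M1_opD(5)[OF P] M1_tf_shift)

lemma gabor_op_M1_op_right:
  assumes P: "M1_op P" and f: "f \<in> M1 w" and g: "g \<in> M1 w" and h: "h \<in> M1 w"
  shows "gabor_op g (P h) f = P (gabor_op g h f)"
proof -
  have "((\<lambda>l. P (cscale (cinner f (tf_shift l g)) (tf_shift l h))) has_sum P (gabor_op g h f)) \<Lambda>"
    unfolding gabor_op_def
    by (intro M1_op_has_sum[OF P] countable_lattice gabor_term_M1 gabor_term_summable f g h)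
  moreover have "P (cscale (cinner f (tf_shift l g)) (tf_shift l h)) = cscale (cinner f (tf_shift l g)) (tf_shift l (P h))" if "l \<in> \<Lambda>" for l
    by (simp add: M1_opD(3,4)[OF P] M1_tf_shift h that)
  ultimately have "((\<lambda>l. cscale (cinner f (tf_shift l g)) (tf_shift l (P h))) has_sum P (gabor_op g h f)) \<Lambda>"
    using has_sum_cong by (metis (no_types, lifting))
  then show ?thesis
    using gabor_op_has_sum[OF f g M1_opD(1)[OF P h]] has_sum_unique by blast
qed

lemma gabor_op_scaleR: "gabor_op (r *\<^sub>R g) (r *\<^sub>R g) f = r\<^sup>2 *\<^sub>R gabor_op g g f"
proof -
  have "cscale (cinner f (tf_shift l (r *\<^sub>R g))) (tf_shift l (r *\<^sub>R g)) = r\<^sup>2 *\<^sub>R cscale (cinner f (tf_shift l g)) (tf_shift l g)" for l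
    by (simp add: tf_shift_cscale cinner_cscale_right cscale_cscale power2_eq_square mult_ac flip: cscale_of_real)
  then show ?thesis
    unfolding gabor_op_def by (simp add: infsum_scaleR_right)
qed

end

lemma cinner_sum_left: "cinner (sum f F) h = (\<Sum>k\<in>F. cinner (f k) h)"
  by (induction F rule: infinite_finite_induct) (simp_all add: cinner_add_left)

lemma has_sum_diff:
  fixes f g :: "'i \<Rightarrow> 'b::real_normed_vector"
  assumes "(f has_sum a) I" "(g has_sum b) I"
  shows "((\<lambda>i. f i - g i) has_sum a - b) I"
  using has_sum_add[OF assms(1) has_sum_bounded_linear[OF bounded_linear_minus[OF bounded_linear_ident] assms(2)]] by simp

lemma image_plus_eq_vimage: "(+) l ` X = (\<lambda>z. z - l) -` (X :: 'a::ab_group_add set)"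
proof (rule equalityI; rule subsetI)
  fix z assume "z \<in> (\<lambda>z. z - l) -` X"
  then show "z \<in> (+) l ` X"
    by (intro image_eqI[of _ _ "z - l"]) simp_all
qed auto

context gabor_weight
begin

lemma M1_norm_tf_shift2:
  assumes f: "f \<in> M1 w" and W: "w p \<le> W"
  shows "M1_norm w (tf_shift l (tf_shift p f)) \<le> ennreal (w l * (W * N f))"
proof -
  have "N (tf_shift p f) \<le> W * N f"
    by (rule order_trans[OF N_tf_shift[OF f] mult_right_mono[OF W]]) simp
  then have "w l * N (tf_shift p f) \<le> w l * (W * N f)"
    by (intro mult_left_mono w_nonneg)
  then show ?thesis
    by (rule order_trans[OF M1_tf_shift_le[OF M1_tf_shift[OF f]] ennreal_leI])
qed

lemma sampling_nn:
  assumes "\<And>f g. f \<in> M1 w \<Longrightarrow> g \<in> M1 w \<Longrightarrow> (\<lambda>l. cmod (cinner f (tf_shift l g)) * w l) summable_on \<Lambda>"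
    "\<And>f g. f \<in> M1 w \<Longrightarrow> g \<in> M1 w \<Longrightarrow> infsum (\<lambda>l. cmod (cinner f (tf_shift l g)) * w l) \<Lambda> \<le> C * N f * N g"
    and "f \<in> M1 w" "g \<in> M1 w"
  shows "(\<integral>\<^sup>+l. ennreal (cmod (cinner f (tf_shift l g)) * w l) \<partial>count_space \<Lambda>) \<le> ennreal (C * N f * N g)"
  using nn_sum_eq_infsum[OF assms(1)[OF assms(3,4)]] assms(2)[OF assms(3,4)] by (simp add: w_nonneg ennreal_leI)

text \<open>The difference of the rank-one integrands at \<open>l + y\<close> and at the sampling point \<open>l + p\<close>, with the phases
  chosen so that only \<open>\<pi>(y - p)\<gamma> - \<gamma>\<close> enters.\<close>

lemma rank_one_difference:
  fixes \<gamma> f h :: "'d L2"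
  defines "F \<equiv> \<lambda>z. cinner f (tf_shift z \<gamma>) * cinner (tf_shift z \<gamma>) h"
    and "A \<equiv> \<lambda>l p x. tf_shift l (tf_shift p (tf_shift x \<gamma>))"
  shows "cmod (F (l + y) - F (l + p)) \<le>
    cmod (cinner f (tf_shift l (tf_shift p (tf_shift (y - p) \<gamma> - \<gamma>)))) * cmod (cinner (A l p (y - p)) h)
    + cmod (cinner f (tf_shift l (tf_shift p \<gamma>))) * cmod (cinner (tf_shift l (tf_shift p (tf_shift (y - p) \<gamma> - \<gamma>))) h)"
proof -
  have inv: "cinner f (cscale c b) * cinner (cscale c b) h = cinner f b * cinner b h" if "cmod c = 1" for c b
  proof -
    have "cnj c * c = 1"
      using that by (simp add: mult.commute[of "cnj c"] complex_norm_square[symmetric])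
    then show ?thesis
      by (simp add: cinner_cscale_left cinner_cscale_right mult_ac)
  qed
  have FA: "F (l + (p + x)) = cinner f (A l p x) * cinner (A l p x) h" for x
    unfolding A_def tf_shift3 F_def by (rule inv[symmetric]) (simp add: norm_mult)
  have 1: "F (l + y) = cinner f (A l p (y - p)) * cinner (A l p (y - p)) h"
    using FA[of "y - p"] by simp
  have 2: "F (l + p) = cinner f (A l p 0) * cinner (A l p 0) h"
    using FA[of 0] by simp
  have \<Delta>: "tf_shift l (tf_shift p (tf_shift (y - p) \<gamma> - \<gamma>)) = A l p (y - p) - A l p 0"
    by (simp add: A_def blinfun.diff_right)
  have "F (l + y) - F (l + p) = cinner f (A l p (y - p) - A l p 0) * cinner (A l p (y - p)) h
      + cinner f (A l p 0) * cinner (A l p (y - p) - A l p 0) h"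
    unfolding 1 2 by (simp add: cinner_diff_left cinner_diff_right algebra_simps)
  then have "cmod (F (l + y) - F (l + p)) \<le> cmod (cinner f (A l p (y - p) - A l p 0) * cinner (A l p (y - p)) h)
      + cmod (cinner f (A l p 0) * cinner (A l p (y - p) - A l p 0) h)"
    by (simp only: norm_triangle_ineq)
  moreover have "A l p 0 = tf_shift l (tf_shift p \<gamma>)"
    by (simp add: A_def)
  ultimately show ?thesis
    unfolding \<Delta> by (simp add: norm_mult)
qed

text \<open>The error is first estimated in each pairing of \<open>f - S f\<close> with a vector h,
  cell by cell. Letting h run through the shifted Gaussians and integrating against w turns this
  into an estimate of \<open>N\<close>. Every error term contains \<pi>(y - p k) \<gamma> -
  \<gamma>, whose norm is below \<eta> once the cells are small; the cell size does not depend on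
  f.\<close>

lemma gabor_riemann_sum:
  assumes \<gamma>: "\<gamma> \<in> M1 w" and \<gamma>0: "\<gamma> \<noteq> 0"
  obtains n :: nat and p a where "\<And>k. k < n \<Longrightarrow> 0 \<le> a k"
    "\<And>f. f \<in> M1 w \<Longrightarrow> N (f - (\<Sum>k<n. a k *\<^sub>R gabor_op (tf_shift (p k) \<gamma>) (tf_shift (p k) \<gamma>) f)) \<le> N f / 2"
proof -
  obtain C where C: "0 < C" "\<And>f g. f \<in> M1 w \<Longrightarrow> g \<in> M1 w \<Longrightarrow> (\<lambda>l. cmod (cinner f (tf_shift l g)) * w l) summable_on \<Lambda>"
    "\<And>f g. f \<in> M1 w \<Longrightarrow> g \<in> M1 w \<Longrightarrow> infsum (\<lambda>l. cmod (cinner f (tf_shift l g)) * w l) \<Lambda> \<le> C * N f * N g"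
    using sampling_bound by blast
  obtain W where W: "1 \<le> W" "\<And>z. norm z \<le> cov \<Longrightarrow> w z \<le> W"
    using weight_bounded_on_ball[OF weight] by metis
  define \<beta> where "\<beta> = measure lborel (ball (0 :: 'd phase) (cov + sep))"
  define E where "E = (norm \<gamma>)\<^sup>2"
  have E: "0 < E"
    using \<gamma>0 by (simp add: E_def)
  \<comment> \<open>All constants of the final estimate: \<open>C\<close> from sampling, one
    \<open>W\<close> for each of the two shifts by \<open>p k\<close>, the sum of N \<gamma> + 1 and
    N \<gamma> from the two terms of \<open>rank_one_difference\<close>, and a bound
    \<open>\<beta>\<close> for the total volume of the cells.\<close>
  define M where "M = C * W * W * (2 * N \<gamma> + 1) * \<beta>"
  have M: "0 \<le> M"
    using C(1) W(1) by (simp add: M_def \<beta>_def)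
  \<comment> \<open>The second bound makes M \<eta> \<le> E/2, with M + 1 in place of M to keep the
    denominator positive. The bound 1 gives N (\<pi>(y - p k) \<gamma>) \<le> N \<gamma> +
    1.\<close>
  define \<eta> where "\<eta> = min 1 (E / (2 * (M + 1)))"
  have \<eta>: "0 < \<eta>" "\<eta> \<le> 1"
    using E M by (auto simp: \<eta>_def)
  have M\<eta>: "M * \<eta> \<le> E / 2"
  proof -
    have "M * \<eta> \<le> (M + 1) * (E / (2 * (M + 1)))"
      using M E by (intro mult_mono) (auto simp: \<eta>_def)
    also have "\<dots> = E / 2"
      using M by (simp add: field_simps)
    finally show ?thesis .
  qed
  obtain d where d: "0 < d" "\<And>u. norm u < d \<Longrightarrow> N (tf_shift u \<gamma> - \<gamma>) < \<eta>"
    using N_tf_shift_small[OF \<gamma> \<eta>(1)] by blast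
  obtain n :: nat and Q p where Q: "\<And>k. k < n \<Longrightarrow> Q k \<in> sets borel" "\<And>k. k < n \<Longrightarrow> Q k \<subseteq> ball (p k) d"
    "\<And>k. k < n \<Longrightarrow> norm (p k) \<le> cov" "\<And>k. k < n \<Longrightarrow> Q k \<subseteq> ball 0 (cov + sep)"
    "disjoint_family_on Q {..<n}" "(\<Union>(k, l)\<in>{..<n} \<times> \<Lambda>. (+) l ` Q k) = UNIV"
    "disjoint_family_on (\<lambda>(k, l). (+) l ` Q k) ({..<n} \<times> \<Lambda>)"
    by (rule fine_partition[OF d(1)]) (rule that)
  define I where "I = {..<n} \<times> \<Lambda>"
  have I: "countable I"
    unfolding I_def by (intro countable_SIGMA countable_lattice) simp_all
  have Qfin: "emeasure lborel (Q k) = ennreal (measure lborel (Q k))" if "k < n" for k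
  proof -
    have "emeasure lborel (Q k) \<le> emeasure lborel (ball (0 :: 'd phase) (cov + sep))"
      by (intro emeasure_mono Q(4) that) simp
    also have "\<dots> < \<infinity>"
      by (rule emeasure_lborel_ball_finite)
    finally show ?thesis
      by (simp add: emeasure_eq_ennreal_measure less_top)
  qed
  have Qsum: "(\<Sum>k<n. emeasure lborel (Q k)) \<le> ennreal \<beta>"
  proof -
    have "(\<Sum>k<n. emeasure lborel (Q k)) = emeasure lborel (\<Union>k<n. Q k)"
      using Q(1,5) by (intro sum_emeasure) auto
    also have "\<dots> \<le> emeasure lborel (ball (0 :: 'd phase) (cov + sep))"
      using Q(4) by (intro emeasure_mono) auto
    also have "\<dots> = ennreal \<beta>"
      using emeasure_lborel_ball_finite[of "0 :: 'd phase" "cov + sep"]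
      by (simp add: \<beta>_def emeasure_eq_ennreal_measure less_top)
    finally show ?thesis .
  qed
  \<comment> \<open>The quadrature weight is the volume of the cell; division by \<open>E\<close>
    normalizes Moyal's formula for a window of arbitrary norm.\<close>
  define a where "a k = measure lborel (Q k) / E" for k
  define S where "S f = (\<Sum>k<n. a k *\<^sub>R gabor_op (tf_shift (p k) \<gamma>) (tf_shift (p k) \<gamma>) f)" for f
  have \<gamma>p: "tf_shift (p k) \<gamma> \<in> M1 w" for k
    by (rule M1_tf_shift[OF \<gamma>])
  have "N (f - S f) \<le> N f / 2" if f: "f \<in> M1 w" for f
  proof -
    have samp: "(\<integral>\<^sup>+l. ennreal (cmod (cinner f (tf_shift l g)) * w l) \<partial>count_space \<Lambda>) \<le> ennreal (C * N f * N g)"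
      if "g \<in> M1 w" for g
      by (rule sampling_nn[OF _ _ f that]) (fact C(2) C(3))+
    define \<Delta> where "\<Delta> k y = tf_shift (y - p k) \<gamma> - \<gamma>" for k y
    define A where "A k l y = tf_shift l (tf_shift (p k) (tf_shift (y - p k) \<gamma>))" for k l y
    define D where "D k l y = tf_shift l (tf_shift (p k) (\<Delta> k y))" for k l y
    define B where "B k l = tf_shift l (tf_shift (p k) \<gamma>)" for k l
    have diff: "of_real E * cinner (f - S f) h = of_real E * cinner f h - of_real E * cinner (S f) h" for h
      by (simp add: cinner_diff_left right_diff_distrib)
    have pointwise: "ennreal (E * cmod (cinner (f - S f) h)) \<le>
        (\<integral>\<^sup>+i. (case i of (k, l) \<Rightarrow> \<integral>\<^sup>+y. indicator (Q k) y *
          (ennreal (cmod (cinner f (D k l y))) * ennreal (cmod (cinner (A k l y) h))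
           + ennreal (cmod (cinner f (B k l))) * ennreal (cmod (cinner (D k l y) h))) \<partial>lborel) \<partial>count_space I)" for h
    proof -
      define F where "F z = cinner f (tf_shift z \<gamma>) * cinner (tf_shift z \<gamma>) h" for z
      have iF: "integrable lborel F" and F: "(\<integral>z. F z \<partial>lborel) = of_real E * cinner f h"
        using has_bochner_integral_moyal[of f \<gamma> h] unfolding F_def E_def has_bochner_integral_iff by simp_all
      note [measurable] = borel_measurable_integrable[OF iF, simplified]
      \<comment> \<open>\<open>G\<close> and \<open>G'\<close> are the contributions of one cell to
        the integral of \<open>F\<close> and to its Riemann sum, so that the error becomes the sum
        of their differences.\<close>
      define G where "G = (\<lambda>(k, l). \<integral>y. indicator (Q k) y *\<^sub>R F (l + y) \<partial>lborel)"
      define G' where "G' = (\<lambda>(k, l). of_real (measure lborel (Q k)) * F (l + p k))"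
      have "((\<lambda>i. \<integral>z. indicator ((\<lambda>(k, l). (+) l ` Q k) i) z *\<^sub>R F z \<partial>lborel) has_sum (\<integral>z. F z \<partial>lborel)) I"
      proof (rule has_sum_integral_partition[OF I _ _ _ iF])
        show "(\<lambda>(k, l). (+) l ` Q k) i \<in> sets lborel" if "i \<in> I" for i
        proof -
          obtain k l where "i = (k, l)" "k < n"
            using \<open>i \<in> I\<close> by (auto simp: I_def)
          moreover have "(\<lambda>z. z - l) -` Q k \<inter> space borel \<in> sets borel" if "k < n" for k
            by (rule measurable_sets[OF _ Q(1)[OF that]]) measurable
          ultimately show ?thesis by (simp add: image_plus_eq_vimage)
        qed
      qed (use Q(6,7) in \<open>simp_all add: I_def\<close>)
      moreover have "(\<integral>z. indicator ((\<lambda>(k, l). (+) l ` Q k) i) z *\<^sub>R F z \<partial>lborel) = G i" if "i \<in> I" for i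
      proof -
        obtain k l where i: "i = (k, l)" "k < n"
          using \<open>i \<in> I\<close> by (auto simp: I_def)
        have [measurable]: "Q k \<in> sets borel"
          by (rule Q(1)[OF i(2)])
        have ind: "indicator ((+) l ` Q k) z = (indicator (Q k) (z - l) :: real)" for z
          by (simp add: image_plus_eq_vimage indicator_def)
        have "(\<integral>z. indicator (Q k) (z - l) *\<^sub>R F z \<partial>lborel) = (\<integral>y. indicator (Q k) (l + y - l) *\<^sub>R F (l + y) \<partial>lborel)"
          by (rule lborel_integral_shift) measurable
        then show ?thesis
          by (simp add: i ind G_def)
      qed
      ultimately have hG: "(G has_sum of_real E * cinner f h) I"
        unfolding F using has_sum_cong by (metis (no_types, lifting))
      have hG': "(G' has_sum of_real E * cinner (S f) h) I"
      proof -
        have "((\<lambda>l. G' (k, l)) has_sum of_real (measure lborel (Q k)) * cinner (gabor_op (tf_shift (p k) \<gamma>) (tf_shift (p k) \<gamma>) f) h) \<Lambda>" for k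
        proof -
          have "((\<lambda>l. cinner (cscale (cinner f (tf_shift l (tf_shift (p k) \<gamma>))) (tf_shift l (tf_shift (p k) \<gamma>))) h)
              has_sum cinner (gabor_op (tf_shift (p k) \<gamma>) (tf_shift (p k) \<gamma>) f) h) \<Lambda>"
            by (rule has_sum_bounded_linear[OF bounded_linear_cinner_left gabor_op_has_sum[OF f \<gamma>p \<gamma>p]])
          then have "((\<lambda>l. of_real (measure lborel (Q k)) * cinner (cscale (cinner f (tf_shift l (tf_shift (p k) \<gamma>))) (tf_shift l (tf_shift (p k) \<gamma>))) h)
              has_sum of_real (measure lborel (Q k)) * cinner (gabor_op (tf_shift (p k) \<gamma>) (tf_shift (p k) \<gamma>) f) h) \<Lambda>"
            by (rule has_sum_cmult_right)
          moreover have "of_real (measure lborel (Q k)) * cinner (cscale (cinner f (tf_shift l (tf_shift (p k) \<gamma>))) (tf_shift l (tf_shift (p k) \<gamma>))) h = G' (k, l)" for l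
            unfolding rank_one_phase[symmetric] by (simp add: G'_def F_def cinner_cscale_left)
          ultimately show ?thesis by simp
        qed
        then have "(G' has_sum (\<Sum>k<n. of_real (measure lborel (Q k)) * cinner (gabor_op (tf_shift (p k) \<gamma>) (tf_shift (p k) \<gamma>) f) h)) I"
          unfolding I_def by (intro has_sum_times_finite) simp_all
        moreover have "(\<Sum>k<n. of_real (measure lborel (Q k)) * cinner (gabor_op (tf_shift (p k) \<gamma>) (tf_shift (p k) \<gamma>) f) h) = of_real E * cinner (S f) h"
          using E by (simp add: S_def a_def cinner_sum_left sum_distrib_left cinner_cscale_left flip: cscale_of_real)
        ultimately show ?thesis by simp
      qed
      have "((\<lambda>i. G i - G' i) has_sum of_real E * cinner (f - S f) h) I"
        unfolding diff by (rule has_sum_diff[OF hG hG'])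
      then have "ennreal (cmod (of_real E * cinner (f - S f) h)) \<le> (\<integral>\<^sup>+i. ennreal (cmod (G i - G' i)) \<partial>count_space I)"
        by (rule ennreal_norm_has_sum_le)
      also have "\<dots> \<le> (\<integral>\<^sup>+i. (case i of (k, l) \<Rightarrow> \<integral>\<^sup>+y. indicator (Q k) y *
          (ennreal (cmod (cinner f (D k l y))) * ennreal (cmod (cinner (A k l y) h))
           + ennreal (cmod (cinner f (B k l))) * ennreal (cmod (cinner (D k l y) h))) \<partial>lborel) \<partial>count_space I)"
      proof (rule nn_integral_mono)
        fix i assume "i \<in> space (count_space I)"
        then obtain k l where i: "i = (k, l)" "k < n"
          by (auto simp: I_def)
        have [measurable]: "Q k \<in> sets borel"
          by (rule Q(1)[OF i(2)])
        have i1: "integrable lborel (\<lambda>y. indicator (Q k) y *\<^sub>R F (l + y))"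
        proof -
          have "integrable (distr lborel borel ((+) l)) F"
            using iF by (simp add: lborel_distr_plus)
          then have "integrable lborel (\<lambda>y. F (l + y))"
            by (subst (asm) integrable_distr_eq) simp_all
          then show ?thesis
            by (intro integrable_mult_indicator) simp_all
        qed
        have i2: "integrable lborel (\<lambda>y. indicator (Q k) y *\<^sub>R F (l + p k))"
          using Qfin[OF i(2)] by (intro integrable_scaleR_left integrable_real_indicator) simp_all
        have "G i - G' i = (\<integral>y. indicator (Q k) y *\<^sub>R F (l + y) \<partial>lborel) - (\<integral>y. indicator (Q k) y *\<^sub>R F (l + p k) \<partial>lborel)"
          using Qfin[OF i(2)] by (simp add: i G_def G'_def scaleR_conv_of_real)
        also have "\<dots> = (\<integral>y. indicator (Q k) y *\<^sub>R F (l + y) - indicator (Q k) y *\<^sub>R F (l + p k) \<partial>lborel)"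
          by (rule Bochner_Integration.integral_diff[OF i1 i2, symmetric])
        finally have "ennreal (cmod (G i - G' i)) \<le> (\<integral>\<^sup>+y. ennreal (norm (indicator (Q k) y *\<^sub>R F (l + y) - indicator (Q k) y *\<^sub>R F (l + p k))) \<partial>lborel)"
          by (simp only: integral_norm_bound_ennreal[OF Bochner_Integration.integrable_diff[OF i1 i2]])
        also have "\<dots> \<le> (\<integral>\<^sup>+y. indicator (Q k) y *
          (ennreal (cmod (cinner f (D k l y))) * ennreal (cmod (cinner (A k l y) h))
           + ennreal (cmod (cinner f (B k l))) * ennreal (cmod (cinner (D k l y) h))) \<partial>lborel)"
        proof (rule nn_integral_mono)
          fix y
          have "cmod (F (l + y) - F (l + p k)) \<le> cmod (cinner f (D k l y)) * cmod (cinner (A k l y) h) + cmod (cinner f (B k l)) * cmod (cinner (D k l y) h)"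
            using rank_one_difference[of f l y \<gamma> h "p k"] unfolding F_def D_def A_def B_def \<Delta>_def .
          then have "ennreal (cmod (F (l + y) - F (l + p k))) \<le> ennreal (cmod (cinner f (D k l y))) * ennreal (cmod (cinner (A k l y) h))
           + ennreal (cmod (cinner f (B k l))) * ennreal (cmod (cinner (D k l y) h))"
            by (simp add: ennreal_leI flip: ennreal_mult ennreal_plus)
          then show "ennreal (norm (indicator (Q k) y *\<^sub>R F (l + y) - indicator (Q k) y *\<^sub>R F (l + p k))) \<le> indicator (Q k) y *
          (ennreal (cmod (cinner f (D k l y))) * ennreal (cmod (cinner (A k l y) h))
           + ennreal (cmod (cinner f (B k l))) * ennreal (cmod (cinner (D k l y) h)))"
            by (cases "y \<in> Q k") simp_all
        qed
        finally show "ennreal (cmod (G i - G' i)) \<le> (case i of (k, l) \<Rightarrow> \<integral>\<^sup>+y. indicator (Q k) y *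
          (ennreal (cmod (cinner f (D k l y))) * ennreal (cmod (cinner (A k l y) h))
           + ennreal (cmod (cinner f (B k l))) * ennreal (cmod (cinner (D k l y) h))) \<partial>lborel)"
          by (simp add: i)
      qed
      finally show ?thesis
        using E by (simp add: norm_mult)
    qed
    have [measurable]: "(\<lambda>(u, y). stft (A k l y) u) \<in> borel_measurable (borel \<Otimes>\<^sub>M borel)" for k l
      unfolding A_def stft_tf_shift by measurable
    have [measurable]: "(\<lambda>(u, y). stft (D k l y) u) \<in> borel_measurable (borel \<Otimes>\<^sub>M borel)" for k l
      unfolding D_def stft_tf_shift unfolding \<Delta>_def stft_def cinner_diff_left by measurable
    have [measurable]: "(\<lambda>y. cinner f (D k l y)) \<in> borel_measurable borel" for k l
      unfolding D_def \<Delta>_def blinfun.diff_right cinner_diff_right tf_shift3 cinner_cscale_right by measurable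
    define J where "J k l y u = ennreal (cmod (cinner f (D k l y))) * ennreal (stft (A k l y) u)
           + ennreal (cmod (cinner f (B k l))) * ennreal (stft (D k l y) u)" for k l y u
    have J_meas [measurable]: "(\<lambda>(u, y). J k l y u) \<in> borel_measurable (borel \<Otimes>\<^sub>M borel)" for k l
      unfolding J_def by measurable
    \<comment> \<open>The pairing bound with h running through the shifted Gaussians. The variable u
      is integrated first; this turns the factors that contain h into norms in M^1 of shifts of the
      window and of its small difference.\<close>
    have "ennreal E * M1_norm w (f - S f) = (\<integral>\<^sup>+u. ennreal (E * cmod (cinner (f - S f) (tf_shift u gaussian))) * ennreal (w u) \<partial>lborel)"
      unfolding M1_norm_eq using E by (subst nn_integral_cmult[symmetric]) (simp_all add: stft_def ennreal_mult mult.assoc)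
    also have "\<dots> \<le> (\<integral>\<^sup>+u. (\<integral>\<^sup>+i. (case i of (k, l) \<Rightarrow> \<integral>\<^sup>+y. indicator (Q k) y * J k l y u \<partial>lborel) \<partial>count_space I) * ennreal (w u) \<partial>lborel)"
      using pointwise unfolding J_def stft_def by (intro nn_integral_mono mult_right_mono) simp_all
    also have "\<dots> = (\<integral>\<^sup>+u. (\<integral>\<^sup>+i. (case i of (k, l) \<Rightarrow> \<integral>\<^sup>+y. indicator (Q k) y * J k l y u \<partial>lborel) * ennreal (w u) \<partial>count_space I) \<partial>lborel)"
      by (simp add: nn_integral_multc)
    also have "\<dots> = (\<integral>\<^sup>+i. (\<integral>\<^sup>+u. (case i of (k, l) \<Rightarrow> \<integral>\<^sup>+y. indicator (Q k) y * J k l y u \<partial>lborel) * ennreal (w u) \<partial>lborel) \<partial>count_space I)"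
    proof (rule nn_integral_count_space_nn_integral[OF I])
      fix i assume "i \<in> I"
      then obtain k l where i: "i = (k, l)" "k < n"
        by (auto simp: I_def)
      have [measurable]: "Q k \<in> sets borel"
        by (rule Q(1)[OF i(2)])
      show "(\<lambda>u. (case i of (k, l) \<Rightarrow> \<integral>\<^sup>+y. indicator (Q k) y * J k l y u \<partial>lborel) * ennreal (w u)) \<in> borel_measurable lborel"
        unfolding i prod.case by measurable
    qed
    also have "\<dots> \<le> (\<integral>\<^sup>+i. (case i of (k, l) \<Rightarrow> \<integral>\<^sup>+y. indicator (Q k) y *
        (ennreal (cmod (cinner f (D k l y)) * w l) * ennreal (W * (N \<gamma> + 1)) + ennreal (cmod (cinner f (B k l)) * w l) * ennreal (W * \<eta>)) \<partial>lborel) \<partial>count_space I)"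
    proof (rule nn_integral_mono)
      fix i assume "i \<in> space (count_space I)"
      then obtain k l where i: "i = (k, l)" "k < n"
        by (auto simp: I_def)
      have [measurable]: "Q k \<in> sets borel"
        by (rule Q(1)[OF i(2)])
      have "(\<integral>\<^sup>+u. (\<integral>\<^sup>+y. indicator (Q k) y * J k l y u \<partial>lborel) * ennreal (w u) \<partial>lborel)
          = (\<integral>\<^sup>+u. (\<integral>\<^sup>+y. indicator (Q k) y * (J k l y u * ennreal (w u)) \<partial>lborel) \<partial>lborel)"
        by (intro nn_integral_cong) (simp add: nn_integral_multc[symmetric] mult.assoc)
      also have "\<dots> = (\<integral>\<^sup>+y. (\<integral>\<^sup>+u. indicator (Q k) y * (J k l y u * ennreal (w u)) \<partial>lborel) \<partial>lborel)"
        by (rule lborel_pair.Fubini') measurable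
      also have "\<dots> \<le> (\<integral>\<^sup>+y. indicator (Q k) y *
        (ennreal (cmod (cinner f (D k l y)) * w l) * ennreal (W * (N \<gamma> + 1)) + ennreal (cmod (cinner f (B k l)) * w l) * ennreal (W * \<eta>)) \<partial>lborel)"
      proof (rule nn_integral_mono)
        fix y
        show "(\<integral>\<^sup>+u. indicator (Q k) y * (J k l y u * ennreal (w u)) \<partial>lborel) \<le> indicator (Q k) y *
        (ennreal (cmod (cinner f (D k l y)) * w l) * ennreal (W * (N \<gamma> + 1)) + ennreal (cmod (cinner f (B k l)) * w l) * ennreal (W * \<eta>))"
        proof (cases "y \<in> Q k")
          case True
          then have "norm (y - p k) < d"
            using Q(2)[OF i(2)] by (auto simp: dist_norm norm_minus_commute)
          then have N\<Delta>: "N (\<Delta> k y) \<le> \<eta>"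
            unfolding \<Delta>_def using d(2) by (simp add: less_imp_le)
          have \<Delta>M: "\<Delta> k y \<in> M1 w" "tf_shift (y - p k) \<gamma> \<in> M1 w"
            unfolding \<Delta>_def by (intro M1_diff M1_tf_shift \<gamma>)+
          have wp: "w (p k) \<le> W"
            by (intro W(2) Q(3) i(2))
          have "N (tf_shift (y - p k) \<gamma>) \<le> N (\<Delta> k y) + N \<gamma>"
            using N_add[OF \<Delta>M(1) \<gamma>] by (simp add: \<Delta>_def)
          also have "\<dots> \<le> N \<gamma> + 1"
            using N\<Delta> \<eta>(2) by simp
          finally have NA: "N (tf_shift (y - p k) \<gamma>) \<le> N \<gamma> + 1" .
          have mA: "M1_norm w (A k l y) \<le> ennreal (w l) * ennreal (W * (N \<gamma> + 1))"
          proof -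
            have "w l * (W * N (tf_shift (y - p k) \<gamma>)) \<le> w l * (W * (N \<gamma> + 1))"
              using W(1) by (intro mult_left_mono NA w_nonneg) simp
            then show ?thesis
              unfolding A_def using M1_norm_tf_shift2[OF \<Delta>M(2) wp, of l] W(1)
              by (simp add: w_nonneg flip: ennreal_mult) (meson ennreal_leI order_trans)
          qed
          have mD: "M1_norm w (D k l y) \<le> ennreal (w l) * ennreal (W * \<eta>)"
          proof -
            have "w l * (W * N (\<Delta> k y)) \<le> w l * (W * \<eta>)"
              using W(1) by (intro mult_left_mono N\<Delta> w_nonneg) simp
            then show ?thesis
              unfolding D_def using M1_norm_tf_shift2[OF \<Delta>M(1) wp, of l] W(1) \<eta>(1)
              by (simp add: w_nonneg flip: ennreal_mult) (meson ennreal_leI order_trans)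
          qed
          have "(\<integral>\<^sup>+u. J k l y u * ennreal (w u) \<partial>lborel)
              = (\<integral>\<^sup>+u. ennreal (cmod (cinner f (D k l y))) * (ennreal (stft (A k l y) u) * ennreal (w u))
                 + ennreal (cmod (cinner f (B k l))) * (ennreal (stft (D k l y) u) * ennreal (w u)) \<partial>lborel)"
            by (intro nn_integral_cong) (simp add: J_def distrib_right mult.assoc)
          also have "\<dots> = ennreal (cmod (cinner f (D k l y))) * M1_norm w (A k l y) + ennreal (cmod (cinner f (B k l))) * M1_norm w (D k l y)"
            unfolding M1_norm_eq by (simp add: nn_integral_add nn_integral_cmult)
          also have "\<dots> \<le> ennreal (cmod (cinner f (D k l y))) * (ennreal (w l) * ennreal (W * (N \<gamma> + 1))) + ennreal (cmod (cinner f (B k l))) * (ennreal (w l) * ennreal (W * \<eta>))"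
            by (intro add_mono mult_left_mono mA mD) simp_all
          also have "\<dots> = ennreal (cmod (cinner f (D k l y)) * w l) * ennreal (W * (N \<gamma> + 1)) + ennreal (cmod (cinner f (B k l)) * w l) * ennreal (W * \<eta>)"
            by (simp add: ennreal_mult w_nonneg mult.assoc)
          finally show ?thesis
            using True by simp
        qed simp
      qed
      finally show "(\<integral>\<^sup>+u. (case i of (k, l) \<Rightarrow> \<integral>\<^sup>+y. indicator (Q k) y * J k l y u \<partial>lborel) * ennreal (w u) \<partial>lborel)
          \<le> (case i of (k, l) \<Rightarrow> \<integral>\<^sup>+y. indicator (Q k) y *
        (ennreal (cmod (cinner f (D k l y)) * w l) * ennreal (W * (N \<gamma> + 1)) + ennreal (cmod (cinner f (B k l)) * w l) * ennreal (W * \<eta>)) \<partial>lborel)"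
        by (simp add: i)
    qed
    also have "\<dots> = (\<Sum>k<n. \<integral>\<^sup>+l. (\<integral>\<^sup>+y. indicator (Q k) y *
        (ennreal (cmod (cinner f (D k l y)) * w l) * ennreal (W * (N \<gamma> + 1)) + ennreal (cmod (cinner f (B k l)) * w l) * ennreal (W * \<eta>)) \<partial>lborel) \<partial>count_space \<Lambda>)"
      unfolding I_def by (subst nn_integral_count_space_times[OF _ countable_lattice]) simp_all
    also have "\<dots> \<le> (\<Sum>k<n. emeasure lborel (Q k) * ennreal (C * N f * (W * \<eta>) * (W * (2 * N \<gamma> + 1))))"
    proof (rule sum_mono)
      fix k assume "k \<in> {..<n}"
      then have k: "k < n" by simp
      have [measurable]: "Q k \<in> sets borel"
        by (rule Q(1)[OF k])
      have wp: "w (p k) \<le> W"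
        by (intro W(2) Q(3) k)
      have "(\<integral>\<^sup>+l. (\<integral>\<^sup>+y. indicator (Q k) y *
        (ennreal (cmod (cinner f (D k l y)) * w l) * ennreal (W * (N \<gamma> + 1)) + ennreal (cmod (cinner f (B k l)) * w l) * ennreal (W * \<eta>)) \<partial>lborel) \<partial>count_space \<Lambda>)
        = (\<integral>\<^sup>+y. (\<integral>\<^sup>+l. indicator (Q k) y *
        (ennreal (cmod (cinner f (D k l y)) * w l) * ennreal (W * (N \<gamma> + 1)) + ennreal (cmod (cinner f (B k l)) * w l) * ennreal (W * \<eta>)) \<partial>count_space \<Lambda>) \<partial>lborel)"
        by (rule nn_integral_count_space_nn_integral[OF countable_lattice, symmetric]) measurable
      \<comment> \<open>For fixed y the sum over l samples f against a single window, so the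
        sampling bound applies; only afterwards is y integrated over the cell.\<close>
      also have "\<dots> \<le> (\<integral>\<^sup>+y. indicator (Q k) y * ennreal (C * N f * (W * \<eta>) * (W * (2 * N \<gamma> + 1))) \<partial>lborel)"
      proof (rule nn_integral_mono)
        fix y
        show "(\<integral>\<^sup>+l. indicator (Q k) y *
        (ennreal (cmod (cinner f (D k l y)) * w l) * ennreal (W * (N \<gamma> + 1)) + ennreal (cmod (cinner f (B k l)) * w l) * ennreal (W * \<eta>)) \<partial>count_space \<Lambda>)
          \<le> indicator (Q k) y * ennreal (C * N f * (W * \<eta>) * (W * (2 * N \<gamma> + 1)))"
        proof (cases "y \<in> Q k")
          case True
          then have "norm (y - p k) < d"
            using Q(2)[OF k] by (auto simp: dist_norm norm_minus_commute)
          then have N\<Delta>: "N (\<Delta> k y) \<le> \<eta>"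
            unfolding \<Delta>_def using d(2) by (simp add: less_imp_le)
          have \<Delta>M: "\<Delta> k y \<in> M1 w"
            unfolding \<Delta>_def by (intro M1_diff M1_tf_shift \<gamma>)
          have s1: "(\<integral>\<^sup>+l. ennreal (cmod (cinner f (D k l y)) * w l) \<partial>count_space \<Lambda>) \<le> ennreal (C * N f * (W * \<eta>))"
          proof -
            have "N (tf_shift (p k) (\<Delta> k y)) \<le> W * \<eta>"
              by (rule order_trans[OF N_tf_shift[OF \<Delta>M] mult_mono[OF wp N\<Delta>]]) (use W(1) in simp_all)
            then have "C * N f * N (tf_shift (p k) (\<Delta> k y)) \<le> C * N f * (W * \<eta>)"
              using C(1) by (intro mult_left_mono) simp_all
            then show ?thesis
              unfolding D_def by (rule order_trans[OF samp[OF M1_tf_shift[OF \<Delta>M]] ennreal_leI])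
          qed
          have s2: "(\<integral>\<^sup>+l. ennreal (cmod (cinner f (B k l)) * w l) \<partial>count_space \<Lambda>) \<le> ennreal (C * N f * (W * N \<gamma>))"
          proof -
            have "N (tf_shift (p k) \<gamma>) \<le> W * N \<gamma>"
              by (rule order_trans[OF N_tf_shift[OF \<gamma>] mult_right_mono[OF wp]]) simp
            then have "C * N f * N (tf_shift (p k) \<gamma>) \<le> C * N f * (W * N \<gamma>)"
              using C(1) by (intro mult_left_mono) simp_all
            then show ?thesis
              unfolding B_def by (rule order_trans[OF samp[OF M1_tf_shift[OF \<gamma>]] ennreal_leI])
          qed
          have "(\<integral>\<^sup>+l. ennreal (cmod (cinner f (D k l y)) * w l) * ennreal (W * (N \<gamma> + 1)) + ennreal (cmod (cinner f (B k l)) * w l) * ennreal (W * \<eta>) \<partial>count_space \<Lambda>)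
            = (\<integral>\<^sup>+l. ennreal (cmod (cinner f (D k l y)) * w l) \<partial>count_space \<Lambda>) * ennreal (W * (N \<gamma> + 1))
            + (\<integral>\<^sup>+l. ennreal (cmod (cinner f (B k l)) * w l) \<partial>count_space \<Lambda>) * ennreal (W * \<eta>)"
            by (simp add: nn_integral_add nn_integral_multc)
          also have "\<dots> \<le> ennreal (C * N f * (W * \<eta>)) * ennreal (W * (N \<gamma> + 1)) + ennreal (C * N f * (W * N \<gamma>)) * ennreal (W * \<eta>)"
            by (intro add_mono mult_right_mono s1 s2) simp_all
          also have "\<dots> = ennreal (C * N f * (W * \<eta>) * (W * (N \<gamma> + 1)) + C * N f * (W * N \<gamma>) * (W * \<eta>))"
            using C(1) W(1) \<eta>(1) by (subst ennreal_plus) (simp_all add: ennreal_mult)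
          also have "C * N f * (W * \<eta>) * (W * (N \<gamma> + 1)) + C * N f * (W * N \<gamma>) * (W * \<eta>) = C * N f * (W * \<eta>) * (W * (2 * N \<gamma> + 1))"
            by (simp add: algebra_simps)
          finally show ?thesis
            using True by simp
        qed simp
      qed
      also have "\<dots> = emeasure lborel (Q k) * ennreal (C * N f * (W * \<eta>) * (W * (2 * N \<gamma> + 1)))"
        by (subst nn_integral_multc) simp_all
      finally show "(\<integral>\<^sup>+l. (\<integral>\<^sup>+y. indicator (Q k) y *
        (ennreal (cmod (cinner f (D k l y)) * w l) * ennreal (W * (N \<gamma> + 1)) + ennreal (cmod (cinner f (B k l)) * w l) * ennreal (W * \<eta>)) \<partial>lborel) \<partial>count_space \<Lambda>)
        \<le> emeasure lborel (Q k) * ennreal (C * N f * (W * \<eta>) * (W * (2 * N \<gamma> + 1)))" .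
    qed
    also have "\<dots> = (\<Sum>k<n. emeasure lborel (Q k)) * ennreal (C * N f * (W * \<eta>) * (W * (2 * N \<gamma> + 1)))"
      by (simp add: sum_distrib_right)
    also have "\<dots> \<le> ennreal \<beta> * ennreal (C * N f * (W * \<eta>) * (W * (2 * N \<gamma> + 1)))"
      by (intro mult_right_mono Qsum) simp
    also have "\<dots> = ennreal (M * \<eta> * N f)"
      by (simp add: M_def \<beta>_def mult_ac flip: ennreal_mult')
    also have "\<dots> \<le> ennreal (E / 2 * N f)"
      by (intro ennreal_leI mult_right_mono M\<eta>) simp
    also have "\<dots> = ennreal E * ennreal (N f / 2)"
      using E by (simp flip: ennreal_mult)
    finally have "ennreal E * M1_norm w (f - S f) \<le> ennreal E * ennreal (N f / 2)" .
    then have "M1_norm w (f - S f) \<le> ennreal (N f / 2)"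
      using E by (simp add: ennreal_mult_le_mult_iff)
    then show ?thesis
      by (rule N_le) simp
  qed
  moreover have "0 \<le> a k" for k
    using E by (simp add: a_def)
  ultimately show ?thesis
    by (intro that[where a = a and p = p and n = n]) (simp_all add: S_def)
qed

text \<open>Both identities come from S P P = 1 with P = (1 - D)^(-1/2) and S = 1 - D. Commuting one
  P past S gives P S P = 1, the tight frame. Putting both factors P on the analysis windows leaves
  the synthesis windows as shifts of the given \<gamma>, which the comparison of norms on modulation
  spaces requires.\<close>

lemma gabor_frames:
  assumes \<gamma>: "\<gamma> \<in> M1 w" and \<gamma>0: "\<gamma> \<noteq> 0"
  obtains n :: nat and p :: "nat \<Rightarrow> 'd phase" and g \<psi> where "\<And>k. g k \<in> M1 w" "\<And>k. \<psi> k \<in> M1 w"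
    "\<And>f. f \<in> M1 w \<Longrightarrow> (\<Sum>k<n. gabor_op (g k) (g k) f) = f"
    "\<And>f. f \<in> M1 w \<Longrightarrow> (\<Sum>k<n. gabor_op (\<psi> k) (tf_shift (p k) \<gamma>) f) = f"
proof -
  obtain n :: nat and p a where a: "\<And>k. k < n \<Longrightarrow> 0 \<le> a k"
    and half: "\<And>f. f \<in> M1 w \<Longrightarrow> N (f - (\<Sum>k<n. a k *\<^sub>R gabor_op (tf_shift (p k) \<gamma>) (tf_shift (p k) \<gamma>) f)) \<le> N f / 2"
    by (rule gabor_riemann_sum[OF \<gamma> \<gamma>0]) (rule that)
  define h where "h k = tf_shift (p k) \<gamma>" for k
  define D where "D f = f - (\<Sum>k<n. a k *\<^sub>R gabor_op (h k) (h k) f)" for f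
  have h: "h k \<in> M1 w" for k
    unfolding h_def by (rule M1_tf_shift[OF \<gamma>])
  have D: "M1_op D"
    unfolding D_def by (intro M1_op_minus M1_op_id M1_op_sum M1_op_scale M1_op_gabor_op h)
  have halfD: "N (D f) \<le> N f / 2" if "f \<in> M1 w" for f
    using half[OF that] by (simp add: D_def h_def)
  define P where "P = inv_sqrt D"
  have P: "M1_op P"
    unfolding P_def by (rule M1_op_inv_sqrt[OF D halfD])
  have comm: "D (P f) = P (D f)" if "f \<in> M1 w" for f
    unfolding P_def by (rule inv_sqrt_commute[OF D halfD D refl that])
  have inv: "(\<Sum>k<n. a k *\<^sub>R gabor_op (h k) (h k) (P (P f))) = f" if "f \<in> M1 w" for f
  proof -
    have "P (P f) - D (P (P f)) = f"
      unfolding P_def by (rule inv_sqrt_inverse[OF D halfD that])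
    then show ?thesis
      by (simp add: D_def[of "P (P f)"])
  qed
  have Pf: "P f \<in> M1 w" if "f \<in> M1 w" for f
    by (rule M1_opD(1)[OF P that])
  show ?thesis
  proof (rule that[of "\<lambda>k. P (sqrt (a k) *\<^sub>R h k)" "\<lambda>k. a k *\<^sub>R P (P (h k))" n p])
    show "P (sqrt (a k) *\<^sub>R h k) \<in> M1 w" "a k *\<^sub>R P (P (h k)) \<in> M1 w" for k
      by (intro Pf M1_scaleR h)+
    fix f assume f: "f \<in> M1 w"
    have "gabor_op (P (sqrt (a k) *\<^sub>R h k)) (P (sqrt (a k) *\<^sub>R h k)) f = P (a k *\<^sub>R gabor_op (h k) (h k) (P f))" if "k < n" for k
      using a[OF that] f h
      by (simp add: gabor_op_M1_op_right[OF P] gabor_op_M1_op_left[OF P] M1_scaleR Pf gabor_op_scaleR gabor_op_M1)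
    then have "(\<Sum>k<n. gabor_op (P (sqrt (a k) *\<^sub>R h k)) (P (sqrt (a k) *\<^sub>R h k)) f) = (\<Sum>k<n. P (a k *\<^sub>R gabor_op (h k) (h k) (P f)))"
      by simp
    also have "\<dots> = P (\<Sum>k<n. a k *\<^sub>R gabor_op (h k) (h k) (P f))"
    proof -
      have "P (\<Sum>k\<in>F. b k) = (\<Sum>k\<in>F. P (b k))" if "\<And>k. b k \<in> M1 w" "finite F" for b :: "nat \<Rightarrow> 'd L2" and F
        using that(2)
      proof (induction F rule: finite_induct)
        case empty
        then show ?case
          using M1_opD(3)[OF P M1_0, of 0] by simp
      next
        case (insert k F)
        then show ?case
          using M1_opD(2)[OF P that(1) M1_sum[of F b, OF that(1)]] by simp
      qed
      from this[of "\<lambda>k. a k *\<^sub>R gabor_op (h k) (h k) (P f)" "{..<n}"] show ?thesis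
        by (simp add: M1_scaleR gabor_op_M1 Pf f h)
    qed
    also have "(\<Sum>k<n. a k *\<^sub>R gabor_op (h k) (h k) (P f)) = P f - D (P f)"
      by (simp add: D_def)
    also have "P (P f - D (P f)) = P (P f) - D (P (P f))"
      by (simp add: M1_op_diff[OF P] Pf f M1_opD(1)[OF D] comm)
    also have "\<dots> = f"
      using inv[OF f] by (simp add: D_def)
    finally show "(\<Sum>k<n. gabor_op (P (sqrt (a k) *\<^sub>R h k)) (P (sqrt (a k) *\<^sub>R h k)) f) = f" .
    have "gabor_op (a k *\<^sub>R P (P (h k))) (tf_shift (p k) \<gamma>) f = a k *\<^sub>R gabor_op (h k) (h k) (P (P f))" for k
    proof -
      have "gabor_op (a k *\<^sub>R P (P (h k))) (h k) f = a k *\<^sub>R gabor_op (P (P (h k))) (h k) f"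
        unfolding gabor_op_def cscale_of_real[symmetric] tf_shift_cscale cinner_cscale_right cscale_cscale[symmetric] complex_cnj_complex_of_real
        unfolding cscale_of_real by (rule infsum_scaleR_right)
      also have "gabor_op (P (P (h k))) (h k) f = gabor_op (h k) (h k) (P (P f))"
        by (simp add: gabor_op_M1_op_left[OF P] Pf f h)
      finally show ?thesis
        by (simp add: h_def)
    qed
    then show "(\<Sum>k<n. gabor_op (a k *\<^sub>R P (P (h k))) (tf_shift (p k) \<gamma>) f) = f"
      using inv[OF f] by simp
  qed
qed

end

section \<open>The module over the twisted group algebra\<close>

lemma cscale_op_add_left: "cscale_op (a + b) T = cscale_op a T + cscale_op b T"
  by (rule blinfun_eqI) (simp add: cscale_op_apply blinfun.add_left cscale_add_left)

lemma cscale_op_cscale_op: "cscale_op a (cscale_op b T) = cscale_op (a * b) T"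
  by (rule blinfun_eqI) (simp add: cscale_op_apply cscale_cscale)

lemma cscale_op_1 [simp]: "cscale_op 1 T = T"
  by (rule blinfun_eqI) (simp add: cscale_op_apply)

lemma cscale_op_0 [simp]: "cscale_op 0 T = 0"
  by (rule blinfun_eqI) (simp add: cscale_op_apply)

lemma cscale_op_uminus: "cscale_op (- a) T = - cscale_op a T"
  using cscale_op_add_left[of a "- a" T] by (simp add: add_eq_0_iff)

lemma norm_cscale_op_le: "norm (cscale_op c T) \<le> cmod c * norm T"
proof (rule norm_blinfun_bound)
  show "norm (cscale_op c T f) \<le> cmod c * norm T * norm f" for f
    using mult_left_mono[OF norm_blinfun[of T f], of "cmod c"] by (simp add: cscale_op_apply norm_cscale mult.assoc)
qed simp

lemma bounded_linear_cscale_op_left: "bounded_linear (\<lambda>c. cscale_op c T)"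
  by (rule bounded_linear_intro[where K = "norm T"])
     (auto simp: cscale_op_add_left blinfun_eqI cscale_op_apply blinfun.scaleR_left cscale_cscale scaleR_conv_of_real
        intro: order_trans[OF norm_cscale_op_le] simp flip: cscale_of_real)

lemma norm_tf_shift_op_le: "norm (tf_shift l) \<le> 1"
  by (rule norm_blinfun_bound) auto

lemma norm_cscale_tf_shift_le: "norm (cscale_op c (tf_shift l)) \<le> cmod c"
  using order_trans[OF norm_cscale_op_le mult_left_mono[OF norm_tf_shift_op_le norm_ge_zero]] by simp

lemma tf_shift_compose_op: "tf_shift l o\<^sub>L tf_shift k = cscale_op (tf_phase l k) (tf_shift (l + k))"
  by (rule blinfun_eqI) (simp add: cscale_op_apply tf_shift_tf_shift)

lemma cscale_op_compose_left: "cscale_op c S o\<^sub>L T = cscale_op c (S o\<^sub>L T)"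
  by (rule blinfun_eqI) (simp add: cscale_op_apply)

lemma tf_shift_compose_cscale_op: "tf_shift l o\<^sub>L cscale_op c T = cscale_op c (tf_shift l o\<^sub>L T)"
  by (rule blinfun_eqI) (simp add: cscale_op_apply tf_shift_cscale)

lemma tf_shift_0_op: "tf_shift 0 = id_blinfun"
  by (rule blinfun_eqI) simp

lemma abelian_group_free_left_module:
  assumes "ring R"
  shows "abelian_group (free_left_module R n)"
proof -
  interpret R: ring R by fact
  show ?thesis
  proof (rule abelian_groupI)
    fix x assume x: "x \<in> carrier (free_left_module R n)"
    show "\<exists>y\<in>carrier (free_left_module R n). y \<oplus>\<^bsub>free_left_module R n\<^esub> x = \<zero>\<^bsub>free_left_module R n\<^esub>"
      by (rule bexI[of _ "\<lambda>i\<in>{..<n}. \<ominus>\<^bsub>R\<^esub> x i"])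
         (use x in \<open>auto simp: free_left_module_def PiE_def Pi_def fun_eq_iff R.l_neg restrict_def extensional_def\<close>)
  qed (auto simp: free_left_module_def PiE_def Pi_def fun_eq_iff R.a_assoc R.a_comm R.a_lcomm restrict_def extensional_def)
qed

context gabor_weight
begin

definition alg :: "('d L2 \<Rightarrow>\<^sub>L 'd L2) set" where
  "alg = carrier (twisted_algebra \<Lambda> w)"

lemma alg_iff: "T \<in> alg \<longleftrightarrow> (\<exists>a. (\<lambda>l. cmod (a l) * w l) summable_on \<Lambda> \<and> ((\<lambda>l. cscale_op (a l) (tf_shift l)) has_sum T) \<Lambda>)"
  by (simp add: alg_def twisted_algebra_def)

lemma algE:
  assumes "T \<in> alg"
  obtains a where "(\<lambda>l. cmod (a l) * w l) summable_on \<Lambda>" "((\<lambda>l. cscale_op (a l) (tf_shift l)) has_sum T) \<Lambda>"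
  using assms unfolding alg_iff by blast

lemma coeff_summable:
  assumes "(\<lambda>l. cmod (a l) * w l) summable_on \<Lambda>"
  shows "(\<lambda>l. cmod (a l)) summable_on \<Lambda>"
  by (rule summable_on_comparison_test[OF assms])
     (use mult_left_mono[OF w_ge1 norm_ge_zero] in \<open>simp_all\<close>)

lemma coeff_op_summable:
  assumes "(\<lambda>l. cmod (a l) * w l) summable_on \<Lambda>"
  shows "(\<lambda>l. cscale_op (a l) (tf_shift l)) summable_on \<Lambda>"
  by (rule abs_summable_summable, rule summable_on_comparison_test[OF coeff_summable[OF assms]])
     (auto simp: norm_cscale_tf_shift_le)

lemma alg_add:
  assumes "S \<in> alg" "T \<in> alg"
  shows "S + T \<in> alg"
proof -
  obtain a where a: "(\<lambda>l. cmod (a l) * w l) summable_on \<Lambda>" "((\<lambda>l. cscale_op (a l) (tf_shift l)) has_sum S) \<Lambda>"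
    using assms(1) by (rule algE)
  obtain b where b: "(\<lambda>l. cmod (b l) * w l) summable_on \<Lambda>" "((\<lambda>l. cscale_op (b l) (tf_shift l)) has_sum T) \<Lambda>"
    using assms(2) by (rule algE)
  have "(\<lambda>l. cmod (a l + b l) * w l) summable_on \<Lambda>"
  proof (rule summable_on_comparison_test[OF summable_on_add[OF a(1) b(1)]])
    show "cmod (a l + b l) * w l \<le> cmod (a l) * w l + cmod (b l) * w l" for l
      using mult_right_mono[OF norm_triangle_ineq[of "a l" "b l"] w_nonneg[of l]] by (simp add: distrib_right)
  qed (simp add: w_nonneg)
  moreover have "((\<lambda>l. cscale_op (a l + b l) (tf_shift l)) has_sum S + T) \<Lambda>"
    unfolding cscale_op_add_left by (rule has_sum_add[OF a(2) b(2)])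
  ultimately show ?thesis
    unfolding alg_iff by (intro exI[of _ "\<lambda>l. a l + b l"] conjI)
qed

lemma alg_0: "0 \<in> alg"
  unfolding alg_iff by (rule exI[of _ "\<lambda>_. 0"]) simp

lemma alg_uminus:
  assumes "T \<in> alg"
  shows "- T \<in> alg"
proof -
  obtain a where a: "(\<lambda>l. cmod (a l) * w l) summable_on \<Lambda>" "((\<lambda>l. cscale_op (a l) (tf_shift l)) has_sum T) \<Lambda>"
    using assms by (rule algE)
  have "((\<lambda>l. cscale_op (- a l) (tf_shift l)) has_sum - T) \<Lambda>"
    unfolding cscale_op_uminus by (rule has_sum_bounded_linear[OF bounded_linear_minus[OF bounded_linear_ident] a(2)])
  then show ?thesis
    unfolding alg_iff using a(1) by (intro exI[of _ "\<lambda>l. - a l"]) simp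
qed

lemma alg_id: "id_blinfun \<in> alg"
proof -
  define a where "a l = (if l = 0 then 1 else 0 :: complex)" for l :: "'d phase"
  have "(\<lambda>l. cmod (a l) * w l) summable_on \<Lambda> \<longleftrightarrow> (\<lambda>l. cmod (a l) * w l) summable_on {0}"
    by (rule summable_on_cong_neutral) (use zero_in in \<open>auto simp: a_def\<close>)
  moreover have "((\<lambda>l. cscale_op (a l) (tf_shift l)) has_sum id_blinfun) \<Lambda> \<longleftrightarrow> ((\<lambda>l. cscale_op (a l) (tf_shift l)) has_sum id_blinfun) {0}"
    by (rule has_sum_cong_neutral) (use zero_in in \<open>auto simp: a_def\<close>)
  moreover have "((\<lambda>l. cscale_op (a l) (tf_shift l)) has_sum id_blinfun) {0}"
    by (rule has_sum_finiteI) (simp_all add: a_def tf_shift_0_op)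
  ultimately show ?thesis
    unfolding alg_iff by (intro exI[of _ a]) simp
qed

text \<open>The coefficients of the product form a twisted convolution. Submultiplicativity of w
  bounds the weighted double family by the product family \<open>q\<close>, whose summability
  justifies summing over pairs of fixed sum first.\<close>

lemma alg_compose:
  assumes "S \<in> alg" "T \<in> alg"
  shows "S o\<^sub>L T \<in> alg"
proof -
  obtain a where a: "(\<lambda>l. cmod (a l) * w l) summable_on \<Lambda>" "((\<lambda>l. cscale_op (a l) (tf_shift l)) has_sum S) \<Lambda>"
    using assms(1) by (rule algE)
  obtain b where b: "(\<lambda>l. cmod (b l) * w l) summable_on \<Lambda>" "((\<lambda>l. cscale_op (b l) (tf_shift l)) has_sum T) \<Lambda>"
    using assms(2) by (rule algE)
  define c where "c = (\<lambda>(l, k). a l * b k * tf_phase l k)"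
  define F where "F = (\<lambda>(l, k). cscale_op (c (l, k)) (tf_shift (l + k)))"
  define q where "q = (\<lambda>(l, k). (cmod (a l) * w l) * (cmod (b k) * w k))"
  have q0: "0 \<le> q p" for p
    unfolding q_def by (rule prod.exhaust[of p], hypsubst) (simp only: prod.case mult_nonneg_nonneg norm_ge_zero w_nonneg)
  have sq: "q summable_on \<Lambda> \<times> \<Lambda>"
  proof (rule summable_on_SigmaI)
    show "((\<lambda>k. q (l, k)) has_sum (cmod (a l) * w l) * infsum (\<lambda>k. cmod (b k) * w k) \<Lambda>) \<Lambda>" for l
      unfolding q_def prod.case by (rule has_sum_cmult_right[OF has_sum_infsum[OF b(1)]])
    show "(\<lambda>l. (cmod (a l) * w l) * infsum (\<lambda>k. cmod (b k) * w k) \<Lambda>) summable_on \<Lambda>"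
      by (rule summable_on_cmult_left[OF a(1)])
  qed (rule q0)
  have cq: "cmod (c p) * w (fst p + snd p) \<le> q p" for p
  proof -
    obtain l k where p: "p = (l, k)" by (rule prod.exhaust)
    have "cmod (a l) * cmod (b k) * w (l + k) \<le> cmod (a l) * cmod (b k) * (w l * w k)"
      by (intro mult_left_mono w_submult) simp
    then show ?thesis
      unfolding p c_def q_def prod.case fst_conv snd_conv norm_mult by (simp add: mult_ac)
  qed
  have cq1: "cmod (c p) \<le> q p" for p
    by (rule order_trans[OF _ cq]) (use mult_left_mono[OF w_ge1 norm_ge_zero] in simp)
  have sF: "F summable_on \<Lambda> \<times> \<Lambda>"
  proof (rule abs_summable_summable, rule summable_on_comparison_test[OF sq])
    show "norm (F p) \<le> q p" for p
      unfolding F_def by (rule prod.exhaust[of p], hypsubst) (simp only: prod.case order_trans[OF norm_cscale_tf_shift_le cq1])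
  qed simp
  have inner: "((\<lambda>k. F (l, k)) has_sum (cscale_op (a l) (tf_shift l) o\<^sub>L T)) \<Lambda>" for l
  proof -
    have "((\<lambda>k. cscale_op (a l) (tf_shift l) o\<^sub>L cscale_op (b k) (tf_shift k)) has_sum (cscale_op (a l) (tf_shift l) o\<^sub>L T)) \<Lambda>"
      by (rule has_sum_bounded_linear[OF bounded_bilinear.bounded_linear_right[OF bounded_bilinear_blinfun_compose] b(2)]) 
    moreover have "cscale_op (a l) (tf_shift l) o\<^sub>L cscale_op (b k) (tf_shift k) = F (l, k)" for k
      by (simp add: F_def c_def cscale_op_compose_left tf_shift_compose_cscale_op tf_shift_compose_op cscale_op_cscale_op mult.assoc)
    ultimately show ?thesis by simp
  qed
  have outer: "((\<lambda>l. cscale_op (a l) (tf_shift l) o\<^sub>L T) has_sum (S o\<^sub>L T)) \<Lambda>"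
    by (rule has_sum_bounded_linear[OF bounded_bilinear.bounded_linear_left[OF bounded_bilinear_blinfun_compose] a(2)])
  have tot: "(F has_sum (S o\<^sub>L T)) (\<Lambda> \<times> \<Lambda>)"
    by (rule has_sum_SigmaI[OF inner outer sF])
  \<comment> \<open>Indexes the pairs by their sum m and their first entry l, so that the inner sum
    over l collects the coefficient of \<pi>(m).\<close>
  define \<tau> where "\<tau> p = (snd p, fst p - snd p)" for p :: "'d phase \<times> 'd phase"
  have bij: "bij_betw \<tau> (\<Lambda> \<times> \<Lambda>) (\<Lambda> \<times> \<Lambda>)"
  proof (rule bij_betwI[of _ _ _ "\<lambda>p. (fst p + snd p, fst p)"])
    show "\<tau> \<in> \<Lambda> \<times> \<Lambda> \<rightarrow> \<Lambda> \<times> \<Lambda>"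
      unfolding \<tau>_def by (intro funcsetI SigmaI diff_in) (simp_all add: mem_Times_iff)
    show "(\<lambda>p. (fst p + snd p, fst p)) \<in> \<Lambda> \<times> \<Lambda> \<rightarrow> \<Lambda> \<times> \<Lambda>"
      by (intro funcsetI SigmaI add_in) (simp_all add: mem_Times_iff)
  qed (simp_all add: \<tau>_def)
  have tot': "((\<lambda>p. F (\<tau> p)) has_sum (S o\<^sub>L T)) (\<Lambda> \<times> \<Lambda>)"
    unfolding has_sum_reindex_bij_betw[OF bij] by (rule tot)
  have "(\<lambda>p. q (\<tau> p)) summable_on \<Lambda> \<times> \<Lambda>"
    unfolding summable_on_reindex_bij_betw[OF bij] by (rule sq)
  then have sq': "(\<lambda>(m, l). q (l, m - l)) summable_on \<Lambda> \<times> \<Lambda>"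
    by (simp add: \<tau>_def case_prod_unfold)
  have sqm: "(\<lambda>l. q (l, m - l)) summable_on \<Lambda>" if "m \<in> \<Lambda>" for m
    using summable_on_SigmaD1[OF sq' that] .
  define d where "d m = infsum (\<lambda>l. c (l, m - l)) \<Lambda>" for m
  have scm: "(\<lambda>l. cmod (c (l, m - l))) summable_on \<Lambda>" if "m \<in> \<Lambda>" for m
    by (rule summable_on_comparison_test[OF sqm[OF that] cq1]) simp
  have hd: "((\<lambda>l. c (l, m - l)) has_sum d m) \<Lambda>" if "m \<in> \<Lambda>" for m
    unfolding d_def by (rule has_sum_infsum[OF abs_summable_summable[OF scm[OF that]]])
  have "((\<lambda>l. F (\<tau> (m, l))) has_sum cscale_op (d m) (tf_shift m)) \<Lambda>" if "m \<in> \<Lambda>" for m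
    using has_sum_bounded_linear[OF bounded_linear_cscale_op_left[of "tf_shift m"] hd[OF that]] by (simp add: F_def \<tau>_def)
  then have sum: "((\<lambda>m. cscale_op (d m) (tf_shift m)) has_sum (S o\<^sub>L T)) \<Lambda>"
    by (rule has_sum_SigmaD[OF tot'])
  have "(\<lambda>m. infsum (\<lambda>l. q (l, m - l)) \<Lambda>) summable_on \<Lambda>"
    using summable_on_SigmaD[OF sq'] sqm by simp
  then have "(\<lambda>m. cmod (d m) * w m) summable_on \<Lambda>"
  proof (rule summable_on_comparison_test)
    show "cmod (d m) * w m \<le> infsum (\<lambda>l. q (l, m - l)) \<Lambda>" if "m \<in> \<Lambda>" for m
    proof -
      have "cmod (d m) * w m \<le> infsum (\<lambda>l. cmod (c (l, m - l))) \<Lambda> * w m"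
        unfolding d_def by (intro mult_right_mono norm_infsum_bound scm that w_nonneg)
      also have "\<dots> = infsum (\<lambda>l. cmod (c (l, m - l)) * w m) \<Lambda>"
        by (rule infsum_cmult_left'[symmetric])
      also have "\<dots> \<le> infsum (\<lambda>l. q (l, m - l)) \<Lambda>"
        by (intro infsum_mono summable_on_cmult_left scm sqm that) (use cq[of "(l, m - l)" for l] in simp)
      finally show ?thesis .
    qed
  qed (simp add: w_nonneg)
  with sum show ?thesis
    unfolding alg_iff by (intro exI[of _ d] conjI)
qed

lemma ring_twisted_algebra: "ring (twisted_algebra \<Lambda> w)"
proof (rule ringI)
  have carrier: "carrier (twisted_algebra \<Lambda> w) = alg"
    by (simp add: alg_def)
  have ops: "mult (twisted_algebra \<Lambda> w) = (o\<^sub>L)" "one (twisted_algebra \<Lambda> w) = id_blinfun"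
    "zero (twisted_algebra \<Lambda> w) = 0" "add (twisted_algebra \<Lambda> w) = (+)"
    by (simp_all add: twisted_algebra_def)
  show "abelian_group (twisted_algebra \<Lambda> w)"
  proof (rule abelian_groupI, unfold carrier ops)
    fix x assume "x \<in> alg"
    then show "\<exists>y\<in>alg. y + x = 0"
      by (intro bexI[of _ "- x"] alg_uminus) simp_all
  qed (simp_all add: alg_add alg_0 add_ac)
  show "monoid (twisted_algebra \<Lambda> w)"
    by (rule monoidI, unfold carrier ops) (auto intro: alg_compose alg_id blinfun_eqI)
  show "(x \<oplus>\<^bsub>twisted_algebra \<Lambda> w\<^esub> y) \<otimes>\<^bsub>twisted_algebra \<Lambda> w\<^esub> z = x \<otimes>\<^bsub>twisted_algebra \<Lambda> w\<^esub> z \<oplus>\<^bsub>twisted_algebra \<Lambda> w\<^esub> y \<otimes>\<^bsub>twisted_algebra \<Lambda> w\<^esub> z"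
    "z \<otimes>\<^bsub>twisted_algebra \<Lambda> w\<^esub> (x \<oplus>\<^bsub>twisted_algebra \<Lambda> w\<^esub> y) = z \<otimes>\<^bsub>twisted_algebra \<Lambda> w\<^esub> x \<oplus>\<^bsub>twisted_algebra \<Lambda> w\<^esub> z \<otimes>\<^bsub>twisted_algebra \<Lambda> w\<^esub> y" for x y z
    unfolding ops by (auto intro!: blinfun_eqI simp: blinfun.add_left blinfun.add_right)
qed

lemma alg_apply:
  assumes a: "(\<lambda>l. cmod (a l) * w l) summable_on \<Lambda>" "((\<lambda>l. cscale_op (a l) (tf_shift l)) has_sum T) \<Lambda>" and f: "f \<in> M1 w"
  shows "(\<lambda>l. N (cscale (a l) (tf_shift l f))) summable_on \<Lambda>" "infsum (\<lambda>l. cscale (a l) (tf_shift l f)) \<Lambda> = T f" "T f \<in> M1 w"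
proof -
  show s: "(\<lambda>l. N (cscale (a l) (tf_shift l f))) summable_on \<Lambda>"
  proof (rule summable_on_comparison_test[OF summable_on_cmult_left[OF a(1), of "N f"]])
    show "N (cscale (a l) (tf_shift l f)) \<le> cmod (a l) * w l * N f" for l
      using mult_left_mono[OF N_tf_shift[OF f, of l], of "cmod (a l)"] by (simp add: N_cscale mult.assoc)
  qed simp
  have "((\<lambda>l. blinfun_apply (cscale_op (a l) (tf_shift l)) f) has_sum T f) \<Lambda>"
    by (rule has_sum_bounded_linear[OF blinfun.bounded_linear_left a(2)])
  then show *: "infsum (\<lambda>l. cscale (a l) (tf_shift l f)) \<Lambda> = T f"
    by (simp add: cscale_op_apply infsumI)
  show "T f \<in> M1 w"
    unfolding *[symmetric] by (intro M1_infsum(2) countable_lattice s M1_cscale M1_tf_shift f)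
qed

lemma alg_M1: "T \<in> alg \<Longrightarrow> f \<in> M1 w \<Longrightarrow> T f \<in> M1 w"
  by (rule algE, assumption) (rule alg_apply(3))

lemma abelian_group_M1: "abelian_group (M1_module w)"
proof (rule abelian_groupI)
  show "\<exists>y\<in>carrier (M1_module w). y \<oplus>\<^bsub>M1_module w\<^esub> x = \<zero>\<^bsub>M1_module w\<^esub>" if "x \<in> carrier (M1_module w)" for x
    using that by (intro bexI[of _ "- x"]) (simp_all add: M1_module_def M1_uminus)
qed (simp_all add: M1_module_def M1_add M1_0 add_ac)

lemma left_module_M1: "left_module (twisted_algebra \<Lambda> w) (M1_module w)"
proof (intro left_module.intro ring_twisted_algebra abelian_group_M1 left_module_axioms.intro)
  have "carrier (twisted_algebra \<Lambda> w) = alg"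
    by (simp add: alg_def)
  then show "a \<odot>\<^bsub>M1_module w\<^esub> x \<in> carrier (M1_module w)" if "a \<in> carrier (twisted_algebra \<Lambda> w)" "x \<in> carrier (M1_module w)" for a x
    using that by (simp add: M1_module_def alg_M1)
qed (simp_all add: M1_module_def twisted_algebra_def blinfun.add_left blinfun.add_right)

lemma lattice_inner_summable:
  assumes "f \<in> M1 w" "g \<in> M1 w"
  shows "(\<lambda>l. cmod (cinner f (tf_shift l g)) * w l) summable_on \<Lambda>"
  using sampling_bound assms by blast

lemma lattice_inner_has_sum:
  assumes "f \<in> M1 w" "g \<in> M1 w"
  shows "((\<lambda>l. cscale_op (cinner f (tf_shift l g)) (tf_shift l)) has_sum lattice_inner \<Lambda> f g) \<Lambda>"
  unfolding lattice_inner_def by (intro has_sum_infsum coeff_op_summable lattice_inner_summable assms)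

lemma lattice_inner_alg: "f \<in> M1 w \<Longrightarrow> g \<in> M1 w \<Longrightarrow> lattice_inner \<Lambda> f g \<in> alg"
  unfolding alg_iff
  by (intro exI[of _ "\<lambda>l. cinner f (tf_shift l g)"] conjI lattice_inner_has_sum lattice_inner_summable)

text \<open>Translates the frame identities, which are proved for \<open>gabor_op\<close>, into
  identities for the algebra-valued inner product.\<close>

lemma lattice_inner_apply:
  assumes "f \<in> M1 w" "g \<in> M1 w"
  shows "lattice_inner \<Lambda> f g h = gabor_op g h f"
proof -
  have "((\<lambda>l. blinfun_apply (cscale_op (cinner f (tf_shift l g)) (tf_shift l)) h) has_sum lattice_inner \<Lambda> f g h) \<Lambda>"
    by (rule has_sum_bounded_linear[OF blinfun.bounded_linear_left lattice_inner_has_sum[OF assms]])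
  then show ?thesis
    by (simp add: cscale_op_apply infsumI gabor_op_def)
qed

lemma lattice_inner_add:
  assumes "f \<in> M1 w" "f' \<in> M1 w" "g \<in> M1 w"
  shows "lattice_inner \<Lambda> (f + f') g = lattice_inner \<Lambda> f g + lattice_inner \<Lambda> f' g"
proof -
  have "((\<lambda>l. cscale_op (cinner (f + f') (tf_shift l g)) (tf_shift l)) has_sum lattice_inner \<Lambda> f g + lattice_inner \<Lambda> f' g) \<Lambda>"
    unfolding cinner_add_left cscale_op_add_left by (intro has_sum_add lattice_inner_has_sum assms)
  then show ?thesis
    using lattice_inner_has_sum[OF M1_add[OF assms(1,2)] assms(3)] has_sum_unique by blast
qed

lemma norm_lattice_inner_le:
  assumes g: "g \<in> M1 w"
  obtains C where "\<And>f. f \<in> M1 w \<Longrightarrow> norm (lattice_inner \<Lambda> f g) \<le> C * N f"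
proof -
  obtain C where C: "0 < C" "\<And>f g. f \<in> M1 w \<Longrightarrow> g \<in> M1 w \<Longrightarrow> (\<lambda>l. cmod (cinner f (tf_shift l g)) * w l) summable_on \<Lambda>"
    "\<And>f g. f \<in> M1 w \<Longrightarrow> g \<in> M1 w \<Longrightarrow> infsum (\<lambda>l. cmod (cinner f (tf_shift l g)) * w l) \<Lambda> \<le> C * N f * N g"
    using sampling_bound by blast
  have "norm (lattice_inner \<Lambda> f g) \<le> (C * N g) * N f" if f: "f \<in> M1 w" for f
  proof -
    have le: "norm (cscale_op (cinner f (tf_shift l g)) (tf_shift l)) \<le> cmod (cinner f (tf_shift l g)) * w l" for l
      by (rule order_trans[OF norm_cscale_tf_shift_le])
         (use mult_left_mono[OF w_ge1[of l] norm_ge_zero, of "cinner f (tf_shift l g)"] in simp)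
    have s: "(\<lambda>l. norm (cscale_op (cinner f (tf_shift l g)) (tf_shift l))) summable_on \<Lambda>"
      by (rule summable_on_comparison_test[OF C(2)[OF f g] le]) simp
    have "norm (lattice_inner \<Lambda> f g) \<le> infsum (\<lambda>l. norm (cscale_op (cinner f (tf_shift l g)) (tf_shift l))) \<Lambda>"
      unfolding lattice_inner_def by (rule norm_infsum_bound[OF s])
    also have "\<dots> \<le> infsum (\<lambda>l. cmod (cinner f (tf_shift l g)) * w l) \<Lambda>"
      by (rule infsum_mono[OF s C(2)[OF f g] le])
    also have "\<dots> \<le> C * N f * N g"
      by (rule C(3)[OF f g])
    finally show ?thesis
      by (simp add: mult_ac)
  qed
  then show ?thesis
    by (rule that)
qed

lemma lattice_inner_cscale_tf_shift:
  assumes f: "f \<in> M1 w" and g: "g \<in> M1 w" and k: "k \<in> \<Lambda>"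
  shows "lattice_inner \<Lambda> (cscale c (tf_shift k f)) g = cscale_op c (tf_shift k) o\<^sub>L lattice_inner \<Lambda> f g"
proof (rule blinfun_eqI)
  fix h
  have "((\<lambda>l. blinfun_apply (cscale_op c (tf_shift k)) (cscale (cinner f (tf_shift l g)) (tf_shift l h)))
      has_sum cscale_op c (tf_shift k) (lattice_inner \<Lambda> f g h)) \<Lambda>"
    using has_sum_bounded_linear[OF blinfun.bounded_linear_left lattice_inner_has_sum[OF f g], of h]
    by (intro has_sum_bounded_linear[OF blinfun.bounded_linear_right]) (simp add: cscale_op_apply)
  moreover have "blinfun_apply (cscale_op c (tf_shift k)) (cscale (cinner f (tf_shift l g)) (tf_shift l h))
      = cscale (cinner (cscale c (tf_shift k f)) (tf_shift (k + l) g)) (tf_shift (k + l) h)" for l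
  proof -
    have "cscale (cinner (cscale c (tf_shift k f)) (tf_shift (k + l) g)) (tf_shift (k + l) h)
        = cscale (cinner (cscale c (tf_shift k f)) (tf_shift k (tf_shift l g))) (tf_shift k (tf_shift l h))"
      by (rule rank_one_phase)
    then show ?thesis
      by (simp add: cscale_op_apply tf_shift_cscale cscale_cscale cinner_cscale_left)
  qed
  ultimately have "((\<lambda>l. cscale (cinner (cscale c (tf_shift k f)) (tf_shift (k + l) g)) (tf_shift (k + l) h))
      has_sum cscale_op c (tf_shift k) (lattice_inner \<Lambda> f g h)) \<Lambda>"
    by simp
  then have "((\<lambda>l. cscale (cinner (cscale c (tf_shift k f)) (tf_shift l g)) (tf_shift l h))
      has_sum cscale_op c (tf_shift k) (lattice_inner \<Lambda> f g h)) \<Lambda>"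
    using has_sum_reindex_bij_betw[OF bij_lattice_shift[OF k], of "\<lambda>l. cscale (cinner (cscale c (tf_shift k f)) (tf_shift l g)) (tf_shift l h)"] by simp
  then show "lattice_inner \<Lambda> (cscale c (tf_shift k f)) g h = (cscale_op c (tf_shift k) o\<^sub>L lattice_inner \<Lambda> f g) h"
    unfolding lattice_inner_apply[OF M1_cscale[OF M1_tf_shift[OF f]] g] gabor_op_def by (simp add: infsumI)
qed

text \<open>Left linearity of the inner product over the algebra. For one term c \<pi>(k) it is a
  shift of the lattice sum. It extends to series because the inner product with a fixed g is bounded
  from M^1 to operators on L^2.\<close>

lemma lattice_inner_alg_apply:
  assumes T: "T \<in> alg" and f: "f \<in> M1 w" and g: "g \<in> M1 w"
  shows "lattice_inner \<Lambda> (T f) g = T o\<^sub>L lattice_inner \<Lambda> f g"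
proof -
  obtain a where a: "(\<lambda>l. cmod (a l) * w l) summable_on \<Lambda>" "((\<lambda>l. cscale_op (a l) (tf_shift l)) has_sum T) \<Lambda>"
    using T by (rule algE)
  obtain C where C: "\<And>f. f \<in> M1 w \<Longrightarrow> norm (lattice_inner \<Lambda> f g) \<le> C * N f"
    using norm_lattice_inner_le[OF g] by blast
  have "((\<lambda>l. lattice_inner \<Lambda> (cscale (a l) (tf_shift l f)) g) has_sum lattice_inner \<Lambda> (infsum (\<lambda>l. cscale (a l) (tf_shift l f)) \<Lambda>) g) \<Lambda>"
    by (rule M1_has_sum_map[OF countable_lattice M1_cscale[OF M1_tf_shift[OF f]] alg_apply(1)[OF a f] lattice_inner_add[OF _ _ g] C])
  then have "((\<lambda>l. lattice_inner \<Lambda> (cscale (a l) (tf_shift l f)) g) has_sum lattice_inner \<Lambda> (T f) g) \<Lambda>"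
    by (simp only: alg_apply(2)[OF a f])
  then have "((\<lambda>l. cscale_op (a l) (tf_shift l) o\<^sub>L lattice_inner \<Lambda> f g) has_sum lattice_inner \<Lambda> (T f) g) \<Lambda>"
    by (rule has_sum_cong[THEN iffD1, rotated]) (rule lattice_inner_cscale_tf_shift[OF f g])
  then show ?thesis
    by (rule has_sum_unique)
       (rule has_sum_bounded_linear[OF bounded_bilinear.bounded_linear_left[OF bounded_bilinear_blinfun_compose] a(2)])
qed

text \<open>A tight module frame splits \<open>M\<^sup>1\<close> off the free module: the analysis map is a section of the synthesis map.\<close>

lemma fg_projective_M1:
  fixes n :: nat and g :: "nat \<Rightarrow> 'd L2"
  assumes g: "\<And>k. g k \<in> M1 w" and frame: "\<And>f. f \<in> M1 w \<Longrightarrow> (\<Sum>k<n. gabor_op (g k) (g k) f) = f"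
  shows "fg_projective_left_module (twisted_algebra \<Lambda> w) (M1_module w)"
proof -
  let ?R = "twisted_algebra \<Lambda> w"
  let ?L = "free_left_module ?R n"
  define h where "h f = (\<lambda>i\<in>{..<n}. lattice_inner \<Lambda> f (g i))" for f
  define s where "s x = (\<Sum>i<n. blinfun_apply (x i) (g i))" for x :: "nat \<Rightarrow> 'd L2 \<Rightarrow>\<^sub>L 'd L2"
  have R: "carrier ?R = alg" "mult ?R = (o\<^sub>L)" "add ?R = (+)" "zero ?R = 0"
    by (simp_all add: alg_def) (simp_all add: twisted_algebra_def)
  have L: "carrier ?L = {..<n} \<rightarrow>\<^sub>E alg" "add ?L = (\<lambda>x y. \<lambda>i\<in>{..<n}. x i + y i)"
    "module.smult ?L = (\<lambda>a x. \<lambda>i\<in>{..<n}. a o\<^sub>L x i)" "zero ?L = (\<lambda>i\<in>{..<n}. 0)"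
    by (simp_all add: free_left_module_def R)
  interpret L: abelian_group ?L
    by (rule abelian_group_free_left_module[OF ring_twisted_algebra])
  have h_in: "h f \<in> {..<n} \<rightarrow>\<^sub>E alg" if "f \<in> M1 w" for f
    using that g by (auto simp: h_def lattice_inner_alg)
  have s_in: "s x \<in> M1 w" if "x \<in> {..<n} \<rightarrow>\<^sub>E alg" for x
    unfolding s_def using that g by (intro M1_sum alg_M1) auto
  have sh: "s (h f) = f" if "f \<in> M1 w" for f
    using frame[OF that] by (simp add: s_def h_def lattice_inner_apply that g)
  have h_add: "h (f + f') = (\<lambda>i\<in>{..<n}. h f i + h f' i)" if "f \<in> M1 w" "f' \<in> M1 w" for f f'
    using that g by (auto simp: h_def lattice_inner_add)
  have h_smult: "h (blinfun_apply T f) = (\<lambda>i\<in>{..<n}. T o\<^sub>L h f i)" if "T \<in> alg" "f \<in> M1 w" for T f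
    using that g by (auto simp: h_def lattice_inner_alg_apply)
  have s_add: "s (\<lambda>i\<in>{..<n}. x i + y i) = s x + s y" for x y
    by (simp add: s_def blinfun.add_left sum.distrib)
  have s_smult: "s (\<lambda>i\<in>{..<n}. T o\<^sub>L x i) = blinfun_apply T (s x)" for T x
    by (simp add: s_def blinfun.sum_right)
  have inv_L: "a_inv ?L x = (\<lambda>i\<in>{..<n}. - x i)" if "x \<in> {..<n} \<rightarrow>\<^sub>E alg" for x
  proof (rule L.minus_equality)
    show "(\<lambda>i\<in>{..<n}. - x i) \<oplus>\<^bsub>?L\<^esub> x = \<zero>\<^bsub>?L\<^esub>"
      by (auto simp: L)
    show "x \<in> carrier ?L" "(\<lambda>i\<in>{..<n}. - x i) \<in> carrier ?L"
      using that by (auto simp: L intro!: alg_uminus)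
  qed
  \<comment> \<open>Closure under negation, which \<open>submodule\<close> demands, is
    multiplication by the scalar \<open>- id_blinfun\<close>.\<close>
  have submod: "submodule H ?R ?L" if H: "H \<subseteq> {..<n} \<rightarrow>\<^sub>E alg" "(\<lambda>i\<in>{..<n}. 0) \<in> H"
      "\<And>x y. x \<in> H \<Longrightarrow> y \<in> H \<Longrightarrow> (\<lambda>i\<in>{..<n}. x i + y i) \<in> H"
      "\<And>T x. T \<in> alg \<Longrightarrow> x \<in> H \<Longrightarrow> (\<lambda>i\<in>{..<n}. T o\<^sub>L x i) \<in> H" for H
  proof (intro submodule.intro subgroup.intro submodule_axioms.intro)
    fix x assume x: "x \<in> H"
    have "(\<lambda>i\<in>{..<n}. (- id_blinfun) o\<^sub>L x i) \<in> H"
      by (rule H(4)[OF alg_uminus[OF alg_id] x])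
    moreover have "(- id_blinfun) o\<^sub>L S = - S" for S :: "'d L2 \<Rightarrow>\<^sub>L 'd L2"
      by (rule blinfun_eqI) (simp add: blinfun.minus_left)
    ultimately have "a_inv ?L x \<in> H"
      using inv_L H(1) x by (simp add: subset_iff)
    then show "inv\<^bsub>add_monoid ?L\<^esub> x \<in> H"
      by (simp add: a_inv_def)
  qed (use H in \<open>simp_all add: L R\<close>)
  define P where "P = h ` M1 w"
  \<comment> \<open>The kernel of synthesis. It complements the range of analysis because synthesis
    after analysis is the identity.\<close>
  define K where "K = {x \<in> {..<n} \<rightarrow>\<^sub>E alg. s x = 0}"
  have P: "submodule P ?R ?L"
  proof (rule submod)
    show "P \<subseteq> {..<n} \<rightarrow>\<^sub>E alg"
      using h_in by (auto simp: P_def)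
    have "h 0 = (\<lambda>i\<in>{..<n}. 0)"
      using h_smult[OF alg_0 M1_0] by (simp add: blinfun_compose_zero)
    then show "(\<lambda>i\<in>{..<n}. 0) \<in> P"
      unfolding P_def by (rule image_eqI[OF sym]) simp
    show "(\<lambda>i\<in>{..<n}. x i + y i) \<in> P" if xy: "x \<in> P" "y \<in> P" for x y
    proof -
      obtain f f' where f: "f \<in> M1 w" "x = h f" "f' \<in> M1 w" "y = h f'"
        using xy unfolding P_def by blast
      show ?thesis
        unfolding f(2,4) h_add[OF f(1,3), symmetric] P_def by (rule imageI[OF M1_add[OF f(1,3)]])
    qed
    show "(\<lambda>i\<in>{..<n}. T o\<^sub>L x i) \<in> P" if Tx: "T \<in> alg" "x \<in> P" for T x
    proof -
      obtain f where f: "f \<in> M1 w" "x = h f"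
        using Tx(2) unfolding P_def by blast
      show ?thesis
        unfolding f(2) h_smult[OF Tx(1) f(1), symmetric] P_def by (rule imageI[OF alg_M1[OF Tx(1) f(1)]])
    qed
  qed
  have K: "submodule K ?R ?L"
  proof (rule submod)
    show "(\<lambda>i\<in>{..<n}. 0) \<in> K"
      by (auto simp: K_def s_def alg_0)
    show "(\<lambda>i\<in>{..<n}. x i + y i) \<in> K" if "x \<in> K" "y \<in> K" for x y
      using that by (auto simp: K_def s_add intro!: alg_add)
    show "(\<lambda>i\<in>{..<n}. T o\<^sub>L x i) \<in> K" if "T \<in> alg" "x \<in> K" for T x
      using that by (auto simp: K_def s_smult intro!: alg_compose)
  qed (auto simp: K_def)
  have "direct_sum_of_submodules ?R ?L P K"
    unfolding direct_sum_of_submodules_def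
  proof (intro conjI P K ballI)
    fix x assume "x \<in> carrier ?L"
    then have x: "x \<in> {..<n} \<rightarrow>\<^sub>E alg" by (simp add: L)
    have sx: "s x \<in> M1 w" by (rule s_in[OF x])
    \<comment> \<open>The component along the kernel: analysis after synthesis is the projection
      onto \<open>P\<close>, and y is what it removes from x.\<close>
    define y where "y = (\<lambda>i\<in>{..<n}. x i + - h (s x) i)"
    have y: "y \<in> {..<n} \<rightarrow>\<^sub>E alg"
      unfolding y_def
      by (intro restrict_PiE_iff[THEN iffD2] ballI alg_add alg_uminus PiE_mem[OF x] PiE_mem[OF h_in[OF sx]])
    have xeq: "x = (\<lambda>i\<in>{..<n}. h (s x) i + y i)"
      using PiE_arb[OF x] by (simp add: y_def fun_eq_iff restrict_def)
    have "s x = s (h (s x)) + s y"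
      using s_add[of "h (s x)" y] unfolding xeq[symmetric] .
    then have "s y = 0"
      unfolding sh[OF sx] by simp
    then have yK: "y \<in> K"
      using y by (simp add: K_def)
    show "\<exists>!(p, q). p \<in> P \<and> q \<in> K \<and> x = p \<oplus>\<^bsub>?L\<^esub> q"
    proof (rule ex1I[of _ "(h (s x), y)"])
      show "case (h (s x), y) of (p, q) \<Rightarrow> p \<in> P \<and> q \<in> K \<and> x = p \<oplus>\<^bsub>?L\<^esub> q"
        using sx yK xeq by (simp add: P_def L)
      fix pq assume pq: "case pq of (p, q) \<Rightarrow> p \<in> P \<and> q \<in> K \<and> x = p \<oplus>\<^bsub>?L\<^esub> q"
      obtain p q where e: "pq = (p, q)" by (cases pq)
      then obtain f where f: "f \<in> M1 w" "p = h f" and q: "q \<in> K" "x = (\<lambda>i\<in>{..<n}. p i + q i)"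
        using pq by (auto simp: P_def L)
      have "s x = s (h f) + s q"
        using s_add[of p q] unfolding q(2)[symmetric] by (simp only: f(2))
      moreover have "s q = 0"
        using q(1) unfolding K_def by blast
      ultimately have "s x = f"
        unfolding sh[OF f(1)] by simp
      then have p: "p = h (s x)"
        using f(2) by simp
      have "q i = y i" if "i < n" for i
        using fun_cong[OF q(2), of i] that by (simp add: y_def p)
      moreover have "q \<in> extensional {..<n}" "y \<in> extensional {..<n}"
        using q(1) y unfolding K_def PiE_def by blast+
      ultimately have "q = y"
        by (intro extensionalityI) auto
      with p e show "pq = (h (s x), y)"
        by simp
    qed
  qed
  moreover have "h \<in> left_module_hom ?R (M1_module w) (?L\<lparr>carrier := P\<rparr>)"
    unfolding left_module_hom_def
    by (auto simp: M1_module_def L R P_def h_add h_smult)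
  moreover have "bij_betw h (carrier (M1_module w)) P"
    unfolding bij_betw_def P_def using sh by (auto simp: M1_module_def intro: inj_on_inverseI)
  ultimately show ?thesis
    unfolding fg_projective_left_module_def using left_module_M1 by blast
qed

end

section \<open>Mixed-norm spaces\<close>

lemma ennreal_powr_ennreal: "0 \<le> x \<Longrightarrow> ennreal_powr (ennreal x) r = ennreal (x powr r)"
  by (simp add: ennreal_powr_def)

lemma ennreal_powr_top [simp]: "ennreal_powr \<infinity> r = \<infinity>" "ennreal_powr Orderings.top r = Orderings.top"
  by (simp_all add: ennreal_powr_def)

lemma ennreal_powr_0 [simp]: "ennreal_powr 0 r = 0"
  by (simp add: ennreal_powr_def)

lemma ennreal_powr_mono:
  assumes "0 < r" "x \<le> y"
  shows "ennreal_powr x r \<le> ennreal_powr y r"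
  using assms
  by (cases x; cases y) (auto simp: ennreal_powr_ennreal top_unique intro!: ennreal_leI powr_mono2)

lemma ennreal_powr_powr:
  assumes "0 < r" "0 < s"
  shows "ennreal_powr (ennreal_powr x r) s = ennreal_powr x (r * s)"
  using assms by (cases x) (auto simp: ennreal_powr_ennreal powr_powr)

lemma ennreal_powr_one [simp]: "ennreal_powr x 1 = x"
  by (cases x) (auto simp: ennreal_powr_ennreal)

lemma ennreal_powr_mult:
  assumes "0 < r"
  shows "ennreal_powr (x * y) r = ennreal_powr x r * ennreal_powr y r"
proof (cases "x = 0 \<or> y = 0")
  case False
  have "ennreal_powr x r \<noteq> 0" if "x \<noteq> 0" for x
    using that assms by (cases x) (auto simp: ennreal_powr_ennreal)
  with False show ?thesis
    by (cases x; cases y)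
       (auto simp: ennreal_powr_ennreal powr_mult ennreal_mult_top ennreal_top_mult simp flip: ennreal_mult)
qed auto

lemma ennreal_powr_eq_0: "0 < r \<Longrightarrow> ennreal_powr x r = 0 \<longleftrightarrow> x = 0"
  by (cases x) (auto simp: ennreal_powr_ennreal)

text \<open>The power with exponent 1/r is a monotone inverse, so the power with exponent r
  preserves suprema.\<close>

lemma ennreal_powr_SUP:
  assumes "0 < r"
  shows "ennreal_powr (SUP i\<in>I. f i) r = (SUP i\<in>I. ennreal_powr (f i) r)"
proof (rule antisym)
  show "(SUP i\<in>I. ennreal_powr (f i) r) \<le> ennreal_powr (SUP i\<in>I. f i) r"
    by (intro SUP_least ennreal_powr_mono assms SUP_upper)
  let ?S = "SUP i\<in>I. ennreal_powr (f i) r"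
  have "(SUP i\<in>I. f i) \<le> ennreal_powr ?S (1 / r)"
  proof (rule SUP_least)
    fix i assume i: "i \<in> I"
    have "f i = ennreal_powr (ennreal_powr (f i) r) (1 / r)"
      using assms by (simp add: ennreal_powr_powr)
    also have "\<dots> \<le> ennreal_powr ?S (1 / r)"
      using assms i by (intro ennreal_powr_mono SUP_upper) auto
    finally show "f i \<le> ennreal_powr ?S (1 / r)" .
  qed
  then have "ennreal_powr (SUP i\<in>I. f i) r \<le> ennreal_powr (ennreal_powr ?S (1 / r)) r"
    by (rule ennreal_powr_mono[OF assms])
  then show "ennreal_powr (SUP i\<in>I. f i) r \<le> ?S"
    using assms by (simp add: ennreal_powr_powr)
qed

lemma borel_measurable_ennreal_powr [measurable (raw)]:
  "f \<in> borel_measurable M \<Longrightarrow> (\<lambda>x. ennreal_powr (f x) r) \<in> borel_measurable M"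
proof -
  assume [measurable]: "f \<in> borel_measurable M"
  have "{x \<in> space M. f x \<in> {\<infinity>}} \<in> sets M"
    by measurable
  then show ?thesis
    unfolding ennreal_powr_def by (intro measurable_If) simp_all
qed

text \<open>Convexity of x powr p up to and including 0. At this endpoint it reduces to c powr p
  \<le> c for c between 0 and 1.\<close>

lemma powr_convex_combination:
  fixes u v l :: real
  assumes p: "1 \<le> p" and uv: "0 \<le> u" "0 \<le> v" and l: "0 \<le> l" "0 \<le> l'" "l + l' = 1"
  shows "(l * u + l' * v) powr p \<le> l * u powr p + l' * v powr p"
proof -
  have contract: "(c * x) powr p \<le> c * x powr p" if "0 \<le> c" "c \<le> 1" "0 \<le> x" for c x :: real
  proof -
    have "c powr p \<le> c powr 1"
      using that p by (cases "c = 0") (use powr_mono'[of 1 p c] in auto)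
    then show ?thesis
      using that by (simp add: powr_mult mult_right_mono)
  qed
  show ?thesis
  proof (cases "u = 0 \<or> v = 0")
    case True
    then show ?thesis
      using contract[of l u] contract[of l' v] l uv p by fastforce
  next
    case False
    have l': "l = 1 - l'"
      using l by simp
    have "((1 - l') * u + l' * v) powr p \<le> (1 - l') * u powr p + l' * v powr p"
      using convex_onD[OF powr_convex[OF p], of l' u v] False uv l by simp
    then show ?thesis
      unfolding l' .
  qed
qed

text \<open>Convexity at the points x/a and y/b with weights a/(a + b) and b/(a + b). When a and b
  are the norms of two functions, integrating this gives Minkowski's inequality.\<close>

lemma ennreal_powr_add_le:
  assumes p: "1 \<le> p" and ab: "0 < a" "0 < b"
  shows "ennreal_powr (x + y) p \<le> ennreal ((a + b) powr (p - 1)) *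
    (ennreal (a powr (1 - p)) * ennreal_powr x p + ennreal (b powr (1 - p)) * ennreal_powr y p)"
proof (cases "x = \<infinity> \<or> y = \<infinity>")
  case True
  then show ?thesis
    using ab by (auto simp: ennreal_mult_top)
next
  case False
  then obtain s t where x: "x = ennreal s" "0 \<le> s" and y: "y = ennreal t" "0 \<le> t"
    by (cases x; cases y) auto
  have pull: "(a + b) powr p * (c / (a + b) * (u / c) powr p) = (a + b) powr (p - 1) * (c powr (1 - p) * u powr p)"
    if "0 < c" "0 \<le> u" for c u
    using that ab by (simp add: powr_diff powr_divide field_simps)
  have "s + t = (a + b) * (a / (a + b) * (s / a) + b / (a + b) * (t / b))"
    using ab by (simp add: add_divide_distrib[symmetric])
  then have "(s + t) powr p = (a + b) powr p * (a / (a + b) * (s / a) + b / (a + b) * (t / b)) powr p"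
    using ab x y by (metis (no_types, lifting) powr_mult)
  also have "\<dots> \<le> (a + b) powr p * (a / (a + b) * (s / a) powr p + b / (a + b) * (t / b) powr p)"
    using ab x y p by (intro mult_left_mono powr_convex_combination) (auto simp: add_divide_distrib[symmetric])
  also have "\<dots> = (a + b) powr (p - 1) * (a powr (1 - p) * s powr p + b powr (1 - p) * t powr p)"
    using ab x y by (simp only: distrib_left pull)
  finally show ?thesis
    using x y by (simp add: ennreal_powr_ennreal ennreal_leI flip: ennreal_mult ennreal_plus)
qed

text \<open>No measurability is assumed of f: the integral is a supremum over simple functions below
  f, and these can be rescaled. The coefficients of an arbitrary functional may thus be handled
  before their measurability is discussed.\<close>

lemma nn_integral_cmult_le:
  assumes c: "0 < c"
  shows "(\<integral>\<^sup>+x. ennreal c * f x \<partial>M) \<le> ennreal c * (\<integral>\<^sup>+x. f x \<partial>M)"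
  unfolding nn_integral_def[of M "\<lambda>x. ennreal c * f x"]
proof (rule SUP_least)
  fix g assume "g \<in> {g. simple_function M g \<and> g \<le> (\<lambda>x. ennreal c * f x)}"
  then have g: "simple_function M g" "\<And>x. g x \<le> ennreal c * f x"
    by (auto simp: le_fun_def)
  have "integral\<^sup>S M g = (\<integral>\<^sup>+x. g x \<partial>M)"
    using g(1) by (rule nn_integral_eq_simple_integral[symmetric])
  also have "\<dots> = (\<integral>\<^sup>+x. ennreal c * (ennreal (1 / c) * g x) \<partial>M)"
    using c by (simp add: mult.assoc[symmetric] flip: ennreal_mult)
  also have "\<dots> = ennreal c * (\<integral>\<^sup>+x. ennreal (1 / c) * g x \<partial>M)"
    using borel_measurable_simple_function[OF g(1)] by (intro nn_integral_cmult) measurable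
  also have "\<dots> \<le> ennreal c * (\<integral>\<^sup>+x. f x \<partial>M)"
  proof (intro mult_left_mono nn_integral_mono)
    show "ennreal (1 / c) * g x \<le> f x" for x
      using mult_left_mono[OF g(2)[of x], of "ennreal (1 / c)"] c by (simp add: mult.assoc[symmetric] flip: ennreal_mult)
  qed simp
  finally show "integral\<^sup>S M g \<le> ennreal c * (\<integral>\<^sup>+x. f x \<partial>M)" .
qed

section \<open>Minkowski's inequality and monotone convergence for the norm of L^p\<close>

lemma Lp_norm_infty: "Lp_norm \<infinity> F = Inf {c. AE x in lborel. F x \<le> c}"
  by (simp add: Lp_norm_def AE_completion_iff)

lemma Lp_norm_finite:
  "p \<noteq> \<infinity> \<Longrightarrow> Lp_norm p F = ennreal_powr (\<integral>\<^sup>+x. ennreal_powr (F x) (enn2real p) \<partial>lborel) (1 / enn2real p)"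
  by (simp add: Lp_norm_def nn_integral_completion)

text \<open>The infimum in the essential supremum is attained: the bounds with excess 1/(n + 1) hold
  simultaneously off one null set.\<close>

lemma AE_le_Lp_norm_infty: "AE x in lborel. F x \<le> Lp_norm \<infinity> F"
proof (cases "Lp_norm \<infinity> F = \<infinity>")
  case False
  have "AE x in lborel. F x \<le> Lp_norm \<infinity> F + ennreal (1 / Suc n)" for n
  proof -
    have "Lp_norm \<infinity> F < Lp_norm \<infinity> F + ennreal (1 / Suc n)"
      using False by (cases "Lp_norm \<infinity> F") (simp_all add: ennreal_less_iff flip: ennreal_plus)
    then obtain c where c: "AE x in lborel. F x \<le> c" "c < Lp_norm \<infinity> F + ennreal (1 / Suc n)"
      unfolding Lp_norm_infty[of F] Inf_less_iff by auto
    from c(1) show ?thesis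
      by eventually_elim (use c(2) in auto)
  qed
  then have "AE x in lborel. \<forall>n. F x \<le> Lp_norm \<infinity> F + ennreal (1 / Suc n)"
    by (simp add: AE_all_countable)
  then show ?thesis
  proof eventually_elim
    fix x assume le: "\<forall>n. F x \<le> Lp_norm \<infinity> F + ennreal (1 / Suc n)"
    show "F x \<le> Lp_norm \<infinity> F"
    proof (rule ennreal_le_epsilon)
      fix e :: real assume "0 < e"
      then obtain n where "1 / Suc n < e" by (metis nat_approx_posE)
      then show "F x \<le> Lp_norm \<infinity> F + ennreal e"
        using le by (meson add_left_mono ennreal_leI less_imp_le order_trans)
    qed
  qed
qed auto

lemma Lp_norm_infty_le_iff: "Lp_norm \<infinity> F \<le> c \<longleftrightarrow> (AE x in lborel. F x \<le> c)"
proof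
  assume "Lp_norm \<infinity> F \<le> c"
  with AE_le_Lp_norm_infty[of F] show "AE x in lborel. F x \<le> c"
    by (auto elim!: eventually_mono)
qed (unfold Lp_norm_infty, rule Inf_lower, rule CollectI)

lemma one_le_enn2real: "1 \<le> p \<Longrightarrow> p \<noteq> \<infinity> \<Longrightarrow> 1 \<le> enn2real p"
  by (cases p) (auto simp: ennreal_1[symmetric] simp del: ennreal_1)

lemma Lp_norm_mono_AE:
  assumes p: "1 \<le> p" and le: "AE x in lborel. F x \<le> G x"
  shows "Lp_norm p F \<le> Lp_norm p G"
proof (cases "p = \<infinity>")
  case True
  have "AE x in lborel. F x \<le> Lp_norm \<infinity> G"
    using le AE_le_Lp_norm_infty[of G] by eventually_elim (rule order_trans)
  then show ?thesis
    unfolding True Lp_norm_infty_le_iff .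
next
  case False
  have r: "1 \<le> enn2real p"
    by (rule one_le_enn2real[OF p False])
  show ?thesis
    unfolding Lp_norm_finite[OF False]
    by (intro ennreal_powr_mono nn_integral_mono_AE eventually_mono[OF le]) (use r in auto)
qed

lemma Lp_norm_cmult_le:
  assumes p: "1 \<le> p" and c: "0 < c"
  shows "Lp_norm p (\<lambda>x. ennreal c * F x) \<le> ennreal c * Lp_norm p F"
proof (cases "p = \<infinity>")
  case True
  have "AE x in lborel. ennreal c * F x \<le> ennreal c * Lp_norm \<infinity> F"
    using AE_le_Lp_norm_infty[of F] by eventually_elim (rule mult_left_mono, auto)
  then show ?thesis
    unfolding True Lp_norm_infty_le_iff .
next
  case False
  let ?r = "enn2real p"
  have r: "1 \<le> ?r"
    by (rule one_le_enn2real[OF p False])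
  have "(\<integral>\<^sup>+x. ennreal_powr (ennreal c * F x) ?r \<partial>lborel) = (\<integral>\<^sup>+x. ennreal (c powr ?r) * ennreal_powr (F x) ?r \<partial>lborel)"
    using r c by (simp add: ennreal_powr_mult ennreal_powr_ennreal)
  also have "\<dots> \<le> ennreal (c powr ?r) * (\<integral>\<^sup>+x. ennreal_powr (F x) ?r \<partial>lborel)"
    using c by (intro nn_integral_cmult_le) auto
  finally have "Lp_norm p (\<lambda>x. ennreal c * F x)
      \<le> ennreal_powr (ennreal (c powr ?r) * (\<integral>\<^sup>+x. ennreal_powr (F x) ?r \<partial>lborel)) (1 / ?r)"
    unfolding Lp_norm_finite[OF False] using r by (intro ennreal_powr_mono) auto
  also have "\<dots> = ennreal c * Lp_norm p F"
    unfolding Lp_norm_finite[OF False] using r c by (simp add: ennreal_powr_mult ennreal_powr_ennreal powr_powr)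
  finally show ?thesis .
qed

lemma Lp_norm_cmult:
  assumes p: "1 \<le> p" and c: "0 < c"
  shows "Lp_norm p (\<lambda>x. ennreal c * F x) = ennreal c * Lp_norm p F"
proof (rule antisym[OF Lp_norm_cmult_le[OF assms]])
  have "ennreal c * Lp_norm p F = ennreal c * Lp_norm p (\<lambda>x. ennreal (1 / c) * (ennreal c * F x))"
    using c by (simp add: mult.assoc[symmetric] flip: ennreal_mult)
  also have "\<dots> \<le> ennreal c * (ennreal (1 / c) * Lp_norm p (\<lambda>x. ennreal c * F x))"
    using c p by (intro mult_left_mono Lp_norm_cmult_le) auto
  finally show "ennreal c * Lp_norm p F \<le> Lp_norm p (\<lambda>x. ennreal c * F x)"
    using c by (simp add: mult.assoc[symmetric] flip: ennreal_mult)
qed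

lemma Lp_norm_0 [simp]: "1 \<le> p \<Longrightarrow> Lp_norm p (\<lambda>x. 0) = 0"
  by (cases "p = \<infinity>") (auto simp: Lp_norm_infty_le_iff[of "\<lambda>_. 0" 0, simplified] Lp_norm_finite)

lemma Lp_norm_eq_0D:
  assumes p: "1 \<le> p" and F [measurable]: "F \<in> borel_measurable borel" and 0: "Lp_norm p F = 0"
  shows "AE x in lborel. F x = 0"
proof (cases "p = \<infinity>")
  case True
  with 0 show ?thesis
    using Lp_norm_infty_le_iff[of F 0] by simp
next
  case False
  have r: "1 \<le> enn2real p"
    by (rule one_le_enn2real[OF p False])
  have "(\<integral>\<^sup>+x. ennreal_powr (F x) (enn2real p) \<partial>lborel) = 0"
    using 0 r unfolding Lp_norm_finite[OF False] by (subst (asm) ennreal_powr_eq_0) auto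
  then have "AE x in lborel. ennreal_powr (F x) (enn2real p) = 0"
    by (subst (asm) nn_integral_0_iff_AE) auto
  then show ?thesis
    using r by (simp add: ennreal_powr_eq_0)
qed

lemma Lp_norm_add_le:
  assumes p: "1 \<le> p" and [measurable]: "F \<in> borel_measurable borel" "G \<in> borel_measurable borel"
  shows "Lp_norm p (\<lambda>x. F x + G x) \<le> Lp_norm p F + Lp_norm p G"
proof (cases "p = \<infinity>")
  case True
  have "AE x in lborel. F x + G x \<le> Lp_norm \<infinity> F + Lp_norm \<infinity> G"
    using AE_le_Lp_norm_infty[of F] AE_le_Lp_norm_infty[of G] by eventually_elim (rule add_mono)
  then show ?thesis
    unfolding True Lp_norm_infty_le_iff .
next
  case False
  define r where "r = enn2real p"
  have r: "1 \<le> r"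
    unfolding r_def by (rule one_le_enn2real[OF p False])
  note Lp = Lp_norm_finite[OF False, folded r_def]
  show ?thesis
  proof (cases "Lp_norm p F = \<infinity> \<or> Lp_norm p G = \<infinity>")
    case True
    then show ?thesis by auto
  next
    case False
    then obtain A B where A: "Lp_norm p F = ennreal A" "0 \<le> A" and B: "Lp_norm p G = ennreal B" "0 \<le> B"
      by (cases "Lp_norm p F"; cases "Lp_norm p G") auto
    have int: "(\<integral>\<^sup>+x. ennreal_powr (H x) r \<partial>lborel) \<le> ennreal (a powr r)"
      if "Lp_norm p H = ennreal h" "0 \<le> h" "h \<le> a" for H :: "real^'d \<Rightarrow> ennreal" and h a
    proof -
      have "(\<integral>\<^sup>+x. ennreal_powr (H x) r \<partial>lborel) = ennreal_powr (Lp_norm p H) r"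
        unfolding Lp using r by (simp add: ennreal_powr_powr)
      also have "\<dots> = ennreal (h powr r)"
        using that by (simp add: ennreal_powr_ennreal)
      also have "\<dots> \<le> ennreal (a powr r)"
        using that r by (intro ennreal_leI powr_mono2) auto
      finally show ?thesis .
    qed
    show ?thesis
    proof (rule ennreal_le_epsilon)
      fix e :: real assume e: "0 < e"
      \<comment> \<open>Enlarging the norms by e/2 makes both positive, so that
        \<open>ennreal_powr_add_le\<close> may divide by them even if a norm vanishes.\<close>
      define a where "a = A + e / 2"
      define b where "b = B + e / 2"
      have ab: "0 < a" "0 < b" "A \<le> a" "B \<le> b"
        using A B e by (auto simp: a_def b_def)
      have "(\<integral>\<^sup>+x. ennreal_powr (F x + G x) r \<partial>lborel)
          \<le> (\<integral>\<^sup>+x. ennreal ((a + b) powr (r - 1)) * (ennreal (a powr (1 - r)) * ennreal_powr (F x) r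
              + ennreal (b powr (1 - r)) * ennreal_powr (G x) r) \<partial>lborel)"
        by (intro nn_integral_mono ennreal_powr_add_le r ab)
      also have "\<dots> = ennreal ((a + b) powr (r - 1)) * (ennreal (a powr (1 - r)) * (\<integral>\<^sup>+x. ennreal_powr (F x) r \<partial>lborel)
              + ennreal (b powr (1 - r)) * (\<integral>\<^sup>+x. ennreal_powr (G x) r \<partial>lborel))"
        by (simp add: nn_integral_cmult nn_integral_add)
      also have "\<dots> \<le> ennreal ((a + b) powr (r - 1)) * (ennreal (a powr (1 - r)) * ennreal (a powr r)
              + ennreal (b powr (1 - r)) * ennreal (b powr r))"
        using A B ab by (intro mult_left_mono add_mono int) auto
      also have "\<dots> = ennreal ((a + b) powr r)"
        using ab by (simp flip: ennreal_mult ennreal_plus powr_add)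
          (simp add: powr_diff)
      finally have "Lp_norm p (\<lambda>x. F x + G x) \<le> ennreal_powr (ennreal ((a + b) powr r)) (1 / r)"
        unfolding Lp using r by (intro ennreal_powr_mono) auto
      also have "\<dots> = ennreal (a + b)"
        using ab r by (simp add: ennreal_powr_ennreal powr_powr)
      also have "\<dots> = Lp_norm p F + Lp_norm p G + ennreal e"
        using A B e by (simp add: a_def b_def add_ac flip: ennreal_plus)
      finally show "Lp_norm p (\<lambda>x. F x + G x) \<le> Lp_norm p F + Lp_norm p G + ennreal e" .
    qed
  qed
qed

lemma Lp_norm_SUP:
  fixes F :: "nat \<Rightarrow> real^'d::finite \<Rightarrow> ennreal"
  assumes p: "1 \<le> p" and F [measurable]: "\<And>n. F n \<in> borel_measurable borel" and inc: "incseq F"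
  shows "Lp_norm p (\<lambda>x. SUP n. F n x) = (SUP n. Lp_norm p (F n))"
proof (cases "p = \<infinity>")
  case True
  have "AE x in lborel. \<forall>n. F n x \<le> Lp_norm \<infinity> (F n)"
    unfolding AE_all_countable by (intro allI AE_le_Lp_norm_infty)
  then have "AE x in lborel. (SUP n. F n x) \<le> (SUP n. Lp_norm \<infinity> (F n))"
  proof eventually_elim
    fix x assume "\<forall>n. F n x \<le> Lp_norm \<infinity> (F n)"
    then show "(SUP n. F n x) \<le> (SUP n. Lp_norm \<infinity> (F n))"
      by (intro SUP_mono') simp
  qed
  then have "Lp_norm p (\<lambda>x. SUP n. F n x) \<le> (SUP n. Lp_norm p (F n))"
    unfolding True Lp_norm_infty_le_iff .
  moreover have "(SUP n. Lp_norm p (F n)) \<le> Lp_norm p (\<lambda>x. SUP n. F n x)"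
    by (intro SUP_least Lp_norm_mono_AE p AE_I2 SUP_upper UNIV_I)
  ultimately show ?thesis by (rule antisym)
next
  case False
  define r where "r = enn2real p"
  have r: "1 \<le> r"
    unfolding r_def by (rule one_le_enn2real[OF p False])
  show ?thesis
  proof -
    have "incseq (\<lambda>n x. ennreal_powr (F n x) r)"
      using r by (intro incseq_SucI le_funI ennreal_powr_mono incseq_SucD[OF inc, THEN le_funD]) simp
    then have "(SUP n. \<integral>\<^sup>+x. ennreal_powr (F n x) r \<partial>lborel) = (\<integral>\<^sup>+x. (SUP n. ennreal_powr (F n x) r) \<partial>lborel)"
      by (intro nn_integral_monotone_convergence_SUP[symmetric]) measurable
    then show ?thesis
      unfolding Lp_norm_finite[OF False, folded r_def] using r by (simp add: ennreal_powr_SUP[symmetric])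
  qed
qed

lemma Lp_norm_suminf_le:
  fixes F :: "nat \<Rightarrow> real^'d::finite \<Rightarrow> ennreal"
  assumes p: "1 \<le> p" and F [measurable]: "\<And>n. F n \<in> borel_measurable borel"
  shows "Lp_norm p (\<lambda>x. \<Sum>n. F n x) \<le> (\<Sum>n. Lp_norm p (F n))"
proof -
  have fin: "Lp_norm p (\<lambda>x. \<Sum>i<n. F i x) \<le> (\<Sum>i<n. Lp_norm p (F i))" for n
  proof (induction n)
    case (Suc n)
    have "Lp_norm p (\<lambda>x. \<Sum>i<Suc n. F i x) \<le> Lp_norm p (\<lambda>x. \<Sum>i<n. F i x) + Lp_norm p (F n)"
      unfolding sum.lessThan_Suc by (intro Lp_norm_add_le p) measurable
    also have "\<dots> \<le> (\<Sum>i<Suc n. Lp_norm p (F i))"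
      using Suc by (simp add: add_right_mono)
    finally show ?case .
  qed (use p in simp)
  have "Lp_norm p (\<lambda>x. \<Sum>n. F n x) = (SUP n. Lp_norm p (\<lambda>x. \<Sum>i<n. F i x))"
    unfolding suminf_eq_SUP by (intro Lp_norm_SUP p) (auto intro!: incseq_SucI le_funI)
  also have "\<dots> \<le> (SUP n. \<Sum>i<n. Lp_norm p (F i))"
    by (intro SUP_mono) (use fin in blast)
  finally show ?thesis
    by (simp add: suminf_eq_SUP)
qed

lemma Lp_norm_translate:
  fixes F :: "real^'d::finite \<Rightarrow> ennreal"
  assumes p: "1 \<le> p" and F [measurable]: "F \<in> borel_measurable borel"
  shows "Lp_norm p (\<lambda>x. F (x + a)) = Lp_norm p F"
proof (cases "p = \<infinity>")
  case True
  have shift: "Lp_norm \<infinity> (\<lambda>x. F (x + a)) \<le> Lp_norm \<infinity> F" for F and a :: "real^'d"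
    unfolding Lp_norm_infty_le_iff using AE_lborel_shift[OF AE_le_Lp_norm_infty[of F], of "- a"] by simp
  show ?thesis
    using shift[of F a] shift[of "\<lambda>x. F (x + a)" "- a"] unfolding True by (simp add: antisym)
next
  case False
  have "(\<integral>\<^sup>+x. ennreal_powr (F (x + a)) r \<partial>lborel) = (\<integral>\<^sup>+x. ennreal_powr (F x) r \<partial>distr lborel borel ((+) a))" for r
    by (subst nn_integral_distr) (auto simp: add.commute)
  then show ?thesis
    by (simp add: Lp_norm_finite[OF False] lborel_distr_plus)
qed

lemma borel_measurable_Lp_norm_section:
  fixes F :: "'d::finite phase \<Rightarrow> ennreal"
  assumes p: "1 \<le> p" and [measurable]: "F \<in> borel_measurable borel"
  shows "(\<lambda>\<omega>. Lp_norm p (\<lambda>x. F (x, \<omega>))) \<in> borel_measurable borel"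
proof -
  have pair [measurable]: "(\<lambda>(\<omega>, x). F (x, \<omega>)) \<in> borel_measurable (borel \<Otimes>\<^sub>M lborel)"
  proof -
    have "(\<lambda>z :: 'd phase. F (snd z, fst z)) \<in> borel_measurable borel"
      by (intro measurable_compose[OF _ assms(2)] borel_measurable_continuous_onI continuous_intros)
    then show ?thesis
      by (simp add: case_prod_unfold borel_prod cong: measurable_cong_sets)
  qed
  show ?thesis
  proof (cases "p = \<infinity>")
    case True
    \<comment> \<open>The essential supremum is at most c precisely when the set where F exceeds c
      is null, and the measure of that set is a measurable function of \<omega>.\<close>
    have "{\<omega>. Lp_norm \<infinity> (\<lambda>x. F (x, \<omega>)) \<le> c} = {\<omega>. (\<integral>\<^sup>+x. (if F (x, \<omega>) \<le> c then 0 else 1) \<partial>lborel) = 0}" for c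
    proof -
      have "(\<lambda>x. if F (x, \<omega>) \<le> c then 0 else 1 :: ennreal) \<in> borel_measurable lborel" for \<omega>
        by measurable
      then show ?thesis
        unfolding Lp_norm_infty_le_iff by (subst nn_integral_0_iff_AE) simp_all
    qed
    moreover have "(\<lambda>\<omega>. \<integral>\<^sup>+x. (if F (x, \<omega>) \<le> c then 0 else 1) \<partial>lborel) \<in> borel_measurable borel" for c
    proof (rule lborel.borel_measurable_nn_integral)
      have "(\<lambda>z. if (\<lambda>(\<omega>, x). F (x, \<omega>)) z \<le> c then 0 else 1 :: ennreal) \<in> borel_measurable (borel \<Otimes>\<^sub>M lborel)"
        by measurable
      then show "(\<lambda>(\<omega>, x). if F (x, \<omega>) \<le> c then 0 else 1 :: ennreal) \<in> borel_measurable (borel \<Otimes>\<^sub>M lborel)"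
        by (simp add: case_prod_unfold)
    qed
    ultimately show ?thesis
      unfolding True by (intro borel_measurableI_le) simp
  next
    case False
    have "(\<lambda>z. ennreal_powr ((\<lambda>(\<omega>, x). F (x, \<omega>)) z) r) \<in> borel_measurable (borel \<Otimes>\<^sub>M lborel)" for r
      by measurable
    then have "(\<lambda>\<omega>. \<integral>\<^sup>+x. ennreal_powr (F (x, \<omega>)) r \<partial>lborel) \<in> borel_measurable borel" for r
      by (intro lborel.borel_measurable_nn_integral) (simp add: case_prod_unfold)
    then show ?thesis
      unfolding Lp_norm_finite[OF False] by measurable
  qed
qed

text \<open>The mixed norm takes its inner norm over the first coordinate, so null sets have to be
  sliced after the coordinates are exchanged.\<close>

lemma AE_lborel_section:
  fixes P :: "'d::finite phase \<Rightarrow> bool"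
  assumes "AE z in lborel. P z"
  shows "AE \<omega> in lborel. AE x in lborel. P (x, \<omega>)"
proof -
  have "AE z in lborel \<Otimes>\<^sub>M lborel. P z"
    unfolding lborel_prod by (rule assms)
  then have "AE z in distr (lborel \<Otimes>\<^sub>M lborel) (lborel \<Otimes>\<^sub>M lborel) (\<lambda>(x, y). (y, x)). P z"
    by (subst (asm) lborel_pair.distr_pair_swap) 
  then have "AE z in lborel \<Otimes>\<^sub>M lborel. P ((\<lambda>(x, y). (y, x)) z)"
    by (rule AE_distrD[rotated]) measurable
  from lborel_pair.AE_pair[OF this] show ?thesis
    by simp
qed

text \<open>By \<open>Lpq_norm_mixed\<close> any weight can be absorbed into the function. The norm
  that remains is invariant under translation, which the weighted one is not.\<close>

abbreviation mixed_norm :: "ennreal \<Rightarrow> ennreal \<Rightarrow> ('d::finite phase \<Rightarrow> ennreal) \<Rightarrow> ennreal" where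
  "mixed_norm p q F \<equiv> Lpq_norm p q (\<lambda>_. 1) F"

lemma mixed_norm_eq: "mixed_norm p q F = Lp_norm q (\<lambda>\<omega>. Lp_norm p (\<lambda>x. F (x, \<omega>)))"
  by (simp add: Lpq_norm_def)

lemma Lpq_norm_mixed: "Lpq_norm p q m F = mixed_norm p q (\<lambda>z. F z * ennreal (m z))"
  by (simp add: Lpq_norm_def)

context
  fixes p q :: ennreal
  assumes p: "1 \<le> p" and q: "1 \<le> q"
begin

lemma mixed_norm_mono_AE:
  "(AE z in lborel. F z \<le> G z) \<Longrightarrow> mixed_norm p q F \<le> mixed_norm p q G"
  unfolding mixed_norm_eq
  by (intro Lp_norm_mono_AE[OF q], drule AE_lborel_section, erule eventually_mono) (rule Lp_norm_mono_AE[OF p])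

lemma mixed_norm_cong_AE:
  "(AE z in lborel. F z = G z) \<Longrightarrow> mixed_norm p q F = mixed_norm p q G"
  by (intro antisym mixed_norm_mono_AE) auto

lemma mixed_norm_0: "mixed_norm p q (\<lambda>_. 0) = 0"
  unfolding mixed_norm_eq by (simp add: p q)

lemma mixed_norm_cmult:
  "0 \<le> c \<Longrightarrow> mixed_norm p q (\<lambda>z. ennreal c * F z) = ennreal c * mixed_norm p q F"
  by (cases "c = 0") (simp_all add: mixed_norm_0, simp add: mixed_norm_eq Lp_norm_cmult p q)

lemma mixed_norm_translate:
  assumes [measurable]: "F \<in> borel_measurable borel"
  shows "mixed_norm p q (\<lambda>z. F (z + s)) = mixed_norm p q F"
proof (cases s)
  case (Pair a b)
  have "(\<lambda>x. F (x, \<omega>)) \<in> borel_measurable borel" for \<omega>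
    by (intro measurable_compose[OF _ assms] borel_measurable_continuous_onI continuous_intros)
  then have "Lp_norm p (\<lambda>x. F (x + a, \<omega>)) = Lp_norm p (\<lambda>x. F (x, \<omega>))" for \<omega>
    by (rule Lp_norm_translate[OF p])
  then show ?thesis
    unfolding mixed_norm_eq Pair add_Pair
    using Lp_norm_translate[OF q borel_measurable_Lp_norm_section[OF p assms]] by simp
qed

lemma mixed_norm_suminf_le:
  fixes F :: "nat \<Rightarrow> 'd::finite phase \<Rightarrow> ennreal"
  assumes F: "\<And>n. F n \<in> borel_measurable borel"
  shows "mixed_norm p q (\<lambda>z. \<Sum>n. F n z) \<le> (\<Sum>n. mixed_norm p q (F n))"
proof -
  have sec: "(\<lambda>x. F n (x, \<omega>)) \<in> borel_measurable borel" for n \<omega>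
    by (intro measurable_compose[OF _ F] borel_measurable_continuous_onI continuous_intros)
  have "mixed_norm p q (\<lambda>z. \<Sum>n. F n z) \<le> Lp_norm q (\<lambda>\<omega>. \<Sum>n. Lp_norm p (\<lambda>x. F n (x, \<omega>)))"
    unfolding mixed_norm_eq by (intro Lp_norm_mono_AE[OF q] AE_I2 Lp_norm_suminf_le[OF p] sec)
  also have "\<dots> \<le> (\<Sum>n. mixed_norm p q (F n))"
    unfolding mixed_norm_eq by (intro Lp_norm_suminf_le[OF q] borel_measurable_Lp_norm_section[OF p] F)
  finally show ?thesis .
qed

lemma mixed_norm_eq_0D:
  fixes F :: "'d::finite phase \<Rightarrow> ennreal"
  assumes F: "F \<in> borel_measurable borel" and 0: "mixed_norm p q F = 0"
  shows "(\<integral>\<^sup>+z. F z \<partial>lborel) = 0"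
proof -
  have sec: "(\<lambda>x. F (x, \<omega>)) \<in> borel_measurable borel" for \<omega>
    by (intro measurable_compose[OF _ F] borel_measurable_continuous_onI continuous_intros)
  have "AE \<omega> in lborel. Lp_norm p (\<lambda>x. F (x, \<omega>)) = 0"
    using Lp_norm_eq_0D[OF q borel_measurable_Lp_norm_section[OF p F]] 0 unfolding mixed_norm_eq by blast
  then have ae: "AE \<omega> in lborel. (\<integral>\<^sup>+x. F (x, \<omega>) \<partial>lborel) = 0"
  proof eventually_elim
    fix \<omega> assume "Lp_norm p (\<lambda>x. F (x, \<omega>)) = 0"
    from Lp_norm_eq_0D[OF p sec this] show "(\<integral>\<^sup>+x. F (x, \<omega>) \<partial>lborel) = 0"
      using sec by (subst nn_integral_0_iff_AE) simp_all
  qed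
  have "(\<integral>\<^sup>+z. F z \<partial>lborel) = (\<integral>\<^sup>+z. F z \<partial>(lborel \<Otimes>\<^sub>M lborel))"
    by (simp add: lborel_prod)
  also have "\<dots> = (\<integral>\<^sup>+\<omega>. (\<integral>\<^sup>+x. F (x, \<omega>) \<partial>lborel) \<partial>lborel)"
    by (rule lborel_pair.nn_integral_snd[symmetric]) (simp add: lborel_prod F)
  also have "\<dots> = (\<integral>\<^sup>+\<omega>. 0 \<partial>(lborel :: (real^'d) measure))"
    by (rule nn_integral_cong_AE[OF ae])
  finally show ?thesis by simp
qed

end

text \<open>One enumeration serves all summands g. Padding with zeros off \<open>J\<close> treats
  finite and infinite index sets alike, so that results for sums over the naturals carry
  over.\<close>

lemma nn_sum_suminf:
  fixes I :: "'i set"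
  assumes "countable I"
  obtains J and f :: "nat \<Rightarrow> 'i" where "f ` J \<subseteq> I"
    "\<And>g :: 'i \<Rightarrow> ennreal. (\<integral>\<^sup>+i. g i \<partial>count_space I) = (\<Sum>n. if n \<in> J then g (f n) else 0)"
proof -
  define J where "J = to_nat_on I ` I"
  define f where "f = inv_into I (to_nat_on I)"
  have bij: "bij_betw f J I"
    unfolding f_def J_def by (intro bij_betw_inv_into inj_on_imp_bij_betw inj_on_to_nat_on assms)
  have "(\<integral>\<^sup>+i. g i \<partial>count_space I) = (\<Sum>n. if n \<in> J then g (f n) else 0)" for g :: "'i \<Rightarrow> ennreal"
  proof -
    have "(\<integral>\<^sup>+i. g i \<partial>count_space I) = (\<integral>\<^sup>+n. g (f n) \<partial>count_space J)"
      by (rule nn_sum_reindex[OF bij, symmetric])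
    also have "\<dots> = (\<integral>\<^sup>+n. g (f n) * indicator J n \<partial>count_space UNIV)"
      by (simp add: nn_integral_count_space_indicator)
    also have "\<dots> = (\<integral>\<^sup>+n. (if n \<in> J then g (f n) else 0) \<partial>count_space UNIV)"
      by (intro nn_integral_cong) simp
    finally show ?thesis
      by (simp add: nn_integral_count_space_nat)
  qed
  moreover have "f ` J \<subseteq> I"
    using bij by (simp add: bij_betw_def)
  ultimately show ?thesis
    by (intro that)
qed

lemma mixed_norm_nn_sum_le:
  fixes F :: "'i \<Rightarrow> 'd::finite phase \<Rightarrow> ennreal"
  assumes p: "1 \<le> p" and q: "1 \<le> q" and I: "countable I" and F: "\<And>i. i \<in> I \<Longrightarrow> F i \<in> borel_measurable borel"
  shows "mixed_norm p q (\<lambda>z. \<integral>\<^sup>+i. F i z \<partial>count_space I) \<le> (\<integral>\<^sup>+i. mixed_norm p q (F i) \<partial>count_space I)"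
proof -
  obtain J and f :: "nat \<Rightarrow> 'i" where J: "f ` J \<subseteq> I"
    "\<And>g :: 'i \<Rightarrow> ennreal. (\<integral>\<^sup>+i. g i \<partial>count_space I) = (\<Sum>n. if n \<in> J then g (f n) else 0)"
    by (rule nn_sum_suminf[OF I]) (rule that)
  define H where "H n = (if n \<in> J then F (f n) else (\<lambda>_. 0))" for n
  have "H n \<in> borel_measurable borel" for n
    using F J(1) by (cases "n \<in> J") (simp_all add: H_def image_subset_iff)
  then have "mixed_norm p q (\<lambda>z. \<Sum>n. H n z) \<le> (\<Sum>n. mixed_norm p q (H n))"
    by (rule mixed_norm_suminf_le[OF p q])
  moreover have "(\<Sum>n. H n z) = (\<Sum>n. if n \<in> J then F (f n) z else 0)" for z
    by (intro suminf_cong) (simp add: H_def)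
  moreover have "(\<Sum>n. mixed_norm p q (H n)) = (\<Sum>n. if n \<in> J then mixed_norm p q (F (f n)) else 0)"
    by (intro suminf_cong) (simp add: H_def mixed_norm_0[OF p q])
  ultimately show ?thesis
    unfolding J(2) by (simp only:)
qed

text \<open>The inequality shared by the analysis bound, the synthesis bound and the bound on single
  coefficients, named so that its constant is fixed before all families. An index pairs a window
  number with a lattice point. Measurability is asked of the functions F i only, while G may be any
  function below the sum.\<close>

definition convolution_constant :: "ennreal \<Rightarrow> ennreal \<Rightarrow> ('d::finite phase \<Rightarrow> real) \<Rightarrow> ('d phase \<Rightarrow> real) \<Rightarrow> real \<Rightarrow> bool" where
  "convolution_constant p q w m C \<longleftrightarrow> (\<forall>(I :: (nat \<times> 'd phase) set) b s F G. countable I \<longrightarrow>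
     (\<forall>i\<in>I. F i \<in> borel_measurable lebesgue) \<longrightarrow> (\<forall>i\<in>I. 0 \<le> b i) \<longrightarrow>
     (\<forall>z. G z \<le> (\<integral>\<^sup>+i. ennreal (b i) * F i (z + s i) \<partial>count_space I)) \<longrightarrow>
     Lpq_norm p q m G \<le> ennreal C * (\<integral>\<^sup>+i. ennreal (b i * w (s i)) * Lpq_norm p q m (F i) \<partial>count_space I))"

lemma convolution_constantD:
  fixes I :: "(nat \<times> 'd::finite phase) set" and w m :: "'d phase \<Rightarrow> real"
  assumes "convolution_constant p q w m C" "countable I" "\<And>i. i \<in> I \<Longrightarrow> F i \<in> borel_measurable lebesgue"
    "\<And>i. i \<in> I \<Longrightarrow> 0 \<le> b i" "\<And>z. G z \<le> (\<integral>\<^sup>+i. ennreal (b i) * F i (z + s i) \<partial>count_space I)"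
  shows "Lpq_norm p q m G \<le> ennreal C * (\<integral>\<^sup>+i. ennreal (b i * w (s i)) * Lpq_norm p q m (F i) \<partial>count_space I)"
  using assms(1)[unfolded convolution_constant_def, THEN spec, of I, THEN spec, of b, THEN spec, of s,
      THEN spec, of F, THEN spec, of G] assms(2-) by simp

text \<open>After passing to a Borel m' comparable with m and to Borel representatives of the F i,
  moderateness pulls the weight under each translate at the cost of w (s i). Translation invariance
  and Minkowski's inequality for countable sums then finish the estimate.\<close>

lemma convolution_constant_exists:
  fixes w m :: "'d::finite phase \<Rightarrow> real"
  assumes p: "1 \<le> p" and q: "1 \<le> q" and w: "is_weight w" and m: "moderate_weight w m"
  obtains C where "0 < C" "convolution_constant p q w m C"
proof -
  obtain m' K where m' [measurable]: "m' \<in> borel_measurable borel" and K: "1 \<le> K" and m'_pos: "\<And>z. 0 < m' z"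
    and mm': "\<And>z. m z \<le> K * m' z" and m'm: "\<And>z. m' z \<le> K * m z"
    using moderate_weight_borel_equivalent[OF w m] by blast
  obtain C where C: "0 < C" "\<And>z u. m (z + u) \<le> C * w z * m u"
    using m by (auto simp: moderate_weight_def)
  have w0: "0 \<le> w z" "w (- z) = w z" for z
    by (rule is_weightD[OF w])+
  \<comment> \<open>One K for m' \<le> K m, the moderateness constant C, and one K for m \<le> K
    m'.\<close>
  define D where "D = K * C * K"
  have D: "0 \<le> D" "m' z \<le> D * w s * m' (z + s)" for z s
  proof -
    have "m' z \<le> K * m (- s + (z + s))"
      using m'm by simp
    also have "\<dots> \<le> K * (C * w (- s) * m (z + s))"
      using K by (intro mult_left_mono C) simp
    also have "\<dots> \<le> K * (C * w (- s) * (K * m' (z + s)))"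
      using K C w0 by (intro mult_left_mono mm') simp_all
    finally show "m' z \<le> D * w s * m' (z + s)"
      using w0 by (simp add: D_def mult_ac)
  qed (use K C in \<open>simp add: D_def\<close>)
  have mono: "Lpq_norm p q \<mu> F \<le> ennreal K * Lpq_norm p q \<nu> F" if "\<And>z. \<mu> z \<le> K * \<nu> z" for \<mu> \<nu> and F :: "'d phase \<Rightarrow> ennreal"
  proof -
    have "Lpq_norm p q \<mu> F \<le> mixed_norm p q (\<lambda>z. ennreal K * (F z * ennreal (\<nu> z)))"
      unfolding Lpq_norm_mixed[of p q \<mu>]
    proof (intro mixed_norm_mono_AE p q AE_I2)
      fix z
      have "F z * ennreal (\<mu> z) \<le> F z * (ennreal K * ennreal (\<nu> z))"
        using that[of z] K by (intro mult_left_mono) (simp_all add: ennreal_leI flip: ennreal_mult')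
      then show "F z * ennreal (\<mu> z) \<le> ennreal K * (F z * ennreal (\<nu> z))"
        by (simp add: mult_ac)
    qed
    then show ?thesis
      using K by (simp add: mixed_norm_cmult p q Lpq_norm_mixed[of p q \<nu>])
  qed
  show ?thesis
  \<comment> \<open>The two further factors K compare the norms for m and m' on the left and on the
    right; adding 1 makes the constant positive.\<close>
  proof (rule that[of "K * D * K + 1"])
    show "0 < K * D * K + 1"
      using K D by (simp add: add_nonneg_pos)
    show "convolution_constant p q w m (K * D * K + 1)"
      unfolding convolution_constant_def
    proof (intro allI impI)
    fix I :: "(nat \<times> 'd phase) set" and b s and F :: "nat \<times> 'd phase \<Rightarrow> 'd phase \<Rightarrow> ennreal" and G
    assume I: "countable I" and "\<forall>i\<in>I. F i \<in> borel_measurable lebesgue" "\<forall>i\<in>I. 0 \<le> b i"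
      and G': "\<forall>z. G z \<le> (\<integral>\<^sup>+i. ennreal (b i) * F i (z + s i) \<partial>count_space I)"
    then have F: "\<And>i. i \<in> I \<Longrightarrow> F i \<in> borel_measurable lebesgue" and b: "\<And>i. i \<in> I \<Longrightarrow> 0 \<le> b i"
      by simp_all
    note G = G'[rule_format]
    have "\<exists>F'. \<forall>i\<in>I. F' i \<in> borel_measurable borel \<and> (AE z in lborel. F i z = F' i z)"
    proof (rule bchoice, rule ballI)
      fix i assume "i \<in> I"
      then show "\<exists>G. G \<in> borel_measurable borel \<and> (AE z in lborel. F i z = G z)"
        using completion_ex_borel_measurable[OF F, of i] by (simp add: Bex_def)
    qed
    then obtain F' where F': "\<And>i. i \<in> I \<Longrightarrow> F' i \<in> borel_measurable borel" "\<And>i. i \<in> I \<Longrightarrow> AE z in lborel. F i z = F' i z"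
      by blast
    define H where "H i z = F' i z * ennreal (m' z)" for i z
    have H: "H i \<in> borel_measurable borel" "mixed_norm p q (H i) = Lpq_norm p q m' (F i)" if "i \<in> I" for i
    proof -
      have [measurable]: "F' i \<in> borel_measurable borel"
        by (rule F'(1)[OF that])
      show "H i \<in> borel_measurable borel"
        unfolding H_def by measurable
      have "AE z in lborel. F' i z * ennreal (m' z) = F i z * ennreal (m' z)"
        using F'(2)[OF that] by eventually_elim simp
      then show "mixed_norm p q (H i) = Lpq_norm p q m' (F i)"
        unfolding H_def Lpq_norm_mixed[of p q m'] by (rule mixed_norm_cong_AE[OF p q])
    qed
    have shifted: "(\<lambda>z. H i (z + s i)) \<in> borel_measurable borel" if "i \<in> I" for i
      by (intro measurable_compose[OF _ H(1)[OF that]] borel_measurable_continuous_onI continuous_intros)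
    have "AE z in lborel. F i (z + s i) = F' i (z + s i)" if "i \<in> I" for i
      using AE_lborel_shift[OF F'(2)[OF that], of "- s i"] by simp
    then have "AE z in lborel. \<forall>i\<in>I. F i (z + s i) = F' i (z + s i)"
      by (intro AE_ball_countable[OF I, THEN iffD2] ballI)
    then have "AE z in lborel. G z * ennreal (m' z) \<le> (\<integral>\<^sup>+i. ennreal (D * (b i * w (s i))) * H i (z + s i) \<partial>count_space I)"
    proof eventually_elim
      fix z assume eq: "\<forall>i\<in>I. F i (z + s i) = F' i (z + s i)"
      have "G z * ennreal (m' z) \<le> (\<integral>\<^sup>+i. ennreal (b i) * F' i (z + s i) \<partial>count_space I) * ennreal (m' z)"
        using G[of z] eq by (intro mult_right_mono) (simp_all cong: nn_integral_cong_simp)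
      also have "\<dots> = (\<integral>\<^sup>+i. ennreal (b i) * F' i (z + s i) * ennreal (m' z) \<partial>count_space I)"
        by (rule nn_integral_multc[symmetric]) simp
      also have "\<dots> \<le> (\<integral>\<^sup>+i. ennreal (D * (b i * w (s i))) * H i (z + s i) \<partial>count_space I)"
      proof (rule nn_integral_mono)
        fix i assume "i \<in> space (count_space I)"
        then have i: "0 \<le> b i" by (simp add: b)
        have "ennreal (b i) * F' i (z + s i) * ennreal (m' z) \<le> ennreal (b i) * F' i (z + s i) * ennreal (D * w (s i) * m' (z + s i))"
          by (intro mult_left_mono ennreal_leI D) simp
        also have "\<dots> = ennreal (D * (b i * w (s i))) * H i (z + s i)"
          using i D(1) w0 less_imp_le[OF m'_pos] by (simp add: H_def ennreal_mult mult_ac)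
        finally show "ennreal (b i) * F' i (z + s i) * ennreal (m' z) \<le> ennreal (D * (b i * w (s i))) * H i (z + s i)" .
      qed
      finally show "G z * ennreal (m' z) \<le> (\<integral>\<^sup>+i. ennreal (D * (b i * w (s i))) * H i (z + s i) \<partial>count_space I)" .
    qed
    then have "Lpq_norm p q m' G \<le> mixed_norm p q (\<lambda>z. \<integral>\<^sup>+i. ennreal (D * (b i * w (s i))) * H i (z + s i) \<partial>count_space I)"
      unfolding Lpq_norm_mixed[of p q m'] by (rule mixed_norm_mono_AE[OF p q])
    also have "\<dots> \<le> (\<integral>\<^sup>+i. mixed_norm p q (\<lambda>z. ennreal (D * (b i * w (s i))) * H i (z + s i)) \<partial>count_space I)"
      by (intro mixed_norm_nn_sum_le p q I borel_measurable_times_ennreal borel_measurable_const shifted)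
    also have "\<dots> \<le> (\<integral>\<^sup>+i. ennreal (D * K) * (ennreal (b i * w (s i)) * Lpq_norm p q m (F i)) \<partial>count_space I)"
    proof (rule nn_integral_mono)
      fix i assume "i \<in> space (count_space I)"
      then have i: "i \<in> I" by simp
      have "mixed_norm p q (\<lambda>z. ennreal (D * (b i * w (s i))) * H i (z + s i)) = ennreal (D * (b i * w (s i))) * Lpq_norm p q m' (F i)"
        using D(1) b[OF i] w0 H[OF i] by (simp add: mixed_norm_cmult p q mixed_norm_translate)
      also have "\<dots> \<le> ennreal (D * (b i * w (s i))) * (ennreal K * Lpq_norm p q m (F i))"
        by (intro mult_left_mono mono m'm) simp
      also have "\<dots> = ennreal (D * K) * (ennreal (b i * w (s i)) * Lpq_norm p q m (F i))"
        using D(1) b[OF i] w0 K by (simp add: ennreal_mult mult_ac)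
      finally show "mixed_norm p q (\<lambda>z. ennreal (D * (b i * w (s i))) * H i (z + s i))
        \<le> ennreal (D * K) * (ennreal (b i * w (s i)) * Lpq_norm p q m (F i))" .
    qed
    also have "\<dots> = ennreal (D * K) * (\<integral>\<^sup>+i. ennreal (b i * w (s i)) * Lpq_norm p q m (F i) \<partial>count_space I)"
      by (rule nn_integral_cmult) simp
    finally have "Lpq_norm p q m G \<le> ennreal K * (ennreal (D * K) * (\<integral>\<^sup>+i. ennreal (b i * w (s i)) * Lpq_norm p q m (F i) \<partial>count_space I))"
      by (intro order_trans[OF mono[OF mm']] mult_left_mono) simp_all
    also have "\<dots> = ennreal (K * D * K) * (\<integral>\<^sup>+i. ennreal (b i * w (s i)) * Lpq_norm p q m (F i) \<partial>count_space I)"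
      using K D(1) by (simp add: ennreal_mult mult_ac)
    also have "\<dots> \<le> ennreal (K * D * K + 1) * (\<integral>\<^sup>+i. ennreal (b i * w (s i)) * Lpq_norm p q m (F i) \<partial>count_space I)"
      by (intro mult_right_mono ennreal_leI) simp_all
    finally show "Lpq_norm p q m G \<le> ennreal (K * D * K + 1) * (\<integral>\<^sup>+i. ennreal (b i * w (s i)) * Lpq_norm p q m (F i) \<partial>count_space I)" .
    qed
  qed
qed

section \<open>Multi-window Gabor frames\<close>

definition cell_function :: "'d::finite phase set \<Rightarrow> 'd phase set \<Rightarrow> ('d phase \<Rightarrow> complex) \<Rightarrow> 'd phase \<Rightarrow> ennreal" where
  "cell_function \<Lambda> Q a z = (\<Sum>\<^sub>\<infinity>l\<in>\<Lambda>. ennreal (cmod (a l)) * indicator ((\<lambda>y. l + y) ` Q) z)"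

lemma coeff_norm_cell: "coeff_norm \<Lambda> Q n p q m a = (\<Sum>i=1..n. Lpq_norm p q m (cell_function \<Lambda> Q (a i)))"
  unfolding coeff_norm_def cell_function_def ..

lemma fundamental_domain_cases:
  assumes "fundamental_domain \<Lambda> Q"
  obtains l y where "l \<in> \<Lambda>" "y \<in> Q" "z = l + y"
  using assms unfolding fundamental_domain_def by (metis imageE)

text \<open>The cells l + Q do not overlap, so a single summand survives. The second form, over the
  counting measure, is the one that can be enumerated to show measurability.\<close>

lemma cell_function_eq:
  assumes Q: "fundamental_domain \<Lambda> Q" and l: "l \<in> \<Lambda>" and y: "y \<in> Q"
  shows "cell_function \<Lambda> Q a (l + y) = ennreal (cmod (a l))"
    "(\<integral>\<^sup>+k. ennreal (cmod (a k)) * indicator ((\<lambda>y. k + y) ` Q) (l + y) \<partial>count_space \<Lambda>) = ennreal (cmod (a l))"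
proof -
  have uniq: "l + y \<in> (\<lambda>y. k + y) ` Q \<longleftrightarrow> k = l" if "k \<in> \<Lambda>" for k
    using Q l y that unfolding fundamental_domain_def by (metis imageI)
  have "cell_function \<Lambda> Q a (l + y) = (\<Sum>\<^sub>\<infinity>k\<in>{l}. ennreal (cmod (a k)) * indicator ((\<lambda>y. k + y) ` Q) (l + y))"
    unfolding cell_function_def
  proof (rule infsum_cong_neutral)
    fix k assume "k \<in> \<Lambda> - {l}"
    then show "ennreal (cmod (a k)) * indicator ((\<lambda>y. k + y) ` Q) (l + y) = 0"
      using uniq[of k] by simp
  qed (use l in simp_all)
  then show "cell_function \<Lambda> Q a (l + y) = ennreal (cmod (a l))"
    using uniq[OF l] by simp
  have "(\<integral>\<^sup>+k. ennreal (cmod (a k)) * indicator ((\<lambda>y. k + y) ` Q) (l + y) \<partial>count_space \<Lambda>)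
      = (\<integral>\<^sup>+k. ennreal (cmod (a l)) * indicator {l} k \<partial>count_space \<Lambda>)"
    by (rule nn_integral_cong) (use uniq in \<open>simp add: indicator_def\<close>)
  also have "\<dots> = ennreal (cmod (a l))"
    using l by (simp add: nn_integral_cmult)
  finally show "(\<integral>\<^sup>+k. ennreal (cmod (a k)) * indicator ((\<lambda>y. k + y) ` Q) (l + y) \<partial>count_space \<Lambda>) = ennreal (cmod (a l))" .
qed

lemma fundamental_domain_translate_sets:
  "fundamental_domain \<Lambda> Q \<Longrightarrow> (\<lambda>y. l + y) ` Q \<in> sets lebesgue"
  by (auto simp: fundamental_domain_def intro: lebesgue_sets_translation)

lemma cell_function_measurable:
  assumes Q: "fundamental_domain \<Lambda> Q" and c: "countable \<Lambda>"
  shows "cell_function \<Lambda> Q a \<in> borel_measurable lebesgue"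
proof -
  obtain J and f :: "nat \<Rightarrow> 'a phase" where J: "f ` J \<subseteq> \<Lambda>"
    "\<And>g :: 'a phase \<Rightarrow> ennreal. (\<integral>\<^sup>+i. g i \<partial>count_space \<Lambda>) = (\<Sum>n. if n \<in> J then g (f n) else 0)"
    by (rule nn_sum_suminf[OF c]) (rule that)
  have "cell_function \<Lambda> Q a z = (\<Sum>n. if n \<in> J then ennreal (cmod (a (f n))) * indicator ((\<lambda>y. f n + y) ` Q) z else 0)" for z
  proof -
    obtain l y where "l \<in> \<Lambda>" "y \<in> Q" "z = l + y"
      using fundamental_domain_cases[OF Q] .
    then show ?thesis
      using cell_function_eq[OF Q, of l y a] J(2)[of "\<lambda>k. ennreal (cmod (a k)) * indicator ((\<lambda>y. k + y) ` Q) z"] by simp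
  qed
  moreover have [measurable]: "(\<lambda>y. l + y) ` Q \<in> sets lebesgue" for l
    by (rule fundamental_domain_translate_sets[OF Q])
  have "(\<lambda>z. \<Sum>n. if n \<in> J then ennreal (cmod (a (f n))) * indicator ((\<lambda>y. f n + y) ` Q) z else 0) \<in> borel_measurable lebesgue"
    by measurable
  ultimately show ?thesis
    by (simp cong: measurable_cong)
qed

context gabor_weight
begin

text \<open>As m is positive, norm zero would make Q a null set; but countably many translates of Q
  cover the whole space.\<close>

lemma fundamental_domain_norm_pos:
  assumes Q: "fundamental_domain \<Lambda> Q" and p: "1 \<le> p" and q: "1 \<le> q" and m: "moderate_weight w m"
  shows "0 < Lpq_norm p q m (indicator Q)"
proof (rule ccontr)
  assume "\<not> 0 < Lpq_norm p q m (indicator Q)"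
  then have 0: "mixed_norm p q (\<lambda>z. indicator Q z * ennreal (m z)) = 0"
    by (simp add: Lpq_norm_mixed[of p q m])
  have Qs [measurable]: "Q \<in> sets lebesgue"
    using Q by (simp add: fundamental_domain_def)
  have m_meas [measurable]: "m \<in> borel_measurable lebesgue" and m_pos: "\<And>z. 0 < m z"
    using m unfolding moderate_weight_def by blast+
  have "(\<lambda>z. indicator Q z * ennreal (m z)) \<in> borel_measurable lebesgue"
    by measurable
  from completion_ex_borel_measurable[OF this] obtain H where H: "H \<in> borel_measurable lborel"
    "AE z in lborel. indicator Q z * ennreal (m z) = H z" by blast
  have "mixed_norm p q H = 0"
    using 0 mixed_norm_cong_AE[OF p q H(2)] by simp
  then have "(\<integral>\<^sup>+z. H z \<partial>lborel) = 0"
    using H(1) by (intro mixed_norm_eq_0D[OF p q]) simp_all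
  then have "AE z in lborel. H z = 0"
    using H(1) by (simp add: nn_integral_0_iff_AE)
  then have "AE z in lborel. z \<notin> Q"
    using H(2)
  proof eventually_elim
    fix z assume "H z = 0" "indicator Q z * ennreal (m z) = H z"
    then show "z \<notin> Q"
      using m_pos[of z] by (auto simp: indicator_def split: if_splits)
  qed
  then have "AE z in lborel. z - l \<notin> Q" for l
    by (rule AE_lborel_shift)
  then have "AE z in lborel. \<forall>l\<in>\<Lambda>. z - l \<notin> Q"
    by (intro AE_ball_countable[OF countable_lattice, THEN iffD2] ballI)
  then have "AE z in (lborel :: 'd phase measure). False"
  proof eventually_elim
    fix z assume no: "\<forall>l\<in>\<Lambda>. z - l \<notin> Q"
    obtain l y where "l \<in> \<Lambda>" "y \<in> Q" "z = l + y"
      using fundamental_domain_cases[OF Q] .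
    then show False
      using no by (metis add_diff_cancel_left')
  qed
  then show False
    by (subst (asm) AE_iff_measurable[where N = UNIV]) simp_all
qed

text \<open>On Q the cell function translated by l has the constant value |a l|. Comparing with
  \<open>indicator Q\<close> bounds |a l| by the norm of the family, where the translation costs w
  l. Hence coefficient families grow at most like the weight, and pairing them with w-summable
  samples converges.\<close>

lemma coeff_bound:
  assumes Q: "fundamental_domain \<Lambda> Q" and p: "1 \<le> p" and q: "1 \<le> q" and m: "moderate_weight w m"
  obtains K :: real where "0 \<le> K"
    "\<And>a l. l \<in> \<Lambda> \<Longrightarrow> ennreal (cmod (a l)) \<le> ennreal (K * w l) * Lpq_norm p q m (cell_function \<Lambda> Q a)"
proof -
  obtain C where C: "0 < C" "convolution_constant p q w m C"
    using convolution_constant_exists[OF p q weight m] .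
  \<comment> \<open>A positive real below the norm of \<open>indicator Q\<close>, chosen so that the
    case of an infinite norm is covered too.\<close>
  obtain L where L: "0 < L" "ennreal L \<le> Lpq_norm p q m (indicator Q)"
  proof (cases "Lpq_norm p q m (indicator Q)")
    case (real r)
    then show thesis
      using that[of r] fundamental_domain_norm_pos[OF Q p q m] by simp
  next
    case top
    then show thesis
      using that[of 1] by simp
  qed
  have "ennreal (cmod (a l)) \<le> ennreal (C / L * w l) * Lpq_norm p q m (cell_function \<Lambda> Q a)" if l: "l \<in> \<Lambda>" for a l
  proof (cases "a l = 0")
    case False
    define t where "t = cmod (a l)"
    have t: "0 < t" using False by (simp add: t_def)
    \<comment> \<open>A one-element family: the only translate is the one by l, with coefficient
      1/t.\<close>
    let ?I = "{(0::nat, 0::'d phase)}"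
    have "Lpq_norm p q m (indicator Q) \<le> ennreal C * (\<integral>\<^sup>+i. ennreal (1 / t * w l) * Lpq_norm p q m (cell_function \<Lambda> Q a) \<partial>count_space ?I)"
    proof (rule convolution_constantD[OF C(2)])
      fix z
      have "indicator Q z \<le> ennreal (1 / t) * cell_function \<Lambda> Q a (z + l)"
      proof (cases "z \<in> Q")
        case True
        then have "cell_function \<Lambda> Q a (z + l) = ennreal t"
          using cell_function_eq(1)[OF Q l True, of a] by (simp add: add.commute t_def)
        then show ?thesis
          using t True by (simp flip: ennreal_mult)
      qed simp
      then show "indicator Q z \<le> (\<integral>\<^sup>+i. ennreal (1 / t) * cell_function \<Lambda> Q a (z + l) \<partial>count_space ?I)"
        by (simp add: nn_integral_count_space_finite)
    qed (use t in \<open>simp_all add: cell_function_measurable[OF Q countable_lattice]\<close>)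
    also have "\<dots> = ennreal (C * (1 / t * w l)) * Lpq_norm p q m (cell_function \<Lambda> Q a)"
      using C(1) t w_nonneg[of l] by (simp add: nn_integral_count_space_finite mult.assoc[symmetric] flip: ennreal_mult)
    finally have "ennreal L \<le> ennreal (C * (1 / t * w l)) * Lpq_norm p q m (cell_function \<Lambda> Q a)"
      using L(2) by (rule order_trans[rotated])
    then have "ennreal (t / L) * ennreal L \<le> ennreal (t / L) * (ennreal (C * (1 / t * w l)) * Lpq_norm p q m (cell_function \<Lambda> Q a))"
      by (rule mult_left_mono) simp
    then show ?thesis
      using t L(1) C(1) w_nonneg[of l] by (simp add: mult.assoc[symmetric] t_def[symmetric] flip: ennreal_mult)
  qed simp
  then show ?thesis
    using L C by (intro that[of "C / L"]) simp_all
qed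

section \<open>Functionals on M^1 and the analysis bound\<close>

lemma antidualD:
  assumes "u \<in> M1_antidual w"
  shows "f \<in> M1 w \<Longrightarrow> g \<in> M1 w \<Longrightarrow> u (f + g) = u f + u g" "f \<in> M1 w \<Longrightarrow> u (cscale c f) = cnj c * u f"
    "f \<notin> M1 w \<Longrightarrow> u f = 0"
  using assms unfolding M1_antidual_def by blast+

lemma antidual_bound:
  assumes "u \<in> M1_antidual w"
  obtains C where "0 \<le> C" "\<And>f. f \<in> M1 w \<Longrightarrow> cmod (u f) \<le> C * N f"
proof -
  obtain C where C: "\<And>f. f \<in> M1 w \<Longrightarrow> cmod (u f) \<le> C * N f"
    using assms unfolding M1_antidual_def N_def by blast
  have "cmod (u f) \<le> \<bar>C\<bar> * N f" if "f \<in> M1 w" for f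
    by (rule order_trans[OF C[OF that]]) (simp add: mult_right_mono)
  then show ?thesis
    by (intro that[of "\<bar>C\<bar>"]) simp_all
qed

lemma antidual_diff:
  assumes u: "u \<in> M1_antidual w" and f: "f \<in> M1 w" and g: "g \<in> M1 w"
  shows "u (f - g) = u f - u g"
  using antidualD(1)[OF u M1_diff[OF f g] g] by (simp add: algebra_simps)

lemma cmod_antidual_tf_shift:
  assumes u: "u \<in> M1_antidual w" and f: "f \<in> M1 w"
  shows "cmod (u (tf_shift z (tf_shift s f))) = cmod (u (tf_shift (z + s) f))"
  by (simp add: tf_shift_tf_shift antidualD(2)[OF u M1_tf_shift[OF f]] norm_mult)

text \<open>The function is continuous: factoring out \<pi>(z) leaves \<pi>(s) f - f with s small,
  which is small in M^1. The phase created by the factoring disappears because only the modulus is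
  considered.\<close>

lemma antidual_stft_measurable:
  assumes u: "u \<in> M1_antidual w" and f: "f \<in> M1 w"
  shows "(\<lambda>z. ennreal (cmod (u (tf_shift z f)))) \<in> borel_measurable borel"
proof -
  obtain C where C: "0 \<le> C" "\<And>f. f \<in> M1 w \<Longrightarrow> cmod (u f) \<le> C * N f"
    using antidual_bound[OF u] by blast
  have "continuous_on UNIV (\<lambda>z. cmod (u (tf_shift z f)))"
    unfolding continuous_on_iff dist_real_def
  proof (intro ballI allI impI)
    fix z :: "'d phase" and e :: real assume e: "0 < e"
    define K where "K = C * w z + 1"
    have K: "0 < K"
      using C(1) w_nonneg[of z] by (simp add: K_def add_nonneg_pos)
    obtain d where d: "0 < d" "\<And>u. norm u < d \<Longrightarrow> N (tf_shift u f - f) < e / K"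
      using N_tf_shift_small[OF f, of "e / K"] e K by (auto simp: divide_pos_pos)
    show "\<exists>d>0. \<forall>x'\<in>UNIV. dist x' z < d \<longrightarrow> \<bar>cmod (u (tf_shift x' f)) - cmod (u (tf_shift z f))\<bar> < e"
    proof (intro exI[of _ d] conjI ballI impI d(1))
      fix x' assume "dist x' z < d"
      then have s: "norm (x' - z) < d"
        by (simp add: dist_norm)
      let ?s = "x' - z"
      have "cmod (u (tf_shift x' f)) = cmod (u (tf_shift z (tf_shift ?s f)))"
        by (simp add: cmod_antidual_tf_shift[OF u f])
      then have "\<bar>cmod (u (tf_shift x' f)) - cmod (u (tf_shift z f))\<bar> \<le> cmod (u (tf_shift z (tf_shift ?s f)) - u (tf_shift z f))"
        using norm_triangle_ineq3 by simp
      also have "\<dots> = cmod (u (tf_shift z (tf_shift ?s f - f)))"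
        by (simp add: blinfun.diff_right antidual_diff[OF u] M1_tf_shift f)
      also have "\<dots> \<le> C * N (tf_shift z (tf_shift ?s f - f))"
        by (intro C M1_tf_shift M1_diff f)
      also have "\<dots> \<le> C * (w z * N (tf_shift ?s f - f))"
        by (intro mult_left_mono N_tf_shift M1_diff M1_tf_shift f C)
      also have "\<dots> \<le> K * N (tf_shift ?s f - f)"
        by (simp add: K_def algebra_simps)
      also have "\<dots> < K * (e / K)"
        by (intro mult_strict_left_mono d s K)
      finally show "\<bar>cmod (u (tf_shift x' f)) - cmod (u (tf_shift z f))\<bar> < e"
        using K by simp
    qed
  qed
  then have "(\<lambda>z. cmod (u (tf_shift z f))) \<in> borel_measurable borel"
    by (rule borel_measurable_continuous_onI)
  then show ?thesis by measurable
qed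

end

context gabor_weight
begin

text \<open>The expansion is recentred at an arbitrary point z: \<pi>(-z) h is expanded and \<pi>(z)
  is put back. The values of u then appear as translates of the function |u (\<pi>(z) \<gamma>)| of
  z by steps that do not depend on z, the form to which \<open>convolution_constant\<close>
  applies.\<close>

lemma antidual_expansion:
  fixes n :: nat
  assumes u: "u \<in> M1_antidual w" and h: "h \<in> M1 w" and \<psi>: "\<And>k. \<psi> k \<in> M1 w" and \<gamma>: "\<gamma> \<in> M1 w"
    and frame: "\<And>f. f \<in> M1 w \<Longrightarrow> (\<Sum>k<n. gabor_op (\<psi> k) (tf_shift (p k) \<gamma>) f) = f"
  shows "ennreal (cmod (u h)) \<le> (\<integral>\<^sup>+i. ennreal (cmod (cinner h (tf_shift (z + snd i) (\<psi> (fst i)))))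
    * ennreal (cmod (u (tf_shift (z + (snd i + p (fst i))) \<gamma>))) \<partial>count_space ({..<n} \<times> \<Lambda>))"
proof -
  obtain C where C: "0 \<le> C" "\<And>f. f \<in> M1 w \<Longrightarrow> cmod (u f) \<le> C * N f"
    using antidual_bound[OF u] by blast
  define f where "f = tf_shift (- z) h"
  have f: "f \<in> M1 w"
    unfolding f_def by (rule M1_tf_shift[OF h])
  define t where "t i = cscale (cinner f (tf_shift (snd i) (\<psi> (fst i)))) (tf_shift (snd i) (tf_shift (p (fst i)) \<gamma>))" for i :: "nat \<times> 'd phase"
  have tM: "t i \<in> M1 w" for i
    unfolding t_def by (intro M1_cscale M1_tf_shift \<gamma>)
  have "(t has_sum (\<Sum>k<n. gabor_op (\<psi> k) (tf_shift (p k) \<gamma>) f)) ({..<n} \<times> \<Lambda>)"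
  proof (rule has_sum_times_finite)
    show "((\<lambda>l. t (k, l)) has_sum gabor_op (\<psi> k) (tf_shift (p k) \<gamma>) f) \<Lambda>" for k
      using gabor_op_has_sum[OF f \<psi>[of k] M1_tf_shift[OF \<gamma>, of "p k"]] by (simp add: t_def)
  qed simp
  then have sum: "infsum t ({..<n} \<times> \<Lambda>) = f"
    by (simp add: frame[OF f] infsumI)
  have "((\<lambda>i. N (t i)) has_sum (\<Sum>k<n. infsum (\<lambda>l. N (t (k, l))) \<Lambda>)) ({..<n} \<times> \<Lambda>)"
  proof (rule has_sum_times_finite)
    show "((\<lambda>l. N (t (k, l))) has_sum infsum (\<lambda>l. N (t (k, l))) \<Lambda>) \<Lambda>" for k
      using gabor_term_summable[OF f \<psi>[of k] M1_tf_shift[OF \<gamma>, of "p k"]] by (intro has_sum_infsum) (simp add: t_def)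
  qed simp
  then have tN: "(\<lambda>i. N (t i)) summable_on ({..<n} \<times> \<Lambda>)"
    by (rule has_sum_imp_summable)
  have "((\<lambda>i. u (tf_shift z (t i))) has_sum u (tf_shift z (infsum t ({..<n} \<times> \<Lambda>)))) ({..<n} \<times> \<Lambda>)"
  proof (rule M1_has_sum_map[OF _ tM tN])
    show "countable ({..<n} \<times> \<Lambda>)"
      by (simp add: countable_lattice)
    show "u (tf_shift z (g + h)) = u (tf_shift z g) + u (tf_shift z h)" if "g \<in> M1 w" "h \<in> M1 w" for g h
      using that by (simp add: tf_shift_add antidualD(1)[OF u] M1_tf_shift)
    show "norm (u (tf_shift z g)) \<le> C * w z * N g" if "g \<in> M1 w" for g
      using order_trans[OF C(2)[OF M1_tf_shift[OF that]] mult_left_mono[OF N_tf_shift[OF that] C(1)]] by (simp add: mult.assoc)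
  qed
  from ennreal_norm_has_sum_le[OF this]
  have "ennreal (cmod (u (tf_shift z f))) \<le> (\<integral>\<^sup>+i. ennreal (cmod (u (tf_shift z (t i)))) \<partial>count_space ({..<n} \<times> \<Lambda>))"
    unfolding sum .
  moreover have "cmod (u (tf_shift z f)) = cmod (u h)"
    unfolding f_def using cmod_antidual_tf_shift[OF u h, of z "- z"] by simp
  moreover have "cmod (u (tf_shift z (t i))) = cmod (cinner h (tf_shift (z + snd i) (\<psi> (fst i)))) * cmod (u (tf_shift (z + (snd i + p (fst i))) \<gamma>))" for i
  proof -
    have "cmod (u (tf_shift z (t i))) = cmod (cinner f (tf_shift (snd i) (\<psi> (fst i)))) * cmod (u (tf_shift z (tf_shift (snd i) (tf_shift (p (fst i)) \<gamma>))))"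
      unfolding t_def tf_shift_cscale by (simp add: antidualD(2)[OF u] M1_tf_shift \<gamma> norm_mult)
    also have "cmod (cinner f (tf_shift (snd i) (\<psi> (fst i)))) = cmod (cinner h (tf_shift (z + snd i) (\<psi> (fst i))))"
      unfolding f_def cmod_cinner_tf_shift by (simp add: add.commute)
    also have "cmod (u (tf_shift z (tf_shift (snd i) (tf_shift (p (fst i)) \<gamma>)))) = cmod (u (tf_shift (z + (snd i + p (fst i))) \<gamma>))"
      by (simp only: cmod_antidual_tf_shift[OF u M1_tf_shift[OF \<gamma>]] cmod_antidual_tf_shift[OF u \<gamma>] add.assoc)
    finally show ?thesis .
  qed
  ultimately show ?thesis
    by (simp add: ennreal_mult)
qed

lemma amalgam_family:
  fixes n :: nat
  assumes "\<And>k. f k \<in> M1 w" "\<And>k. g k \<in> M1 w"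
  obtains b where "\<And>k l. 0 \<le> b k l" "\<And>k l y. l \<in> \<Lambda> \<Longrightarrow> norm y \<le> R \<Longrightarrow> cmod (cinner (f k) (tf_shift (l + y) (g k))) \<le> b k l"
    "\<And>k. (\<lambda>l. b k l * w l) summable_on \<Lambda>"
proof -
  define P where "P k b \<longleftrightarrow> (\<forall>l. 0 \<le> b l) \<and> (\<forall>l\<in>\<Lambda>. \<forall>y. norm y \<le> R \<longrightarrow> cmod (cinner (f k) (tf_shift (l + y) (g k))) \<le> b l) \<and>
      (\<lambda>l. b l * w l) summable_on \<Lambda>" for k and b :: "'d phase \<Rightarrow> real"
  obtain C where C: "0 < C" "\<And>f g. f \<in> M1 w \<Longrightarrow> g \<in> M1 w \<Longrightarrow>
    \<exists>b. (\<forall>l. 0 \<le> b l) \<and> (\<forall>l\<in>\<Lambda>. \<forall>y. norm y \<le> R \<longrightarrow> cmod (cinner f (tf_shift (l + y) g)) \<le> b l) \<and>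
      (\<lambda>l. b l * w l) summable_on \<Lambda> \<and> infsum (\<lambda>l. b l * w l) \<Lambda> \<le> C * N f * N g"
    using amalgam_bound[of R] by blast
  have "\<exists>b. P k b" for k
    using C(2)[OF assms(1)[of k] assms(2)[of k]] unfolding P_def by blast
  then obtain b where b: "\<And>k. P k (b k)"
    by metis
  show ?thesis
    by (rule that[of b]; use b[unfolded P_def] in blast)
qed

lemma fundamental_domain_norm_bound:
  assumes "fundamental_domain \<Lambda> Q"
  obtains r where "0 \<le> r" "\<And>y. y \<in> Q \<Longrightarrow> norm y \<le> r"
proof -
  have "bounded Q"
    using assms bounded_subset[OF compact_imp_bounded closure_subset] unfolding fundamental_domain_def by blast
  then obtain r where "\<And>y. y \<in> Q \<Longrightarrow> norm y \<le> r"
    unfolding bounded_iff by blast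
  then show ?thesis
    by (intro that[of "max 0 r"]) (simp_all add: le_max_iff_disj)
qed

lemma nn_sum_shifted_weight:
  assumes K: "finite K" and b: "\<And>k l. 0 \<le> b k l" and s: "\<And>k. (\<lambda>l. b k l * w l) summable_on \<Lambda>"
  obtains B where "0 \<le> B" "(\<integral>\<^sup>+i. ennreal (b (fst i) (snd i) * w (snd i + p (fst i))) \<partial>count_space (K \<times> \<Lambda>)) \<le> ennreal B"
proof -
  have "(\<integral>\<^sup>+l. ennreal (b k l * w (l + p k)) \<partial>count_space \<Lambda>) \<le> ennreal (infsum (\<lambda>l. b k l * w l) \<Lambda> * w (p k))" for k
  proof -
    have "(\<integral>\<^sup>+l. ennreal (b k l * w (l + p k)) \<partial>count_space \<Lambda>) \<le> (\<integral>\<^sup>+l. ennreal (b k l * w l * w (p k)) \<partial>count_space \<Lambda>)"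
      using mult_left_mono[OF w_submult b] by (intro nn_integral_mono ennreal_leI) (simp add: mult.assoc)
    also have "\<dots> = ennreal (infsum (\<lambda>l. b k l * w l * w (p k)) \<Lambda>)"
      by (intro nn_sum_eq_infsum summable_on_cmult_left s) (simp add: b w_nonneg)
    finally show ?thesis
      by (simp add: infsum_cmult_left')
  qed
  then have "(\<integral>\<^sup>+i. ennreal (b (fst i) (snd i) * w (snd i + p (fst i))) \<partial>count_space (K \<times> \<Lambda>))
      \<le> (\<Sum>k\<in>K. ennreal (infsum (\<lambda>l. b k l * w l) \<Lambda> * w (p k)))"
    by (simp add: nn_integral_count_space_times[OF K countable_lattice] sum_mono)
  also have "\<dots> = ennreal (\<Sum>k\<in>K. infsum (\<lambda>l. b k l * w l) \<Lambda> * w (p k))"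
    by (intro sum_ennreal) (simp add: infsum_nonneg b w_nonneg)
  finally show ?thesis
    by (intro that[of "\<Sum>k\<in>K. infsum (\<lambda>l. b k l * w l) \<Lambda> * w (p k)"]) (simp_all add: sum_nonneg infsum_nonneg b w_nonneg)
qed

text \<open>For z = l + y in the cell of l, expand \<pi>(l) g around z. By covariance the
  coefficient at the lattice point k has the modulus of the pairing of g with \<pi>(k + y) applied
  to a dual window. Since Q is bounded, this is below a local supremum that does not depend on z and
  is w-summable in k.\<close>

lemma analysis_bound:
  assumes Q: "fundamental_domain \<Lambda> Q" and p: "1 \<le> p" and q: "1 \<le> q" and m: "moderate_weight w m"
    and g: "g \<in> M1 w" and \<gamma>: "\<gamma> \<in> M1 w" "\<gamma> \<noteq> 0"
  obtains B :: real where "0 \<le> B"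
    "\<And>u. u \<in> M1_antidual w \<Longrightarrow> Lpq_norm p q m (cell_function \<Lambda> Q (\<lambda>l. u (tf_shift l g))) \<le> ennreal B * modulation_norm \<gamma> p q m u"
proof -
  obtain C where C: "0 < C" "convolution_constant p q w m C"
    using convolution_constant_exists[OF p q weight m] .
  obtain n :: nat and s and g' \<psi> :: "nat \<Rightarrow> 'd L2" where "\<And>k. g' k \<in> M1 w" and \<psi>: "\<And>k. \<psi> k \<in> M1 w"
    and "\<And>f. f \<in> M1 w \<Longrightarrow> (\<Sum>k<n. gabor_op (g' k) (g' k) f) = f"
    and frame: "\<And>f. f \<in> M1 w \<Longrightarrow> (\<Sum>k<n. gabor_op (\<psi> k) (tf_shift (s k) \<gamma>) f) = f"
    by (rule gabor_frames[OF \<gamma>]) (rule that)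
  obtain r where r: "0 \<le> r" "\<And>y. y \<in> Q \<Longrightarrow> norm y \<le> r"
    using fundamental_domain_norm_bound[OF Q] by blast
  obtain b where b: "\<And>k l. 0 \<le> b k l" "\<And>k l y. l \<in> \<Lambda> \<Longrightarrow> norm y \<le> r \<Longrightarrow> cmod (cinner g (tf_shift (l + y) (\<psi> k))) \<le> b k l"
    "\<And>k. (\<lambda>l. b k l * w l) summable_on \<Lambda>"
    by (rule amalgam_family[of "\<lambda>_. g" \<psi> r, OF g \<psi>]) (rule that)
  let ?I = "{..<n} \<times> \<Lambda>"
  obtain B where B: "0 \<le> B" "(\<integral>\<^sup>+i. ennreal (b (fst i) (snd i) * w (snd i + s (fst i))) \<partial>count_space ?I) \<le> ennreal B"
    using nn_sum_shifted_weight[OF finite_lessThan b(1,3)] .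
  have "Lpq_norm p q m (cell_function \<Lambda> Q (\<lambda>l. u (tf_shift l g))) \<le> ennreal (C * B) * modulation_norm \<gamma> p q m u"
    if u: "u \<in> M1_antidual w" for u
  proof -
    define F where "F z = ennreal (cmod (u (tf_shift z \<gamma>)))" for z
    have F: "F \<in> borel_measurable lebesgue"
      unfolding F_def by (rule measurable_completion) (use antidual_stft_measurable[OF u \<gamma>(1)] in simp)
    have "cell_function \<Lambda> Q (\<lambda>l. u (tf_shift l g)) z \<le> (\<integral>\<^sup>+i. ennreal (b (fst i) (snd i)) * F (z + (snd i + s (fst i))) \<partial>count_space ?I)" for z
    proof -
      obtain l y where ly: "l \<in> \<Lambda>" "y \<in> Q" "z = l + y"
        using fundamental_domain_cases[OF Q] .
      have "cell_function \<Lambda> Q (\<lambda>l. u (tf_shift l g)) z = ennreal (cmod (u (tf_shift l g)))"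
        unfolding ly(3) by (rule cell_function_eq(1)[OF Q ly(1,2)])
      also have "\<dots> \<le> (\<integral>\<^sup>+i. ennreal (cmod (cinner (tf_shift l g) (tf_shift (z + snd i) (\<psi> (fst i))))) * F (z + (snd i + s (fst i))) \<partial>count_space ?I)"
        unfolding F_def by (rule antidual_expansion[OF u M1_tf_shift[OF g] \<psi> \<gamma>(1) frame])
      also have "\<dots> \<le> (\<integral>\<^sup>+i. ennreal (b (fst i) (snd i)) * F (z + (snd i + s (fst i))) \<partial>count_space ?I)"
      proof (intro nn_integral_mono mult_right_mono ennreal_leI)
        fix i assume "i \<in> space (count_space ?I)"
        then have i: "snd i \<in> \<Lambda>" by (simp add: mem_Times_iff)
        have eq: "z + snd i - l = snd i + y"
          by (simp add: ly(3))
        show "cmod (cinner (tf_shift l g) (tf_shift (z + snd i) (\<psi> (fst i)))) \<le> b (fst i) (snd i)"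
          unfolding cmod_cinner_tf_shift eq by (rule b(2)[OF i r(2)[OF ly(2)]])
      qed simp
      finally show ?thesis .
    qed
    then have "Lpq_norm p q m (cell_function \<Lambda> Q (\<lambda>l. u (tf_shift l g)))
        \<le> ennreal C * (\<integral>\<^sup>+i. ennreal (b (fst i) (snd i) * w (snd i + s (fst i))) * Lpq_norm p q m F \<partial>count_space ?I)"
      by (intro convolution_constantD[OF C(2)]) (simp_all add: F b(1) countable_lattice)
    also have "\<dots> = ennreal C * ((\<integral>\<^sup>+i. ennreal (b (fst i) (snd i) * w (snd i + s (fst i))) \<partial>count_space ?I) * Lpq_norm p q m F)"
      by (simp add: nn_integral_multc)
    also have "\<dots> \<le> ennreal C * (ennreal B * Lpq_norm p q m F)"
      by (intro mult_left_mono mult_right_mono B) simp_all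
    finally show ?thesis
      using C(1) B(1) unfolding modulation_norm_def F_def by (simp add: ennreal_mult mult.assoc)
  qed
  then show ?thesis
    using C B by (intro that[of "C * B"]) simp_all
qed

end

section \<open>Synthesis from coefficient families and the frame property\<close>

context gabor_weight
begin

text \<open>The functional given weakly by the series with coefficients \<open>a i l\<close> and
  vectors \<pi>(l) (g i). It is zero off M^1, as membership in \<open>M1_antidual\<close>
  demands.\<close>

definition synthesis :: "nat \<Rightarrow> (nat \<Rightarrow> 'd L2) \<Rightarrow> (nat \<Rightarrow> 'd phase \<Rightarrow> complex) \<Rightarrow> 'd L2 \<Rightarrow> complex" where
  "synthesis n g a h = (if h \<in> M1 w then \<Sum>i=1..n. \<Sum>\<^sub>\<infinity>l\<in>\<Lambda>. a i l * cinner (tf_shift l (g i)) h else 0)"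

text \<open>The weighted l^\<infinity> condition dual to w-summability. It holds on every
  coefficient space under consideration, so one synthesis map serves all p, q and m.\<close>

definition w_bounded :: "nat \<Rightarrow> (nat \<Rightarrow> 'd phase \<Rightarrow> complex) \<Rightarrow> bool" where
  "w_bounded n a \<longleftrightarrow> (\<exists>A\<ge>0. \<forall>i\<in>{1..n}. \<forall>l\<in>\<Lambda>. cmod (a i l) \<le> A * w l)"

lemma synthesis_term_summable:
  assumes A: "\<And>l. l \<in> \<Lambda> \<Longrightarrow> cmod (a l) \<le> A * w l" and g: "g \<in> M1 w" and h: "h \<in> M1 w"
  shows "(\<lambda>l. cmod (a l * cinner (tf_shift l g) h)) summable_on \<Lambda>"
    "cmod (\<Sum>\<^sub>\<infinity>l\<in>\<Lambda>. a l * cinner (tf_shift l g) h) \<le> A * infsum (\<lambda>l. cmod (cinner h (tf_shift l g)) * w l) \<Lambda>"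
proof -
  have s: "(\<lambda>l. A * (cmod (cinner h (tf_shift l g)) * w l)) summable_on \<Lambda>"
    by (rule summable_on_cmult_right[OF lattice_inner_summable[OF h g]])
  have le: "cmod (a l * cinner (tf_shift l g) h) \<le> A * (cmod (cinner h (tf_shift l g)) * w l)" if "l \<in> \<Lambda>" for l
    using mult_right_mono[OF A[OF that], of "cmod (cinner h (tf_shift l g))"]
    by (simp add: norm_mult cmod_cinner_commute[of _ h] mult_ac)
  show 1: "(\<lambda>l. cmod (a l * cinner (tf_shift l g) h)) summable_on \<Lambda>"
    by (rule summable_on_comparison_test[OF s le]) simp_all
  have "cmod (\<Sum>\<^sub>\<infinity>l\<in>\<Lambda>. a l * cinner (tf_shift l g) h) \<le> infsum (\<lambda>l. cmod (a l * cinner (tf_shift l g) h)) \<Lambda>"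
    by (rule norm_infsum_bound[OF 1])
  also have "\<dots> \<le> infsum (\<lambda>l. A * (cmod (cinner h (tf_shift l g)) * w l)) \<Lambda>"
    by (rule infsum_mono[OF 1 s le])
  finally show "cmod (\<Sum>\<^sub>\<infinity>l\<in>\<Lambda>. a l * cinner (tf_shift l g) h) \<le> A * infsum (\<lambda>l. cmod (cinner h (tf_shift l g)) * w l) \<Lambda>"
    by (simp add: infsum_cmult_right')
qed

lemma synthesis_has_sum:
  assumes a: "w_bounded n a" and i: "i \<in> {1..n}" and g: "g i \<in> M1 w" and h: "h \<in> M1 w"
  shows "((\<lambda>l. a i l * cinner (tf_shift l (g i)) h) has_sum (\<Sum>\<^sub>\<infinity>l\<in>\<Lambda>. a i l * cinner (tf_shift l (g i)) h)) \<Lambda>"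
proof -
  obtain A where "\<And>l. l \<in> \<Lambda> \<Longrightarrow> cmod (a i l) \<le> A * w l"
    using a i unfolding w_bounded_def by blast
  from synthesis_term_summable(1)[OF this g h] show ?thesis
    by (rule has_sum_infsum[OF abs_summable_summable])
qed

lemma synthesis_antidual:
  assumes a: "w_bounded n a" and g: "\<And>i. g i \<in> M1 w"
  shows "synthesis n g a \<in> M1_antidual w"
proof -
  have "synthesis n g a (f + h) = synthesis n g a f + synthesis n g a h" if f: "f \<in> M1 w" and h: "h \<in> M1 w" for f h
  proof -
    have "(\<Sum>\<^sub>\<infinity>l\<in>\<Lambda>. a i l * cinner (tf_shift l (g i)) (f + h))
        = (\<Sum>\<^sub>\<infinity>l\<in>\<Lambda>. a i l * cinner (tf_shift l (g i)) f) + (\<Sum>\<^sub>\<infinity>l\<in>\<Lambda>. a i l * cinner (tf_shift l (g i)) h)" if "i \<in> {1..n}" for i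
      unfolding cinner_add_right distrib_left
      by (intro infsumI has_sum_add synthesis_has_sum[where g = g and n = n] a that g f h)
    then show ?thesis
      using f h by (simp add: synthesis_def M1_add sum.distrib)
  qed
  moreover have "synthesis n g a (cscale c f) = cnj c * synthesis n g a f" if f: "f \<in> M1 w" for c f
  proof -
    have "(\<Sum>\<^sub>\<infinity>l\<in>\<Lambda>. a i l * cinner (tf_shift l (g i)) (cscale c f)) = cnj c * (\<Sum>\<^sub>\<infinity>l\<in>\<Lambda>. a i l * cinner (tf_shift l (g i)) f)" for i
      by (subst infsum_cmult_right'[symmetric]) (simp only: cinner_cscale_right mult.left_commute)
    then show ?thesis
      using f by (simp only: synthesis_def M1_cscale if_True sum_distrib_left)
  qed
  moreover have "\<exists>C. \<forall>f\<in>M1 w. cmod (synthesis n g a f) \<le> C * enn2real (M1_norm w f)"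
  proof -
    obtain A where A: "0 \<le> A" "\<And>i l. i \<in> {1..n} \<Longrightarrow> l \<in> \<Lambda> \<Longrightarrow> cmod (a i l) \<le> A * w l"
      using a unfolding w_bounded_def by blast
    obtain C where "0 < C" "\<And>f g. f \<in> M1 w \<Longrightarrow> g \<in> M1 w \<Longrightarrow> (\<lambda>l. cmod (cinner f (tf_shift l g)) * w l) summable_on \<Lambda>"
      and C: "\<And>f g. f \<in> M1 w \<Longrightarrow> g \<in> M1 w \<Longrightarrow> infsum (\<lambda>l. cmod (cinner f (tf_shift l g)) * w l) \<Lambda> \<le> C * N f * N g"
      using sampling_bound by blast
    have "cmod (synthesis n g a f) \<le> (\<Sum>i=1..n. A * (C * N (g i))) * N f" if f: "f \<in> M1 w" for f
    proof -
      have "cmod (synthesis n g a f) \<le> (\<Sum>i=1..n. cmod (\<Sum>\<^sub>\<infinity>l\<in>\<Lambda>. a i l * cinner (tf_shift l (g i)) f))"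
        using f by (simp add: synthesis_def norm_sum)
      also have "\<dots> \<le> (\<Sum>i=1..n. A * (C * N f * N (g i)))"
      proof (rule sum_mono)
        fix i assume i: "i \<in> {1..n}"
        show "cmod (\<Sum>\<^sub>\<infinity>l\<in>\<Lambda>. a i l * cinner (tf_shift l (g i)) f) \<le> A * (C * N f * N (g i))"
          by (rule order_trans[OF synthesis_term_summable(2)[OF A(2)[OF i] g f] mult_left_mono[OF C[OF f g] A(1)]])
      qed
      finally show ?thesis
        by (simp add: sum_distrib_left mult_ac)
    qed
    then show ?thesis
      unfolding N_def by blast
  qed
  ultimately show ?thesis
    unfolding M1_antidual_def by (simp add: synthesis_def)
qed

lemma synthesis_add:
  assumes "w_bounded n a" "w_bounded n b" "\<And>i. g i \<in> M1 w"
  shows "synthesis n g (\<lambda>i l. a i l + b i l) = (\<lambda>h. synthesis n g a h + synthesis n g b h)"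
proof
  fix h
  have "(\<Sum>\<^sub>\<infinity>l\<in>\<Lambda>. (a i l + b i l) * cinner (tf_shift l (g i)) h)
      = (\<Sum>\<^sub>\<infinity>l\<in>\<Lambda>. a i l * cinner (tf_shift l (g i)) h) + (\<Sum>\<^sub>\<infinity>l\<in>\<Lambda>. b i l * cinner (tf_shift l (g i)) h)"
    if "i \<in> {1..n}" "h \<in> M1 w" for i
    unfolding distrib_right by (intro infsumI has_sum_add synthesis_has_sum[where g = g and n = n] that assms)
  then show "synthesis n g (\<lambda>i l. a i l + b i l) h = synthesis n g a h + synthesis n g b h"
    by (simp add: synthesis_def sum.distrib)
qed

lemma synthesis_cmult: "synthesis n g (\<lambda>i l. c * a i l) = (\<lambda>h. c * synthesis n g a h)"
proof
  fix h
  have "(\<Sum>\<^sub>\<infinity>l\<in>\<Lambda>. c * a i l * cinner (tf_shift l (g i)) h) = c * (\<Sum>\<^sub>\<infinity>l\<in>\<Lambda>. a i l * cinner (tf_shift l (g i)) h)" for i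
    by (subst infsum_cmult_right'[symmetric]) (simp only: mult.assoc)
  then show "synthesis n g (\<lambda>i l. c * a i l) h = c * synthesis n g a h"
    by (simp add: synthesis_def sum_distrib_left)
qed

text \<open>Apply u to the tight expansion of h. Conjugate linearity turns each coefficient, the
  pairing of h with \<pi>(l) (g i), into its conjugate, and the synthesis series of the coefficients
  of u appears.\<close>

lemma synthesis_gabor_coeffs:
  assumes u: "u \<in> M1_antidual w" and g: "\<And>i. g i \<in> M1 w"
    and frame: "\<And>f. f \<in> M1 w \<Longrightarrow> (\<Sum>i=1..n. gabor_op (g i) (g i) f) = f"
  shows "synthesis n g (gabor_coeffs \<Lambda> n g u) = u"
proof
  fix h
  show "synthesis n g (gabor_coeffs \<Lambda> n g u) h = u h"
  proof (cases "h \<in> M1 w")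
    case h: True
    obtain C where C: "\<And>f. f \<in> M1 w \<Longrightarrow> cmod (u f) \<le> C * N f"
      using antidual_bound[OF u] by blast
    have u_sum: "u (sum f F) = (\<Sum>i\<in>F. u (f i))" if "finite F" "\<And>i. f i \<in> M1 w" for F :: "nat set" and f
      using that
    proof (induction F rule: finite_induct)
      case empty
      have "u 0 = 0"
        using C[of 0] by simp
      then show ?case by simp
    qed (simp add: antidualD(1)[OF u] M1_sum)
    have "(\<Sum>\<^sub>\<infinity>l\<in>\<Lambda>. gabor_coeffs \<Lambda> n g u i l * cinner (tf_shift l (g i)) h) = u (gabor_op (g i) (g i) h)" if i: "i \<in> {1..n}" for i
    proof -
      have "((\<lambda>l. u (cscale (cinner h (tf_shift l (g i))) (tf_shift l (g i)))) has_sum u (gabor_op (g i) (g i) h)) \<Lambda>"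
        unfolding gabor_op_def
        by (rule M1_has_sum_map[OF countable_lattice gabor_term_M1[OF g] gabor_term_summable[OF h g g] antidualD(1)[OF u] C])
      moreover have "u (cscale (cinner h (tf_shift l (g i))) (tf_shift l (g i))) = gabor_coeffs \<Lambda> n g u i l * cinner (tf_shift l (g i)) h" if "l \<in> \<Lambda>" for l
        using that i by (simp add: gabor_coeffs_def antidualD(2)[OF u M1_tf_shift[OF g]] cinner_commute[of "tf_shift l (g i)" h])
      ultimately have "((\<lambda>l. gabor_coeffs \<Lambda> n g u i l * cinner (tf_shift l (g i)) h) has_sum u (gabor_op (g i) (g i) h)) \<Lambda>"
        by (rule has_sum_cong[THEN iffD1, rotated])
      then show ?thesis
        by (rule infsumI)
    qed
    then have "synthesis n g (gabor_coeffs \<Lambda> n g u) h = (\<Sum>i=1..n. u (gabor_op (g i) (g i) h))"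
      using h by (simp add: synthesis_def)
    also have "\<dots> = u (\<Sum>i=1..n. gabor_op (g i) (g i) h)"
      by (rule u_sum[symmetric]) (simp_all add: gabor_op_M1 h g)
    finally show ?thesis
      by (simp only: frame[OF h])
  qed (simp add: synthesis_def antidualD(3)[OF u])
qed

text \<open>Let z lie in the cell of l and count the lattice from l. The coefficient at l + k is
  then the value of the cell function at z + k, and the pairing of \<pi>(l + k) (g i) with \<pi>(z)
  \<gamma> is below a local supremum at k that does not depend on z.\<close>

lemma synthesis_bound:
  assumes Q: "fundamental_domain \<Lambda> Q" and p: "1 \<le> p" and q: "1 \<le> q" and m: "moderate_weight w m"
    and g: "\<And>i. g i \<in> M1 w" and \<gamma>: "\<gamma> \<in> M1 w"
  obtains B :: real where "0 \<le> B"
    "\<And>a. w_bounded n a \<Longrightarrow> modulation_norm \<gamma> p q m (synthesis n g a) \<le> ennreal B * coeff_norm \<Lambda> Q n p q m a"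
proof -
  obtain C where C: "0 < C" "convolution_constant p q w m C"
    using convolution_constant_exists[OF p q weight m] .
  obtain r where r: "0 \<le> r" "\<And>y. y \<in> Q \<Longrightarrow> norm y \<le> r"
    using fundamental_domain_norm_bound[OF Q] by blast
  obtain b where b: "\<And>k l. 0 \<le> b k l" "\<And>k l y. l \<in> \<Lambda> \<Longrightarrow> norm y \<le> r \<Longrightarrow> cmod (cinner \<gamma> (tf_shift (l + y) (g k))) \<le> b k l"
    "\<And>k. (\<lambda>l. b k l * w l) summable_on \<Lambda>"
    by (rule amalgam_family[of "\<lambda>_. \<gamma>" g r, OF \<gamma> g]) (rule that)
  let ?I = "{1..n} \<times> \<Lambda>"
  obtain B where B: "0 \<le> B" "(\<integral>\<^sup>+i. ennreal (b (fst i) (snd i) * w (snd i + 0)) \<partial>count_space ?I) \<le> ennreal B"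
    by (rule nn_sum_shifted_weight[where K = "{1..n}" and b = b and p = "\<lambda>_. 0", OF _ b(1,3)]) (simp, rule that)
  have "modulation_norm \<gamma> p q m (synthesis n g a) \<le> ennreal (C * B) * coeff_norm \<Lambda> Q n p q m a" if a: "w_bounded n a" for a
  proof -
    have "ennreal (cmod (synthesis n g a (tf_shift z \<gamma>)))
        \<le> (\<integral>\<^sup>+i. ennreal (b (fst i) (snd i)) * cell_function \<Lambda> Q (a (fst i)) (z + snd i) \<partial>count_space ?I)" for z
    proof -
      obtain l y where ly: "l \<in> \<Lambda>" "y \<in> Q" "z = l + y"
        using fundamental_domain_cases[OF Q] .
      \<comment> \<open>The lattice is reindexed by translation with l, the corner of the cell that
        contains z; the second entry of an index is the offset from l.\<close>
      define t where "t i = a (fst i) (l + snd i) * cinner (tf_shift (l + snd i) (g (fst i))) (tf_shift z \<gamma>)" for i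
      have "((\<lambda>k. t (i, k)) has_sum (\<Sum>\<^sub>\<infinity>k\<in>\<Lambda>. a i k * cinner (tf_shift k (g i)) (tf_shift z \<gamma>))) \<Lambda>" if "i \<in> {1..n}" for i
        unfolding t_def fst_conv snd_conv
        using has_sum_reindex_bij_betw[OF bij_lattice_shift[OF ly(1)], of "\<lambda>k. a i k * cinner (tf_shift k (g i)) (tf_shift z \<gamma>)"]
          synthesis_has_sum[where g = g, OF a that g M1_tf_shift[OF \<gamma>]] by blast
      then have "(t has_sum (\<Sum>i=1..n. \<Sum>\<^sub>\<infinity>k\<in>\<Lambda>. a i k * cinner (tf_shift k (g i)) (tf_shift z \<gamma>))) ?I"
        by (rule has_sum_times_finite[OF finite_atLeastAtMost])
      then have "(t has_sum synthesis n g a (tf_shift z \<gamma>)) ?I"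
        unfolding synthesis_def if_P[OF M1_tf_shift[OF \<gamma>]] .
      then have "ennreal (cmod (synthesis n g a (tf_shift z \<gamma>))) \<le> (\<integral>\<^sup>+i. ennreal (cmod (t i)) \<partial>count_space ?I)"
        by (rule ennreal_norm_has_sum_le)
      also have "\<dots> \<le> (\<integral>\<^sup>+i. ennreal (b (fst i) (snd i)) * cell_function \<Lambda> Q (a (fst i)) (z + snd i) \<partial>count_space ?I)"
      proof (rule nn_integral_mono)
        fix i assume "i \<in> space (count_space ?I)"
        then have i: "snd i \<in> \<Lambda>" by (simp add: mem_Times_iff)
        have eq: "z + snd i = (l + snd i) + y" "l + snd i - z = snd i + - y"
          by (simp_all add: ly(3))
        have c: "cell_function \<Lambda> Q (a (fst i)) (z + snd i) = ennreal (cmod (a (fst i) (l + snd i)))"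
          unfolding eq(1) by (rule cell_function_eq(1)[OF Q add_in[OF ly(1) i] ly(2)])
        have "cmod (cinner (tf_shift (l + snd i) (g (fst i))) (tf_shift z \<gamma>)) \<le> b (fst i) (snd i)"
          unfolding cmod_cinner_commute[of _ "tf_shift z \<gamma>"] cmod_cinner_tf_shift eq(2)
          by (rule b(2)[OF i]) (simp add: r(2)[OF ly(2)])
        then have "cmod (t i) \<le> b (fst i) (snd i) * cmod (a (fst i) (l + snd i))"
          unfolding t_def norm_mult mult.commute[of "b _ _"] by (rule mult_left_mono) simp
        then show "ennreal (cmod (t i)) \<le> ennreal (b (fst i) (snd i)) * cell_function \<Lambda> Q (a (fst i)) (z + snd i)"
          unfolding c by (simp add: b(1) ennreal_leI flip: ennreal_mult)
      qed
      finally show ?thesis .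
    qed
    then have "modulation_norm \<gamma> p q m (synthesis n g a)
        \<le> ennreal C * (\<integral>\<^sup>+i. ennreal (b (fst i) (snd i) * w (snd i)) * Lpq_norm p q m (cell_function \<Lambda> Q (a (fst i))) \<partial>count_space ?I)"
      unfolding modulation_norm_def
      by (intro convolution_constantD[OF C(2)]) (simp_all add: b(1) countable_lattice cell_function_measurable[OF Q])
    also have "\<dots> \<le> ennreal C * (\<integral>\<^sup>+i. ennreal (b (fst i) (snd i) * w (snd i)) * coeff_norm \<Lambda> Q n p q m a \<partial>count_space ?I)"
      unfolding coeff_norm_cell
      by (intro mult_left_mono nn_integral_mono member_le_sum[of _ "{1..n}" "\<lambda>k. Lpq_norm p q m (cell_function \<Lambda> Q (a k))"])
         (simp_all add: mem_Times_iff)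
    also have "\<dots> = ennreal C * ((\<integral>\<^sup>+i. ennreal (b (fst i) (snd i) * w (snd i)) \<partial>count_space ?I) * coeff_norm \<Lambda> Q n p q m a)"
      by (simp add: nn_integral_multc)
    also have "\<dots> \<le> ennreal C * (ennreal B * coeff_norm \<Lambda> Q n p q m a)"
      by (intro mult_left_mono mult_right_mono) (use B(2) in simp_all)
    finally show ?thesis
      using C(1) B(1) by (simp add: ennreal_mult mult.assoc)
  qed
  then show ?thesis
    using C B by (intro that[of "C * B"]) simp_all
qed

lemma coeff_space_w_bounded:
  assumes Q: "fundamental_domain \<Lambda> Q" and p: "1 \<le> p" and q: "1 \<le> q" and m: "moderate_weight w m"
    and a: "a \<in> coeff_space \<Lambda> Q n p q m"
  shows "w_bounded n a"
proof -
  obtain K :: real where K: "0 \<le> K" "\<And>a l. l \<in> \<Lambda> \<Longrightarrow> ennreal (cmod (a l)) \<le> ennreal (K * w l) * Lpq_norm p q m (cell_function \<Lambda> Q a)"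
    by (rule coeff_bound[OF Q p q m]) (rule that)
  have "coeff_norm \<Lambda> Q n p q m a < \<infinity>"
    using a by (simp add: coeff_space_def)
  then obtain c where c: "coeff_norm \<Lambda> Q n p q m a = ennreal c" "0 \<le> c"
    by (cases "coeff_norm \<Lambda> Q n p q m a") auto
  have "cmod (a i l) \<le> K * c * w l" if i: "i \<in> {1..n}" and l: "l \<in> \<Lambda>" for i l
  proof -
    have "Lpq_norm p q m (cell_function \<Lambda> Q (a i)) \<le> ennreal c"
      unfolding c(1)[symmetric] coeff_norm_cell using i
      by (intro member_le_sum[of _ "{1..n}" "\<lambda>k. Lpq_norm p q m (cell_function \<Lambda> Q (a k))"]) simp_all
    then have "ennreal (cmod (a i l)) \<le> ennreal (K * w l) * ennreal c"
      by (intro order_trans[OF K(2)[OF l]] mult_left_mono) simp_all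
    then show ?thesis
      using K(1) c(2) w_nonneg[of l] by (simp add: mult_ac flip: ennreal_mult)
  qed
  then show ?thesis
    unfolding w_bounded_def by (intro exI[of _ "K * c"] conjI ballI mult_nonneg_nonneg K(1) c(2))
qed

lemma coeff_norm_gabor_coeffs:
  "coeff_norm \<Lambda> Q n p q m (gabor_coeffs \<Lambda> n g u) = (\<Sum>i=1..n. Lpq_norm p q m (cell_function \<Lambda> Q (\<lambda>l. u (tf_shift l (g i)))))"
proof -
  have "cell_function \<Lambda> Q (gabor_coeffs \<Lambda> n g u i) = cell_function \<Lambda> Q (\<lambda>l. u (tf_shift l (g i)))" if "i \<in> {1..n}" for i
    using that by (intro ext) (simp add: cell_function_def gabor_coeffs_def cong: infsum_cong)
  then show ?thesis
    unfolding coeff_norm_cell by (intro sum.cong) simp_all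
qed

text \<open>Analysis gives the upper bound and synthesis is the reconstruction operator R. The lower
  bound is then automatic: u equals R applied to its coefficients, and R is bounded.\<close>

lemma multi_window_gabor_frame_M1:
  assumes Q: "fundamental_domain \<Lambda> Q" and p: "1 \<le> p" and q: "1 \<le> q" and m: "moderate_weight w m"
    and g: "\<And>i. g i \<in> M1 w" and \<gamma>: "\<gamma> \<in> M1 w" "\<gamma> \<noteq> 0"
    and frame: "\<And>f. f \<in> M1 w \<Longrightarrow> (\<Sum>i=1..n. gabor_op (g i) (g i) f) = f"
  shows "multi_window_gabor_frame \<Lambda> Q w \<gamma> p q m n g"
proof -
  let ?M = "modulation_space w \<gamma> p q m" and ?Y = "coeff_space \<Lambda> Q n p q m"
  let ?N = "modulation_norm \<gamma> p q m" and ?C = "coeff_norm \<Lambda> Q n p q m" and ?c = "gabor_coeffs \<Lambda> n g" and ?R = "synthesis n g"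
  have "\<exists>B\<ge>0. \<forall>u\<in>M1_antidual w. Lpq_norm p q m (cell_function \<Lambda> Q (\<lambda>l. u (tf_shift l (g i)))) \<le> ennreal B * ?N u" for i
    by (rule analysis_bound[OF Q p q m g[of i] \<gamma>]) blast
  then obtain B where B: "\<And>i. 0 \<le> B i"
    "\<And>i u. u \<in> M1_antidual w \<Longrightarrow> Lpq_norm p q m (cell_function \<Lambda> Q (\<lambda>l. u (tf_shift l (g i)))) \<le> ennreal (B i) * ?N u"
    by metis
  obtain K :: real where K: "0 \<le> K" "\<And>a. w_bounded n a \<Longrightarrow> ?N (?R a) \<le> ennreal K * ?C a"
    by (rule synthesis_bound[OF Q p q m g \<gamma>(1)]) (rule that)
  define B' where "B' = (\<Sum>i=1..n. B i) + 1"
  have B': "0 < B'"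
    unfolding B'_def by (intro add_nonneg_pos sum_nonneg B) simp
  have upper: "?C (?c u) \<le> ennreal B' * ?N u" if u: "u \<in> M1_antidual w" for u
  proof -
    have "?C (?c u) \<le> (\<Sum>i=1..n. ennreal (B i) * ?N u)"
      unfolding coeff_norm_gabor_coeffs by (intro sum_mono B u)
    also have "\<dots> = ennreal (\<Sum>i=1..n. B i) * ?N u"
      by (simp add: sum_distrib_right[symmetric] sum_ennreal B)
    also have "\<dots> \<le> ennreal B' * ?N u"
      by (intro mult_right_mono ennreal_leI) (simp_all add: B'_def)
    finally show ?thesis .
  qed
  have antidual: "u \<in> M1_antidual w" "?N u < \<infinity>" if "u \<in> ?M" for u
    using that by (simp_all add: modulation_space_def)
  have c_in: "?c u \<in> ?Y" if u: "u \<in> ?M" for u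
  proof -
    have "?C (?c u) < \<infinity>"
      using upper[OF antidual(1)[OF u]] antidual(2)[OF u] by (auto intro: le_less_trans simp: ennreal_mult_less_top)
    then show ?thesis
      by (simp add: coeff_space_def gabor_coeffs_def)
  qed
  have bdd: "w_bounded n a" if "a \<in> ?Y" for a
    by (rule coeff_space_w_bounded[OF Q p q m that])
  have R_in: "?R a \<in> ?M" if a: "a \<in> ?Y" for a
  proof -
    have "ennreal K * ?C a < \<infinity>"
      using a by (simp add: coeff_space_def ennreal_mult_less_top)
    then have "?N (?R a) < \<infinity>"
      by (rule le_less_trans[OF K(2)[OF bdd[OF a]]])
    then show ?thesis
      using synthesis_antidual[OF bdd[OF a] g] by (simp add: modulation_space_def)
  qed
  have Rc: "?R (?c u) = u" if "u \<in> ?M" for u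
    by (rule synthesis_gabor_coeffs[OF antidual(1)[OF that] g frame])
  have lower: "ennreal (1 / (K + 1)) * ?N u \<le> ?C (?c u)" if u: "u \<in> ?M" for u
  proof -
    have "?N u \<le> ennreal K * ?C (?c u)"
      using K(2)[OF bdd[OF c_in[OF u]]] by (simp only: Rc[OF u])
    also have "\<dots> \<le> ennreal (K + 1) * ?C (?c u)"
      by (intro mult_right_mono ennreal_leI) simp_all
    finally have "ennreal (1 / (K + 1)) * ?N u \<le> ennreal (1 / (K + 1)) * (ennreal (K + 1) * ?C (?c u))"
      by (rule mult_left_mono) simp
    then show ?thesis
      using K(1) by (simp add: mult.assoc[symmetric] del: ennreal_plus flip: ennreal_mult)
  qed
  have frame_bounds: "\<exists>A B :: real. 0 < A \<and> 0 < B \<and> (\<forall>u\<in>?M. ennreal A * ?N u \<le> ?C (?c u) \<and> ?C (?c u) \<le> ennreal B * ?N u)"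
    by (rule exI[of _ "1 / (K + 1)"], rule exI[of _ B'])
       (use K(1) B' in \<open>simp_all add: lower upper antidual(1)\<close>)
  show ?thesis
    unfolding multi_window_gabor_frame_def
  proof (rule conjI[OF frame_bounds], rule exI[of _ ?R], intro conjI ballI allI)
    show "?R \<in> ?Y \<rightarrow> ?M"
      using R_in by (rule funcsetI)
    show "?R (\<lambda>i l. a i l + b i l) = (\<lambda>h. ?R a h + ?R b h)" if "a \<in> ?Y" "b \<in> ?Y" for a b
      by (rule synthesis_add[OF bdd[OF that(1)] bdd[OF that(2)] g])
    show "\<exists>K :: real. \<forall>a\<in>?Y. ?N (?R a) \<le> ennreal K * ?C a"
      using K(2) bdd by blast
  qed (simp_all add: Rc synthesis_cmult)
qed

end

section \<open>Passage between equivalent weights and conclusion\<close>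

lemma M1_norm_weight_le:
  assumes "1 \<le> C" "\<And>z. v z \<le> C * w z"
  shows "M1_norm v f \<le> ennreal C * M1_norm w f"
proof -
  have "M1_norm v f \<le> (\<integral>\<^sup>+z. ennreal C * ennreal (cmod (cinner f (tf_shift z gaussian)) * w z) \<partial>lebesgue)"
    unfolding M1_norm_def
  proof (rule nn_integral_mono)
    fix z
    have "cmod (cinner f (tf_shift z gaussian)) * v z \<le> C * (cmod (cinner f (tf_shift z gaussian)) * w z)"
      using mult_left_mono[OF assms(2)[of z] norm_ge_zero[of "cinner f (tf_shift z gaussian)"]] by (simp add: mult_ac)
    then show "ennreal (cmod (cinner f (tf_shift z gaussian)) * v z) \<le> ennreal C * ennreal (cmod (cinner f (tf_shift z gaussian)) * w z)"
      using assms(1) by (simp add: ennreal_leI flip: ennreal_mult')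
  qed
  also have "\<dots> \<le> ennreal C * M1_norm w f"
    unfolding M1_norm_def using assms(1) by (intro nn_integral_cmult_le) simp
  finally show ?thesis .
qed

lemma M1_weight_subset:
  assumes "1 \<le> C" "\<And>z. v z \<le> C * w z"
  shows "M1 w \<subseteq> M1 v"
proof
  fix f assume "f \<in> M1 w"
  then have "ennreal C * M1_norm w f < \<infinity>"
    by (simp add: M1_def ennreal_mult_less_top)
  with M1_norm_weight_le[where v = v and w = w, OF assms] show "f \<in> M1 v"
    unfolding M1_def mem_Collect_eq by (rule le_less_trans)
qed

text \<open>Functionals are extended by zero off M^1, so the two spaces must coincide as sets; after
  that only the constant in the bound changes with the weight.\<close>

lemma M1_antidual_weight_subset:
  assumes C: "1 \<le> C" "\<And>z. v z \<le> C * w z" and eq: "M1 v = M1 w"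
  shows "M1_antidual v \<subseteq> M1_antidual w"
proof
  fix u assume u: "u \<in> M1_antidual v"
  then obtain D where D: "\<And>f. f \<in> M1 w \<Longrightarrow> cmod (u f) \<le> D * enn2real (M1_norm v f)"
    unfolding M1_antidual_def eq by blast
  have "cmod (u f) \<le> \<bar>D\<bar> * C * enn2real (M1_norm w f)" if f: "f \<in> M1 w" for f
  proof -
    have "enn2real (M1_norm v f) \<le> enn2real (ennreal C * M1_norm w f)"
      using f by (intro enn2real_mono M1_norm_weight_le C) (simp add: M1_def ennreal_mult_less_top)
    also have "\<dots> = C * enn2real (M1_norm w f)"
      using C(1) by (simp add: enn2real_mult)
    finally have "\<bar>D\<bar> * enn2real (M1_norm v f) \<le> \<bar>D\<bar> * (C * enn2real (M1_norm w f))"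
      by (rule mult_left_mono) simp
    moreover have "D * enn2real (M1_norm v f) \<le> \<bar>D\<bar> * enn2real (M1_norm v f)"
      by (rule mult_right_mono) simp_all
    ultimately show ?thesis
      using D[OF f] by (simp add: mult.assoc)
  qed
  then show "u \<in> M1_antidual w"
    using u unfolding M1_antidual_def eq by blast
qed

lemma twisted_algebra_weight_cong:
  assumes v: "1 \<le> C" "\<And>z. v z \<le> C * w z" and w: "\<And>z. w z \<le> C * v z" and pos: "\<And>z. 0 \<le> v z" "\<And>z. 0 \<le> w z"
  shows "twisted_algebra \<Lambda> v = twisted_algebra \<Lambda> w"
proof -
  have le: "(\<lambda>l. cmod (a l) * \<nu> l) summable_on \<Lambda>"
    if s: "(\<lambda>l. cmod (a l) * \<mu> l) summable_on \<Lambda>" and \<mu>: "\<And>z. \<nu> z \<le> C * \<mu> z" "\<And>z. 0 \<le> \<nu> z" for \<mu> \<nu> :: "'a phase \<Rightarrow> real" and a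
  proof (rule summable_on_comparison_test[OF summable_on_cmult_right[OF s, of C]])
    show "cmod (a l) * \<nu> l \<le> C * (cmod (a l) * \<mu> l)" for l
      using mult_left_mono[OF \<mu>(1)[of l] norm_ge_zero[of "a l"]] by (simp add: mult_ac)
  qed (simp add: \<mu>)
  have "(\<lambda>l. cmod (a l) * v l) summable_on \<Lambda> \<longleftrightarrow> (\<lambda>l. cmod (a l) * w l) summable_on \<Lambda>" for a
    using le[of a v w, OF _ w pos(2)] le[of a w v, OF _ v(2) pos(1)] by blast
  then show ?thesis
    unfolding twisted_algebra_def by simp
qed

theorem theorem4p5:
  fixes \<Lambda> :: "'d::finite phase set" and v :: "'d phase \<Rightarrow> real"
  assumes "is_lattice \<Lambda>" and "GRS_weight \<Lambda> v"
  shows "fg_projective_left_module (twisted_algebra \<Lambda> v) (M1_module v) \<and>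
    (\<exists>(n::nat) g.
       standard_tight_module_frame \<Lambda> v n g \<and>
       (\<forall>(p::ennreal) (q::ennreal) m Q \<gamma>. 1 \<le> p \<and> 1 \<le> q \<and> moderate_weight v m \<and>
          fundamental_domain \<Lambda> Q \<and> \<gamma> \<in> M1 v \<and> \<gamma> \<noteq> 0 \<longrightarrow>
          multi_window_gabor_frame \<Lambda> Q v \<gamma> p q m n g))"
proof -
  have v: "is_weight v"
    using assms(2) by (simp add: GRS_weight_def)
  obtain w C where w: "is_weight w" "w \<in> borel_measurable borel" and C: "1 \<le> C"
    and vw: "\<And>z. v z \<le> C * w z" and wv: "\<And>z. w z \<le> C * v z"
    by (rule is_weight_borel_equivalent[OF v]) (rule that)
  obtain sep cov where "phase_lattice \<Lambda> sep cov"
    using is_lattice_imp_phase_lattice[OF assms(1)] .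
  then interpret gabor_weight \<Lambda> sep cov w
    by (intro gabor_weight.intro gabor_weight_axioms.intro w)
  have M1: "M1 v = M1 w"
    using M1_weight_subset[where v = v and w = w, OF C vw] M1_weight_subset[where v = w and w = v, OF C wv] by blast
  have antidual: "M1_antidual v = M1_antidual w"
    using M1_antidual_weight_subset[OF C vw M1] M1_antidual_weight_subset[OF C wv M1[symmetric]] by blast
  have algebra: "twisted_algebra \<Lambda> v = twisted_algebra \<Lambda> w"
    by (rule twisted_algebra_weight_cong[OF C vw wv]) (rule is_weightD(4)[OF v] w_nonneg)+
  have "M1_module v = M1_module w"
    by (simp add: M1_module_def M1)
  have moderate: "moderate_weight w m" if "moderate_weight v m" for m
  proof -
    obtain D where D: "0 < D" "\<And>z u. m (z + u) \<le> D * v z * m u" and m: "m \<in> borel_measurable lebesgue" "\<And>z. 0 < m z"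
      using \<open>moderate_weight v m\<close> unfolding moderate_weight_def by blast
    have "m (z + u) \<le> D * C * w z * m u" for z u
    proof -
      have "D * v z * m u \<le> D * (C * w z) * m u"
        using D(1) less_imp_le[OF m(2)] by (intro mult_right_mono mult_left_mono vw) simp_all
      with D(2)[of z u] show ?thesis
        by (simp add: mult.assoc)
    qed
    then show ?thesis
      using m D(1) C unfolding moderate_weight_def by (intro conjI allI exI[of _ "D * C"]) simp_all
  qed
  \<comment> \<open>The windows are built from the Gaussian before p, q, m, Q and \<gamma> are
    given, so one choice serves the whole class of modulation spaces.\<close>
  obtain n :: nat and p g and \<psi> :: "nat \<Rightarrow> 'd L2" where g: "\<And>k. g k \<in> M1 w" and "\<And>k. \<psi> k \<in> M1 w"
    and frame: "\<And>f. f \<in> M1 w \<Longrightarrow> (\<Sum>k<n. gabor_op (g k) (g k) f) = f"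
    and "\<And>f. f \<in> M1 w \<Longrightarrow> (\<Sum>k<n. gabor_op (\<psi> k) (tf_shift (p k) gaussian) f) = f"
    by (rule gabor_frames[OF gaussian_M1 gaussian_nonzero]) (rule that)
  \<comment> \<open>Shifts the indices from 0..n-1 to 1..n. By truncated subtraction
    \<open>g' 0\<close> is \<open>g 0\<close>, so \<open>g' i\<close> lies in M^1 for every
    i.\<close>
  define g' where "g' i = g (i - 1)" for i
  have g': "g' i \<in> M1 w" for i
    unfolding g'_def by (rule g)
  have frame': "(\<Sum>i=1..n. gabor_op (g' i) (g' i) f) = f" if "f \<in> M1 w" for f
    using frame[OF that] by (simp add: g'_def sum.atLeast1_atMost_eq)
  have "fg_projective_left_module (twisted_algebra \<Lambda> v) (M1_module v)"
    unfolding algebra \<open>M1_module v = M1_module w\<close> by (rule fg_projective_M1[OF g frame])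
  moreover have "standard_tight_module_frame \<Lambda> v n g'"
    unfolding standard_tight_module_frame_def M1
  proof (intro conjI ballI g')
    show "f = (\<Sum>i=1..n. blinfun_apply (lattice_inner \<Lambda> f (g' i)) (g' i))" if "f \<in> M1 w" for f
      by (simp only: lattice_inner_apply[OF that g'] frame'[OF that])
  qed
  moreover have "multi_window_gabor_frame \<Lambda> Q v \<gamma> p q m n g'"
    if "1 \<le> p" "1 \<le> q" "moderate_weight v m" "fundamental_domain \<Lambda> Q" "\<gamma> \<in> M1 v" "\<gamma> \<noteq> 0" for p q m Q \<gamma>
  proof -
    have "\<gamma> \<in> M1 w"
      using that(5) by (simp add: M1)
    then have "multi_window_gabor_frame \<Lambda> Q w \<gamma> p q m n g'"
      by (rule multi_window_gabor_frame_M1[OF that(4,1,2) moderate[OF that(3)] g' _ that(6) frame'])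
    then show ?thesis
      unfolding multi_window_gabor_frame_def modulation_space_def antidual .
  qed
  ultimately show ?thesis by blast
qed

end
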